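(* Let $A\in C([0,T_*],C^4_{\mathrm b}(\mathbb{R}))$ (complex-valued, $T_*>0$) be a solution of the Ginzburg--Landau equation $$\partial_T A=(1+4\partial_X^2)A-\Bigl(2k_0+k_2-\frac{q_1q_2}{9}-\frac{q_1^2}{9}-2q_0q_1-2q_1^2\Bigr)|A|^2A ,$$ and set $$\psi(x,t)=\varepsilon\bigl(A(\varepsilon x,\varepsilon^2t)\mathrm{e}^{\mathrm{i}x}+\overline{A}(\varepsilon x,\varepsilon^2t)\mathrm{e}^{-\mathrm{i}x}\bigr).$$ Then for each $d>0$ there exist constants $\varepsilon_*,C>0$ such that for all $\varepsilon\in(0,\varepsilon_* )$ the following holds. If $u_0\in C^4_{\mathrm b}(\mathbb{R})$ is real-valued with $\|u_0-\psi(\cdot,0)\|_{C^4}\le d\varepsilon^2$, then there exists a unique solution $u$ of the non-local Swift--Hohenberg equation $$\partial_t u=-(1+\partial_x^2)^2u+\varepsilon^2u-u\,(Q\ast u)-u\,(K\ast u^2)\quad\text{on }\mathbb{R}$$ on the time interval $[0,T_*/\varepsilon^2]$ with $u(\cdot,0)=u_0$, and moreover $$\|u(\cdot,t)-\psi(\cdot,t)\|_{C^4}\le C\varepsilon^2\qquad\text{for all }t\in[0,T_*/\varepsilon^2].$$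
   Context: $Q$ and $K$ are finite (signed, real) measures on $\mathbb{R}$, symmetric under $x\mapsto -x$, which can be decomposed as $Q=Q_r+Q_s$, $K=K_r+K_s$ with $Q_r,K_r$ Schwartz functions (identified with the measures having these densities) and $Q_s,K_s$ compactly supported finite measures. In particular $\int|x|\,|Q|(dx)<\infty$ and $\int|x|\,|K|(dx)<\infty$. Here $\ast$ is convolution in the space variable $x$. For $n\in\mathbb{Z}$: $q_n=\int_{\mathbb{R}}\mathrm{e}^{\mathrm{i}nx}Q(dx)$ and $k_n=\int_{\mathbb{R}}\mathrm{e}^{\mathrm{i}nx}K(dx)$; these are real and $q_{-n}=q_n$, $k_{-n}=k_n$. $C^n_{\mathrm b}(\mathbb{R})$ is the space of $n$ times continuously differentiable functions with globally bounded derivatives up to order $n$, with norm $\|\cdot\|_{C^n}$ (maximum or sum of the sup-norms of the derivatives of order $\le n$). The norm is taken in the space variable. A solution $u$ of the Swift--Hohenberg equation on $[0,T]$ is understood in the mild sense: $u(\cdot,t)\in C^4_{\mathrm b}(\mathbb{R})$ with $\sup_{t\in[0,T]}\|u(\cdot,t)\|_{C^4}<\infty$, $t\mapsto u(\cdot,t)$ is continuous in the sup-norm, and $u(t)=\mathrm{e}^{\mathcal{L}t}u_0+\int_0^t\mathrm{e}^{\mathcal{L}(t-\tau)}\mathcal{N}(u(\tau))\,d\tau$, where $\mathcal{N}(u)=-u(Q\ast u)-u(K\ast u^2)$ and $\mathrm{e}^{\mathcal{L}t}$ is the semigroup of $\mathcal{L}=-(1+\partial_x^2)^2+\varepsilon^2$,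 i.e. convolution with the inverse Fourier transform of $k\mapsto\mathrm{e}^{t(\varepsilon^2-(1-k^2)^2)}$ for $t>0$, and the identity for $t=0$. *)

theory Defs
  imports "HOL-Analysis.Analysis"
begin

subsection \<open>Spaces of functions with bounded derivatives\<close>

text \<open>Iterated derivatives of real- or complex-valued functions of one real variable
  (\<^const>\<open>deriv\<close> does not apply to functions from the reals to the complex numbers).\<close>

definition vderiv :: "nat \<Rightarrow> (real \<Rightarrow> 'a::real_normed_vector) \<Rightarrow> real \<Rightarrow> 'a" where
  "vderiv k f = ((\<lambda>g x. vector_derivative g (at x)) ^^ k) f"

definition Cb :: "nat \<Rightarrow> (real \<Rightarrow> 'a::real_normed_vector) set" where
  "Cb n = {f. (\<forall>k<n. \<forall>x. vderiv k f differentiable (at x)) \<and>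
              (\<forall>k\<le>n. continuous_on UNIV (vderiv k f) \<and> bounded (range (vderiv k f)))}"

text \<open>A supremum over the reals is meaningful only for bounded sets; the norm below is only
  ever applied to members of \<^term>\<open>Cb n\<close>.\<close>

definition Cb_norm :: "nat \<Rightarrow> (real \<Rightarrow> 'a::real_normed_vector) \<Rightarrow> real" where
  "Cb_norm n f = (\<Sum>k\<le>n. SUP x. norm (vderiv k f x))"

text \<open>Space-time functions take the space variable first. Membership in
  $C([0,T], C^n_b)$ and sup-norm continuity in time only concern times in $[0,T]$.\<close>

definition time_continuous :: "nat \<Rightarrow> real \<Rightarrow> (real \<Rightarrow> real \<Rightarrow> 'a::real_normed_vector) \<Rightarrow> bool" where
  "time_continuous n T u \<longleftrightarrow>
     (\<forall>t\<in>{0..T}. (\<lambda>x. u x t) \<in> Cb n) \<and>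
     (\<forall>t\<in>{0..T}. ((\<lambda>s. Cb_norm n (\<lambda>x. u x s - u x t)) \<longlongrightarrow> 0) (at t within {0..T}))"

definition schwartz :: "(real \<Rightarrow> real) \<Rightarrow> bool" where
  "schwartz f \<longleftrightarrow>
     (\<forall>k x. vderiv k f differentiable (at x)) \<and>
     (\<forall>k m. bounded (range (\<lambda>x. x ^ m * vderiv k f x)))"

subsection \<open>Finite signed measures\<close>

text \<open>A finite signed Borel measure on the reals is represented by a pair of finite (positive)
  Borel measures and stands for their difference; by the Jordan decomposition every finite signed
  measure arises in this way. The two components need not be mutually singular, so
  properties of the signed measure are stated through the values \<open>sm_val\<close>.\<close>

type_synonym smeasure = "real measure \<times> real measure"

definition finite_signed :: "smeasure \<Rightarrow> bool" where
  "finite_signed \<mu> \<longleftrightarrow>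
     finite_measure (fst \<mu>) \<and> sets (fst \<mu>) = sets borel \<and>
     finite_measure (snd \<mu>) \<and> sets (snd \<mu>) = sets borel"

definition sm_val :: "smeasure \<Rightarrow> real set \<Rightarrow> real" where
  "sm_val \<mu> A = measure (fst \<mu>) A - measure (snd \<mu>) A"

definition sm_integral :: "smeasure \<Rightarrow> (real \<Rightarrow> 'a::{banach, second_countable_topology}) \<Rightarrow> 'a" where
  "sm_integral \<mu> f = (LINT x|fst \<mu>. f x) - (LINT x|snd \<mu>. f x)"

definition sm_symmetric :: "smeasure \<Rightarrow> bool" where
  "sm_symmetric \<mu> \<longleftrightarrow> (\<forall>A\<in>sets borel. sm_val \<mu> (uminus ` A) = sm_val \<mu> A)"

definition sm_compact_support :: "smeasure \<Rightarrow> bool" where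
  "sm_compact_support \<mu> \<longleftrightarrow>
     (\<exists>S. compact S \<and> (\<forall>A\<in>sets borel. A \<inter> S = {} \<longrightarrow> sm_val \<mu> A = 0))"

definition admissible_kernel :: "smeasure \<Rightarrow> bool" where
  "admissible_kernel \<mu> \<longleftrightarrow> finite_signed \<mu> \<and> sm_symmetric \<mu> \<and>
     (\<exists>r \<sigma>. schwartz r \<and> finite_signed \<sigma> \<and> sm_compact_support \<sigma> \<and>
        (\<forall>A\<in>sets borel. sm_val \<mu> A = (LINT x:A|lborel. r x) + sm_val \<sigma> A))"

definition sm_conv :: "smeasure \<Rightarrow> (real \<Rightarrow> real) \<Rightarrow> real \<Rightarrow> real" where
  "sm_conv \<mu> f x = sm_integral \<mu> (\<lambda>y. f (x - y))"

definition sm_fourier :: "smeasure \<Rightarrow> int \<Rightarrow> complex" where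
  "sm_fourier \<mu> n = sm_integral \<mu> (\<lambda>x. exp (\<i> * of_int n * of_real x))"

subsection \<open>The Ginzburg--Landau equation\<close>

definition gl_coeff :: "smeasure \<Rightarrow> smeasure \<Rightarrow> complex" where
  "gl_coeff Q K =
     (let q = sm_fourier Q; k = sm_fourier K in
      2 * k 0 + k 2 - q 1 * q 2 / 9 - (q 1)\<^sup>2 / 9 - 2 * q 0 * q 1 - 2 * (q 1)\<^sup>2)"

text \<open>The equation holds pointwise, with one-sided time derivatives at the end points.\<close>

definition gl_solution :: "smeasure \<Rightarrow> smeasure \<Rightarrow> real \<Rightarrow> (real \<Rightarrow> real \<Rightarrow> complex) \<Rightarrow> bool" where
  "gl_solution Q K T A \<longleftrightarrow> time_continuous 4 T A \<and>
     (\<forall>X. \<forall>t\<in>{0..T}. (A X has_vector_derivative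
         (A X t + 4 * vderiv 2 (\<lambda>Y. A Y t) X
            - gl_coeff Q K * of_real ((cmod (A X t))\<^sup>2) * A X t)) (at t within {0..T}))"

text \<open>The expression inside \<^const>\<open>Re\<close> is real, see \<open>of_real_psi\<close>.\<close>

definition psi :: "(real \<Rightarrow> real \<Rightarrow> complex) \<Rightarrow> real \<Rightarrow> real \<Rightarrow> real \<Rightarrow> real" where
  "psi A \<epsilon> x t = Re (of_real \<epsilon> *
     (A (\<epsilon> * x) (\<epsilon>\<^sup>2 * t) * exp (\<i> * of_real x)
      + cnj (A (\<epsilon> * x) (\<epsilon>\<^sup>2 * t)) * exp (- \<i> * of_real x)))"

lemma of_real_psi:
  "complex_of_real (psi A \<epsilon> x t) = of_real \<epsilon> *
     (A (\<epsilon> * x) (\<epsilon>\<^sup>2 * t) * exp (\<i> * of_real x)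
      + cnj (A (\<epsilon> * x) (\<epsilon>\<^sup>2 * t)) * exp (- \<i> * of_real x))"
  by (simp add: psi_def complex_eq_iff Re_exp Im_exp)

subsection \<open>The non-local Swift--Hohenberg equation\<close>

text \<open>Inverse Fourier transform of the symbol of the semigroup; it is real because the symbol
  is even in \<open>k\<close>.\<close>

definition sh_kernel :: "real \<Rightarrow> real \<Rightarrow> real \<Rightarrow> real" where
  "sh_kernel \<epsilon> t x =
     Re (1 / (2 * pi) *
       (LINT k|lborel. exp (\<i> * of_real (k * x)) * of_real (exp (t * (\<epsilon>\<^sup>2 - (1 - k\<^sup>2)\<^sup>2)))))"

definition sh_semigroup :: "real \<Rightarrow> real \<Rightarrow> (real \<Rightarrow> real) \<Rightarrow> real \<Rightarrow> real" where
  "sh_semigroup \<epsilon> t f x =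
     (if t = 0 then f x else (LINT y|lborel. sh_kernel \<epsilon> t (x - y) * f y))"

definition sh_nonlin :: "smeasure \<Rightarrow> smeasure \<Rightarrow> (real \<Rightarrow> real) \<Rightarrow> real \<Rightarrow> real" where
  "sh_nonlin Q K f x = - f x * sm_conv Q f x - f x * sm_conv K (\<lambda>y. (f y)\<^sup>2) x"

text \<open>Mild solutions on $[0,T]$ with initial datum \<open>u0\<close>. The last clause is the
  variation-of-constants formula, evaluated at each point \<open>x\<close>; at time 0 it says
  $u(\cdot,0)=u_0$.\<close>

definition sh_mild_solution ::
    "smeasure \<Rightarrow> smeasure \<Rightarrow> real \<Rightarrow> real \<Rightarrow> (real \<Rightarrow> real) \<Rightarrow> (real \<Rightarrow> real \<Rightarrow> real) \<Rightarrow> bool" where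
  "sh_mild_solution Q K \<epsilon> T u0 u \<longleftrightarrow>
     (\<forall>t\<in>{0..T}. (\<lambda>x. u x t) \<in> Cb 4) \<and>
     (\<exists>M. \<forall>t\<in>{0..T}. Cb_norm 4 (\<lambda>x. u x t) \<le> M) \<and>
     time_continuous 0 T u \<and>
     (\<forall>t\<in>{0..T}. \<forall>x.
        ((\<lambda>\<tau>. sh_semigroup \<epsilon> (t - \<tau>) (sh_nonlin Q K (\<lambda>y. u y \<tau>)) x)
           has_integral (u x t - sh_semigroup \<epsilon> t u0 x)) {0..t})"

end

theory Submission
  imports Defs "HOL-Probability.Probability"
begin

text \<open>Write \<open>a(k) = (1 - k\<^sup>2)\<^sup>2\<close> for the symbol of \<open>\<Lambda> = (1 + \<partial>\<^sub>x\<^sup>2)\<^sup>2\<close>, \<open>B(f,g) = - f (Q * g)\<close> and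
\<open>C(f,g,h) = - f (K * (g h))\<close>. Solutions have size \<open>e\<close> (the small parameter), so the quadratic term
changes an error by a relative amount \<open>e\<close> per unit of time, while the time interval has length
\<open>T / e\<^sup>2\<close>: Gronwall's inequality alone only reaches times of order \<open>1 / e\<close>. What saves the estimate is a
frequency count. The linear flow preserves only frequencies near \<open>1\<close> and \<open>- 1\<close>, and a product of two
functions with such critical frequencies has frequencies near \<open>0\<close>, \<open>2\<close> and \<open>- 2\<close>, where the flow decays
exponentially.

Approximation. Let \<open>E\<close> be a smooth frequency cut-off to the critical set and \<open>\<nu>\<close> a cut-off version
of \<open>1 / a\<close> near \<open>0\<close> and \<open>2\<close>. Instead of \<open>\<psi>\<close> the proof uses
\<open>E \<psi> + \<nu>(\<Lambda>) B(E \<psi>, E \<psi>)\<close>, which differs from \<open>\<psi>\<close> by \<open>O(e\<^sup>2)\<close>. The second term removes the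
quadratic part of the residual exactly; the rest is \<open>O(e\<^sup>3)\<close>. Its critical part is even \<open>O(e\<^sup>4)\<close>:
collecting the coefficient of \<open>|A|\<^sup>2 A exp(i x)\<close> from the three cubic interactions gives minus the
coefficient of the Ginzburg--Landau equation (\<open>ansatz_mild\<close>, \<open>residual_expansion\<close>, \<open>ansatz_small\<close>).
Operators act on a slowly modulated wave like their symbol at its frequency, up to one power of \<open>e\<close>
(\<open>wave_op_wv\<close>); this needs only first moments of the kernels, hence of \<open>Q\<close> and \<open>K\<close>.

Error. The mild error equation is split into a critical part of size \<open>e\<^sup>2\<close> and a stable part. On the
stable part the flow decays (\<open>stable_decay\<close>), so integration in time costs nothing. In the critical part
\<open>E B(V, V') = 0\<close> for critical \<open>V\<close>, \<open>V'\<close> (\<open>critical_quadratic\<close>), and what is left is Lipschitz with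
constant \<open>O(e\<^sup>2)\<close>, harmless over times \<open>T / e\<^sup>2\<close>. A sup-norm with weight \<open>exp(\<lambda> e\<^sup>2 t)\<close> turns this into
a contraction on the whole interval (\<open>error_equation_solvable\<close>).

Bounds in \<open>C\<^sup>4\<close> come from working with jets: a function together with its first four derivatives, as
a function into a five-dimensional space. Translation-invariant operators act on the components and the
product becomes the Leibniz product, so plain sup-norm estimates for jets are \<open>C\<^sup>4\<close> estimates.
Fourier multipliers are realised as convolutions with the cosine integrals of their symbols; products of
symbols correspond to compositions by the inversion formula \<open>ci_inversion\<close>.\<close>

section \<open>Smooth functions of one variable\<close>

primrec Ck :: "nat => (real => real) => bool" where
 "Ck 0 f \<longleftrightarrow> continuous_on UNIV f"
| "Ck (Suc n) f \<longleftrightarrow> (EX f'. (ALL x. (f has_real_derivative f' x) (at x)) & Ck n f')"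

lemma Ck_SucD: "Ck (Suc n) f ==> Ck n f"
proof (induction n arbitrary: f)
 case 0
 thus ?case by (auto intro!: continuous_at_imp_continuous_on intro: DERIV_isCont)
next
 case (Suc n)
 thus ?case by (metis Ck.simps(2))
qed

lemma Ck_continuous: "Ck n f ==> continuous_on UNIV f"
 by (induction n) (auto dest!: Ck_SucD simp del: Ck.simps(2))

lemma Ck_const: "Ck n (%_. c)"
 by (induction n arbitrary: c) (auto intro!: exI[of _ "%_. 0"])

lemma Ck_id: "Ck n (%x. x)"
 by (cases n) (auto intro!: exI[of _ "%_. 1"] Ck_const)

lemma Ck_add: "Ck n f ==> Ck n g ==> Ck n (%x. f x + g x)"
proof (induction n arbitrary: f g)
 case (Suc n)
 then obtain f' g' where "!!x. (f has_real_derivative f' x) (at x)" "Ck n f'"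
  "!!x. (g has_real_derivative g' x) (at x)" "Ck n g'" by auto
 thus ?case using Suc.IH[of f' g']
  by (auto intro!: exI[of _ "%x. f' x + g' x"] derivative_eq_intros)
qed (auto intro: continuous_intros)

lemma Ck_mult: "Ck n f ==> Ck n g ==> Ck n (%x. f x * g x)"
proof (induction n arbitrary: f g)
 case (Suc n)
 then obtain f' g' where d: "!!x. (f has_real_derivative f' x) (at x)" "Ck n f'"
  "!!x. (g has_real_derivative g' x) (at x)" "Ck n g'" by auto
 have "Ck n f" "Ck n g" using Suc.prems Ck_SucD by blast+
 hence "Ck n (%x. f' x * g x + f x * g' x)"
  using Suc.IH d by (intro Ck_add) auto
 thus ?case using d
  by (auto intro!: exI[of _ "%x. f' x * g x + f x * g' x"] derivative_eq_intros)
qed (auto intro: continuous_intros)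

lemma Ck_compose: "Ck n f ==> Ck n g ==> Ck n (%x. f (g x))"
proof (induction n arbitrary: f)
 case 0
 thus ?case using continuous_on_compose2[of UNIV f UNIV g] by auto
next
 case (Suc n)
 then obtain f' g' where d: "!!x. (f has_real_derivative f' x) (at x)" "Ck n f'"
  "!!x. (g has_real_derivative g' x) (at x)" "Ck n g'" by auto
 have "Ck n g" using Suc.prems Ck_SucD by blast
 hence "Ck n (%x. f' (g x) * g' x)"
  using Suc.IH[of f'] d by (intro Ck_mult) auto
 moreover have "((%x. f (g x)) has_real_derivative f' (g x) * g' x) (at x)" for x
  by (rule DERIV_chain2[OF d(1) d(3)])
 ultimately show ?case unfolding Ck.simps(2)
  by (intro exI[of _ "%x. f' (g x) * g' x"]) simp
qed

lemma Ck_inverse: "Ck n f ==> (!!x. f x \<noteq> 0) ==> Ck n (%x. inverse (f x))"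
proof (induction n)
 case 0
 thus ?case by (auto intro!: continuous_intros)
next
 case (Suc n)
 then obtain f' where d: "!!x. (f has_real_derivative f' x) (at x)" "Ck n f'" by auto
 have "Ck n (%x. inverse (f x))" using Suc Ck_SucD by blast
 hence "Ck n (%x. (-1) * ((inverse (f x) * f' x) * inverse (f x)))"
  using d by (intro Ck_mult Ck_const)
 hence "Ck n (%x. - (inverse (f x) * f' x * inverse (f x)))" by simp
 thus ?case using d Suc.prems
  by (auto intro!: exI[of _ "%x. - (inverse (f x) * f' x * inverse (f x))"] DERIV_inverse_fun derivative_eq_intros)
qed

lemma Ck_power: "Ck n f ==> Ck n (%x. f x ^ j)"
 by (induction j) (auto intro: Ck_const Ck_mult)

lemma Ck_minus: "Ck n f ==> Ck n (%x. - f x)"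
 using Ck_mult[OF Ck_const[of n "-1"], of f] by simp

lemma Ck_diff: "Ck n f ==> Ck n g ==> Ck n (%x. f x - g x)"
 using Ck_add[OF _ Ck_minus, of n f g] by simp

lemma Ck_exp: "Ck n exp"
 by (induction n) (auto intro!: exI[of _ exp] continuous_intros)

lemmas Ck_intros = Ck_const Ck_id Ck_add Ck_mult Ck_power Ck_minus Ck_diff Ck_compose[OF Ck_exp]

lemma pos_part_power_deriv:
 "((%x::real. max 0 x ^ Suc (Suc n)) has_real_derivative real (Suc (Suc n)) * max 0 x ^ Suc n) (at x)"
proof -
 consider "x > 0" | "x < 0" | "x = 0" by linarith
 thus ?thesis
 proof cases
  case 1
  have "((%x::real. x ^ Suc (Suc n)) has_real_derivative real (Suc (Suc n)) * max 0 x ^ Suc n) (at x)"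
   using DERIV_pow[of "Suc (Suc n)" x UNIV] 1 by (simp add: max_def del: power_Suc)
  thus ?thesis
   by (rule has_field_derivative_transform_within_open[where S="{0<..}"]) (use 1 in "auto simp: max_def")
 next
  case 2
  have "((%x::real. 0) has_real_derivative real (Suc (Suc n)) * max 0 x ^ Suc n) (at x)"
   using 2 by (auto intro!: derivative_eq_intros simp: max_def)
  thus ?thesis
   by (rule has_field_derivative_transform_within_open[where S="{..<0}"]) (use 2 in "auto simp: max_def")
 next
  case 3
  have "((%h::real. max 0 h ^ Suc n) \<longlongrightarrow> max 0 0 ^ Suc n) (at 0)"
   by (intro tendsto_intros)
  hence "((%h::real. max 0 h ^ Suc n) \<longlongrightarrow> 0) (at 0)" by simp
  hence "((%h::real. (max 0 h ^ Suc (Suc n) - max 0 0 ^ Suc (Suc n)) / (h - 0)) \<longlongrightarrow> 0) (at 0)"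
   by (rule Lim_transform_eventually) (auto simp: eventually_at max_def intro!: exI[of _ 1])
  thus ?thesis using 3 by (simp add: has_field_derivative_iff)
 qed
qed

text \<open>Powers of the positive part are the building blocks of the cut-offs: they are as smooth as needed, vanish on a half-line and are elementary to differentiate.\<close>

lemma Ck_pos_part_power: "Ck n (%x. max 0 x ^ Suc n)"
proof (induction n)
 case 0
 thus ?case by (auto intro!: continuous_intros)
next
 case (Suc n)
 have "Ck n (%x. real (Suc (Suc n)) * max 0 x ^ Suc n)"
  by (rule Ck_mult[OF Ck_const Suc])
 thus ?case unfolding Ck.simps(2)
  using pos_part_power_deriv[of n] by (intro exI[of _ "%x. real (Suc (Suc n)) * max 0 x ^ Suc n"]) auto
qed

text \<open>A cut-off that is rational in truncated powers, hence three times continuously differentiable.\<close>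

definition plateau :: "real => real" where
 "plateau x = max 0 (2 - x) ^ 4 * inverse (max 0 (2 - x) ^ 4 + max 0 (x - 1) ^ 4)"

lemma plateau_denominator_pos: "max 0 (2 - x) ^ 4 + max 0 (x - 1) ^ 4 > (0::real)"
proof (cases "x < 2")
 case True
 hence "max 0 (2 - x) ^ 4 > 0" by auto
 thus ?thesis by (meson add_pos_nonneg max.cobounded1 zero_le_power)
next
 case False
 hence "max 0 (x - 1) ^ 4 > 0" by (auto simp: max_def)
 thus ?thesis by (meson add_nonneg_pos max.cobounded1 zero_le_power)
qed

lemma plateau_one: "x <= 1 ==> plateau x = 1"
 by (simp add: plateau_def max_def)

lemma plateau_zero: "x >= 2 ==> plateau x = 0"
 by (simp add: plateau_def max_def)

lemma plateau_bounds: "0 <= plateau x" "plateau x <= 1"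
proof -
 have *: "(0::real) <= max 0 (2 - x) ^ 4" "(0::real) <= max 0 (x - 1) ^ 4" by auto
 show "0 <= plateau x" using plateau_denominator_pos[of x] *
  unfolding plateau_def by (intro mult_nonneg_nonneg) auto
 show "plateau x <= 1" using plateau_denominator_pos[of x] *
  unfolding plateau_def by (simp add: field_simps)
qed

lemma Ck_plateau: "Ck 3 plateau"
proof -
 have p: "Ck 3 (%x::real. max 0 x ^ 4)" using Ck_pos_part_power[of 3] by (simp add: eval_nat_numeral)
 have "Ck 3 (%x::real. max 0 (2 - x) ^ 4)" "Ck 3 (%x::real. max 0 (x - 1) ^ 4)"
  by (rule Ck_compose[OF p], intro Ck_intros)+
 thus ?thesis unfolding plateau_def
  using plateau_denominator_pos by (intro Ck_mult Ck_inverse Ck_add) (auto simp: less_le)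
qed

section \<open>Cosine integrals\<close>

lemma
 shows integrable_recip_quadratic: "integrable lborel (%x::real. c / (1 + x^2))"
  and integral_recip_quadratic: "(LINT x|lborel. c / (1 + x^2)) = c * pi"
proof -
 have i: "integrable lborel (%x::real. inverse (1 + x^2))"
  using integrable_inverse_1_plus_square by (simp add: set_integrable_def)
 have "(LINT x|lborel. inverse (1 + x^2)) = pi"
  using LBINT_inverse_1_plus_square
  by (simp add: interval_lebesgue_integral_def set_lebesgue_integral_def)
 hence "(LINT x|lborel. c * inverse (1 + x^2)) = c * pi" by simp
 moreover have "integrable lborel (%x::real. c * inverse (1 + x^2))" using i by simp
 ultimately show "integrable lborel (%x::real. c / (1 + x^2))"
  "(LINT x|lborel. c / (1 + x^2)) = c * pi" by (simp_all add: divide_inverse)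
qed

lemma integral_derivative_zero:
 fixes F f :: "real => real"
 assumes "!!x. (F has_real_derivative f x) (at x)" "continuous_on UNIV f"
  "integrable lborel f" "(F \<longlongrightarrow> 0) at_top" "(F \<longlongrightarrow> 0) at_bot"
 shows "(LINT x|lborel. f x) = 0"
proof -
 have "(LBINT x=-\<infinity>..\<infinity>. f x) = 0 - 0"
 proof (rule interval_integral_FTC_integrable)
  show "!!x. (F has_vector_derivative f x) (at x)"
   using assms(1) by (simp add: has_real_derivative_iff_has_vector_derivative)
  show "!!x. isCont f x" using assms(2) by (simp add: continuous_on_eq_continuous_at)
  show "set_integrable lborel (einterval (- \<infinity>) \<infinity>) f" using assms(3) by (simp add: set_integrable_def)
  show "((F \<circ> real_of_ereal) \<longlongrightarrow> 0) (at_right (- \<infinity>))" "((F \<circ> real_of_ereal) \<longlongrightarrow> 0) (at_left \<infinity>)"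
   using assms(4,5) by (auto simp: ereal_tendsto_simps)
 qed auto
 thus ?thesis by (simp add: interval_lebesgue_integral_def set_lebesgue_integral_def)
qed

lemma tendsto_zero_of_recip_quadratic:
 fixes m :: "real => real"
 assumes "!!k. abs (m k) <= c / (1 + k^2)"
 shows "(m \<longlongrightarrow> 0) at_top" "(m \<longlongrightarrow> 0) at_bot"
proof -
 have "((%k::real. c / (1 + k^2)) \<longlongrightarrow> 0) at_top" "((%k::real. c / (1 + k^2)) \<longlongrightarrow> 0) at_bot"
  by real_asymp+
 thus "(m \<longlongrightarrow> 0) at_top" "(m \<longlongrightarrow> 0) at_bot"
  using assms by (auto intro!: Lim_null_comparison[where g="%k. c / (1 + k^2)"] always_eventually)
qed

text \<open>The phase \<open>th\<close> makes the family closed under differentiation (phase shift by \<open>pi / 2\<close>) and under integration by parts; phase \<open>0\<close> is the inverse Fourier transform of an even symbol.\<close>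

definition ci :: "real => (real => real) => real => real" where
 "ci th m x = (LINT k|lborel. cos (k * x + th) * m k) / (2 * pi)"

lemma integrable_times_bounded:
 fixes f g :: "'b => real"
 assumes "integrable M f" "g : borel_measurable M" "!!x. abs (g x) <= c"
 shows "integrable M (%x. g x * f x)"
proof (rule Bochner_Integration.integrable_bound[where f="%x. c * f x"])
 have "abs (g x) <= abs (c)" for x using assms(3)[of x] by linarith
 thus "AE x in M. norm (g x * f x) <= norm (c * f x)"
  by (intro AE_I2) (auto simp: abs_mult intro!: mult_right_mono)
qed (use assms in auto)

lemma integrable_cos_mult:
 fixes m :: "real => real"
 assumes "integrable lborel m"
 shows "integrable lborel (%k. cos (k * x + th) * m k)"
 by (rule integrable_times_bounded[OF assms, where c=1]) auto

lemma ci_abs_le: "integrable lborel m ==> abs (ci th m x) <= (LINT k|lborel. abs (m k)) / (2 * pi)"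
proof -
 assume i: "integrable lborel m"
 have "abs (LINT k|lborel. cos (k * x + th) * m k) <= (LINT k|lborel. abs (cos (k * x + th) * m k))"
  by (rule integral_abs_bound)
 also have "... <= (LINT k|lborel. abs (m k))"
  using i integrable_cos_mult[OF i, of x th]
  by (intro integral_mono integrable_abs) (simp_all add: abs_mult mult_left_le_one_le)
 finally show ?thesis by (simp add: ci_def divide_right_mono abs_divide)
qed

lemma ci_by_parts:
 assumes d: "!!k. (m has_real_derivative m1 k) (at k)" and c: "continuous_on UNIV m1"
  and i: "integrable lborel m" "integrable lborel m1"
  and t: "(m \<longlongrightarrow> 0) at_top" "(m \<longlongrightarrow> 0) at_bot"
 shows "x * ci th m x = - ci (th - pi / 2) m1 x"
proof -
 have cm: "continuous_on UNIV m" using d by (auto intro!: continuous_at_imp_continuous_on intro: DERIV_isCont)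
 have eq: "cos (k * x + (th - pi / 2)) = sin (k * x + th)" for k
  using cos_diff[of "k*x+th" "pi/2"] by (simp add: algebra_simps)
 have i1: "integrable lborel (%k. x * (cos (k * x + th) * m k))"
  using integrable_cos_mult[OF i(1)] by simp
 have i2: "integrable lborel (%k. sin (k * x + th) * m1 k)"
  by (rule integrable_times_bounded[OF i(2), where c=1]) auto
 have "(LINT k|lborel. x * (cos (k * x + th) * m k) + sin (k * x + th) * m1 k) = 0"
 proof (rule integral_derivative_zero[where F="%k. sin (k * x + th) * m k"])
  show "((%k. sin (k * x + th) * m k) has_real_derivative
    x * (cos (k * x + th) * m k) + sin (k * x + th) * m1 k) (at k)" for k
   by (auto intro!: derivative_eq_intros d simp: algebra_simps)
  show "continuous_on UNIV (%k. x * (cos (k * x + th) * m k) + sin (k * x + th) * m1 k)"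
   by (intro continuous_intros cm c)
  show "integrable lborel (%k. x * (cos (k * x + th) * m k) + sin (k * x + th) * m1 k)"
   using i1 i2 by (rule Bochner_Integration.integrable_add)
  have b: "\<forall>\<^sub>F k in F. norm (sin (k * x + th) * m k) <= abs (m k)" for F
   by (intro always_eventually allI) (auto simp: abs_mult intro!: mult_left_le_one_le)
  show "((%k. sin (k * x + th) * m k) \<longlongrightarrow> 0) at_top" "((%k. sin (k * x + th) * m k) \<longlongrightarrow> 0) at_bot"
   using t by (auto intro!: Lim_null_comparison[OF b] tendsto_rabs_zero)
 qed
 hence "x * (LINT k|lborel. cos (k * x + th) * m k) + (LINT k|lborel. sin (k * x + th) * m1 k) = 0"
  using i1 i2 by simp
 hence "x * (LINT k|lborel. cos (k * x + th) * m k) = - (LINT k|lborel. sin (k * x + th) * m1 k)"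
  by linarith
 thus ?thesis by (simp add: ci_def eq)
qed

text \<open>Two integrable derivatives of the symbol make the kernel decay like \<open>1 / (1 + x\<^sup>2)\<close>, with a constant that depends linearly on the symbol. Tracking this constant is what gives uniform kernel bounds in families of symbols.\<close>

definition dec2 :: "real => (real => real) => bool" where
 "dec2 c m \<longleftrightarrow> (EX m1 m2. (ALL k. (m has_real_derivative m1 k) (at k)) &
   (ALL k. (m1 has_real_derivative m2 k) (at k)) & continuous_on UNIV m2 &
   (ALL k. abs (m k) <= c / (1 + k^2) & abs (m1 k) <= c / (1 + k^2) & abs (m2 k) <= c / (1 + k^2)))"

lemma integrable_of_recip_quadratic:
 fixes m :: "real => 'a::euclidean_space"
 assumes "m : borel_measurable lborel" "!!k. norm (m k) <= c / (1 + k^2)"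
 shows "integrable lborel m"
proof (rule Bochner_Integration.integrable_bound[OF integrable_recip_quadratic[of c]])
 have "norm (m x) <= norm (c / (1 + x^2))" for x
  unfolding real_norm_def using assms(2)[of x] by (rule order_trans) (rule abs_ge_self)
 thus "AE x in lborel. norm (m x) <= norm (c / (1 + x^2))" by simp
qed (use assms in auto)

lemma integral_le_of_recip_quadratic:
 fixes m :: "real => real"
 assumes "m : borel_measurable lborel" "!!k. abs (m k) <= c / (1 + k^2)"
 shows "(LINT k|lborel. abs (m k)) <= c * pi"
proof -
 have "integrable lborel m"
  by (rule integrable_of_recip_quadratic[OF assms(1), of c]) (simp only: real_norm_def assms(2))
 hence "(LINT k|lborel. abs (m k)) <= (LINT k|lborel. c / (1 + k^2))"
  by (intro integral_mono integrable_abs integrable_recip_quadratic assms(2))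
 thus ?thesis by (simp add: integral_recip_quadratic)
qed

lemma continuous_imp_measurable: "continuous_on UNIV (f::real => 'a::topological_space) ==> f : borel_measurable lborel"
 using borel_measurable_continuous_onI by (auto simp: measurable_lborel1)

lemma ci_second_moment:
 assumes d: "!!k. (m has_real_derivative m1 k) (at k)" "!!k. (m1 has_real_derivative m2 k) (at k)"
  "continuous_on UNIV m2"
  and b: "!!k. abs (m k) <= c / (1 + k^2)" "!!k. abs (m1 k) <= c / (1 + k^2)" "!!k. abs (m2 k) <= c / (1 + k^2)"
 shows "x^2 * ci th m x = ci (th - pi / 2 - pi / 2) m2 x"
proof -
 have c: "continuous_on UNIV m" "continuous_on UNIV m1"
  using d by (auto intro!: continuous_at_imp_continuous_on intro: DERIV_isCont)
 have i: "integrable lborel m" "integrable lborel m1" "integrable lborel m2"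
  by (rule integrable_of_recip_quadratic[where c=c]; (rule continuous_imp_measurable c d(3) | simp only: real_norm_def b)+)+
 have "x * ci th m x = - ci (th - pi / 2) m1 x"
  by (rule ci_by_parts) (use i c d tendsto_zero_of_recip_quadratic[OF b(1)] in auto)
 moreover have "x * ci (th - pi / 2) m1 x = - ci (th - pi / 2 - pi / 2) m2 x"
  by (rule ci_by_parts) (use i c d tendsto_zero_of_recip_quadratic[OF b(2)] in auto)
 ultimately show ?thesis by (simp add: power2_eq_square mult.assoc)
qed

lemma dec2_continuous: "dec2 c m ==> continuous_on UNIV m"
 unfolding dec2_def by (auto intro!: continuous_at_imp_continuous_on intro: DERIV_isCont)

lemma dec2_integrable: "dec2 c m ==> integrable lborel m"
 by (rule integrable_of_recip_quadratic[OF continuous_imp_measurable[OF dec2_continuous], where c=c])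
   (auto simp: dec2_def)

lemma dec2_abs: "dec2 c m ==> abs (m k) <= c / (1 + k^2)"
 by (auto simp: dec2_def)

lemma dec2_nonneg: "dec2 c m ==> 0 <= c"
 using dec2_abs[of c m 0] by simp

lemma ci_dec2: assumes "dec2 c m" shows "abs (ci th m x) <= c / (1 + x^2)"
proof -
 obtain m1 m2 where d: "!!k. (m has_real_derivative m1 k) (at k)" "!!k. (m1 has_real_derivative m2 k) (at k)"
  "continuous_on UNIV m2"
  and b: "!!k. abs (m k) <= c / (1 + k^2)" "!!k. abs (m1 k) <= c / (1 + k^2)" "!!k. abs (m2 k) <= c / (1 + k^2)"
  using assms unfolding dec2_def by blast
 have meas: "m : borel_measurable lborel" "m2 : borel_measurable lborel"
  using d(3) dec2_continuous[OF assms] continuous_imp_measurable by auto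
 have i: "integrable lborel m" "integrable lborel m2"
  by (rule integrable_of_recip_quadratic[where c=c]; (rule meas | simp only: real_norm_def b)+)+
 have "abs (ci th m x) <= c * pi / (2 * pi)"
  by (rule order_trans[OF ci_abs_le[OF i(1)]]) (intro divide_right_mono integral_le_of_recip_quadratic meas b, simp)
 moreover have "abs (x^2 * ci th m x) <= c * pi / (2 * pi)"
  unfolding ci_second_moment[OF d b]
  by (rule order_trans[OF ci_abs_le[OF i(2)]]) (intro divide_right_mono integral_le_of_recip_quadratic meas b, simp)
 ultimately have "abs (ci th m x) * (1 + x^2) <= c"
  by (simp add: abs_mult algebra_simps)
 moreover have "1 + x^2 > 0" by (smt (verit) zero_le_power2)
 ultimately show ?thesis by (simp add: field_simps)
qed

lemma derivative_under_integral:
 fixes f :: "real => 'b => real"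
 assumes d: "!!x k. a < x ==> x < b ==> ((%x. f x k) has_real_derivative f' x k) (at x)"
  and i: "!!x. a < x ==> x < b ==> integrable M (f x)"
  and w: "integrable M w" "!!x k. a < x ==> x < b ==> abs (f' x k) <= w k"
  and x0: "a < x0" "x0 < b"
 shows "((%x. LINT k|M. f x k) has_real_derivative (LINT k|M. f' x0 k)) (at x0)"
proof -
 have "((%y. ((LINT k|M. f y k) - (LINT k|M. f x0 k)) / (y - x0)) \<longlongrightarrow> (LINT k|M. f' x0 k)) (at x0)"
  unfolding tendsto_at_iff_sequentially comp_def
 proof (intro allI impI)
  fix X :: "nat => real" assume X: "ALL i. X i : UNIV - {x0}" "X \<longlonglongrightarrow> x0"
  have "\<forall>\<^sub>F n in sequentially. a < X n" "\<forall>\<^sub>F n in sequentially. X n < b"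
   using X(2) x0 order_tendstoD by blast+
  hence "\<forall>\<^sub>F n in sequentially. a < X n & X n < b" by eventually_elim auto
  then obtain N where N: "!!n. n >= N ==> a < X n & X n < b"
   by (auto simp: eventually_sequentially)
  define Y where "Y n = X (n + N)" for n
  have Y: "a < Y n" "Y n < b" "Y n \<noteq> x0" for n using N[of "n+N"] X(1) by (auto simp: Y_def)
  have Yl: "Y \<longlonglongrightarrow> x0" unfolding Y_def using X(2) by (rule LIMSEQ_ignore_initial_segment)
  have dq: "(LINT k|M. (f (Y n) k - f x0 k) / (Y n - x0)) = ((LINT k|M. f (Y n) k) - (LINT k|M. f x0 k)) / (Y n - x0)" for n
   using i[OF Y(1,2)] i[OF x0] by simp
  have lim: "(%n. (f (Y n) k - f x0 k) / (Y n - x0)) \<longlonglongrightarrow> f' x0 k" for k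
  proof -
   have "((%y. (f y k - f x0 k) / (y - x0)) \<longlongrightarrow> f' x0 k) (at x0)"
    using d[OF x0] by (simp add: has_field_derivative_iff)
   thus ?thesis using Yl Y(3) by (auto simp: tendsto_at_iff_sequentially comp_def)
  qed
  have meas: "(%k. (f (Y n) k - f x0 k) / (Y n - x0)) : borel_measurable M" for n
   using i[OF Y(1,2)] i[OF x0] by (intro borel_measurable_divide borel_measurable_diff) auto
  have bound: "abs ((f (Y n) k - f x0 k) / (Y n - x0)) <= w k" for n k
  proof -
   have "EX z. min (Y n) x0 < z & z < max (Y n) x0 & f (max (Y n) x0) k - f (min (Y n) x0) k = (max (Y n) x0 - min (Y n) x0) * f' z k"
    by (rule MVT2) (use Y[of n] x0 in "auto intro!: d")
   then obtain z where z: "min (Y n) x0 < z" "z < max (Y n) x0"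
    "f (max (Y n) x0) k - f (min (Y n) x0) k = (max (Y n) x0 - min (Y n) x0) * f' z k" by blast
   have "f (Y n) k - f x0 k = (Y n - x0) * f' z k"
    using z(3) by (cases "Y n <= x0") (auto simp: max_def min_def algebra_simps split: if_splits)
   hence "(f (Y n) k - f x0 k) / (Y n - x0) = f' z k" using Y(3)[of n] by simp
   moreover have "a < z" "z < b" using z(1,2) Y(1,2)[of n] x0 by auto
   ultimately show ?thesis using w(2) by simp
  qed
  have "(%n. LINT k|M. (f (Y n) k - f x0 k) / (Y n - x0)) \<longlonglongrightarrow> (LINT k|M. f' x0 k)"
  proof (rule integral_dominated_convergence[where w=w])
   show "f' x0 : borel_measurable M" using lim meas by (rule borel_measurable_LIMSEQ_real)
  qed (use lim meas bound w in auto)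
  hence "(%n. ((LINT k|M. f (Y n) k) - (LINT k|M. f x0 k)) / (Y n - x0)) \<longlonglongrightarrow> (LINT k|M. f' x0 k)"
   by (simp only: dq)
  thus "(%n. ((LINT k|M. f (X n) k) - (LINT k|M. f x0 k)) / (X n - x0)) \<longlonglongrightarrow> (LINT k|M. f' x0 k)"
   unfolding Y_def by (rule LIMSEQ_offset)
 qed
 thus ?thesis by (simp add: has_field_derivative_iff)
qed

lemma ci_derivative:
 assumes "integrable lborel m" "integrable lborel (%k. k * m k)"
 shows "(ci th m has_real_derivative ci (th + pi / 2) (%k. k * m k) x) (at x)"
proof -
 have eq: "cos (k * x + (th + pi / 2)) = - sin (k * x + th)" for k x
  using cos_add[of "k*x+th" "pi/2"] by (simp add: algebra_simps)
 have "((%x. LINT k|lborel. cos (k * x + th) * m k) has_real_derivative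
   (LINT k|lborel. cos (k * x + (th + pi / 2)) * (k * m k))) (at x)"
 proof (rule derivative_under_integral[where a="x-1" and b="x+1" and w="%k. abs (k * m k)"])
  show "integrable lborel (%k. abs (k * m k))" using assms(2) by simp
  show "abs (cos (k * x + (th + pi / 2)) * (k * m k)) <= abs (k * m k)" for k x
   by (subst abs_mult) (auto intro!: mult_left_le_one_le)
 qed (auto intro!: derivative_eq_intros integrable_cos_mult assms simp: eq)
 from DERIV_cdivide[OF this, of "2*pi"] show ?thesis by (simp add: ci_def[abs_def])
qed

section \<open>Convolution operators\<close>

lemma
 fixes f :: "'b => 'c => 'a::euclidean_space"
 assumes s: "sigma_finite_measure M" "sigma_finite_measure N"
  and m: "(%(x, y). f x y) : borel_measurable (M \<Otimes>\<^sub>M N)"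
  and i: "!!x. integrable N (f x)" "!!x. (LINT y|N. norm (f x y)) <= w x" "integrable M w"
 shows fubini_general_integrable: "integrable (M \<Otimes>\<^sub>M N) (%(x, y). f x y)"
  and fubini_general: "(LINT x|M. LINT y|N. f x y) = (LINT y|N. LINT x|M. f x y)"
proof -
 interpret M: sigma_finite_measure M by fact
 interpret N: sigma_finite_measure N by fact
 interpret pair_sigma_finite M N ..
 note [measurable] = m
 show int: "integrable (M \<Otimes>\<^sub>M N) (%(x, y). f x y)"
 proof (rule Fubini_integrable)
  show "integrable M (%x. LINT y|N. norm (case (x, y) of (x, y) => f x y))"
  proof (rule Bochner_Integration.integrable_bound[OF i(3)])
   have "norm (LINT y|N. norm (f x y)) <= norm (w x)" for x
    using i(2)[of x] integral_nonneg_AE[of "%y. norm (f x y)" N] by auto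
   thus "AE x in M. norm (LINT y|N. norm (case (x, y) of (x, y) => f x y)) <= norm (w x)" by simp
  qed measurable
 qed (use i m in auto)
 show "(LINT x|M. LINT y|N. f x y) = (LINT y|N. LINT x|M. f x y)"
  using Fubini_integral[OF int] by simp
qed

lemma
 fixes f :: "'b => 'c => 'a::euclidean_space"
 assumes s: "sigma_finite_measure M" "sigma_finite_measure N"
  and m: "(%(x, y). f x y) : borel_measurable (M \<Otimes>\<^sub>M N)"
  and i: "integrable M v" "integrable N w" "!!x y. norm (f x y) <= v x * w y"
 shows fubini_product_integrable: "integrable (M \<Otimes>\<^sub>M N) (%(x, y). f x y)"
  and fubini_product: "(LINT x|M. LINT y|N. f x y) = (LINT y|N. LINT x|M. f x y)"
proof -
 note [measurable] = m
 have int: "integrable (M \<Otimes>\<^sub>M N) (%(x, y). v x * w y)"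
 proof (rule fubini_general_integrable[OF s])
  show "integrable M (%x. abs (v x) * (LINT y|N. abs (w y)))" using i by auto
 qed (use i in "auto simp: abs_mult")
 interpret M: sigma_finite_measure M by fact
 interpret N: sigma_finite_measure N by fact
 interpret pair_sigma_finite M N ..
 show int: "integrable (M \<Otimes>\<^sub>M N) (%(x, y). f x y)"
  by (rule Bochner_Integration.integrable_bound[OF int m])
   (use i(3) in "auto intro!: AE_I2 order_trans[OF _ abs_ge_self]")
 show "(LINT x|M. LINT y|N. f x y) = (LINT y|N. LINT x|M. f x y)"
  using Fubini_integral[OF int] by simp
qed

definition kern :: "'b measure => ('b => real) => ('b => real) => bool" where
 "kern M w g \<longleftrightarrow> sigma_finite_measure M & integrable M w & g : borel_measurable M"

text \<open>A convolution whose kernel lives on an arbitrary measure space. Measures, cosine kernels and the rescaled heat kernel are all of this form, so commutation, continuity and preservation of derivatives are proved once.\<close>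

definition cv :: "'b measure => ('b => real) => ('b => real) => (real => 'a::euclidean_space) => real => 'a" where
 "cv M w g f x = (LINT z|M. w z *\<^sub>R f (x - g z))"

definition bcf :: "(real => 'a::real_normed_vector) => bool" where
 "bcf f \<longleftrightarrow> continuous_on UNIV f & (EX B. ALL x. norm (f x) <= B)"

lemma bcfI: "continuous_on UNIV f ==> (!!x. norm (f x) <= B) ==> bcf f"
 by (auto simp: bcf_def)

lemma bcf_measurable: "bcf (f::real => 'a::euclidean_space) ==> f : borel_measurable borel"
 by (auto simp: bcf_def intro: borel_measurable_continuous_onI)

lemma bcf_bound: assumes "bcf f" obtains B where "B >= 0" "!!x. norm (f x) <= B"
 using assms unfolding bcf_def by (metis norm_ge_zero order_trans)

lemma bcf_add: "bcf f ==> bcf g ==> bcf (%x. f x + g x)"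
 unfolding bcf_def by (auto intro!: continuous_intros) (meson add_mono norm_triangle_le)

lemma bcf_linear: "bcf f ==> bounded_linear h ==> bcf (%x. h (f x))"
proof -
 assume f: "bcf f" and h: "bounded_linear h"
 obtain B where B: "!!x. norm (f x) <= B" using bcf_bound[OF f] by blast
 obtain K where K: "!!x. norm (h x) <= norm x * K" "K > 0"
  using bounded_linear.pos_bounded[OF h] by blast
 have "norm (h (f x)) <= B * K" for x
  by (rule order_trans[OF K(1)]) (use B K(2) in auto)
 thus ?thesis using f bounded_linear.continuous_on[OF h]
  by (auto simp: bcf_def)
qed

lemma bcf_scaleR: "bcf f ==> bcf (%x. c *\<^sub>R f x)"
 by (rule bcf_linear[OF _ bounded_linear_scaleR_right])

lemma bcf_minus: "bcf f ==> bcf (%x. - f x)"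
 using bcf_scaleR[of f "-1"] by simp

lemma bcf_diff: "bcf f ==> bcf g ==> bcf (%x. f x - g x)"
 using bcf_add[OF _ bcf_minus, of f g] by simp

lemma bcf_bilinear:
 assumes p: "bounded_bilinear p" and f: "bcf f" and g: "bcf g"
 shows "bcf (%x. p (f x) (g x))"
proof -
 obtain B where B: "B >= 0" "!!x. norm (f x) <= B" using bcf_bound[OF f] by blast
 obtain C where C: "C >= 0" "!!x. norm (g x) <= C" using bcf_bound[OF g] by blast
 obtain K where K: "K > 0" "!!a b. norm (p a b) <= norm a * norm b * K"
  using bounded_bilinear.pos_bounded[OF p] by blast
 have "norm (p (f x) (g x)) <= B * C * K" for x
  by (rule order_trans[OF K(2)]) (use B C K in "auto intro!: mult_right_mono mult_mono")
 thus ?thesis using f g bounded_bilinear.continuous_on[OF p] by (auto simp: bcf_def)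
qed

lemma kern_measurable: "kern M w g ==> w : borel_measurable M" "kern M w g ==> g : borel_measurable M"
 by (auto simp: kern_def)

lemma cv_integrable:
 fixes f :: "real => 'a::euclidean_space"
 assumes k: "kern M w g" and f: "bcf f"
 shows "integrable M (%z. w z *\<^sub>R f (x - g z))"
proof -
 obtain B where B: "B >= 0" "!!x. norm (f x) <= B" using bcf_bound[OF f] by blast
 have [measurable]: "w : borel_measurable M" "g : borel_measurable M" "f : borel_measurable borel"
  using kern_measurable[OF k] bcf_measurable[OF f] by auto
 show ?thesis
 proof (rule Bochner_Integration.integrable_bound[where f="%z. B * w z"])
  show "integrable M (%z. B * w z)" using k by (auto simp: kern_def)
  show "AE z in M. norm (w z *\<^sub>R f (x - g z)) <= norm (B * w z)"
   using B by (intro AE_I2) (auto simp: abs_mult mult.commute[of B] intro!: mult_left_mono)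
 qed measurable
qed

lemma cv_norm_le:
 assumes k: "kern M w g" and f: "bcf f" and B: "!!x. norm (f x) <= B"
 shows "norm (cv M w g f x) <= B * (LINT z|M. abs (w z))"
proof -
 have i: "integrable M (%z. norm (w z *\<^sub>R f (x - g z)))"
  using cv_integrable[OF k f] by (rule integrable_norm)
 have "norm (cv M w g f x) <= (LINT z|M. norm (w z *\<^sub>R f (x - g z)))"
  unfolding cv_def by (rule integral_norm_bound)
 also have "... <= (LINT z|M. B * abs (w z))"
  using k B by (intro integral_mono i) (auto simp: kern_def mult.commute[of B] intro!: mult_left_mono)
 finally show ?thesis by simp
qed

lemma cv_continuous_param:
 fixes F :: "real => 'p::metric_space => 'a::euclidean_space"
 assumes W: "integrable M W" "!!p z. p : P ==> abs (w p z) <= W z"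
  and m: "!!p. p : P ==> w p : borel_measurable M" "!!p. p : P ==> g p : borel_measurable M"
  and c: "!!z. continuous_on P (%p. w p z)" "!!z. continuous_on P (%p. g p z)"
  and F: "continuous_on (UNIV \<times> P) (%(x, p). F x p)" "!!x p. p : P ==> norm (F x p) <= B"
 shows "continuous_on (UNIV \<times> P) (%(x, p). cv M (w p) (g p) (%y. F y p) x)"
 unfolding continuous_on_sequentially
proof (intro allI ballI impI, elim conjE)
 fix X :: "nat => real \<times> 'p" and a
 assume a: "a : UNIV \<times> P" and X: "ALL n. X n : UNIV \<times> P" "X \<longlonglongrightarrow> a"
 obtain x p where ap: "a = (x, p)" "p : P" using a by auto
 have Xp: "snd (X n) : P" for n using X(1)[rule_format, of n] by auto
 have l: "(%n. fst (X n)) \<longlonglongrightarrow> x" "(%n. snd (X n)) \<longlonglongrightarrow> p"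
  using tendsto_fst[OF X(2)] tendsto_snd[OF X(2)] ap by auto
 have lim: "(%n. w (snd (X n)) z *\<^sub>R F (fst (X n) - g (snd (X n)) z) (snd (X n))) \<longlonglongrightarrow> w p z *\<^sub>R F (x - g p z) p" for z
 proof (intro tendsto_scaleR)
  show "(%n. w (snd (X n)) z) \<longlonglongrightarrow> w p z"
   using continuous_on_tendsto_compose[OF c(1) l(2) ap(2)] Xp by auto
  have g: "(%n. g (snd (X n)) z) \<longlonglongrightarrow> g p z"
   using continuous_on_tendsto_compose[OF c(2) l(2) ap(2)] Xp by auto
  have "(%n. (fst (X n) - g (snd (X n)) z, snd (X n))) \<longlonglongrightarrow> (x - g p z, p)"
   by (intro tendsto_Pair tendsto_diff l g)
  from continuous_on_tendsto_compose[OF F(1) this]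
  show "(%n. F (fst (X n) - g (snd (X n)) z) (snd (X n))) \<longlonglongrightarrow> F (x - g p z) p"
   using ap Xp by auto
 qed
 have Fm: "(%y. F y q) : borel_measurable borel" if "q : P" for q
 proof -
  have "continuous_on UNIV (%y. (%(x, p). F x p) (y, q))"
   by (rule continuous_on_compose2[OF F(1)]) (use that in "auto intro!: continuous_intros")
  thus ?thesis by (auto intro: borel_measurable_continuous_onI)
 qed
 have meas: "(%z. w q z *\<^sub>R F (y - g q z) q) : borel_measurable M" if "q : P" for q y
  using m[OF that] measurable_compose[OF _ Fm[OF that], of "%z. y - g q z" M]
  by (intro borel_measurable_scaleR) auto
 have "(%n. LINT z|M. w (snd (X n)) z *\<^sub>R F (fst (X n) - g (snd (X n)) z) (snd (X n))) \<longlonglongrightarrow> (LINT z|M. w p z *\<^sub>R F (x - g p z) p)"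
 proof (rule integral_dominated_convergence[where w="%z. W z * B"])
  have "norm (w (snd (X n)) z *\<^sub>R F (fst (X n) - g (snd (X n)) z) (snd (X n))) <= W z * B" for n z
   unfolding norm_scaleR using W(2)[OF Xp] F(2)[OF Xp]
   by (intro mult_mono) (auto intro: order_trans[OF abs_ge_zero W(2)[OF Xp]])
  thus "!!n. AE z in M. norm (w (snd (X n)) z *\<^sub>R F (fst (X n) - g (snd (X n)) z) (snd (X n))) <= W z * B" by simp
 qed (use lim meas Xp ap W in auto)
 thus "((%(x, p). cv M (w p) (g p) (%y. F y p) x) \<circ> X) \<longlonglongrightarrow> (case a of (x, p) => cv M (w p) (g p) (%y. F y p) x)"
  by (simp add: cv_def ap comp_def case_prod_beta)
qed

lemma cv_continuous:
 assumes k: "kern M w g" and f: "bcf f" shows "continuous_on UNIV (cv M w g f)"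
proof -
 obtain B where B: "B >= 0" "!!x. norm (f x) <= B" using bcf_bound[OF f] by blast
 have c: "continuous_on (UNIV \<times> {0::real}) (%(x, p). f x)"
  unfolding case_prod_beta by (rule continuous_on_compose2[of UNIV f]) (use f in "auto simp: bcf_def intro!: continuous_intros")
 have "continuous_on (UNIV \<times> {0::real}) (%(x, p). cv M w g f x)"
  by (rule cv_continuous_param[where W="%z. abs (w z)" and w="%_. w" and g="%_. g" and F="%x p. f x" and B=B])
    (use k kern_measurable[OF k] c B in "auto simp: kern_def intro!: continuous_intros")
 hence "continuous_on UNIV (%x. (%(x, p). cv M w g f x) (x, 0::real))"
  by (rule continuous_on_compose2) (auto intro!: continuous_intros)
 thus ?thesis by simp
qed

lemma cv_bcf:
 assumes k: "kern M w g" and f: "bcf f" shows "bcf (cv M w g f)"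
proof -
 obtain B where B: "B >= 0" "!!x. norm (f x) <= B" using bcf_bound[OF f] by blast
 show ?thesis by (rule bcfI[OF cv_continuous[OF k f] cv_norm_le[OF k f B(2)]])
qed

lemma cv_add:
 assumes k: "kern M w g" and f: "bcf f" "bcf h"
 shows "cv M w g (%x. f x + h x) x = cv M w g f x + cv M w g h x"
 unfolding cv_def using cv_integrable[OF k f(1)] cv_integrable[OF k f(2)]
 by (simp add: scaleR_add_right)

lemma cv_linear:
 assumes k: "kern M w g" and f: "bcf f" and h: "bounded_linear h"
 shows "cv M w g (%x. h (f x)) x = h (cv M w g f x)"
proof -
 have "h (cv M w g f x) = (LINT z|M. h (w z *\<^sub>R f (x - g z)))"
  unfolding cv_def by (rule integral_bounded_linear[OF h cv_integrable[OF k f], symmetric])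
 thus ?thesis
  by (simp add: cv_def linear_cmul[OF bounded_linear.linear[OF h]])
qed

lemma cv_scaleR:
 assumes k: "kern M w g" and f: "bcf f" shows "cv M w g (%x. c *\<^sub>R f x) x = c *\<^sub>R cv M w g f x"
 by (rule cv_linear[OF k f bounded_linear_scaleR_right])

lemma cv_minus:
 assumes k: "kern M w g" and f: "bcf f" shows "cv M w g (%x. - f x) x = - cv M w g f x"
 using cv_scaleR[OF k f, of "-1"] by simp

lemma cv_diff:
 assumes k: "kern M w g" and f: "bcf f" "bcf h"
 shows "cv M w g (%x. f x - h x) x = cv M w g f x - cv M w g h x"
 using cv_add[OF k f(1) bcf_minus[OF f(2)]] cv_minus[OF k f(2)] by simp

lemma cv_commute:
 assumes k: "kern M w g" and l: "kern N v h" and f: "bcf f"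
 shows "cv M w g (cv N v h f) x = cv N v h (cv M w g f) x"
proof -
 obtain B where B: "B >= 0" "!!x. norm (f x) <= B" using bcf_bound[OF f] by blast
 have s: "sigma_finite_measure M" "sigma_finite_measure N" using k l by (auto simp: kern_def)
 have [measurable]: "w : borel_measurable M" "g : borel_measurable M" "v : borel_measurable N"
  "h : borel_measurable N" "f : borel_measurable borel"
  using kern_measurable[OF k] kern_measurable[OF l] bcf_measurable[OF f] by auto
 have "cv M w g (cv N v h f) x = (LINT z|M. LINT y|N. (w z * v y) *\<^sub>R f (x - g z - h y))"
  unfolding cv_def by (simp flip: scaleR_scaleR)
 also have "... = (LINT y|N. LINT z|M. (w z * v y) *\<^sub>R f (x - g z - h y))"
 proof (rule fubini_product[OF s])
  show "integrable M (%z. abs (w z))" "integrable N (%y. abs (v y) * B)" using k l by (auto simp: kern_def)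
  show "norm ((w z * v y) *\<^sub>R f (x - g z - h y)) <= abs (w z) * (abs (v y) * B)" for z y
   using B(2)[of "x - g z - h y"] by (simp add: abs_mult mult.assoc mult_left_mono)
 qed measurable
 also have "... = cv N v h (cv M w g f) x"
  unfolding cv_def by (simp add: algebra_simps flip: scaleR_scaleR integral_scaleR_right)
 finally show ?thesis .
qed

section \<open>Fourier multipliers\<close>

lemma ci_measurable[measurable]:
 assumes [measurable]: "m : borel_measurable borel" shows "ci th m : borel_measurable borel"
 unfolding ci_def by measurable

lemma gauss_cos:
 "(LINT z|lborel. std_normal_density z * cos (t * z)) = exp (- t\<^sup>2 / 2)"
proof -
 have i: "integrable std_normal_distribution (%z. iexp (t * z))"
  using real_distribution.axioms(1)[OF real_dist_normal_dist] prob_space.finite_measure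
  by (intro finite_measure.integrable_const_bound[where B=1]) auto
 have "exp (- t\<^sup>2 / 2) = Re (char std_normal_distribution t)"
  by (simp add: char_std_normal_distribution)
 also have "... = (LINT z|std_normal_distribution. Re (iexp (t * z)))"
  unfolding char_def using integral_Re[OF i] by simp
 also have "... = (LINT z|lborel. std_normal_density z *\<^sub>R Re (iexp (t * z)))"
  by (rule integral_density) (auto simp: normal_density_nonneg)
 finally show ?thesis by (simp add: Re_exp)
qed

text \<open>The cosine transform of the kernel returns the symbol: insert a Gaussian factor, exchange the integrals, and let the Gaussian become an approximate identity in frequency space.\<close>

lemma ci_inversion:
 assumes m: "continuous_on UNIV m" "!!k. abs (m k) <= B" "integrable lborel m" "!!k. m (- k) = m k"
  and i: "integrable lborel (ci 0 m)"
 shows "(LINT y|lborel. ci 0 m y * cos (xi * y)) = m xi"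
proof -
 define G where "G n y = std_normal_density (y / real (Suc n)) / std_normal_density 0" for n y
 have s0: "std_normal_density 0 = 1 / sqrt (2 * pi)" by (simp add: normal_density_def)
 have Gexp: "G n y = exp (- (y / real (Suc n))\<^sup>2 / 2)" for n y
  unfolding G_def s0 by (simp add: normal_density_def)
 have [measurable]: "m : borel_measurable borel" using m(1) by (rule borel_measurable_continuous_onI)
 have [measurable]: "G n : borel_measurable borel" for n unfolding G_def by measurable
 have Gi: "integrable lborel (G n)" for n
 proof -
  have "integrable lborel std_normal_density" by simp
  from lborel_integrable_real_affine[OF this, of "1 / real (Suc n)" 0]
  show ?thesis unfolding G_def by simp
 qed
 define I where "I n = (LINT y|lborel. ci 0 m y * cos (xi * y) * G n y)" for n
 have "I \<longlonglongrightarrow> (LINT y|lborel. ci 0 m y * cos (xi * y))"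
  unfolding I_def
 proof (rule integral_dominated_convergence[where w="%y. abs (ci 0 m y)"])
  show "AE y in lborel. (%n. ci 0 m y * cos (xi * y) * G n y) \<longlonglongrightarrow> ci 0 m y * cos (xi * y)"
  proof (intro AE_I2)
   fix y :: real
   have h: "(%n. y / real (Suc n)) \<longlonglongrightarrow> 0"
    unfolding divide_inverse by (rule tendsto_mult_right_zero[OF LIMSEQ_inverse_real_of_nat])
   have "(%n. exp (- (y / real (Suc n))\<^sup>2 / 2)) \<longlonglongrightarrow> exp (- 0\<^sup>2 / 2)"
    by (intro tendsto_exp tendsto_divide tendsto_minus tendsto_power tendsto_const h) simp
   hence "(%n. exp (- (y / real (Suc n))\<^sup>2 / 2)) \<longlonglongrightarrow> 1"
    by (simp only: power_zero_numeral minus_zero div_0 exp_zero)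
   thus "(%n. ci 0 m y * cos (xi * y) * G n y) \<longlonglongrightarrow> ci 0 m y * cos (xi * y)"
    unfolding Gexp using tendsto_mult_left[of _ 1 sequentially "ci 0 m y * cos (xi * y)"] by simp
  qed
  have "abs (cos (xi * y) * G n y) <= 1" for n y
   unfolding abs_mult by (rule mult_le_one) (auto simp: Gexp)
  hence "abs (ci 0 m y) * abs (cos (xi * y) * G n y) <= abs (ci 0 m y)" for n y
   by (rule mult_left_le) auto
  thus "AE y in lborel. norm (ci 0 m y * cos (xi * y) * G n y) <= abs (ci 0 m y)" for n
   by (intro AE_I2) (simp add: abs_mult mult.assoc)
 qed (use i in auto)
 moreover have "I \<longlonglongrightarrow> m xi"
 proof -
  have inner: "(LINT y|lborel. cos (k * y) * cos (xi * y) * G n y)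
    = real (Suc n) * sqrt (2 * pi) * ((exp (- (real (Suc n) * (k - xi))\<^sup>2 / 2) + exp (- (real (Suc n) * (k + xi))\<^sup>2 / 2)) / 2)" for k n
  proof -
   let ?n = "real (Suc n)"
   have ii: "integrable lborel (%z. cos (l * z) * std_normal_density z)" for l
    by (rule integrable_times_bounded[where c=1]) auto
   have "(LINT y|lborel. cos (k * y) * cos (xi * y) * G n y) =
    ?n * (LINT z|lborel. cos (k * (?n * z)) * cos (xi * (?n * z)) * G n (?n * z))"
    by (subst lborel_integral_real_affine[of ?n _ 0]) auto
   also have "(LINT z|lborel. cos (k * (?n * z)) * cos (xi * (?n * z)) * G n (?n * z)) =
    (LINT z|lborel. sqrt (2 * pi) * ((std_normal_density z * cos ((?n * (k - xi)) * z) + std_normal_density z * cos ((?n * (k + xi)) * z)) / 2))"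
   proof (rule Bochner_Integration.integral_cong[OF refl])
    fix z
    have "cos (k * (?n * z)) * cos (xi * (?n * z)) = (cos ((?n * (k - xi)) * z) + cos ((?n * (k + xi)) * z)) / 2"
    unfolding cos_times_cos by (simp add: algebra_simps)
    moreover have "G n (?n * z) = sqrt (2 * pi) * std_normal_density z"
    unfolding G_def s0 by simp
    moreover have "X * Y * V = r * ((d * A1 + d * A2) / 2)" if "X * Y = (A1 + A2) / 2" "V = r * d" for X Y V r d A1 A2 :: real
    by (simp only: that times_divide_eq_right times_divide_eq_left distrib_left mult_ac)
    ultimately show "cos (k * (?n * z)) * cos (xi * (?n * z)) * G n (?n * z) =
    sqrt (2 * pi) * ((std_normal_density z * cos ((?n * (k - xi)) * z) + std_normal_density z * cos ((?n * (k + xi)) * z)) / 2)"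
    by blast
   qed
   also have "... = sqrt (2 * pi) * ((exp (- (?n * (k - xi))\<^sup>2 / 2) + exp (- (?n * (k + xi))\<^sup>2 / 2)) / 2)"
    using ii by (simp only: integral_mult_right_zero integral_divide_zero mult.commute[of "std_normal_density _"] Bochner_Integration.integral_add)
    (simp only: mult.commute[of _ "std_normal_density _"] gauss_cos)
   finally show ?thesis by (simp add: algebra_simps)
  qed
  define H where "H n = (LINT l|lborel. std_normal_density l * ((m (xi + l / real (Suc n)) + m (- xi + l / real (Suc n))) / 2))" for n
  have IH: "I n = H n" for n
  proof -
   let ?n = "real (Suc n)"
   have "I n = (LINT y|lborel. LINT k|lborel. (cos (k * y) * m k * (cos (xi * y) * G n y)) / (2 * pi))"
    unfolding I_def ci_def add_0_right
    by (simp only: integral_divide_zero integral_mult_left_zero times_divide_eq_left) (simp only: mult.assoc)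
   also have "... = (LINT k|lborel. LINT y|lborel. (cos (k * y) * m k * (cos (xi * y) * G n y)) / (2 * pi))"
   proof (rule fubini_product)
    show "integrable lborel (%y. abs (G n y))" "integrable lborel (%k. abs (m k) / (2 * pi))" using Gi m by auto
    have cc: "abs (cos (k * y) * cos (xi * y)) <= 1" for k y
    unfolding abs_mult by (rule mult_le_one) auto
    show "norm ((cos (k * y) * m k * (cos (xi * y) * G n y)) / (2 * pi)) <= abs (G n y) * (abs (m k) / (2 * pi))" for k y
    using mult_right_mono[OF cc[of k y], of "abs (m k) * abs (G n y) / (2*pi)"]
    by (simp add: abs_mult mult_ac)
   qed (auto simp: sigma_finite_lborel)
   also have "... = (LINT k|lborel. m k * (LINT y|lborel. cos (k * y) * cos (xi * y) * G n y) / (2 * pi))"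
    by (simp add: mult_ac)
   also have "... = (LINT k|lborel. (m k * ?n * std_normal_density (?n * (k - xi))) / 2 + (m k * ?n * std_normal_density (?n * (k + xi))) / 2)"
   proof (rule Bochner_Integration.integral_cong[OF refl])
    fix k
    have sq: "sqrt (2 * pi) * sqrt (2 * pi) = 2 * pi" by simp
    have nd: "std_normal_density x = exp (- x\<^sup>2 / 2) / sqrt (2 * pi)" for x
    by (simp add: normal_density_def)
    have "a * (r * s * ((A1 + A2) / 2)) / (s * s) = a * r * (A1 / s) / 2 + a * r * (A2 / s) / 2" if "s \<noteq> 0" for a r s A1 A2 :: real
    using that by (simp add: field_simps)
    from this[of "sqrt (2 * pi)"] show "m k * (LINT y|lborel. cos (k * y) * cos (xi * y) * G n y) / (2 * pi) =
    m k * ?n * std_normal_density (?n * (k - xi)) / 2 + m k * ?n * std_normal_density (?n * (k + xi)) / 2"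
    unfolding inner nd sq by simp
   qed
   also have "... = (LINT k|lborel. (m k * ?n * std_normal_density (?n * (k - xi))) / 2) + (LINT k|lborel. (m k * ?n * std_normal_density (?n * (k + xi))) / 2)"
   proof (rule Bochner_Integration.integral_add)
    have "integrable lborel (%k. std_normal_density (?n * c + ?n * k))" for c
    using lborel_integrable_real_affine[of std_normal_density ?n "?n * c"] by simp
    from this[of "-xi"] this[of xi] have *: "integrable lborel (%k. std_normal_density (?n * (k - xi)))" "integrable lborel (%k. std_normal_density (?n * (k + xi)))"
    by (simp_all add: algebra_simps)
    have "integrable lborel (%k. m k * (std_normal_density (?n * (k - xi))))" "integrable lborel (%k. m k * (std_normal_density (?n * (k + xi))))"
    by (rule integrable_times_bounded[where c=B, OF _ _ m(2)] * | simp)+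
    note i2 = this[THEN integrable_mult_right[where c="?n / 2"]]
    have "?n / 2 * (m k * x) = m k * ?n * x / 2" for k x by simp
    with i2 show "integrable lborel (%k. (m k * ?n * std_normal_density (?n * (k - xi))) / 2)"
    "integrable lborel (%k. (m k * ?n * std_normal_density (?n * (k + xi))) / 2)"
    by (simp_all only:)
   qed
   also have "(LINT k|lborel. (m k * ?n * std_normal_density (?n * (k - xi))) / 2) = (LINT l|lborel. std_normal_density l * m (xi + l / ?n) / 2)"
    by (subst lborel_integral_real_affine[of "1 / ?n" _ "xi"]) (auto simp: mult_ac simp flip: integral_mult_right_zero)
   also have "(LINT k|lborel. (m k * ?n * std_normal_density (?n * (k + xi))) / 2) = (LINT l|lborel. std_normal_density l * m (-xi + l / ?n) / 2)"
    by (subst lborel_integral_real_affine[of "1 / ?n" _ "-xi"]) (auto simp: mult_ac simp flip: integral_mult_right_zero)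
   also have "(LINT l|lborel. std_normal_density l * m (xi + l / ?n) / 2) + (LINT l|lborel. std_normal_density l * m (-xi + l / ?n) / 2) = H n"
   proof -
    have "integrable lborel (%l. m (c + l / ?n) * std_normal_density l)" for c
    by (rule integrable_times_bounded[where c=B, OF _ _ m(2)]) auto
    from this[of xi] this[of "- xi"] show ?thesis unfolding H_def
    by (subst Bochner_Integration.integral_add[symmetric]) (simp_all add: mult.commute algebra_simps add_divide_distrib)
   qed
   finally show ?thesis .
  qed
  have "H \<longlonglongrightarrow> (LINT l|lborel. std_normal_density l * ((m xi + m (- xi)) / 2))"
   unfolding H_def
  proof (rule integral_dominated_convergence[where w="%l. std_normal_density l * B"])
   show "AE l in lborel. (%n. std_normal_density l * ((m (xi + l / real (Suc n)) + m (- xi + l / real (Suc n))) / 2))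
    \<longlonglongrightarrow> std_normal_density l * ((m xi + m (- xi)) / 2)"
   proof (intro AE_I2)
    fix l :: real
    have "(%n. m (c + l / real (Suc n))) \<longlonglongrightarrow> m c" for c
    proof (rule continuous_on_tendsto_compose[OF m(1)])
    show "(%n. c + l / real (Suc n)) \<longlonglongrightarrow> c" by real_asymp
    qed auto
    note l = this[of xi] this[of "- xi"]
    show "(%n. std_normal_density l * ((m (xi + l / real (Suc n)) + m (- xi + l / real (Suc n))) / 2))
    \<longlonglongrightarrow> std_normal_density l * ((m xi + m (- xi)) / 2)"
    by (intro tendsto_mult[OF tendsto_const] tendsto_divide tendsto_add tendsto_const l) simp
   qed
   have b: "abs ((m a + m b) / 2) <= B" for a b
    using m(2)[of a] m(2)[of b] abs_triangle_ineq[of "m a" "m b"] by simp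
   show "AE l in lborel. norm (std_normal_density l * ((m (xi + l / real (Suc n)) + m (- xi + l / real (Suc n))) / 2)) <= std_normal_density l * B" for n
    by (intro AE_I2) (simp only: real_norm_def abs_mult[of "std_normal_density _"] abs_of_nonneg[OF normal_density_nonneg] mult_left_mono[OF b normal_density_nonneg])
  qed auto
  moreover have "(LINT l|lborel. std_normal_density l * ((m xi + m (- xi)) / 2)) = m xi"
   using m(4)[of xi] integral_normal_density[of 1 0] by simp
  moreover have "I = H" using IH by auto
  ultimately show ?thesis by simp
 qed
 ultimately show ?thesis by (rule LIMSEQ_unique)
qed

lemma integral_reflect: "(LINT y|lborel. f (- y :: real)) = (LINT y|lborel. (f y :: 'a::euclidean_space))"
 by (subst lborel_integral_real_affine[of "-1" f 0]) auto

lemma integral_translate_reflect: "(LINT y|lborel. f (a - y :: real)) = (LINT y|lborel. (f y :: 'a::euclidean_space))"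
 by (subst lborel_integral_real_affine[of "-1" f a]) auto

lemma ci_even: "ci 0 m (- x) = ci 0 m x"
 by (simp add: ci_def)

definition symb :: "'b measure => ('b => real) => ('b => real) => (real => real) => bool" where
 "symb M w g s \<longleftrightarrow> (ALL k. (LINT z|M. w z * cos (k * g z)) = s k & (LINT z|M. w z * sin (k * g z)) = 0)"

lemma kern_integrable_bounded:
 assumes k: "kern M w g" and [measurable]: "h : borel_measurable borel" and b: "!!x. abs (h x) <= 1"
 shows "integrable M (%z. w z * h (g z))"
proof -
 have [measurable]: "g : borel_measurable M" using k by (simp add: kern_def)
 have "integrable M (%z. h (g z) * w z)"
  by (rule integrable_times_bounded[where c=1]) (use k b in "auto simp: kern_def")
 thus ?thesis by (simp add: mult.commute)
qed

lemma symb_cos: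
 assumes k: "kern M w g" and s: "symb M w g s"
 shows "(LINT z|M. w z * cos (l * (x - g z))) = cos (l * x) * s l"
proof -
 have i: "integrable M (%z. w z * cos (l * g z))" "integrable M (%z. w z * sin (l * g z))"
  by (rule kern_integrable_bounded[OF k]; simp)+
 have "(LINT z|M. w z * cos (l * (x - g z))) = (LINT z|M. cos (l * x) * (w z * cos (l * g z)) + sin (l * x) * (w z * sin (l * g z)))"
  by (intro Bochner_Integration.integral_cong refl) (simp add: right_diff_distrib cos_diff algebra_simps)
 also have "... = cos (l * x) * s l"
  using i s by (simp add: symb_def)
 finally show ?thesis .
qed

definition evs :: "(real => real) => bool" where
 "evs m \<longleftrightarrow> (EX c. dec2 c m) & (ALL k. m (- k) = m k)"

lemma evs_continuous: "evs m ==> continuous_on UNIV m"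
 by (auto simp: evs_def dec2_continuous)

lemma evs_measurable: "evs m ==> m : borel_measurable borel"
 by (intro borel_measurable_continuous_onI evs_continuous)

lemma evs_integrable: "evs m ==> integrable lborel m"
 by (auto simp: evs_def dec2_integrable)

lemma evs_kern: assumes "evs m" shows "kern lborel (ci 0 m) (%y. y)"
proof -
 obtain c where c: "dec2 c m" using assms by (auto simp: evs_def)
 have "integrable lborel (ci 0 m)"
  by (rule integrable_of_recip_quadratic[where c=c])
    (use ci_measurable[OF evs_measurable[OF assms]] ci_dec2[OF c] in auto)
 thus ?thesis by (simp add: kern_def sigma_finite_lborel)
qed

lemma evs_symb: assumes "evs m" shows "symb lborel (ci 0 m) (%y. y) m"
 unfolding symb_def
proof (intro allI conjI)
 fix k
 obtain c where c: "dec2 c m" using assms by (auto simp: evs_def)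
 have "abs (m l) <= c" for l
 proof -
  have "c / (1 + l^2) <= c / 1" using dec2_nonneg[OF c] by (intro divide_left_mono) (auto simp: add_pos_nonneg)
  thus ?thesis using dec2_abs[OF c, of l] by simp
 qed
 thus "(LINT z|lborel. ci 0 m z * cos (k * z)) = m k"
  using assms evs_kern[OF assms]
  by (intro ci_inversion) (auto simp: evs_continuous evs_integrable kern_def evs_def)
 have "(LINT z|lborel. ci 0 m (- z) * sin (k * (- z))) = (LINT z|lborel. ci 0 m z * sin (k * z))"
  by (rule integral_reflect)
 thus "(LINT z|lborel. ci 0 m z * sin (k * z)) = 0"
  by (simp add: ci_even)
qed

definition fmult :: "(real => real) => (real => 'a::euclidean_space) => real => 'a" where
 "fmult m = cv lborel (ci 0 m) (%y. y)"

lemma fmult_bcf: "evs m ==> bcf f ==> bcf (fmult m f)"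
 unfolding fmult_def by (intro cv_bcf evs_kern)

lemma fmult_reflect: "fmult m f x = (LINT z|lborel. ci 0 m (x - z) *\<^sub>R f z)"
 unfolding fmult_def cv_def
 using integral_translate_reflect[of "%y. ci 0 m y *\<^sub>R f (x - y)" x] by simp

lemma cv_ci:
 assumes k: "kern M w g" and s: "symb M w g s" and m: "integrable lborel m"
 shows "(LINT z|M. w z * ci 0 m (y - g z)) = ci 0 (%l. s l * m l) y"
proof -
 have [measurable]: "w : borel_measurable M" "g : borel_measurable M" "m : borel_measurable borel"
  using kern_measurable[OF k] m by auto
 have "(LINT z|M. w z * ci 0 m (y - g z)) = (LINT z|M. LINT l|lborel. w z * (cos (l * (y - g z)) * m l) / (2 * pi))"
  by (simp add: ci_def)
 also have "... = (LINT l|lborel. LINT z|M. w z * (cos (l * (y - g z)) * m l) / (2 * pi))"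
 proof (rule fubini_product)
  show "integrable M (%z. abs (w z))" "integrable lborel (%l. abs (m l) / (2 * pi))"
   using k m by (auto simp: kern_def)
  show "norm (w z * (cos (l * (y - g z)) * m l) / (2 * pi)) <= abs (w z) * (abs (m l) / (2 * pi))" for z l
   by (auto simp: abs_mult intro!: divide_right_mono mult_left_mono mult_left_le_one_le)
 qed (use k in "auto simp: sigma_finite_lborel kern_def")
 also have "... = (LINT l|lborel. (LINT z|M. w z * cos (l * (y - g z))) * m l / (2 * pi))"
  by (simp add: mult.assoc[symmetric])
 also have "... = ci 0 (%l. s l * m l) y"
  by (simp add: symb_cos[OF k s] ci_def mult.assoc)
 finally show ?thesis .
qed

lemma cv_fmult:
 fixes f :: "real => 'a::euclidean_space"
 assumes k: "kern M w g" and s: "symb M w g s" and m: "evs m" and f: "bcf f"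
 shows "cv M w g (fmult m f) x = fmult (%l. s l * m l) f x"
proof -
 obtain B where B: "B >= 0" "!!x. norm (f x) <= B" using bcf_bound[OF f] by blast
 note [measurable] = bcf_measurable[OF f] evs_measurable[OF m] kern_measurable[OF k]
 have ci: "integrable lborel (ci 0 m)" using evs_kern[OF m] by (simp add: kern_def)
 have ci': "integrable lborel (%y. ci 0 m (a - y))" for a
  using lborel_integrable_real_affine[OF ci, of "-1" a] by simp
 have bnd: "norm ((w z * ci 0 m (a - y)) *\<^sub>R f y) <= abs (w z) * B * abs (ci 0 m (a - y))" for z a y
  using mult_left_mono[OF B(2)[of y], of "abs (w z * ci 0 m (a - y))"] by (simp add: abs_mult mult_ac)
 have i: "integrable lborel (%y. (w z * ci 0 m (a - y)) *\<^sub>R f y)" for z a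
  by (rule Bochner_Integration.integrable_bound[where f="%y. abs (w z) * B * abs (ci 0 m (a - y))"])
    (use ci'[of a] bnd B in "auto intro!: AE_I2 simp: abs_mult")
 have "cv M w g (fmult m f) x = (LINT z|M. LINT y|lborel. (w z * ci 0 m (x - g z - y)) *\<^sub>R f y)"
  unfolding cv_def fmult_reflect by (simp flip: scaleR_scaleR)
 also have "... = (LINT y|lborel. LINT z|M. (w z * ci 0 m (x - g z - y)) *\<^sub>R f y)"
 proof (rule fubini_general[where w="%z. abs (w z) * (B * (LINT y|lborel. abs (ci 0 m y)))"])
  show "integrable M (%z. abs (w z) * (B * (LINT y|lborel. abs (ci 0 m y))))" using k by (auto simp: kern_def)
  show "integrable lborel (%y. (w z * ci 0 m (x - g z - y)) *\<^sub>R f y)" for z by (rule i)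
  show "(LINT y|lborel. norm ((w z * ci 0 m (x - g z - y)) *\<^sub>R f y)) <= abs (w z) * (B * (LINT y|lborel. abs (ci 0 m y)))" for z
  proof -
   have "(LINT y|lborel. norm ((w z * ci 0 m (x - g z - y)) *\<^sub>R f y)) <= (LINT y|lborel. abs (w z) * B * abs (ci 0 m (x - g z - y)))"
    by (intro integral_mono integrable_norm i bnd integrable_mult_right integrable_abs ci')
   also have "... = abs (w z) * (B * (LINT y|lborel. abs (ci 0 m y)))"
    using integral_translate_reflect[of "%y. abs (ci 0 m y)" "x - g z"] by simp
   finally show ?thesis .
  qed
 qed (use k in "auto simp: sigma_finite_lborel kern_def")
 also have "... = (LINT y|lborel. (LINT z|M. w z * ci 0 m ((x - y) - g z)) *\<^sub>R f y)"
 proof (rule Bochner_Integration.integral_cong[OF refl])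
  fix y
  have "abs (ci 0 m a) <= (LINT k|lborel. abs (m k)) / (2 * pi)" for a by (rule ci_abs_le[OF evs_integrable[OF m]])
  hence "integrable M (%z. ci 0 m (x - y - g z) * w z)"
   by (intro integrable_times_bounded) (use k in "auto simp: kern_def")
  thus "(LINT z|M. (w z * ci 0 m (x - g z - y)) *\<^sub>R f y) = (LINT z|M. w z * ci 0 m ((x - y) - g z)) *\<^sub>R f y"
   by (subst integral_scaleR_left[symmetric]) (auto simp: algebra_simps)
 qed
 also have "... = fmult (%l. s l * m l) f x"
  unfolding fmult_reflect by (simp add: cv_ci[OF k s evs_integrable[OF m]])
 finally show ?thesis .
qed

lemma fmult_fmult:
 "evs n ==> evs m ==> bcf f ==> fmult n (fmult m f) x = fmult (%l. n l * m l) f x"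
 using cv_fmult[OF evs_kern evs_symb] unfolding fmult_def by blast

lemma ci_add: "integrable lborel m ==> integrable lborel n ==> ci th (%k. m k + n k) x = ci th m x + ci th n x"
 using integrable_cos_mult[of m] integrable_cos_mult[of n]
 by (simp add: ci_def distrib_left add_divide_distrib)

lemma ci_cmult: "ci th (%k. c * m k) x = c * ci th m x"
proof -
 have "(LINT k|lborel. cos (k * x + th) * (c * m k)) = (LINT k|lborel. c * (cos (k * x + th) * m k))"
  by (simp add: mult_ac)
 thus ?thesis by (simp add: ci_def)
qed

lemma fmult_add_symbol:
 "evs m ==> evs n ==> bcf f ==> fmult (%k. m k + n k) f x = fmult m f x + fmult n f x"
 unfolding fmult_def cv_def
 using cv_integrable[OF evs_kern, of m f x] cv_integrable[OF evs_kern, of n f x]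
 by (simp add: ci_add evs_integrable scaleR_add_left)

lemma fmult_cmult_symbol: "fmult (%k. c * m k) f x = c *\<^sub>R fmult m f x"
 unfolding fmult_def cv_def by (simp add: ci_cmult flip: scaleR_scaleR)

text \<open>A product of two kernels has its frequencies in the sums \<open>l + j\<close> of frequencies of the factors. Expanding both factors into cosines and applying \<open>e\<close> to each product of cosines replaces \<open>e\<close> by its constant value there.\<close>

lemma ci_product_symbol:
 assumes e: "evs e" and a: "evs a" and b: "evs b"
  and c: "!!l j. a l \<noteq> 0 ==> b j \<noteq> 0 ==> e (l + j) = c"
 shows "(LINT y|lborel. ci 0 e y * (ci 0 a (al - y) * ci 0 b (be - y))) = c * (ci 0 a al * ci 0 b be)"
proof -
 note [measurable] = evs_measurable[OF e] evs_measurable[OF a] evs_measurable[OF b]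
 let ?N = "lborel \<Otimes>\<^sub>M lborel :: (real \<times> real) measure"
 have iab: "integrable (lborel \<Otimes>\<^sub>M lborel) (%(l, j). abs (a l) * abs (b j))"
  by (rule fubini_product_integrable[where v="%l. abs (a l)" and w="%l. abs (b l)"])
    (auto simp: sigma_finite_lborel intro: integrable_abs[OF evs_integrable[OF a]] integrable_abs[OF evs_integrable[OF b]])
 have prod: "ci 0 a s * ci 0 b t = (LINT p|?N. (cos (fst p * s) * a (fst p)) * (cos (snd p * t) * b (snd p))) / (2 * pi)^2" for s t
 proof -
  have ii: "integrable (lborel \<Otimes>\<^sub>M lborel) (%p. (cos (fst p * s) * a (fst p)) * (cos (snd p * t) * b (snd p)))"
   by (rule Bochner_Integration.integrable_bound[OF iab])
    (auto intro!: AE_I2 mult_mono simp: abs_mult case_prod_beta mult_left_le_one_le)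
  have "(LINT p|?N. (cos (fst p * s) * a (fst p)) * (cos (snd p * t) * b (snd p)))
    = (LINT l|lborel. LINT j|lborel. (cos (l * s) * a l) * (cos (j * t) * b j))"
   using lborel_pair.integral_fst'[OF ii] by simp
  thus ?thesis by (simp add: ci_def power2_eq_square)
 qed
 have sf: "sigma_finite_measure (lborel \<Otimes>\<^sub>M lborel :: (real \<times> real) measure)"
  by (simp add: lborel_prod sigma_finite_lborel)
 have half: "(LINT y|lborel. ci 0 e y * (cos (l * (al - y)) * cos (j * (be - y)))) = c * (cos (l * al) * cos (j * be))"
  if "a l \<noteq> 0" "b j \<noteq> 0" for l j
 proof -
  have "b (- j) \<noteq> 0" using that b by (simp add: evs_def)
  hence c': "e (l + j) = c" "e (l - j) = c" using c[of l j] c[of l "- j"] that by auto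
  have x: "(LINT y|lborel. ci 0 e y * cos (q * (r - y))) = cos (q * r) * e q" for q r
   using symb_cos[OF evs_kern evs_symb, OF e e] .
  have y: "(LINT y|lborel. ci 0 e y * cos (p - q * y)) = cos p * e q" for p q
  proof (cases "q = 0")
   case True thus ?thesis using x[of 0 0] by (simp add: mult.commute)
  next
   case False thus ?thesis using x[of q "p / q"] by (simp add: algebra_simps)
  qed
  have i: "integrable lborel (%y. ci 0 e y * cos (p - q * y))" for p q
   by (rule kern_integrable_bounded[OF evs_kern[OF e]]) auto
  have "(LINT y|lborel. ci 0 e y * (cos (l * (al - y)) * cos (j * (be - y)))) =
   (LINT y|lborel. (ci 0 e y * cos ((l * al - j * be) - (l - j) * y) + ci 0 e y * cos ((l * al + j * be) - (l + j) * y)) / 2)"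
   unfolding cos_times_cos by (intro Bochner_Integration.integral_cong refl) (simp add: algebra_simps)
  also have "... = (cos (l * al - j * be) * c + cos (l * al + j * be) * c) / 2"
   using i by (simp add: y c')
  also have "... = c * (cos (l * al) * cos (j * be))"
   unfolding cos_times_cos by (simp add: algebra_simps)
  finally show ?thesis .
 qed
 have "(LINT y|lborel. ci 0 e y * (ci 0 a (al - y) * ci 0 b (be - y))) =
   (LINT y|lborel. LINT p|?N. ci 0 e y * ((cos (fst p * (al - y)) * a (fst p)) * (cos (snd p * (be - y)) * b (snd p))) / (2 * pi)^2)"
  unfolding prod by simp
 also have "... = (LINT p|?N. LINT y|lborel. ci 0 e y * ((cos (fst p * (al - y)) * a (fst p)) * (cos (snd p * (be - y)) * b (snd p))) / (2 * pi)^2)"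
 proof (rule fubini_product[OF sigma_finite_lborel sf])
  show "integrable lborel (%y. abs (ci 0 e y))" using evs_kern[OF e] by (simp add: kern_def)
  show "integrable (lborel \<Otimes>\<^sub>M lborel) (%p. (abs (a (fst p)) * abs (b (snd p))) / (2 * pi)^2)"
   using iab by (simp add: split_def)
  show "norm (ci 0 e y * ((cos (fst p * (al - y)) * a (fst p)) * (cos (snd p * (be - y)) * b (snd p))) / (2 * pi)^2)
   <= abs (ci 0 e y) * ((abs (a (fst p)) * abs (b (snd p))) / (2 * pi)^2)" for y p
  proof -
   have "abs ((cos u * x) * (cos v * y)) <= abs (x) * abs (y)" for u v x y :: real
    unfolding abs_mult by (intro mult_mono mult_left_le_one_le mult_nonneg_nonneg) auto
   hence "abs (ci 0 e y) * abs ((cos (fst p * (al - y)) * a (fst p)) * (cos (snd p * (be - y)) * b (snd p))) / (2 * pi)^2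
    <= abs (ci 0 e y) * (abs (a (fst p)) * abs (b (snd p))) / (2 * pi)^2"
    by (intro divide_right_mono mult_left_mono) auto
   thus ?thesis by (simp add: abs_mult)
  qed
 qed measurable
 also have "... = (LINT p|?N. c * ((cos (fst p * al) * a (fst p)) * (cos (snd p * be) * b (snd p))) / (2 * pi)^2)"
 proof (rule Bochner_Integration.integral_cong[OF refl])
  fix p :: "real \<times> real"
  have "(LINT y|lborel. ci 0 e y * ((cos (fst p * (al - y)) * a (fst p)) * (cos (snd p * (be - y)) * b (snd p))) / (2 * pi)^2)
   = (LINT y|lborel. (ci 0 e y * (cos (fst p * (al - y)) * cos (snd p * (be - y)))) * (a (fst p) * b (snd p) / (2 * pi)^2))"
   by (intro Bochner_Integration.integral_cong refl) (simp add: algebra_simps)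
  also have "... = (LINT y|lborel. ci 0 e y * (cos (fst p * (al - y)) * cos (snd p * (be - y)))) * (a (fst p) * b (snd p) / (2 * pi)^2)"
   by (rule integral_mult_left_zero)
  also have "... = c * ((cos (fst p * al) * a (fst p)) * (cos (snd p * be) * b (snd p))) / (2 * pi)^2"
   by (cases "a (fst p) = 0 \<or> b (snd p) = 0") (auto simp: half)
  finally show "(LINT y|lborel. ci 0 e y * ((cos (fst p * (al - y)) * a (fst p)) * (cos (snd p * (be - y)) * b (snd p))) / (2 * pi)^2)
   = c * ((cos (fst p * al) * a (fst p)) * (cos (snd p * be) * b (snd p))) / (2 * pi)^2" .
 qed
 also have "... = c * (ci 0 a al * ci 0 b be)"
  unfolding prod by simp
 finally show ?thesis .
qed

lemma fmult_product:
 fixes p :: "'a::euclidean_space => 'b::euclidean_space => 'c::euclidean_space"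
 assumes p: "bounded_bilinear p" and e: "evs e" and a: "evs a" and b: "evs b"
  and c: "!!l j. a l \<noteq> 0 ==> b j \<noteq> 0 ==> e (l + j) = c"
  and f: "bcf f" and g: "bcf g"
 shows "fmult e (%x. p (fmult a f x) (fmult b g x)) x = c *\<^sub>R p (fmult a f x) (fmult b g x)"
proof -
 interpret p: bounded_bilinear p by fact
 obtain B where B: "B >= 0" "!!x. norm (f x) <= B" using bcf_bound[OF f] by blast
 obtain C where C: "C >= 0" "!!x. norm (g x) <= C" using bcf_bound[OF g] by blast
 obtain K where K: "K > 0" "!!a b. norm (p a b) <= norm a * norm b * K"
  using p.pos_bounded by blast
 note [measurable] = evs_measurable[OF e] evs_measurable[OF a] evs_measurable[OF b]
  bcf_measurable[OF f] bcf_measurable[OF g]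
 have sf: "sigma_finite_measure (lborel \<Otimes>\<^sub>M lborel :: (real \<times> real) measure)"
  by (simp add: lborel_prod sigma_finite_lborel)
 let ?N = "lborel \<Otimes>\<^sub>M lborel :: (real \<times> real) measure"
 have ci: "integrable lborel (ci 0 a)" "integrable lborel (ci 0 b)"
  using evs_kern[OF a] evs_kern[OF b] by (simp_all add: kern_def)
 have ci': "integrable lborel (%y. ci 0 a (s - y))" "integrable lborel (%y. ci 0 b (s - y))" for s
  using lborel_integrable_real_affine[OF ci(1), of "-1" s] lborel_integrable_real_affine[OF ci(2), of "-1" s] by simp_all
 have pm: "(%q. p (f (fst q)) (g (snd q))) : borel_measurable ?N"
 proof -
  have "continuous_on UNIV (%q. p (f (fst q)) (g (snd q)))"
   using f g by (intro p.continuous_on continuous_on_compose2[of UNIV f UNIV fst] continuous_on_compose2[of UNIV g UNIV snd])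
    (simp_all add: bcf_def continuous_on_fst continuous_on_snd)
  hence "(%q. p (f (fst q)) (g (snd q))) : borel_measurable borel" by (rule borel_measurable_continuous_onI)
  thus ?thesis by (simp add: lborel_prod)
 qed
 have pb: "norm (p (f s) (g t)) <= B * C * K" for s t
  by (rule order_trans[OF K(2)]) (use B C K in "auto intro!: mult_right_mono mult_mono")
 define ib where "ib s = (%q. abs (ci 0 a (s - fst q)) * abs (ci 0 b (s - snd q)))" for s
 have ibi: "integrable ?N (ib s)" for s
 proof -
  have "integrable ?N (%(z, w). abs (ci 0 a (s - z)) * abs (ci 0 b (s - w)))"
   by (rule fubini_product_integrable[where v="%z. abs (ci 0 a (s - z))" and w="%w. abs (ci 0 b (s - w))"])
    (auto simp: sigma_finite_lborel intro!: integrable_abs ci')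
  thus ?thesis by (simp add: split_def ib_def)
 qed
 have ibv: "integral\<^sup>L ?N (ib s) = (LINT z|lborel. abs (ci 0 a z)) * (LINT z|lborel. abs (ci 0 b z))" for s
 proof -
  have "integral\<^sup>L ?N (ib s) = (LINT z|lborel. LINT w|lborel. ib s (z, w))"
   using lborel_pair.integral_fst'[OF ibi] by simp
  thus ?thesis
   using integral_translate_reflect[of "%z. abs (ci 0 a z)" s] integral_translate_reflect[of "%z. abs (ci 0 b z)" s]
   by (simp add: ib_def)
 qed
 have Fb: "norm ((r * (ci 0 a (s - fst q) * ci 0 b (s - snd q))) *\<^sub>R p (f (fst q)) (g (snd q))) <= abs (r) * (B * C * K) * ib s q" for r s q
  using mult_left_mono[OF pb[of "fst q" "snd q"], of "abs (r) * ib s q"]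
  by (simp add: ib_def abs_mult mult_ac)
 have Fm: "(%q. (r * (ci 0 a (s - fst q) * ci 0 b (s - snd q))) *\<^sub>R p (f (fst q)) (g (snd q))) : borel_measurable ?N" for r s
  using pm by measurable
 have Fi: "integrable ?N (%q. (r * (ci 0 a (s - fst q) * ci 0 b (s - snd q))) *\<^sub>R p (f (fst q)) (g (snd q)))" for r s
 proof (rule Bochner_Integration.integrable_bound[where f="%q. abs (r) * (B * C * K) * ib s q"])
  show "AE q in ?N. norm ((r * (ci 0 a (s - fst q) * ci 0 b (s - snd q))) *\<^sub>R p (f (fst q)) (g (snd q))) <= norm (abs (r) * (B * C * K) * ib s q)"
   by (intro AE_I2 order_trans[OF Fb]) simp
 qed (use ibi Fm in auto)
 have val: "p (fmult a f s) (fmult b g s) = (LINT q|?N. (ci 0 a (s - fst q) * ci 0 b (s - snd q)) *\<^sub>R p (f (fst q)) (g (snd q)))" for s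
 proof -
  have ia: "integrable lborel (%z. ci 0 a (s - z) *\<^sub>R f z)"
   by (rule Bochner_Integration.integrable_bound[where f="%z. B * abs (ci 0 a (s - z))"])
    (use ci'[of s] B in "auto intro!: AE_I2 mult_left_mono simp: abs_mult mult.commute[of B]")
  have ib: "integrable lborel (%z. ci 0 b (s - z) *\<^sub>R g z)"
   by (rule Bochner_Integration.integrable_bound[where f="%z. C * abs (ci 0 b (s - z))"])
    (use ci'[of s] C in "auto intro!: AE_I2 mult_left_mono simp: abs_mult mult.commute[of C]")
  have "(LINT q|?N. (ci 0 a (s - fst q) * ci 0 b (s - snd q)) *\<^sub>R p (f (fst q)) (g (snd q)))
    = (LINT z|lborel. LINT w|lborel. (ci 0 a (s - z) * ci 0 b (s - w)) *\<^sub>R p (f z) (g w))"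
   using lborel_pair.integral_fst'[OF Fi[of 1 s]] by simp
  also have "... = (LINT z|lborel. p (ci 0 a (s - z) *\<^sub>R f z) (LINT w|lborel. ci 0 b (s - w) *\<^sub>R g w))"
   by (subst integral_bounded_linear[OF p.bounded_linear_right ib, symmetric])
    (simp add: p.scaleR_left p.scaleR_right mult.commute)
  also have "... = p (LINT z|lborel. ci 0 a (s - z) *\<^sub>R f z) (LINT w|lborel. ci 0 b (s - w) *\<^sub>R g w)"
   by (rule integral_bounded_linear[OF p.bounded_linear_left ia])
  finally show ?thesis by (simp add: fmult_reflect)
 qed
 have "fmult e (%x. p (fmult a f x) (fmult b g x)) x
   = (LINT y|lborel. LINT q|?N. (ci 0 e y * (ci 0 a (x - y - fst q) * ci 0 b (x - y - snd q))) *\<^sub>R p (f (fst q)) (g (snd q)))"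
  by (simp add: fmult_def[of e] cv_def val flip: scaleR_scaleR)
 also have "... = (LINT q|?N. LINT y|lborel. (ci 0 e y * (ci 0 a (x - y - fst q) * ci 0 b (x - y - snd q))) *\<^sub>R p (f (fst q)) (g (snd q)))"
 proof (rule fubini_general[OF sigma_finite_lborel sf, where w="%y. abs (ci 0 e y) * ((B * C * K) * ((LINT z|lborel. abs (ci 0 a z)) * (LINT z|lborel. abs (ci 0 b z))))"])
  show "(%(y, q). (ci 0 e y * (ci 0 a (x - y - fst q) * ci 0 b (x - y - snd q))) *\<^sub>R p (f (fst q)) (g (snd q))) : borel_measurable (lborel \<Otimes>\<^sub>M ?N)"
   using pm by measurable
  show "integrable ?N (%q. (ci 0 e y * (ci 0 a (x - y - fst q) * ci 0 b (x - y - snd q))) *\<^sub>R p (f (fst q)) (g (snd q)))" for y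
   by (rule Fi)
  have "(LINT q|?N. norm ((ci 0 e y * (ci 0 a (x - y - fst q) * ci 0 b (x - y - snd q))) *\<^sub>R p (f (fst q)) (g (snd q))))
    <= (LINT q|?N. abs (ci 0 e y) * (B * C * K) * ib (x - y) q)" for y
   by (intro integral_mono integrable_norm Fi Fb integrable_mult_right ibi)
  thus "(LINT q|?N. norm ((ci 0 e y * (ci 0 a (x - y - fst q) * ci 0 b (x - y - snd q))) *\<^sub>R p (f (fst q)) (g (snd q))))
    <= abs (ci 0 e y) * ((B * C * K) * ((LINT z|lborel. abs (ci 0 a z)) * (LINT z|lborel. abs (ci 0 b z))))" for y
   by (simp add: ibv mult.assoc)
  show "integrable lborel (%y. abs (ci 0 e y) * ((B * C * K) * ((LINT z|lborel. abs (ci 0 a z)) * (LINT z|lborel. abs (ci 0 b z)))))"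
   using evs_kern[OF e] by (simp add: kern_def)
 qed
 also have "... = (LINT q|?N. (LINT y|lborel. ci 0 e y * (ci 0 a ((x - fst q) - y) * ci 0 b ((x - snd q) - y))) *\<^sub>R p (f (fst q)) (g (snd q)))"
 proof (rule Bochner_Integration.integral_cong[OF refl])
  fix q :: "real \<times> real"
  have m: "abs (ci 0 a t) <= (LINT k|lborel. abs (a k)) / (2 * pi)" "abs (ci 0 b t) <= (LINT k|lborel. abs (b k)) / (2 * pi)" for t
   by (auto intro!: ci_abs_le evs_integrable a b)
  have "integrable lborel (%y. (ci 0 a ((x - fst q) - y) * ci 0 b ((x - snd q) - y)) * ci 0 e y)"
   by (rule integrable_times_bounded[where c="(LINT k|lborel. abs (a k)) / (2 * pi) * ((LINT k|lborel. abs (b k)) / (2 * pi))"])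
    (use evs_kern[OF e] m in "auto simp: kern_def abs_mult simp del: times_divide_eq_right times_divide_eq_left intro!: mult_mono divide_nonneg_nonneg integral_nonneg")
  thus "(LINT y|lborel. (ci 0 e y * (ci 0 a (x - y - fst q) * ci 0 b (x - y - snd q))) *\<^sub>R p (f (fst q)) (g (snd q)))
   = (LINT y|lborel. ci 0 e y * (ci 0 a ((x - fst q) - y) * ci 0 b ((x - snd q) - y))) *\<^sub>R p (f (fst q)) (g (snd q))"
   by (subst integral_scaleR_left[symmetric]) (auto simp: algebra_simps)
 qed
 also have "... = (LINT q|?N. c *\<^sub>R ((ci 0 a (x - fst q) * ci 0 b (x - snd q)) *\<^sub>R p (f (fst q)) (g (snd q))))"
  by (simp add: ci_product_symbol[OF e a b c])
 also have "... = c *\<^sub>R p (fmult a f x) (fmult b g x)"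
  by (simp only: integral_scaleR_right val)
 finally show ?thesis .
qed

section \<open>The semigroup\<close>

lemma exp_neg_square_moments:
 fixes z :: real
 defines "w \<equiv> exp (- z\<^sup>2 / 2)"
 shows "0 < w" "w <= 1" "w * z^2 <= 2" "w * abs (z) <= 3 / 2" "w * abs (z) ^ 3 <= 5" "w <= 1 / (1 + z^2 / 2)"
proof -
 show w: "0 < w" "w <= 1" by (simp_all add: w_def)
 have "1 + z^2 / 2 + (z^2 / 2)^2 / 2 <= exp (z^2 / 2)" by (rule exp_lower_Taylor_quadratic) simp
 hence "w * (1 + z^2 / 2 + (z^2 / 2)^2 / 2) <= w * exp (z^2 / 2)" using w by (intro mult_left_mono) auto
 also have "... = 1" by (simp add: w_def flip: exp_add)
 finally have *: "w + w * z^2 / 2 + w * z ^ 4 / 8 <= 1"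
  by (simp add: algebra_simps power2_eq_square power4_eq_xxxx)
 have nn: "0 <= w * z^2" "0 <= w * z ^ 4" using w by auto
 show "w * z^2 <= 2" using * nn w by linarith
 have "w * (1 + z^2 / 2) <= 1" using * nn by (simp add: algebra_simps)
 moreover have "1 + z^2 / 2 > 0" by (simp add: add_pos_nonneg)
 ultimately show "w <= 1 / (1 + z^2 / 2)" by (simp add: field_simps)
 have "2 * abs (z) <= 1 + z^2" using sum_squares_bound[of 1 "abs (z)"] by simp
 from mult_left_mono[OF this, of w] w have "2 * (w * abs (z)) <= w + w * z^2" by (simp add: algebra_simps)
 thus "w * abs (z) <= 3 / 2" using * nn w by linarith
 have "2 * abs (z) ^ 3 <= z^2 + z ^ 4"
  using sum_squares_bound[of "abs (z)" "z^2"] by (simp add: power3_eq_cube power2_eq_square power4_eq_xxxx abs_mult mult_ac)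
 from mult_left_mono[OF this, of w] w have "2 * (w * abs (z) ^ 3) <= w * z^2 + w * z ^ 4" by (simp add: algebra_simps)
 thus "w * abs (z) ^ 3 <= 5" using * nn w by linarith
qed

definition qgauss :: "real => real => real" where
 "qgauss s l = exp (- (s - l^2)\<^sup>2)"

lemma qgauss_bounds:
 fixes s l :: real
 assumes s: "0 <= s"
 defines "w \<equiv> exp (- (s - l^2)\<^sup>2 / 2)"
 shows "(qgauss s has_real_derivative 4 * l * (s - l^2) * qgauss s l) (at l)"
  and "((%l. 4 * l * (s - l^2) * qgauss s l) has_real_derivative
   (16 * l^2 * (s - l^2)^2 + 4 * (s - l^2) - 8 * l^2) * qgauss s l) (at l)"
  and "abs (qgauss s l) <= w"
  and "abs (4 * l * (s - l^2) * qgauss s l) <= 100 * (1 + s) * w"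
  and "abs ((16 * l^2 * (s - l^2)^2 + 4 * (s - l^2) - 8 * l^2) * qgauss s l) <= 100 * (1 + s) * w"
  and "w <= 5 / 2 * (1 + s) / (1 + l^2)"
proof -
 define z where "z = s - l^2"
 have ww: "w = exp (- z\<^sup>2 / 2)" by (simp add: w_def z_def)
 note e = exp_neg_square_moments[of z, folded ww]
 have q: "qgauss s l = w * w" by (simp add: qgauss_def ww z_def flip: exp_add)
 have l2: "l^2 <= s + abs (z)" by (simp add: z_def)
 show "(qgauss s has_real_derivative 4 * l * (s - l^2) * qgauss s l) (at l)"
  unfolding qgauss_def[abs_def] by (auto intro!: derivative_eq_intros simp: algebra_simps)
 thus "((%l. 4 * l * (s - l^2) * qgauss s l) has_real_derivative
   (16 * l^2 * (s - l^2)^2 + 4 * (s - l^2) - 8 * l^2) * qgauss s l) (at l)"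
  by (auto intro!: derivative_eq_intros simp: algebra_simps power2_eq_square)
 show "abs (qgauss s l) <= w" unfolding q using e(1,2) by (simp add: mult_left_le)
 have lw: "l^2 * (w * c) <= (s + abs (z)) * (w * c)" if "c >= 0" for c
  using l2 e(1) that by (intro mult_right_mono) auto
 show "w <= 5 / 2 * (1 + s) / (1 + l^2)"
 proof -
  have "w * (1 + l^2) <= 5 / 2 * (1 + s)"
   using lw[of 1] e mult_right_mono[OF e(2) s] s by (simp add: algebra_simps)
  moreover have "1 + l^2 > 0" by (simp add: add_pos_nonneg)
  ultimately show ?thesis by (simp add: field_simps)
 qed
 have sw: "s * w <= s" "s * (w * abs (z)) <= s * (3 / 2)" "s * (w * z^2) <= s * 2"
  using mult_left_mono[OF e(2) s] mult_left_mono[OF e(4) s] mult_left_mono[OF e(3) s] by simp_all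
 have "abs (4 * l * (s - l^2) * qgauss s l) = (4 * abs (l) * (w * abs (z))) * w"
  using e(1) by (simp add: q abs_mult z_def)
 also have "... <= (100 * (1 + s)) * w"
 proof (rule mult_right_mono)
  have "2 * abs (l) <= 1 + l^2" using sum_squares_bound[of 1 "abs (l)"] by simp
  hence "4 * abs (l) * (w * abs (z)) <= 2 * (1 + (s + abs (z))) * (w * abs (z))"
   using l2 e(1) by (intro mult_right_mono) auto
  also have "... = 2 * (w * abs (z)) + 2 * (s * (w * abs (z))) + 2 * (w * z^2)"
   by (simp add: algebra_simps power2_eq_square)
  also have "... <= 100 * (1 + s)" using sw e s by simp
  finally show "4 * abs (l) * (w * abs (z)) <= 100 * (1 + s)" .
 qed (simp add: ww)
 finally show "abs (4 * l * (s - l^2) * qgauss s l) <= 100 * (1 + s) * w" .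
 have "abs ((16 * l^2 * (s - l^2)^2 + 4 * (s - l^2) - 8 * l^2) * qgauss s l)
  = abs (16 * l^2 * z^2 + 4 * z - 8 * l^2) * w * w"
  using e(1) by (simp add: q abs_mult z_def)
 also have "... <= (100 * (1 + s)) * w"
 proof (rule mult_right_mono)
  have "abs (16 * l^2 * z^2 + 4 * z - 8 * l^2) <= 16 * l^2 * z^2 + 4 * abs (z) + 8 * l^2"
   by (rule order_trans[OF abs_triangle_ineq4] add_mono order_trans[OF abs_triangle_ineq] | simp add: abs_mult)+
  hence "abs (16 * l^2 * z^2 + 4 * z - 8 * l^2) * w <= (16 * l^2 * z^2 + 4 * abs (z) + 8 * l^2) * w"
   using e(1) by (intro mult_right_mono) auto
  also have "... = 16 * (l^2 * (w * z^2)) + 4 * (w * abs (z)) + 8 * (l^2 * (w * 1))"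
   by (simp add: algebra_simps)
  also have "... <= 16 * ((s + abs (z)) * (w * z^2)) + 4 * (w * abs (z)) + 8 * ((s + abs (z)) * (w * 1))"
   by (intro add_mono mult_left_mono lw) (use e(1) in auto)
  also have "... = 16 * (s * (w * z^2)) + 16 * (w * abs (z) ^ 3) + 12 * (w * abs (z)) + 8 * (s * w)"
   by (simp add: algebra_simps power2_eq_square power3_eq_cube)
  also have "... <= 100 * (1 + s)" using sw e s by simp
  finally show "abs (16 * l^2 * z^2 + 4 * z - 8 * l^2) * w <= 100 * (1 + s)" .
 qed (simp add: ww)
 finally show "abs ((16 * l^2 * (s - l^2)^2 + 4 * (s - l^2) - 8 * l^2) * qgauss s l) <= 100 * (1 + s) * w" .
qed

lemma qgauss_continuous: "continuous_on UNIV (qgauss s)" "continuous_on UNIV (%s. qgauss s l)"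
 unfolding qgauss_def[abs_def] by (intro continuous_intros)+

lemma dec2_qgauss: assumes s: "0 <= s" shows "dec2 (250 * (1 + s)^2) (qgauss s)"
 unfolding dec2_def
proof (intro exI conjI allI)
 note b = qgauss_bounds[OF s]
 show "(qgauss s has_real_derivative 4 * l * (s - l^2) * qgauss s l) (at l)" for l by (rule b(1))
 show "((%l. 4 * l * (s - l^2) * qgauss s l) has_real_derivative
   (16 * l^2 * (s - l^2)^2 + 4 * (s - l^2) - 8 * l^2) * qgauss s l) (at l)" for l by (rule b(2))
 show "continuous_on UNIV (%l. (16 * l^2 * (s - l^2)^2 + 4 * (s - l^2) - 8 * l^2) * qgauss s l)"
  by (intro continuous_intros qgauss_continuous)
 have eq: "100 * a * (5 / 2 * a / c) = 250 * a^2 / c" for a c :: real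
  by (cases "c = 0") (auto simp: field_simps power2_eq_square)
 have k: "100 * (1 + s) * exp (- (s - l^2)\<^sup>2 / 2) <= 250 * (1 + s)^2 / (1 + l^2)" for l
  unfolding eq[symmetric] using s by (intro mult_left_mono b(6)) simp
 have k0: "exp (- (s - l^2)\<^sup>2 / 2) <= 100 * (1 + s) * exp (- (s - l^2)\<^sup>2 / 2)" for l
  using s by simp
 fix l
 show "abs (qgauss s l) <= 250 * (1 + s)^2 / (1 + l^2)"
  using b(3)[of l] k[of l] k0[of l] by linarith
 show "abs (4 * l * (s - l^2) * qgauss s l) <= 250 * (1 + s)^2 / (1 + l^2)"
  "abs ((16 * l^2 * (s - l^2)^2 + 4 * (s - l^2) - 8 * l^2) * qgauss s l) <= 250 * (1 + s)^2 / (1 + l^2)"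
  using b(4,5)[of l] k[of l] by linarith+
qed

lemma evs_qgauss: "0 <= s ==> evs (qgauss s)"
 unfolding evs_def using dec2_qgauss by (auto simp: qgauss_def)

text \<open>The substitution \<open>y = t powr (1/4) z\<close> with \<open>s = sqrt t\<close> turns the kernel of the semigroup into the family \<open>kS s\<close>, for which \<open>s = 0\<close> (time zero) is regular.\<close>

definition kS :: "real => real => real" where "kS s = ci 0 (qgauss s)"

lemma kS_bound: "0 <= s ==> abs (kS s z) <= 250 * (1 + s)^2 / (1 + z^2)"
 unfolding kS_def by (rule ci_dec2[OF dec2_qgauss])

lemma integral_recip_quadratic_affine:
 assumes "q > 0"
 shows "integrable lborel (%x::real. c / (1 + (q * (x - a))^2))"
  "(LINT x|lborel. c / (1 + (q * (x - a))^2)) = c * pi / q"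
proof -
 have i: "integrable lborel (%x::real. c / (1 + (- (q * a) + q * x)^2))"
  using lborel_integrable_real_affine[OF integrable_recip_quadratic[of c], of q "- (q * a)"] assms by simp
 have "(LINT x|lborel. c / (1 + x^2)) = abs (q) *\<^sub>R (LINT x|lborel. c / (1 + (- (q * a) + q * x)^2))"
  using assms by (intro lborel_integral_real_affine) auto
 hence "(LINT x|lborel. c / (1 + (- (q * a) + q * x)^2)) = c * pi / q"
  using assms by (simp add: integral_recip_quadratic field_simps)
 moreover have "- (q * a) + q * x = q * (x - a)" for x by (simp add: algebra_simps)
 ultimately show "integrable lborel (%x::real. c / (1 + (q * (x - a))^2))"
  "(LINT x|lborel. c / (1 + (q * (x - a))^2)) = c * pi / q" using i by simp_all
qed

lemma kS_integrable: assumes "0 <= s" shows "integrable lborel (kS s)"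
 using evs_kern[OF evs_qgauss[OF assms]] by (simp add: kern_def kS_def)

text \<open>For bounded \<open>s\<close> this is the decay of the symbol. For large \<open>s\<close> the symbol concentrates at \<open>l = sqrt s\<close> and \<open>l = - sqrt s\<close> with width \<open>1 / sqrt s\<close>, and each derivative costs a factor \<open>sqrt s\<close>: weighting the kernel at the scale \<open>sqrt s\<close> makes the bound uniform.\<close>

lemma kS_L1: assumes s: "0 <= s" shows "(LINT z|lborel. abs (kS s z)) <= 1000 * pi"
proof (cases "s <= 1")
 case True
 have "(LINT z|lborel. abs (kS s z)) <= 250 * (1 + s)^2 * pi"
  by (rule integral_le_of_recip_quadratic) (use kS_integrable[OF s] kS_bound[OF s] in auto)
 also have "250 * (1 + s)^2 * pi <= 250 * (1 + 1)^2 * pi"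
  using True s by (intro mult_right_mono mult_left_mono power_mono) auto
 finally show ?thesis by simp
next
 case False
 hence s1: "s > 1" by simp
 define w where "w l = exp (- (s - l^2)\<^sup>2 / 2)" for l
 define q where "q = sqrt (s / 2)"
 have q: "q > 0" "q^2 = s / 2" using s1 by (simp_all add: q_def)
 note b = qgauss_bounds[OF s, folded w_def]
 have wle: "w l <= 1 / (1 + (q * (l - sqrt s))^2) + 1 / (1 + (q * (l - - sqrt s))^2)" for l
 proof -
  have key: "w l <= 1 / (1 + (q * (abs (l) - sqrt s))^2)"
  proof -
   have "s - l^2 = (sqrt s - abs (l)) * (sqrt s + abs (l))"
    using s by (simp add: algebra_simps power2_eq_square)
   hence "(s - l^2)^2 = (abs (l) - sqrt s)^2 * (sqrt s + abs (l))^2"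
    by (simp add: power_mult_distrib power2_commute)
   moreover have "(sqrt s + abs (l))^2 >= (sqrt s)^2" using s by (intro power_mono) auto
   ultimately have "(abs (l) - sqrt s)^2 * s <= (s - l^2)^2"
    using s by (simp add: mult_left_mono)
   moreover have "(q * (abs (l) - sqrt s))^2 = s / 2 * (abs (l) - sqrt s)^2"
    by (simp only: power_mult_distrib q(2))
   ultimately have "(q * (abs (l) - sqrt s))^2 <= (s - l^2)^2 / 2"
    by (simp add: mult.commute)
   hence "1 / (1 + (s - l^2)^2 / 2) <= 1 / (1 + (q * (abs (l) - sqrt s))^2)"
    by (intro divide_left_mono mult_pos_pos) (auto simp: add_pos_nonneg)
   with exp_neg_square_moments(6)[of "s - l^2"] show ?thesis by (simp add: w_def)
  qed
  have nn: "0 <= 1 / (1 + (q * (l - sqrt s))^2)" "0 <= 1 / (1 + (q * (l - - sqrt s))^2)"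
   by (simp_all add: add_nonneg_nonneg)
  show ?thesis
  proof (cases "l >= 0")
   case True
   hence "w l <= 1 / (1 + (q * (l - sqrt s))^2)" using key by simp
   thus ?thesis using nn(2) by linarith
  next
   case False
   hence "(q * (abs (l) - sqrt s))^2 = (q * (l - - sqrt s))^2"
    by (simp add: power_mult_distrib power2_eq_square algebra_simps)
   hence "w l <= 1 / (1 + (q * (l - - sqrt s))^2)" using key by simp
   thus ?thesis using nn(1) by linarith
  qed
 qed
 have wm: "w : borel_measurable lborel" unfolding w_def by simp
 note ir = integral_recip_quadratic_affine[OF q(1), of 1 "sqrt s"] integral_recip_quadratic_affine[OF q(1), of 1 "- sqrt s"]
 have wi: "integrable lborel w"
  by (rule Bochner_Integration.integrable_bound[OF Bochner_Integration.integrable_add[OF ir(1) ir(3)] wm])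
    (use wle in "auto intro!: AE_I2 order_trans[OF wle] abs_ge_self simp: w_def")
 define J where "J = (LINT l|lborel. w l)"
 have "J <= (LINT l|lborel. 1 / (1 + (q * (l - sqrt s))^2) + 1 / (1 + (q * (l - - sqrt s))^2))"
  unfolding J_def using wi ir(1,3) wle by (intro integral_mono Bochner_Integration.integrable_add)
 also have "... = 2 * pi / q" using ir by simp
 finally have J: "J <= 2 * pi / q" .
 have J0: "J >= 0" unfolding J_def by (intro Bochner_Integration.integral_nonneg) (simp add: w_def)
 note d = dec2_qgauss[OF s]
 define m2 where "m2 l = (16 * l^2 * (s - l^2)^2 + 4 * (s - l^2) - 8 * l^2) * qgauss s l" for l
 have m2c: "continuous_on UNIV m2" unfolding m2_def by (intro continuous_intros qgauss_continuous)
 have mi: "integrable lborel (qgauss s)" "integrable lborel m2"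
 proof -
  show "integrable lborel (qgauss s)" using dec2_integrable[OF d] .
  show "integrable lborel m2"
   by (rule Bochner_Integration.integrable_bound[OF integrable_mult_right[OF wi, of "100 * (1 + s)"] continuous_imp_measurable[OF m2c]])
    (use b(5) s in "auto intro!: AE_I2 simp: m2_def abs_mult w_def")
 qed
 have "(LINT l|lborel. abs (qgauss s l)) <= J" unfolding J_def
  using b(3) by (intro integral_mono wi integrable_abs mi)
 moreover have "(LINT l|lborel. abs (m2 l)) <= (LINT l|lborel. 100 * (1 + s) * w l)"
  using b(5) by (intro integral_mono integrable_abs mi integrable_mult_right wi) (auto simp: m2_def)
 ultimately have N: "(LINT l|lborel. abs (qgauss s l)) <= J" "(LINT l|lborel. abs (m2 l)) <= 100 * (1 + s) * J"
  by (auto simp: J_def)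
 have pt: "abs (kS s x) <= 201 * J / (2 * pi) / (1 + (1 / sqrt s * (x - 0))^2)" for x
 proof -
  have "abs (kS s x) <= (LINT l|lborel. abs (qgauss s l)) / (2 * pi)"
   unfolding kS_def by (rule ci_abs_le[OF mi(1)])
  also have "... <= J / (2 * pi)" using N by (intro divide_right_mono) auto
  finally have 1: "abs (kS s x) <= J / (2 * pi)" .
  have "x^2 * kS s x = ci (0 - pi / 2 - pi / 2) m2 x"
   unfolding kS_def
  proof (rule ci_second_moment[where c="250 * (1 + s)^2"])
   have eq: "100 * a * (5 / 2 * a / c) = 250 * a^2 / c" for a c :: real
    by (cases "c = 0") (auto simp: field_simps power2_eq_square)
   have k: "100 * (1 + s) * w l <= 250 * (1 + s)^2 / (1 + l^2)" for l
    unfolding eq[symmetric] using s by (intro mult_left_mono b(6)) simp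
   show "abs (qgauss s l) <= 250 * (1 + s)^2 / (1 + l^2)" for l by (rule dec2_abs[OF d])
   show "abs (4 * l * (s - l^2) * qgauss s l) <= 250 * (1 + s)^2 / (1 + l^2)" "abs (m2 l) <= 250 * (1 + s)^2 / (1 + l^2)" for l
    using b(4,5)[of l] k[of l] unfolding m2_def by linarith+
  qed (use b m2c in "auto simp: m2_def")
  hence "abs (x^2 * kS s x) <= (LINT l|lborel. abs (m2 l)) / (2 * pi)" using ci_abs_le[OF mi(2)] by simp
  also have "... <= 100 * (1 + s) * J / (2 * pi)" using N by (intro divide_right_mono) auto
  also have "... <= 200 * s * J / (2 * pi)" using s1 J0 by (intro divide_right_mono mult_right_mono) auto
  finally have 2: "x^2 * abs (kS s x) <= 200 * s * J / (2 * pi)" by (simp add: abs_mult)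
  have "x^2 * abs (kS s x) / s <= 200 * J / (2 * pi)"
   using divide_right_mono[OF 2, of s] s1 by simp
  hence "abs (kS s x) * (1 + x^2 / s) <= 201 * J / (2 * pi)"
   using 1 by (simp add: algebra_simps)
  moreover have "1 + x^2 / s > 0" using s1 by (simp add: add_pos_nonneg)
  moreover have "(1 / sqrt s * (x - 0))^2 = x^2 / s" using s1 by (simp add: power_divide)
  ultimately show ?thesis by (simp only: pos_le_divide_eq)
 qed
 note ir2 = integral_recip_quadratic_affine[of "1 / sqrt s" "201 * J / (2 * pi)" 0]
 have "(LINT x|lborel. abs (kS s x)) <= (LINT x|lborel. 201 * J / (2 * pi) / (1 + (1 / sqrt s * (x - 0))^2))"
  using pt s1 by (intro integral_mono integrable_abs kS_integrable[OF s] ir2(1)) auto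
 also have "... = 201 * J / (2 * pi) * pi / (1 / sqrt s)" using s1 by (intro ir2(2)) auto
 also have "... = 201 / 2 * (J * sqrt s)" by simp
 also have "... <= 201 / 2 * (2 * pi / q * sqrt s)" using J s by (intro mult_left_mono mult_right_mono) auto
 also have "2 * pi / q * sqrt s = 2 * pi * sqrt 2" using s1 by (simp add: q_def real_sqrt_divide)
 also have "201 / 2 * (2 * pi * sqrt 2) <= 201 / 2 * (2 * pi * 2)"
  by (intro mult_left_mono) (auto simp: real_le_lsqrt sqrt_le_D intro: real_sqrt_le_iff[THEN iffD1])
 also have "... <= 1000 * pi" by simp
 finally show ?thesis .
qed

lemma kS_continuous: "continuous_on {0..R} (%s. kS s z)"
proof -
 have m: "(%l. cos (l * z + 0) * qgauss s l) : borel_measurable lborel" for s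
  by (intro continuous_imp_measurable continuous_intros qgauss_continuous)
 have "continuous_on (UNIV \<times> {0..R}) (%(x, s). cv lborel (%l. cos (l * z + 0) * qgauss s l) (%l. l) (%_. 1::real) x)"
 proof (rule cv_continuous_param[where W="%l. 250 * (1 + R)^2 / (1 + l^2)" and F="%_ _. 1::real"
    and w="%s l. cos (l * z + 0) * qgauss s l" and g="%_ l. l" and B=1])
  fix s l :: real assume s: "s : {0..R}"
  have "abs (cos (l * z + 0) * qgauss s l) <= abs (qgauss s l)"
   unfolding abs_mult by (rule mult_left_le_one_le) auto
  also have "... <= 250 * (1 + s)^2 / (1 + l^2)"
   using dec2_abs[OF dec2_qgauss, of s l] s by simp
  also have "... <= 250 * (1 + R)^2 / (1 + l^2)"
   using s by (intro divide_right_mono mult_left_mono power_mono) (auto simp: add_nonneg_nonneg)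
  finally show "abs (cos (l * z + 0) * qgauss s l) <= 250 * (1 + R)^2 / (1 + l^2)" .
 next
  show "continuous_on {0..R} (%s. cos (l * z + 0) * qgauss s l)" for l
   by (intro continuous_intros continuous_on_subset[OF qgauss_continuous(2)]) auto
 qed (use m in "auto intro!: continuous_intros integrable_recip_quadratic simp: split_def")
 hence "continuous_on {0..R} (%s. (%(x, s). cv lborel (%l. cos (l * z + 0) * qgauss s l) (%l. l) (%_. 1::real) x) (0, s))"
  by (rule continuous_on_compose2) (auto intro!: continuous_intros)
 hence "continuous_on {0..R} (%s. LINT l|lborel. cos (l * z + 0) * qgauss s l)"
  by (simp add: cv_def)
 thus ?thesis unfolding kS_def ci_def by (intro continuous_intros) auto
qed

text \<open>The formula also makes sense at \<open>t = 0\<close>, where it is the identity because \<open>kS 0\<close> has integral one. Joint continuity in time and space up to \<open>t = 0\<close> is then a case of dominated convergence.\<close>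

definition sg :: "real => (real => 'a::euclidean_space) => real => 'a" where
 "sg t = cv lborel (kS (sqrt t)) (%z. sqrt (sqrt t) * z)"

definition sa :: "real => real" where "sa k = (1 - k^2)^2"

definition heat :: "real => real => real" where "heat t k = exp (- (t * sa k))"

lemma sa_nonneg: "0 <= sa k" by (simp add: sa_def)

lemma sg_kern: "0 <= t ==> kern lborel (kS (sqrt t)) (%z. sqrt (sqrt t) * z)"
 by (auto simp: kern_def sigma_finite_lborel intro: kS_integrable)

lemma qgauss_scale: "0 <= t ==> qgauss (sqrt t) (k * sqrt (sqrt t)) = heat t k"
proof -
 assume t: "0 <= t"
 have "sqrt t - (k * sqrt (sqrt t))^2 = sqrt t * (1 - k^2)"
  using t by (simp add: power_mult_distrib algebra_simps)
 hence "(sqrt t - (k * sqrt (sqrt t))^2)^2 = t * (1 - k^2)^2"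
  using t by (simp add: power_mult_distrib)
 thus ?thesis by (simp add: qgauss_def heat_def sa_def)
qed

lemma sg_symb: "0 <= t ==> symb lborel (kS (sqrt t)) (%z. sqrt (sqrt t) * z) (heat t)"
 using evs_symb[OF evs_qgauss, of "sqrt t"]
 by (auto simp: symb_def kS_def mult.assoc[symmetric] qgauss_scale)

lemma sg_zero: "sg 0 f = f"
proof
 fix x
 have "symb lborel (ci 0 (qgauss 0)) (%y. y) (qgauss 0)" by (rule evs_symb[OF evs_qgauss]) simp
 hence "(LINT z|lborel. kS 0 z * cos (0 * z)) = qgauss 0 0" unfolding symb_def kS_def by blast
 hence "(LINT z|lborel. kS 0 z) = 1" by (simp add: qgauss_def)
 moreover have "sg 0 f x = (LINT z|lborel. kS 0 z) *\<^sub>R f x"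
  unfolding sg_def cv_def using kS_integrable[of 0] by simp
 ultimately show "sg 0 f x = f x" by simp
qed

lemma sg_bcf: "0 <= t ==> bcf f ==> bcf (sg t f)"
 unfolding sg_def by (intro cv_bcf sg_kern)

lemma sg_norm_le:
 assumes "0 <= t" "bcf f" "!!x. norm (f x) <= B"
 shows "norm (sg t f x) <= 1000 * pi * B"
proof -
 have "0 <= B" using assms(3)[of 0] norm_ge_zero order_trans by blast
 have "norm (sg t f x) <= B * (LINT z|lborel. abs (kS (sqrt t) z))"
  unfolding sg_def by (rule cv_norm_le[OF sg_kern assms(2,3)]) fact
 also have "... <= B * (1000 * pi)" by (intro mult_left_mono kS_L1) (use assms \<open>0 <= B\<close> in auto)
 finally show ?thesis by (simp add: mult.commute)
qed

lemma sg_continuous: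
 fixes F :: "real => 'p::metric_space => 'a::euclidean_space"
 assumes F: "continuous_on (UNIV \<times> S) (%(x, s). F x s)" "!!x s. s : S ==> norm (F x s) <= B"
 shows "continuous_on (UNIV \<times> ({0..R} \<times> S)) (%(x, (t, s)). sg t (%y. F y s) x)"
proof -
 have "continuous_on (UNIV \<times> ({0..R} \<times> S)) (%(x, p). cv lborel (kS (sqrt (fst p))) (%z. sqrt (sqrt (fst p)) * z) (%y. F y (snd p)) x)"
 proof (rule cv_continuous_param[where W="%z. 250 * (1 + sqrt R)^2 / (1 + z^2)" and B=B])
  show "abs (kS (sqrt (fst p)) z) <= 250 * (1 + sqrt R)^2 / (1 + z^2)" if "p : {0..R} \<times> S" for p z
  proof -
   have "abs (kS (sqrt (fst p)) z) <= 250 * (1 + sqrt (fst p))^2 / (1 + z^2)"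
    using that by (intro kS_bound) auto
   also have "... <= 250 * (1 + sqrt R)^2 / (1 + z^2)"
    using that by (intro divide_right_mono mult_left_mono power_mono add_left_mono real_sqrt_le_mono) (auto simp: add_nonneg_nonneg)
   finally show ?thesis .
  qed
  show "continuous_on ({0..R} \<times> S) (%p. kS (sqrt (fst p)) z)" for z
   by (rule continuous_on_compose2[OF kS_continuous[of "sqrt R"]])
    (auto intro!: continuous_intros real_sqrt_le_mono)
  show "continuous_on ({0..R} \<times> S) (%p. sqrt (sqrt (fst p)) * z)" for z
   by (intro continuous_intros)
  show "continuous_on (UNIV \<times> ({0..R} \<times> S)) (%(x, p). F x (snd p))"
   unfolding split_def
   by (rule continuous_on_compose2[OF F(1), of _ "%q. (fst q, snd (snd q))", unfolded split_def fst_conv snd_conv])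
    (auto intro!: continuous_intros)
  show "kS (sqrt (fst p)) : borel_measurable lborel" if "p : {0..R} \<times> S" for p
   using kS_integrable[of "sqrt (fst p)"] that by auto
 qed (use F(2) in "auto intro: integrable_recip_quadratic")
 thus ?thesis by (simp add: sg_def split_def)
qed

lemma dec2_scale:
 assumes d: "dec2 c m" and q: "q > 0"
 shows "EX c'. dec2 c' (%k. m (k * q))"
proof -
 obtain m1 m2 where m: "!!k. (m has_real_derivative m1 k) (at k)" "!!k. (m1 has_real_derivative m2 k) (at k)"
  "continuous_on UNIV m2"
  and b: "!!k. abs (m k) <= c / (1 + k^2)" "!!k. abs (m1 k) <= c / (1 + k^2)" "!!k. abs (m2 k) <= c / (1 + k^2)"
  using d unfolding dec2_def by blast
 have c0: "0 <= c" by (rule dec2_nonneg[OF d])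
 define r where "r = max 1 (1 / q^2)"
 define p where "p = max 1 (q^2)"
 have p: "1 <= p" "q <= p" "q * q <= p"
 proof -
  show "1 <= p" "q * q <= p" by (simp_all add: p_def power2_eq_square)
  show "q <= p"
  proof (cases "q <= 1")
   case False
   hence "q * 1 <= q * q" by (intro mult_left_mono) auto
   thus ?thesis by (simp add: p_def power2_eq_square)
  qed (simp add: p_def)
 qed
 have s: "c / (1 + (k * q)^2) <= r * c / (1 + k^2)" for k
 proof -
  have "1 <= r * q^2" using q by (simp add: r_def max_mult_distrib_right)
  hence "k^2 * 1 <= k^2 * (r * q^2)" by (intro mult_left_mono) auto
  moreover have "1 <= r" by (simp add: r_def)
  ultimately have "1 + k^2 <= r * 1 + k^2 * (r * q^2)" by simp
  hence "1 + k^2 <= r * (1 + (k * q)^2)" by (simp add: algebra_simps power_mult_distrib)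
  from mult_left_mono[OF this c0] have "c * (1 + k^2) <= r * c * (1 + (k * q)^2)" by (simp add: mult_ac)
  moreover have "1 + k^2 > 0" "1 + (k * q)^2 > 0" by (simp_all add: add_pos_nonneg)
  ultimately show ?thesis by (simp add: field_simps)
 qed
 have rc: "0 <= r * c / (1 + k^2)" for k using c0 by (auto simp: r_def add_nonneg_nonneg)
 have pp: "x * y <= p * (r * c) / (1 + k^2)" if "0 <= x" "x <= c / (1 + (k * q)^2)" "0 <= y" "y <= p" for x y k
 proof -
  have "x * y <= (r * c / (1 + k^2)) * p"
   using that s[of k] rc[of k] by (intro mult_mono) auto
  thus ?thesis by (simp add: mult_ac)
 qed
 have "dec2 (p * (r * c)) (%k. m (k * q))"
  unfolding dec2_def
 proof (intro exI conjI allI)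
  have lin: "((%k. k * q) has_real_derivative q) (at k)" for k by (auto intro!: derivative_eq_intros)
  show "((%k. m (k * q)) has_real_derivative m1 (k * q) * q) (at k)" for k
   by (rule DERIV_chain2[OF m(1) lin])
  show "((%k. m1 (k * q) * q) has_real_derivative (m2 (k * q) * q) * q) (at k)" for k
   by (rule DERIV_cmult_right[OF DERIV_chain2[OF m(2) lin]])
  show "continuous_on UNIV (%k. (m2 (k * q) * q) * q)"
   by (intro continuous_intros continuous_on_compose2[OF m(3)]) auto
  fix k
  show "abs (m (k * q)) <= p * (r * c) / (1 + k^2)" using pp[OF _ b(1), of k 1] p by simp
  show "abs (m1 (k * q) * q) <= p * (r * c) / (1 + k^2)" using pp[OF _ b(2), of k q] p q by (simp add: abs_mult)
  show "abs (m2 (k * q) * q * q) <= p * (r * c) / (1 + k^2)" using pp[OF _ b(3), of k "q * q"] p q by (simp add: abs_mult mult.assoc)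
 qed
 thus ?thesis by blast
qed

lemma evs_heat: assumes t: "t > 0" shows "evs (heat t)"
proof -
 have "EX c'. dec2 c' (%k. qgauss (sqrt t) (k * sqrt (sqrt t)))"
  by (rule dec2_scale[OF dec2_qgauss]) (use t in auto)
 moreover have "(%k. qgauss (sqrt t) (k * sqrt (sqrt t))) = heat t" using t by (simp add: qgauss_scale fun_eq_iff)
 ultimately show ?thesis by (simp add: evs_def) (simp add: heat_def sa_def)
qed

lemma ci_heat: assumes t: "t > 0"
 shows "ci 0 (heat t) (sqrt (sqrt t) * y) = kS (sqrt t) y / sqrt (sqrt t)"
proof -
 let ?q = "sqrt (sqrt t)"
 have q: "?q > 0" using t by simp
 have "(LINT l|lborel. cos (l * y) * qgauss (sqrt t) l) = abs (?q) *\<^sub>R (LINT k|lborel. cos ((0 + ?q * k) * y) * qgauss (sqrt t) (0 + ?q * k))"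
  by (rule lborel_integral_real_affine) (use q in simp)
 also have "... = ?q * (LINT k|lborel. cos (k * (?q * y)) * heat t k)"
  using q t qgauss_scale[of t] by (simp add: mult_ac)
 finally show ?thesis using q by (simp add: ci_def kS_def field_simps)
qed

lemma sg_eq_fmult: assumes t: "t > 0" shows "sg t f x = fmult (heat t) f x"
proof -
 let ?q = "sqrt (sqrt t)"
 have q: "?q > 0" using t by simp
 have "fmult (heat t) f x = abs (?q) *\<^sub>R (LINT z|lborel. ci 0 (heat t) (0 + ?q * z) *\<^sub>R f (x - (0 + ?q * z)))"
  unfolding fmult_def cv_def by (rule lborel_integral_real_affine) (use q in simp)
 also have "... = (LINT z|lborel. (?q * ci 0 (heat t) (?q * z)) *\<^sub>R f (x - ?q * z))"
  using q by (simp flip: scaleR_scaleR)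
 also have "... = sg t f x" using q by (simp add: sg_def cv_def ci_heat[OF t])
 finally show ?thesis ..
qed

lemma heat_add: "heat s k * heat t k = heat (s + t) k"
 by (simp add: heat_def distrib_right flip: exp_add)

lemma sg_sg: assumes "0 <= t" "0 <= s" "bcf f" shows "sg t (sg s f) x = sg (t + s) f x"
proof (cases "s = 0")
 case True thus ?thesis by (simp add: sg_zero)
next
 case False
 hence s: "s > 0" using assms by simp
 have "sg s f = fmult (heat s) f" using sg_eq_fmult[OF s] by auto
 hence "sg t (sg s f) x = fmult (%k. heat t k * heat s k) f x"
  using cv_fmult[OF sg_kern sg_symb evs_heat[OF s] assms(3)] assms(1) by (simp add: sg_def)
 also have "... = sg (t + s) f x" using assms s by (simp add: heat_add sg_eq_fmult)
 finally show ?thesis .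
qed

lemma sh_semigroup_eq:
 assumes t: "t >= 0"
 shows "sh_semigroup e t f x = exp (e^2 * t) * sg t f x"
proof (cases "t = 0")
 case True thus ?thesis by (simp add: sh_semigroup_def sg_zero)
next
 case False
 hence t: "t > 0" using t by simp
 have k: "sh_kernel e t y = exp (e^2 * t) * ci 0 (heat t) y" for y
 proof -
  let ?F = "%k. exp (\<i> * complex_of_real (k * y)) * complex_of_real (exp (t * (e^2 - (1 - k^2)^2)))"
  have e: "exp (t * (e^2 - (1 - k^2)^2)) = exp (e^2 * t) * heat t k" for k
   by (simp add: heat_def sa_def algebra_simps flip: exp_add)
  have hi: "integrable lborel (heat t)" using evs_integrable[OF evs_heat[OF t]] .
  have i: "integrable lborel ?F"
  proof (rule Bochner_Integration.integrable_bound[where f="%k. exp (e^2 * t) * heat t k"])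
   show "integrable lborel (%k. exp (e^2 * t) * heat t k)" using hi by simp
   show "AE k in lborel. norm (?F k) <= norm (exp (e^2 * t) * heat t k)"
    unfolding e by (intro AE_I2) (simp add: norm_mult)
  qed measurable
  have "Re (LINT k|lborel. ?F k) = (LINT k|lborel. Re (?F k))" using integral_Re[OF i] by simp
  also have "... = (LINT k|lborel. exp (e^2 * t) * (cos (k * y + 0) * heat t k))"
   unfolding e by (intro Bochner_Integration.integral_cong refl) (simp add: Re_exp mult_ac)
  also have "... = exp (e^2 * t) * (LINT k|lborel. cos (k * y + 0) * heat t k)"
   by simp
  finally have "Re (LINT k|lborel. ?F k) = exp (e^2 * t) * (LINT k|lborel. cos (k * y + 0) * heat t k)" .
  moreover have "Re (1 / (2 * complex_of_real pi) * z) = Re z / (2 * pi)" for z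
  proof -
   have "Re (1 / (2 * complex_of_real pi) * z) = Re (z / complex_of_real (2 * pi))" by simp
   thus ?thesis by (simp only: Re_divide_of_real)
  qed
  ultimately show ?thesis by (simp add: sh_kernel_def ci_def)
 qed
 show ?thesis using t
  by (simp add: sh_semigroup_def k sg_eq_fmult fmult_reflect mult.assoc)
qed

text \<open>The modulus depends on \<open>f\<close> only through its bound and its Lipschitz constant: the difference of the kernels at times \<open>h\<close> and \<open>0\<close> is small in the mean, and the shift of the argument is at most \<open>h powr (1/4) |z|\<close>.\<close>

lemma sg_uniform_continuity_at_zero:
 fixes L :: real
 assumes "B >= 0" "L >= 0"
 shows "EX om. (om \<longlongrightarrow> 0) (at_right 0) & (ALL h:{0..1}. ALL (f::real => 'a::euclidean_space) x.
  bcf f --> (ALL x. norm (f x) <= B) --> (ALL x y. norm (f x - f y) <= L * abs (x - y)) --> norm (sg h f x - f x) <= om h)"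
proof -
 define om where "om h = cv lborel (%z. abs (kS (sqrt h) z - kS 0 z) * B + abs (kS 0 z) * min (2 * B) (L * abs (sqrt (sqrt h) * z))) (%z. z) (%_. 1::real) 0" for h
 let ?W = "%z. (1000 + 250) * B / (1 + z^2) + 250 * (2 * B) / (1 + z^2)"
 have b: "abs (kS (sqrt h) z) <= 1000 / (1 + z^2)" if "h : {0..1}" for h z
 proof -
  have "abs (kS (sqrt h) z) <= 250 * (1 + sqrt h)^2 / (1 + z^2)" using that by (intro kS_bound) auto
  also have "... <= 250 * (1 + 1)^2 / (1 + z^2)"
   using that by (intro divide_right_mono mult_left_mono power_mono) (auto simp: add_nonneg_nonneg)
  finally show ?thesis by simp
 qed
 have b0: "abs (kS 0 z) <= 250 / (1 + z^2)" for z using kS_bound[of 0 z] by simp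
 have bw: "abs (abs (kS (sqrt h) z - kS 0 z) * B + abs (kS 0 z) * min (2 * B) (L * abs (sqrt (sqrt h) * z))) <= ?W z" if "h : {0..1}" for h z
 proof -
  have "abs (kS (sqrt h) z - kS 0 z) <= (1000 + 250) / (1 + z^2)"
   using b[OF that, of z] b0[of z] by (simp add: add_divide_distrib)
  hence "abs (kS (sqrt h) z - kS 0 z) * B <= (1000 + 250) / (1 + z^2) * B" using assms by (intro mult_right_mono) auto
  moreover have "abs (kS 0 z) * min (2 * B) (L * abs (sqrt (sqrt h) * z)) <= 250 / (1 + z^2) * (2 * B)"
   using b0[of z] assms by (intro mult_mono) auto
  moreover have "0 <= abs (kS 0 z) * min (2 * B) (L * abs (sqrt (sqrt h) * z))" using assms by simp
  moreover have "0 <= abs (kS (sqrt h) z - kS 0 z) * B" using assms by simp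
  ultimately show ?thesis by simp
 qed
 have m: "kS (sqrt h) : borel_measurable borel" if "h >= 0" for h
  using kS_integrable[of "sqrt h"] that by auto
 have m': "(%z. abs (kS (sqrt h) z - kS 0 z) * B + abs (kS 0 z) * min (2 * B) (L * abs (sqrt (sqrt h) * z))) : borel_measurable lborel" if "h : {0..1}" for h
  using m[of h] m[of 0] that by simp
 have c: "continuous_on {0..1} (%h. abs (kS (sqrt h) z - kS 0 z) * B + abs (kS 0 z) * min (2 * B) (L * abs (sqrt (sqrt h) * z)))" for z
  by (intro continuous_intros continuous_on_compose2[OF kS_continuous[of 1]]) auto
 have Wi: "integrable lborel ?W" by (intro Bochner_Integration.integrable_add integrable_recip_quadratic)
 have "continuous_on (UNIV \<times> {0..1}) (%(x, h). cv lborel (%z. abs (kS (sqrt h) z - kS 0 z) * B + abs (kS 0 z) * min (2 * B) (L * abs (sqrt (sqrt h) * z))) (%z. z) (%_. 1::real) x)"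
  by (rule cv_continuous_param[where W="?W" and F="%_ _. 1::real" and g="%_ z. z" and B=1
    and w="%h z. abs (kS (sqrt h) z - kS 0 z) * B + abs (kS 0 z) * min (2 * B) (L * abs (sqrt (sqrt h) * z))"])
    (use Wi bw m' c in "auto intro!: continuous_intros simp: split_def")
 hence "continuous_on {0..1} (%h. (%(x, h). cv lborel (%z. abs (kS (sqrt h) z - kS 0 z) * B + abs (kS 0 z) * min (2 * B) (L * abs (sqrt (sqrt h) * z))) (%z. z) (%_. 1::real) x) (0, h))"
  by (rule continuous_on_compose2) (auto intro!: continuous_intros)
 hence "continuous_on {0..1} om" unfolding om_def by simp
 hence "(om \<longlongrightarrow> om 0) (at 0 within {0..1})" by (auto simp: continuous_on_def)
 moreover have "at 0 within {0..1} = at_right (0::real)" by (rule at_within_Icc_at_right) simp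
 moreover have "om 0 = 0" using assms by (simp add: om_def cv_def)
 ultimately have "(om \<longlongrightarrow> 0) (at_right 0)" by simp
 moreover have "norm (sg h f x - f x) <= om h"
  if h: "h : {0..1}" and f: "bcf f" "!!x. norm (f x) <= B" "!!x y. norm (f x - f y) <= L * abs (x - y)"
  for h and f :: "real => 'a" and x
 proof -
  let ?q = "sqrt (sqrt h)"
  have i1: "integrable lborel (%z. kS (sqrt h) z *\<^sub>R f (x - ?q * z))"
   using cv_integrable[OF sg_kern f(1)] h by simp
  have i2: "integrable lborel (%z. kS (sqrt 0) z *\<^sub>R f (x - sqrt (sqrt 0) * z))"
   by (rule cv_integrable[OF sg_kern f(1)]) simp
  have "sg h f x - f x = sg h f x - sg 0 f x" by (simp add: sg_zero)
  also have "sg h f x - sg 0 f x = (LINT z|lborel. kS (sqrt h) z *\<^sub>R f (x - ?q * z) - kS (sqrt 0) z *\<^sub>R f (x - sqrt (sqrt 0) * z))"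
   unfolding sg_def cv_def using i1 i2 by (rule Bochner_Integration.integral_diff[symmetric])
  finally have "norm (sg h f x - f x) <= (LINT z|lborel. norm (kS (sqrt h) z *\<^sub>R f (x - ?q * z) - kS (sqrt 0) z *\<^sub>R f (x - sqrt (sqrt 0) * z)))"
   by (simp only: integral_norm_bound)
  also have "... <= (LINT z|lborel. abs (kS (sqrt h) z - kS 0 z) * B + abs (kS 0 z) * min (2 * B) (L * abs (?q * z)))"
  proof (rule integral_mono)
   show "integrable lborel (%z. norm (kS (sqrt h) z *\<^sub>R f (x - ?q * z) - kS (sqrt 0) z *\<^sub>R f (x - sqrt (sqrt 0) * z)))"
    using i1 i2 by (intro integrable_norm Bochner_Integration.integrable_diff)
   show "integrable lborel (%z. abs (kS (sqrt h) z - kS 0 z) * B + abs (kS 0 z) * min (2 * B) (L * abs (?q * z)))"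
    by (rule Bochner_Integration.integrable_bound[OF Wi m'[OF h]])
    (intro AE_I2, unfold real_norm_def, rule order_trans[OF bw[OF h] abs_ge_self])
   fix z :: real
   have "kS (sqrt h) z *\<^sub>R f (x - ?q * z) - kS (sqrt 0) z *\<^sub>R f (x - sqrt (sqrt 0) * z)
    = (kS (sqrt h) z - kS 0 z) *\<^sub>R f (x - ?q * z) + kS 0 z *\<^sub>R (f (x - ?q * z) - f x)"
    by (simp add: algebra_simps)
   moreover have "norm (f (x - ?q * z) - f x) <= min (2 * B) (L * abs (?q * z))"
    using f(3)[of "x - ?q * z" x] norm_triangle_ineq4[of "f (x - ?q * z)" "f x"] f(2)[of x] f(2)[of "x - ?q * z"] by simp
   ultimately show "norm (kS (sqrt h) z *\<^sub>R f (x - ?q * z) - kS (sqrt 0) z *\<^sub>R f (x - sqrt (sqrt 0) * z))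
    <= abs (kS (sqrt h) z - kS 0 z) * B + abs (kS 0 z) * min (2 * B) (L * abs (?q * z))"
    using f(2)[of "x - ?q * z"]
    by (auto intro!: norm_triangle_le add_mono mult_left_mono simp del: min.bounded_iff)
  qed
  also have "... = om h" by (simp add: om_def cv_def)
  finally show ?thesis .
 qed
 ultimately show ?thesis by blast
qed

section \<open>Compactly supported symbols\<close>

definition csym :: "nat => (real => real) => bool" where
 "csym n m \<longleftrightarrow> Ck n m & (EX R. ALL k. R < abs (k) --> m k = 0)"

lemma csym_bound: assumes "csym n m" shows "EX c>=0. ALL k. abs (m k) <= c / (1 + k^2)"
proof -
 obtain R where R: "!!k. R < abs (k) ==> m k = 0" and c: "continuous_on UNIV m"
  using assms by (auto simp: csym_def intro: Ck_continuous)
 have "compact ((%k. m k * (1 + k^2)) ` {-abs (R)..abs (R)})"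
  by (intro compact_continuous_image continuous_intros continuous_on_subset[OF c]) auto
 then obtain B where "ALL k:{-abs (R)..abs (R)}. abs (m k * (1 + k^2)) <= B"
  by (auto dest!: compact_imp_bounded simp: bounded_iff)
 hence B: "abs (m k * (1 + k^2)) <= B" if "k : {-abs (R)..abs (R)}" for k using that by blast
 have "abs (m k * (1 + k^2)) <= abs (B)" for k
 proof (cases "abs (k) <= abs (R)")
  case True
  hence "k : {-abs (R)..abs (R)}" by (simp add: abs_le_iff)
  from B[OF this] show ?thesis by linarith
 next
  case False thus ?thesis using R[of k] by auto
 qed
 moreover have "1 + k^2 > 0" for k :: real by (simp add: add_pos_nonneg)
 ultimately have "abs (m k) <= abs (B) / (1 + k^2)" for k
  by (simp add: pos_le_divide_eq abs_mult abs_of_pos)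
 thus ?thesis by (intro exI[of _ "abs (B)"]) auto
qed

lemma csym_derivative:
 assumes "csym (Suc n) m"
 obtains m' where "!!k. (m has_real_derivative m' k) (at k)" "csym n m'"
proof -
 obtain R m' where R: "!!k. R < abs (k) ==> m k = 0" and d: "!!k. (m has_real_derivative m' k) (at k)" "Ck n m'"
  using assms by (auto simp: csym_def)
 have "m' k = 0" if k: "R < abs (k)" for k
 proof -
  have op: "open {k::real. R < abs (k)}" by (intro open_Collect_less continuous_intros)
  have "(m has_real_derivative 0) (at k)"
   by (rule has_field_derivative_transform_within_open[OF _ op, of "%_. 0"]) (use k R in auto)
  thus ?thesis using d(1) DERIV_unique by blast
 qed
 hence "csym n m'" using d(2) by (auto simp: csym_def)
 thus ?thesis using d(1) that by blast
qed

lemma csym_continuous: "csym n m ==> continuous_on UNIV m"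
 by (auto simp: csym_def intro: Ck_continuous)

lemma csym_Suc: "csym (Suc n) m ==> csym n m"
 using Ck_SucD by (auto simp: csym_def simp del: Ck.simps)

lemma csym_mult: "csym n m ==> Ck n f ==> csym n (%k. f k * m k)"
 unfolding csym_def by (fastforce intro: Ck_mult)

lemma csym_integrable: assumes "csym n m" shows "integrable lborel m"
proof -
 obtain c where c: "!!k. abs (m k) <= c / (1 + k^2)" using csym_bound[OF assms] by blast
 show ?thesis
  by (rule integrable_of_recip_quadratic[OF continuous_imp_measurable[OF csym_continuous[OF assms]], of c])
    (simp only: real_norm_def c)
qed

lemma csym_dec2: assumes "csym 2 m" shows "EX c. dec2 c m"
proof -
 obtain m1 where m1: "!!k. (m has_real_derivative m1 k) (at k)" "csym 1 m1"
  using csym_derivative[of 1 m] assms by (auto simp: numeral_2_eq_2)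
 obtain m2 where m2: "!!k. (m1 has_real_derivative m2 k) (at k)" "csym 0 m2"
  using csym_derivative[of 0 m1] m1 by auto
 obtain c c1 c2 where c: "c >= 0" "!!k. abs (m k) <= c / (1 + k^2)" "c1 >= 0" "!!k. abs (m1 k) <= c1 / (1 + k^2)"
  "c2 >= 0" "!!k. abs (m2 k) <= c2 / (1 + k^2)"
  using csym_bound[OF assms] csym_bound[OF m1(2)] csym_bound[OF m2(2)] by blast
 have "x <= (c + c1 + c2) / (1 + k^2)" if "x <= r / (1 + k^2)" "r <= c + c1 + c2" for x r k
  using that divide_right_mono[OF that(2), of "1 + k^2"] by (simp add: add_nonneg_nonneg)
 hence le: "abs (m k) <= (c + c1 + c2) / (1 + k^2)" "abs (m1 k) <= (c + c1 + c2) / (1 + k^2)"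
  "abs (m2 k) <= (c + c1 + c2) / (1 + k^2)" for k
  using c(2)[of k] c(4)[of k] c(6)[of k] c(1,3,5) by force+
 have "dec2 (c + c1 + c2) m" unfolding dec2_def
  using m1(1) m2(1) csym_continuous[OF m2(2)] le by blast
 thus ?thesis by blast
qed

lemma csym_3_2: "csym 3 m ==> csym 2 m" using csym_Suc[of 2 m] by (simp add: eval_nat_numeral)

lemma csym_evs: "csym 3 m ==> (!!k. m (- k) = m k) ==> evs m"
 unfolding evs_def using csym_dec2[OF csym_3_2] by auto

lemma csym_third_moment: assumes "csym 3 m" shows "integrable lborel (%y. abs (y) * ci 0 m y)"
proof -
 obtain m1 where m1: "!!k. (m has_real_derivative m1 k) (at k)" "csym 2 m1"
  using csym_derivative[of 2 m] assms by (auto simp: eval_nat_numeral)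
 obtain c where c: "dec2 c m1" using csym_dec2[OF m1(2)] by blast
 have i: "integrable lborel m" "integrable lborel m1" using csym_integrable assms m1(2) by blast+
 obtain b where b: "!!k. abs (m k) <= b / (1 + k^2)" using csym_bound[OF assms] by blast
 have p: "y * ci 0 m y = - ci (0 - pi / 2) m1 y" for y
  by (rule ci_by_parts) (use m1 i csym_continuous[OF m1(2)] tendsto_zero_of_recip_quadratic[OF b] in auto)
 have [measurable]: "ci 0 m : borel_measurable borel" using i(1) by (intro ci_measurable) auto
 show ?thesis
 proof (rule integrable_of_recip_quadratic[where c=c])
  show "norm (abs (y) * ci 0 m y) <= c / (1 + y^2)" for y
   using ci_dec2[OF c, of "0 - pi/2" y] p[of y] by (simp add: abs_mult)
 qed measurable
qed

lemma Ck_even_poly: "Ck n sa"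
 unfolding sa_def[abs_def] by (intro Ck_intros)

lemma csym_of_sa: assumes "Ck 3 h" "!!a. a > R ==> h a = 0" shows "csym 3 (%k. h (sa k))"
 unfolding csym_def
proof
 show "Ck 3 (%k. h (sa k))" by (rule Ck_compose[OF assms(1) Ck_even_poly])
 have "sa k > R" if "2 + abs (R) < abs (k)" for k
 proof -
  have "abs (k) * 1 <= abs (k) * abs (k)" using that by (intro mult_left_mono) auto
  hence "k^2 - 1 >= 1 + abs (R)" using that by (simp add: power2_eq_square)
  hence "(k^2 - 1)^2 >= (1 + abs (R))^2" by (intro power_mono) auto
  moreover have "(1 + abs (R))^2 = 1 + 2 * abs (R) + (abs (R))^2" by (simp add: power2_eq_square algebra_simps)
  ultimately show ?thesis by (simp add: sa_def power2_commute[of 1]) (smt (verit) zero_le_power2)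
 qed
 thus "EX R. ALL k. R < abs (k) --> h (sa k) = 0" using assms(2) by blast
qed

lemma sa_even: "sa (- k) = sa k" by (simp add: sa_def)

definition csa :: "(real => real) => bool" where
 "csa h \<longleftrightarrow> Ck 3 h & (EX R. ALL a>R. h a = 0)"

lemma csa_csym: "csa h ==> csym 3 (%k. h (sa k))"
 unfolding csa_def using csym_of_sa by blast

lemma csa_evs: "csa h ==> evs (%k. h (sa k))"
 by (intro csym_evs csa_csym) (simp_all add: sa_even)

lemma csa_plateau: assumes "r > 0" shows "csa (%a. plateau (r * a))"
 unfolding csa_def
proof
 show "Ck 3 (%a. plateau (r * a))" by (rule Ck_compose[OF Ck_plateau]) (intro Ck_intros)
 have "plateau (r * a) = 0" if "a > 2 / r" for a
  using that assms by (intro plateau_zero) (simp add: field_simps)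
 thus "EX R. ALL a>R. plateau (r * a) = 0" by blast
qed

section \<open>Decay off the critical modes\<close>

lemma bounded_of_limits:
 fixes f :: "real => real"
 assumes "continuous_on UNIV f" "(f \<longlongrightarrow> 0) at_top" "(f \<longlongrightarrow> 0) at_bot"
 shows "EX C. ALL k. abs (f k) <= C"
proof -
 have "\<forall>\<^sub>F k in at_top. abs (f k) < 1" "\<forall>\<^sub>F k in at_bot. abs (f k) < 1"
  using tendstoD[OF assms(2), of 1] tendstoD[OF assms(3), of 1] by auto
 then obtain a b where ab: "!!k. k >= a ==> abs (f k) < 1" "!!k. k <= b ==> abs (f k) < 1"
  by (auto simp: eventually_at_top_linorder eventually_at_bot_linorder)
 have "compact (f ` {b..a})"
  by (intro compact_continuous_image continuous_on_subset[OF assms(1)]) auto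
 then obtain B where "ALL k:{b..a}. abs (f k) <= B"
  by (auto dest!: compact_imp_bounded simp: bounded_iff)
 hence B: "abs (f k) <= B" if "k : {b..a}" for k using that by blast
 have "abs (f k) <= max 1 B" for k
  using ab(1)[of k] ab(2)[of k] B[of k] by (cases "k >= a"; cases "k <= b") auto
 thus ?thesis by blast
qed

definition crit :: "real => real" where "crit k = plateau (100 * sa k)"

lemma crit_evs: "evs crit" and crit_csym: "csym 3 crit"
 using csa_evs[OF csa_plateau[of 100]] csa_csym[OF csa_plateau[of 100]] by (auto simp: crit_def[abs_def])

lemma stable_heat_dec2:
 "EX C. ALL t>=1. dec2 (C * exp (- t / 400)) (%k. (1 - crit k) * heat t k)"
proof -
 define a1 where "a1 k = - 4 * k * (1 - k^2)" for k :: real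
 define a2 where "a2 k = 12 * k^2 - 4" for k :: real
 obtain c1 where c1: "!!k. (crit has_real_derivative c1 k) (at k)" "csym 2 c1"
  using csym_derivative[of 2 crit] crit_csym by (auto simp: eval_nat_numeral)
 obtain c2 where c2: "!!k. (c1 has_real_derivative c2 k) (at k)" "csym 1 c2"
  using csym_derivative[of 1 c1] c1(2) by (auto simp: eval_nat_numeral)
 obtain B1 B2 where B: "B1 >= 0" "!!k. abs (c1 k) <= B1 / (1 + k^2)" "B2 >= 0" "!!k. abs (c2 k) <= B2 / (1 + k^2)"
  using csym_bound[OF c1(2)] csym_bound[OF c2(2)] by blast
 have B': "abs (c1 k) <= B1" "abs (c2 k) <= B2" for k
 proof -
  have "b / (1 + k^2) <= b / 1" if "b >= 0" for b using that by (intro divide_left_mono) (auto simp: add_pos_nonneg)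
  thus "abs (c1 k) <= B1" "abs (c2 k) <= B2" using B(1,3) B(2)[of k] B(4)[of k] by (metis div_by_1 order_trans)+
 qed
 define P where "P k = (6 + 4 * (a1 k)^2 + 12 * k^2) * (1 + k^2) * exp (- sa k / 2)" for k
 have "continuous_on UNIV P" unfolding P_def a1_def sa_def by (intro continuous_intros) auto
 moreover have "(P \<longlongrightarrow> 0) at_top" "(P \<longlongrightarrow> 0) at_bot" unfolding P_def a1_def sa_def by real_asymp+
 ultimately obtain CP where CP: "!!k. abs (P k) <= CP" using bounded_of_limits by blast
 define C where "C = (1 + B1 + B2) * 4 * 320000 * CP"
 have da: "(sa has_real_derivative a1 k) (at k)" "(a1 has_real_derivative a2 k) (at k)" for k
  unfolding sa_def[abs_def] a1_def[abs_def] a2_def by (auto intro!: derivative_eq_intros simp: algebra_simps power2_eq_square)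
 have main: "dec2 (C * exp (- t / 400)) (%k. (1 - crit k) * heat t k)" if t: "t >= 1" for t
  unfolding dec2_def
 proof (intro exI conjI allI)
  let ?h = "heat t"
  let ?h1 = "%k. - (t * a1 k) * ?h k"
  let ?h2 = "%k. ((t * a1 k)^2 - t * a2 k) * ?h k"
  have dh: "(?h has_real_derivative ?h1 k) (at k)" for k
   unfolding heat_def[abs_def] by (auto intro!: derivative_eq_intros da simp: heat_def)
  have dh1: "(?h1 has_real_derivative ?h2 k) (at k)" for k
   by (auto intro!: derivative_eq_intros da dh simp: algebra_simps power2_eq_square)
  let ?m1 = "%k. - c1 k * ?h k + (1 - crit k) * ?h1 k"
  let ?m2 = "%k. - c2 k * ?h k - 2 * c1 k * ?h1 k + (1 - crit k) * ?h2 k"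
  show "((%k. (1 - crit k) * ?h k) has_real_derivative ?m1 k) (at k)" for k
   by (auto intro!: derivative_eq_intros c1 dh simp: algebra_simps)
  show "(?m1 has_real_derivative ?m2 k) (at k)" for k
   by (rule DERIV_cong[OF DERIV_add[OF DERIV_mult[OF DERIV_minus[OF c2(1)] dh]
    DERIV_mult[OF DERIV_diff[OF DERIV_const c1(1)] dh1]]]) (simp add: algebra_simps)
  have hc: "continuous_on UNIV ?h" unfolding heat_def[abs_def] sa_def by (intro continuous_intros)
  show "continuous_on UNIV ?m2"
   unfolding a1_def a2_def by (intro continuous_intros hc csym_continuous[OF c1(2)] csym_continuous[OF c2(2)] csym_continuous[OF crit_csym])
  have z: "crit k = 1 & c1 k = 0 & c2 k = 0" if "sa k < 1 / 100" for k
  proof -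
   have op: "open {k. sa k < 1 / 100}" unfolding sa_def by (intro open_Collect_less continuous_intros)
   have 1: "crit k = 1" if "sa k < 1 / 100" for k using that by (simp add: crit_def plateau_one)
   have 2: "c1 k = 0" if "sa k < 1 / 100" for k
   proof -
    have "(crit has_real_derivative 0) (at k)"
    by (rule has_field_derivative_transform_within_open[OF _ op, of "%_. 1"]) (use that 1 in auto)
    thus ?thesis using c1(1) DERIV_unique by blast
   qed
   have "(c1 has_real_derivative 0) (at k)"
    by (rule has_field_derivative_transform_within_open[OF _ op, of "%_. 0"]) (use that 2 in auto)
   thus ?thesis using c2(1) DERIV_unique 1 2 that by blast
  qed
  fix k
  have Cn: "0 <= C * exp (- t / 400) / (1 + k^2)"
  proof -
   have "0 <= CP" using CP[of 0] by linarith
   hence "0 <= C" using B by (simp add: C_def)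
   thus ?thesis by (simp add: add_nonneg_nonneg)
  qed
  have cr: "abs (1 - crit k) <= 1" using plateau_bounds[of "100 * sa k"] by (simp add: crit_def)
  have "abs ((1 - crit k) * ?h k) <= C * exp (- t / 400) / (1 + k^2) & abs (?m1 k) <= C * exp (- t / 400) / (1 + k^2)
    & abs (?m2 k) <= C * exp (- t / 400) / (1 + k^2)"
  proof (cases "sa k < 1 / 100")
   case True thus ?thesis using z[OF True] Cn by simp
  next
   case False
   define E where "E = exp (- t / 200) * exp (- sa k / 2)"
   have h: "0 < ?h k" "?h k <= E"
   proof -
    have "t * (1 / 100) <= t * sa k" "1 * sa k <= t * sa k" using False t sa_nonneg[of k] by (auto intro!: mult_left_mono mult_right_mono)
    thus "?h k <= E" by (simp add: E_def heat_def flip: exp_add)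
   qed (simp add: heat_def)
   define A where "A = 1 + abs (a1 k) + (a1 k)^2 + abs (a2 k)"
   have A: "1 <= A" "abs (a1 k) <= A" "(a1 k)^2 + abs (a2 k) <= A" by (auto simp: A_def)
   have tt: "t <= t^2" "1 <= t^2" using t self_le_power[of t 2] by auto
   define D where "D = t^2 * A * E"
   have E0: "E > 0" by (simp add: E_def)
   have D0: "?h k <= D"
   proof -
    have "1 * 1 * E <= t^2 * A * E" using tt A E0 by (intro mult_mono) auto
    thus ?thesis unfolding D_def using h by linarith
   qed
   have D1: "abs (?h1 k) <= D"
   proof -
    have "abs (?h1 k) = t * abs (a1 k) * ?h k" using t h by (simp add: abs_mult)
    also have "... <= t^2 * A * E" using tt A E0 h t by (intro mult_mono) auto
    finally show ?thesis by (simp add: D_def)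
   qed
   have D2: "abs (?h2 k) <= D"
   proof -
    have "abs ((t * a1 k)^2 - t * a2 k) <= (t * a1 k)^2 + t * abs (a2 k)"
    using t abs_triangle_ineq4[of "(t * a1 k)^2" "t * a2 k"] by (simp add: abs_mult)
    also have "... <= t^2 * (a1 k)^2 + t^2 * abs (a2 k)"
    using tt by (intro add_mono mult_right_mono) (auto simp: power_mult_distrib)
    also have "... <= t^2 * A" unfolding distrib_left[symmetric] using A by (intro mult_left_mono) auto
    finally have "abs ((t * a1 k)^2 - t * a2 k) * ?h k <= t^2 * A * E"
    using h A by (intro mult_mono) auto
    thus ?thesis using h by (simp add: D_def abs_mult)
   qed
   have Dn: "D >= 0" using D0 h by linarith
   have fin: "(1 + B1 + B2) * 4 * D <= C * exp (- t / 400) / (1 + k^2)"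
   proof -
    have "A <= 6 + 4 * (a1 k)^2 + 12 * k^2"
    proof -
    have "2 * abs (a1 k) <= 1 + (a1 k)^2" using sum_squares_bound[of 1 "abs (a1 k)"] by simp
    moreover have "abs (a2 k) <= 4 + 12 * k^2" unfolding a2_def by (rule order_trans[OF abs_triangle_ineq4]) simp
    moreover have "0 <= (a1 k)^2" by simp
    ultimately show ?thesis unfolding A_def by linarith
    qed
    hence "A * (1 + k^2) * exp (- sa k / 2) <= P k"
    unfolding P_def by (intro mult_right_mono) (auto simp: add_nonneg_nonneg)
    also have "... <= CP" using CP[of k] by linarith
    finally have a: "A * (1 + k^2) * exp (- sa k / 2) <= CP" .
    have "1 + t / 400 + (t / 400)^2 / 2 <= exp (t / 400)" using t by (intro exp_lower_Taylor_quadratic) auto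
    hence "t^2 <= 320000 * exp (t / 400)" using t by (simp add: power_divide)
    hence "t^2 * exp (- t / 200) <= 320000 * exp (t / 400) * exp (- t / 200)" by (intro mult_right_mono) auto
    also have "... = 320000 * exp (- t / 400)" by (simp add: mult.assoc flip: exp_add)
    finally have b: "t^2 * exp (- t / 200) <= 320000 * exp (- t / 400)" .
    have "(t^2 * exp (- t / 200)) * (A * (1 + k^2) * exp (- sa k / 2)) <= (320000 * exp (- t / 400)) * CP"
    by (rule mult_mono[OF b a]) (use A in "auto simp: add_nonneg_nonneg")
    hence "D * (1 + k^2) <= 320000 * CP * exp (- t / 400)"
    by (simp add: D_def E_def mult_ac)
    from mult_left_mono[OF this, of "(1 + B1 + B2) * 4"] B
    have "(1 + B1 + B2) * 4 * D * (1 + k^2) <= C * exp (- t / 400)"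
    by (simp add: C_def mult_ac)
    moreover have "1 + k^2 > 0" by (simp add: add_pos_nonneg)
    ultimately show ?thesis by (simp add: pos_le_divide_eq)
   qed
   have BD: "0 <= B1 * D" "0 <= B2 * D" using B Dn by auto
   have ineq: "D <= (1 + B1 + B2) * 4 * D" "(1 + B1) * D <= (1 + B1 + B2) * 4 * D" "(B2 + 2 * B1 + 1) * D <= (1 + B1 + B2) * 4 * D"
    using BD Dn by (auto simp: algebra_simps)
   have m0: "abs ((1 - crit k) * ?h k) <= D"
    using mult_mono[OF cr D0] h by (simp add: abs_mult)
   have m1: "abs (?m1 k) <= (1 + B1) * D"
   proof -
    have "abs (c1 k * ?h k) <= B1 * D" using mult_mono[OF B'(1) D0] h B by (simp add: abs_mult)
    moreover have "abs ((1 - crit k) * ?h1 k) <= 1 * D" unfolding abs_mult[of "1 - crit k"] using mult_mono[OF cr D1] by simp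
    ultimately show ?thesis by (simp only: distrib_right; linarith)
   qed
   have m2: "abs (?m2 k) <= (B2 + 2 * B1 + 1) * D"
   proof -
    have "abs (c2 k * ?h k) <= B2 * D" using mult_mono[OF B'(2) D0] h B by (simp add: abs_mult)
    moreover have "abs (c1 k * ?h1 k) <= B1 * D" unfolding abs_mult[of "c1 k"] using mult_mono[OF B'(1) D1] B by simp
    moreover have "abs ((1 - crit k) * ?h2 k) <= 1 * D" unfolding abs_mult[of "1 - crit k"] using mult_mono[OF cr D2] by simp
    ultimately show ?thesis by (simp only: distrib_right mult.assoc; linarith)
   qed
   show ?thesis using m0 m1 m2 ineq fin by linarith
  qed
  thus "abs ((1 - crit k) * ?h k) <= C * exp (- t / 400) / (1 + k^2)" "abs (?m1 k) <= C * exp (- t / 400) / (1 + k^2)"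
    "abs (?m2 k) <= C * exp (- t / 400) / (1 + k^2)" by blast+
 qed
 thus ?thesis by blast
qed

text \<open>Off the critical modes \<open>a\<close> is at least \<open>1/100\<close>, so the symbol and its derivatives decay exponentially from time one on; for shorter times boundedness of the semigroup is enough.\<close>

lemma stable_decay:
 "EX C>=1. ALL t>=0. ALL (f::real => 'a::euclidean_space) B x. bcf f --> (ALL x. norm (f x) <= B) -->
   norm (sg t (%y. f y - fmult crit f y) x) <= C * exp (- t / 400) * B"
proof -
 obtain C0 where C0: "!!t. t >= 1 ==> dec2 (C0 * exp (- t / 400)) (%k. (1 - crit k) * heat t k)"
  using stable_heat_dec2 by blast
 define e where "e = (LINT y|lborel. abs (ci 0 crit y))"
 have e0: "0 <= e" unfolding e_def by simp
 define C1 where "C1 = 1000 * pi * (1 + e) * exp (1 / 400)"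
 have C1: "C1 >= 0" unfolding C1_def using e0 by simp
 define C where "C = 1 + abs (C0) * pi + C1"
 have "norm (sg t (%y. f y - fmult crit f y) x) <= C * exp (- t / 400) * B"
  if t: "t >= 0" and f: "bcf f" and B: "!!x. norm (f x) <= B" for t B x and f :: "real => 'a"
 proof -
  have B0: "B >= 0" using B[of 0] norm_ge_zero order_trans by blast
  have fe: "bcf (fmult crit f)" by (rule fmult_bcf[OF crit_evs f])
  show ?thesis
  proof (cases "t >= 1")
   case True
   hence t0: "t > 0" by simp
   have dd: "dec2 (C0 * exp (- t / 400)) (%k. (1 - crit k) * heat t k)" by (rule C0[OF True])
   have ev: "evs (%k. (1 - crit k) * heat t k)"
    unfolding evs_def using dd crit_evs evs_heat[OF t0] by (auto simp: evs_def)
   have evp: "evs (%k. heat t k * crit k)"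
   proof -
    have "csym 3 (%k. heat t k * crit k)"
    by (rule csym_mult[OF crit_csym]) (unfold heat_def[abs_def], intro Ck_intros Ck_even_poly)
    thus ?thesis using crit_evs evs_heat[OF t0] by (intro csym_evs) (auto simp: evs_def)
   qed
   have "sg t (%y. f y - fmult crit f y) x = sg t f x - sg t (fmult crit f) x"
    unfolding sg_def by (rule cv_diff[OF sg_kern f fe]) fact
   also have "... = fmult (heat t) f x - fmult (%k. heat t k * crit k) f x"
    using sg_eq_fmult[OF t0] cv_fmult[OF sg_kern sg_symb crit_evs f] t by (simp add: sg_def)
   also have "... = fmult (%k. (1 - crit k) * heat t k) f x"
    using fmult_add_symbol[OF ev evp f, of x] by (simp add: algebra_simps)
   finally have eq: "sg t (%y. f y - fmult crit f y) x = fmult (%k. (1 - crit k) * heat t k) f x" .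
   have "norm (fmult (%k. (1 - crit k) * heat t k) f x) <= B * (LINT z|lborel. abs (ci 0 (%k. (1 - crit k) * heat t k) z))"
    unfolding fmult_def by (rule cv_norm_le[OF evs_kern[OF ev] f B])
   also have "... <= B * (C0 * exp (- t / 400) * pi)"
    by (intro mult_left_mono B0 integral_le_of_recip_quadratic ci_dec2[OF dd])
    (use evs_kern[OF ev] in "auto simp: kern_def")
   also have "... = (C0 * pi) * (exp (- t / 400) * B)" by (simp add: mult_ac)
   also have "... <= C * (exp (- t / 400) * B)"
    using B0 C1 abs_ge_self[of C0] unfolding C_def
    by (intro mult_right_mono) (auto intro!: order_trans[OF mult_right_mono[of C0 "abs (C0)" pi]])
   finally show ?thesis using eq by (simp add: mult.assoc)
  next
   case False
   have "norm (f y - fmult crit f y) <= (1 + e) * B" for y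
   proof -
    have "norm (fmult crit f y) <= B * e"
    unfolding fmult_def e_def by (rule cv_norm_le[OF evs_kern[OF crit_evs] f B])
    thus ?thesis using norm_triangle_ineq4[of "f y" "fmult crit f y"] B[of y] by (simp add: algebra_simps)
   qed
   hence "norm (sg t (%y. f y - fmult crit f y) x) <= 1000 * pi * ((1 + e) * B)"
    by (intro sg_norm_le t bcf_diff f fe)
   also have "... = C1 * (exp (- 1 / 400) * B)" by (simp add: C1_def flip: exp_add)
   also have "... <= C * (exp (- t / 400) * B)"
    using False B0 C1 unfolding C_def by (intro mult_mono mult_right_mono mult_nonneg_nonneg) auto
   finally show ?thesis by (simp add: mult.assoc)
  qed
 qed
 moreover have "C >= 1" using C1 by (simp add: C_def)
 ultimately show ?thesis by blast
qed

section \<open>Space-time functions and the Duhamel operator\<close>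

text \<open>Bounded and jointly continuous in space and time. This class is stable under all operators of the mild equation, so no separate measurability arguments arise.\<close>

definition bcs :: "'p::metric_space set => (real => 'p => 'a::real_normed_vector) => bool" where
 "bcs P F \<longleftrightarrow> continuous_on (UNIV \<times> P) (%(x, t). F x t) & (EX B. ALL x. ALL t:P. norm (F x t) <= B)"

lemma bcsI: "continuous_on (UNIV \<times> P) (%(x, t). F x t) ==> (!!x t. t : P ==> norm (F x t) <= B) ==> bcs P F"
 by (auto simp: bcs_def)

lemma bcs_continuous: "bcs P F ==> continuous_on (UNIV \<times> P) (%(x, t). F x t)"
 by (simp add: bcs_def)

lemma bcs_bound: assumes "bcs P F" obtains B where "B >= 0" "!!x t. t : P ==> norm (F x t) <= B"
proof -
 obtain B where B: "!!x t. t : P ==> norm (F x t) <= B" using assms by (auto simp: bcs_def)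
 show ?thesis by (rule that[of "abs (B)"]) (use B in "auto intro: order_trans[OF _ abs_ge_self]")
qed

lemma bcs_bdd: "bcs P F ==> EX B>=0. ALL x. ALL t:P. norm (F x t) <= B"
 by (rule bcs_bound[of P F]) auto

lemma bcs_compose:
 assumes F: "bcs P F" and a: "continuous_on S a" and b: "continuous_on S b" "b ` S \<subseteq> P"
 shows "continuous_on S (%s. F (a s) (b s))"
proof -
 have "continuous_on S (%s. (%(x, t). F x t) (a s, b s))"
  by (rule continuous_on_compose2[OF bcs_continuous[OF F]]) (use a b in "auto intro!: continuous_intros")
 thus ?thesis by simp
qed

lemma bcs_bcf: "bcs P F ==> t : P ==> bcf (%x. F x t)"
 by (rule bcs_bound[of P F], assumption, rule bcfI, rule bcs_compose[of P F]) (auto intro: continuous_intros)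

lemma bcs_time: "bcs P F ==> continuous_on P (F x)"
 by (rule bcs_compose[of P F P "%_. x" "%t. t", simplified]) (auto intro: continuous_intros)

lemma bcs_const: "bcf f ==> bcs P (%x t. f x)"
 unfolding bcs_def bcf_def split_def
 by (auto intro!: continuous_on_compose2[of UNIV f _ fst] continuous_intros)

lemma bcs_add: assumes "bcs P F" "bcs P G" shows "bcs P (%x t. F x t + G x t)"
proof -
 obtain B C where "!!x t. t : P ==> norm (F x t) <= B" "!!x t. t : P ==> norm (G x t) <= C"
  using bcs_bound[OF assms(1)] bcs_bound[OF assms(2)] by metis
 hence "norm (F x t + G x t) <= B + C" if "t : P" for x t
  using that by (intro norm_triangle_le add_mono) auto
 thus ?thesis using bcs_continuous[OF assms(1)] bcs_continuous[OF assms(2)]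
  by (intro bcsI[of _ _ "B + C"]) (auto simp: split_def intro!: continuous_intros)
qed

lemma bcs_scale_time:
 assumes F: "bcs P F" and c: "continuous_on P c" "!!t. t : P ==> abs (c t) <= K"
 shows "bcs P (%x t. c t *\<^sub>R F x t)"
proof -
 obtain B where B: "B >= 0" "!!x t. t : P ==> norm (F x t) <= B" using bcs_bound[OF F] by blast
 show ?thesis
 proof (rule bcsI[of _ _ "K * B"])
  show "norm (c t *\<^sub>R F x t) <= K * B" if "t : P" for x t
   unfolding norm_scaleR using B c(2)[OF that] that by (intro mult_mono) (auto intro: order_trans[OF abs_ge_zero])
  show "continuous_on (UNIV \<times> P) (%(x, t). c t *\<^sub>R F x t)"
   using bcs_continuous[OF F] unfolding split_def
   by (intro continuous_on_scaleR continuous_on_compose2[OF c(1), of _ snd] continuous_intros) auto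
 qed
qed

lemma bcs_scaleR: "bcs P F ==> bcs P (%x t. c *\<^sub>R F x t)"
 by (rule bcs_scale_time[of P F "%_. c" "abs (c)"]) auto

lemma bcs_minus: "bcs P F ==> bcs P (%x t. - F x t)"
 using bcs_scaleR[of P F "-1"] by simp

lemma bcs_diff: "bcs P F ==> bcs P G ==> bcs P (%x t. F x t - G x t)"
 using bcs_add[OF _ bcs_minus, of P F G] by simp

lemma bcs_linear: assumes F: "bcs P F" and h: "bounded_linear h" shows "bcs P (%x t. h (F x t))"
proof -
 obtain B where B: "B >= 0" "!!x t. t : P ==> norm (F x t) <= B" using bcs_bound[OF F] by blast
 obtain K where K: "!!x. norm (h x) <= norm x * K" "K > 0"
  using bounded_linear.pos_bounded[OF h] by blast
 have "norm (h (F x t)) <= B * K" if "t : P" for x t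
  by (rule order_trans[OF K(1)]) (use B K(2) that in auto)
 thus ?thesis using bounded_linear.continuous_on[OF h bcs_continuous[OF F]]
  by (intro bcsI[of _ _ "B * K"]) (auto simp: split_def)
qed

lemma bcs_bilinear:
 assumes p: "bounded_bilinear p" and F: "bcs P F" and G: "bcs P G"
 shows "bcs P (%x t. p (F x t) (G x t))"
proof -
 obtain B where B: "B >= 0" "!!x t. t : P ==> norm (F x t) <= B" using bcs_bound[OF F] by blast
 obtain C where C: "C >= 0" "!!x t. t : P ==> norm (G x t) <= C" using bcs_bound[OF G] by blast
 obtain K where K: "K > 0" "!!a b. norm (p a b) <= norm a * norm b * K"
  using bounded_bilinear.pos_bounded[OF p] by blast
 have "norm (p (F x t) (G x t)) <= B * C * K" if "t : P" for x t
  by (rule order_trans[OF K(2)]) (use B C K that in "auto intro!: mult_right_mono mult_mono")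
 thus ?thesis using bounded_bilinear.continuous_on[OF p bcs_continuous[OF F] bcs_continuous[OF G]]
  by (intro bcsI[of _ _ "B * C * K"]) (auto simp: split_def)
qed

lemma bcs_cv:
 fixes F :: "real => 'p::metric_space => 'a::euclidean_space"
 assumes k: "kern M w g" and F: "bcs P F"
 shows "bcs P (%x t. cv M w g (%y. F y t) x)"
proof -
 obtain B where B: "B >= 0" "!!x t. t : P ==> norm (F x t) <= B" using bcs_bound[OF F] by blast
 show ?thesis
 proof (rule bcsI)
  show "continuous_on (UNIV \<times> P) (%(x, t). cv M w g (%y. F y t) x)"
   by (rule cv_continuous_param[where W="%z. abs (w z)" and w="%_. w" and g="%_. g" and B=B])
    (use k kern_measurable[OF k] bcs_continuous[OF F] B in "auto simp: kern_def intro!: continuous_intros")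
  show "norm (cv M w g (%y. F y t) x) <= B * (LINT z|M. abs (w z))" if "t : P" for x t
   by (rule cv_norm_le[OF k bcs_bcf[OF F that]]) (use B that in auto)
 qed
qed

lemma bcs_fmult: "evs m ==> bcs P F ==> bcs P (%x t. fmult m (%y. F y t) x)"
 unfolding fmult_def by (rule bcs_cv[OF evs_kern])

lemma integral_swap_dominated:
 fixes H :: "'b => real => 'a::euclidean_space"
 assumes M: "sigma_finite_measure M" and W: "integrable M W" "!!z s. s : {a..b} ==> norm (H z s) <= W z"
  and m: "(%(z, s). indicator {a..b} s *\<^sub>R H z s) : borel_measurable (M \<Otimes>\<^sub>M lborel)"
  and c: "!!z. z : space M ==> continuous_on {a..b} (H z)"
 shows "(LINT z|M. integral {a..b} (H z)) = integral {a..b} (%s. LINT z|M. H z s)"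
  and "(%s. LINT z|M. H z s) integrable_on {a..b}"
proof -
 have 1: "integral {a..b} (H z) = (LINT s|lborel. indicator {a..b} s *\<^sub>R H z s)" if "z : space M" for z
  using set_borel_integral_eq_integral(2)[OF borel_integrable_atLeastAtMost'[OF c[OF that]]]
  by (simp add: set_lebesgue_integral_def)
 have b: "norm (indicator {a..b} s *\<^sub>R H z s) <= W z * indicator {a..b} s" for z s
  using W(2)[of s z] by (simp add: indicator_def)
 have ind: "integrable lborel (indicator {a..b} :: real => real)"
  using borel_integrable_atLeastAtMost'[of a b "%_. 1::real"] by (simp add: set_integrable_def)
 have i: "integrable (M \<Otimes>\<^sub>M lborel) (%(z, s). indicator {a..b} s *\<^sub>R H z s)"
  by (rule fubini_product_integrable[OF M sigma_finite_lborel m W(1) ind b])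
 interpret M: sigma_finite_measure M by fact
 interpret P: pair_sigma_finite M "lborel :: real measure"
  by (intro pair_sigma_finite.intro M sigma_finite_lborel)
 have "integrable lborel (%s. LINT z|M. indicator {a..b} s *\<^sub>R H z s)"
  using P.integrable_snd[OF i] by simp
 hence si: "set_integrable lborel {a..b} (%s. LINT z|M. H z s)"
  by (simp add: set_integrable_def)
 have "(LINT z|M. integral {a..b} (H z)) = (LINT z|M. LINT s|lborel. indicator {a..b} s *\<^sub>R H z s)"
  by (intro Bochner_Integration.integral_cong refl 1)
 also have "... = (LINT s|lborel. LINT z|M. indicator {a..b} s *\<^sub>R H z s)"
  by (rule fubini_product[OF M sigma_finite_lborel m W(1) ind b])
 also have "... = integral {a..b} (%s. LINT z|M. H z s)"
  using set_borel_integral_eq_integral(2)[OF si] by (simp add: set_lebesgue_integral_def)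
 finally show "(LINT z|M. integral {a..b} (H z)) = integral {a..b} (%s. LINT z|M. H z s)" .
 show "(%s. LINT z|M. H z s) integrable_on {a..b}" by (rule set_borel_integral_eq_integral(1)[OF si])
qed

lemma cv_integral_swap:
 fixes F :: "real => real => 'a::euclidean_space"
 assumes k: "kern M w g" and F: "bcs {a..b} F"
 shows "cv M w g (%x. integral {a..b} (F x)) x = integral {a..b} (%s. cv M w g (%y. F y s) x)"
proof -
 obtain B where B: "B >= 0" "!!x t. t : {a..b} ==> norm (F x t) <= B" using bcs_bound[OF F] by blast
 have [measurable]: "w : borel_measurable M" "g : borel_measurable M" using kern_measurable[OF k] by auto
 have "(%p. indicator (UNIV \<times> {a..b}) p *\<^sub>R (%(x, t). F x t) p) : borel_measurable borel"
  by (rule borel_measurable_continuous_on_indicator[OF _ bcs_continuous[OF F]])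
    (auto intro!: borel_closed closed_Times)
 hence [measurable]: "(%p. indicator (UNIV \<times> {a..b}) p *\<^sub>R F (fst p) (snd p)) : borel_measurable (borel \<Otimes>\<^sub>M borel)"
  by (simp add: split_def borel_prod)
 have "(%q. w (fst q) *\<^sub>R ((%p. indicator (UNIV \<times> {a..b}) p *\<^sub>R F (fst p) (snd p)) (x - g (fst q), snd q))) : borel_measurable (M \<Otimes>\<^sub>M lborel)"
  by measurable
 hence m: "(%(z, s). indicator {a..b} s *\<^sub>R w z *\<^sub>R F (x - g z) s) : borel_measurable (M \<Otimes>\<^sub>M lborel)"
  by (simp add: split_def indicator_times mult.commute)
 have "(LINT z|M. integral {a..b} (%s. w z *\<^sub>R F (x - g z) s)) = integral {a..b} (%s. LINT z|M. w z *\<^sub>R F (x - g z) s)"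
 proof (rule integral_swap_dominated[where W="%z. abs (w z) * B", OF _ _ _ m])
  show "norm (w z *\<^sub>R F (x - g z) s) <= abs (w z) * B" if "s : {a..b}" for z s
   using B(2)[OF that] by (simp add: mult_left_mono)
  show "continuous_on {a..b} (%s. w z *\<^sub>R F (x - g z) s)" for z
   by (intro continuous_intros bcs_time[OF F])
 qed (use k in "auto simp: kern_def")
 thus ?thesis by (simp add: cv_def)
qed

definition duhamel :: "real => (real => real => 'a::euclidean_space) => real => real => 'a" where
 "duhamel e F x t = integral {0..t} (%s. exp (e^2 * (t - s)) *\<^sub>R sg (t - s) (%y. F y s) x)"

lemma duhamel_integrand_bcs:
 fixes F :: "real => real => 'a::euclidean_space"
 assumes F: "bcs {0..R} F"
 shows "bcs ({0..R} \<times> {0..R}) (%x p. exp (e^2 * fst p) *\<^sub>R sg (fst p) (%y. F y (snd p)) x)"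
proof -
 obtain B where B: "B >= 0" "!!x t. t : {0..R} ==> norm (F x t) <= B" using bcs_bound[OF F] by blast
 have "bcs ({0..R} \<times> {0..R}) (%x p. sg (fst p) (%y. F y (snd p)) x)"
 proof (rule bcsI)
  show "continuous_on (UNIV \<times> {0..R} \<times> {0..R}) (%(x, p). sg (fst p) (%y. F y (snd p)) x)"
   using sg_continuous[OF bcs_continuous[OF F] B(2), of R] by (simp add: split_def)
  show "norm (sg (fst p) (%y. F y (snd p)) x) <= 1000 * pi * B" if "p : {0..R} \<times> {0..R}" for x p
   by (rule sg_norm_le[OF _ bcs_bcf[OF F]]) (use B that in auto)
 qed
 thus ?thesis
  by (rule bcs_scale_time[where K="exp (e^2 * R)"]) (auto intro!: continuous_intros mult_left_mono)
qed

lemma duhamel_integrand_continuous: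
 fixes F :: "real => real => 'a::euclidean_space"
 assumes F: "bcs {0..R} F" and t: "t <= R"
 shows "continuous_on {0..t} (%s. exp (e^2 * (t - s)) *\<^sub>R sg (t - s) (%y. F y s) x)"
 using bcs_compose[OF duhamel_integrand_bcs[OF F, of e], of "{0..t}" "%_. x" "%s. (t - s, s)"] t
 by (simp add: image_subset_iff continuous_intros)

lemma duhamel_has_integral:
 fixes F :: "real => real => 'a::euclidean_space"
 assumes F: "bcs {0..R} F" and t: "t <= R"
 shows "((%s. exp (e^2 * (t - s)) *\<^sub>R sg (t - s) (%y. F y s) x) has_integral duhamel e F x t) {0..t}"
 unfolding duhamel_def
 by (rule integrable_integral[OF integrable_continuous_interval[OF duhamel_integrand_continuous[OF F t]]])

lemma duhamel_norm_le:
 fixes F :: "real => real => 'a::euclidean_space"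
 assumes F: "bcs {0..R} F" and t: "0 <= t" "t <= R"
  and b: "!!s. s : {0..t} ==> norm (exp (e^2 * (t - s)) *\<^sub>R sg (t - s) (%y. F y s) x) <= h s"
  and h: "(h has_integral I) {0..t}"
 shows "norm (duhamel e F x t) <= I"
 unfolding duhamel_def integral_unique[OF h, symmetric]
 by (rule integral_norm_bound_integral[OF has_integral_integrable[OF duhamel_has_integral[OF F t(2)]] has_integral_integrable[OF h] b])

text \<open>Rescaling the time integral to the unit interval removes the moving end point.\<close>

lemma duhamel_bcs:
 fixes F :: "real => real => 'a::euclidean_space"
 assumes F: "bcs {0..R} F"
 shows "bcs {0..R} (duhamel e F)"
proof -
 let ?G = "%x p. exp (e^2 * fst p) *\<^sub>R sg (fst p) (%y. F y (snd p)) x"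
 note G = duhamel_integrand_bcs[OF F, of e]
 obtain B where B: "B >= 0" "!!x p. p : {0..R} \<times> {0..R} ==> norm (?G x p) <= B" using bcs_bound[OF G] by blast
 have sub: "duhamel e F x t = t *\<^sub>R integral {0..1} (%th. ?G x (t - t * th, t * th))" if t: "t : {0..R}" for x t
 proof -
  let ?f = "%s. ?G x (t - s, s)"
  have "((%th. t *\<^sub>R ?f (t * th)) has_integral (integral {t * 0..t * 1} ?f)) {0..1}"
  proof (rule has_integral_substitution)
   show "continuous_on {0..t} ?f" using duhamel_integrand_continuous[OF F, of t e x] t by simp
  qed (use t in "auto intro!: derivative_eq_intros simp: mult_left_le")
  hence "integral {0..1} (%th. t *\<^sub>R ?f (t * th)) = duhamel e F x t"
   by (simp add: duhamel_def integral_unique)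
  thus ?thesis by (simp only: Henstock_Kurzweil_Integration.integral_cmul)
 qed
 have tri: "(t - t * th, t * th) : {0..R} \<times> {0..R}" if "t : {0..R}" "th : {0..1}" for t th
 proof -
  have "t * th <= t * 1" by (rule mult_left_mono) (use that in auto)
  moreover have "0 <= t * th" using that by simp
  ultimately have "t * th <= t" "0 <= t * th" by simp_all
  thus ?thesis using that by auto
 qed
 have c: "continuous_on (UNIV \<times> {0..R}) (%q. integral (cbox 0 1) (%th. ?G (fst q) (snd q - snd q * th, snd q * th)))"
 proof (rule integral_continuous_on_param)
  show "continuous_on ((UNIV \<times> {0..R}) \<times> cbox 0 1) (%(q, th). ?G (fst q) (snd q - snd q * th, snd q * th))"
   unfolding split_def
   by (rule bcs_compose[OF G]) (use tri in "auto intro!: continuous_intros")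
 qed
 show ?thesis
 proof (rule bcsI)
  have "continuous_on (UNIV \<times> {0..R}) (%q. snd q *\<^sub>R integral {0..1} (%th. ?G (fst q) (snd q - snd q * th, snd q * th)))"
   using c by (intro continuous_intros) auto
  thus "continuous_on (UNIV \<times> {0..R}) (%(x, t). duhamel e F x t)"
   by (rule continuous_on_eq) (auto simp: sub)
  show "norm (duhamel e F x t) <= R * B" if t: "t : {0..R}" for x t
  proof -
   have "norm (duhamel e F x t) <= t * B"
   proof (rule duhamel_norm_le[OF F, where h="%_. B"])
    show "((%_. B) has_integral t * B) {0..t}" using has_integral_const_real[of B 0 t] t by simp
    show "norm (exp (e^2 * (t - s)) *\<^sub>R sg (t - s) (%y. F y s) x) <= B" if "s : {0..t}" for s
    using B(2)[of "(t - s, s)" x] that t by auto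
   qed (use t in auto)
   also have "... <= R * B" using t B by (intro mult_right_mono) auto
   finally show ?thesis .
  qed
 qed
qed

lemma sg_flow_bcs:
 fixes f :: "real => 'a::euclidean_space"
 assumes f: "bcf f" shows "bcs {0..R} (%x t. exp (e^2 * t) *\<^sub>R sg t f x)"
proof (cases "0 <= R")
 case True
 note G = duhamel_integrand_bcs[OF bcs_const[OF f], of R e]
 from bcs_bdd[OF G] obtain B where "B >= 0 & (ALL x. ALL p:{0..R} \<times> {0..R}. norm (exp (e^2 * fst p) *\<^sub>R sg (fst p) f x) <= B)" ..
 hence B: "norm (exp (e^2 * fst p) *\<^sub>R sg (fst p) f x) <= B" if "p : {0..R} \<times> {0..R}" for x p
  using that by blast
 show ?thesis
 proof (rule bcsI)
  show "norm (exp (e^2 * t) *\<^sub>R sg t f x) <= B" if "t : {0..R}" for x t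
   using B[of "(t, 0)" x] that by simp
  show "continuous_on (UNIV \<times> {0..R}) (%(x, t). exp (e^2 * t) *\<^sub>R sg t f x)"
   using bcs_compose[OF G, of "UNIV \<times> {0..R}" fst "%q. (snd q, 0)"] True
   by (simp add: split_def image_subset_iff continuous_intros)
 qed
qed (auto simp: bcs_def)

lemma cv_duhamel:
 fixes F :: "real => real => 'a::euclidean_space"
 assumes k: "kern M w g" and F: "bcs {0..R} F" and t: "t : {0..R}"
 shows "cv M w g (%y. duhamel e F y t) x = duhamel e (%x s. cv M w g (%y. F y s) x) x t"
proof -
 let ?H = "%x s. exp (e^2 * (t - s)) *\<^sub>R sg (t - s) (%y. F y s) x"
 have H: "bcs {0..t} ?H"
 proof -
  from bcs_bdd[OF duhamel_integrand_bcs[OF F, of e]] obtain B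
   where "B >= 0 & (ALL x. ALL p:{0..R} \<times> {0..R}. norm (exp (e^2 * fst p) *\<^sub>R sg (fst p) (%y. F y (snd p)) x) <= B)" ..
  hence B: "norm (exp (e^2 * fst p) *\<^sub>R sg (fst p) (%y. F y (snd p)) x) <= B" if "p : {0..R} \<times> {0..R}" for x p
   using that by blast
  show ?thesis
  proof (rule bcsI)
   show "norm (?H x s) <= B" if "s : {0..t}" for x s using B[of "(t - s, s)"] that t by simp
   show "continuous_on (UNIV \<times> {0..t}) (%(x, s). ?H x s)"
    using bcs_compose[OF duhamel_integrand_bcs[OF F, of e], of "UNIV \<times> {0..t}" fst "%q. (t - snd q, snd q)"] t
    by (simp add: image_subset_iff continuous_intros split_def)
  qed
 qed
 have "cv M w g (%y. duhamel e F y t) x = integral {0..t} (%s. cv M w g (%y. ?H y s) x)"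
  unfolding duhamel_def by (rule cv_integral_swap[OF k H])
 also have "... = duhamel e (%x s. cv M w g (%y. F y s) x) x t"
  unfolding duhamel_def
 proof (rule integral_cong)
  fix s assume s: "s : {0..t}"
  have Fs: "bcf (%y. F y s)" using bcs_bcf[OF F] s t by auto
  have "cv M w g (%y. ?H y s) x = exp (e^2 * (t - s)) *\<^sub>R cv M w g (sg (t - s) (%y. F y s)) x"
   by (rule cv_scaleR[OF k]) (use s Fs in "auto intro: sg_bcf")
  also have "cv M w g (sg (t - s) (%y. F y s)) x = sg (t - s) (cv M w g (%y. F y s)) x"
   unfolding sg_def by (rule cv_commute[OF k sg_kern Fs]) (use s in auto)
  finally show "cv M w g (%y. ?H y s) x = exp (e^2 * (t - s)) *\<^sub>R sg (t - s) (%y. cv M w g (%y. F y s) y) x" .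
 qed
 finally show ?thesis .
qed

section \<open>Derivatives\<close>

lemma deriv_of_integral_form:
 fixes F f :: "real => real"
 assumes c: "continuous_on UNIV f" and i: "!!x y. x <= y ==> F y - F x = integral {x..y} f"
 shows "(F has_real_derivative f x) (at x)"
proof -
 have "((%u. integral {x - 1..u} f) has_vector_derivative f x) (at x within {x - 1..x + 1})"
  by (rule integral_has_vector_derivative) (auto intro: continuous_on_subset[OF c])
 hence "((%u. integral {x - 1..u} f) has_real_derivative f x) (at x)"
  by (simp add: has_real_derivative_iff_has_vector_derivative at_within_Icc_at)
 hence D: "((%u. F (x - 1) + integral {x - 1..u} f) has_real_derivative f x) (at x)"
  by (auto intro!: derivative_eq_intros)
 have "F (x - 1) + integral {x - 1..u} f = F u" if "u : {x - 1<..<x + 1}" for u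
  using i[of "x - 1" u] that by simp
 thus ?thesis
  by (intro has_field_derivative_transform_within_open[OF D, of "{x - 1<..<x + 1}"]) auto
qed

lemma integral_form_of_deriv:
 fixes F f :: "real => real"
 assumes "!!x. (F has_real_derivative f x) (at x)" "x <= y"
 shows "(f has_integral F y - F x) {x..y}"
 by (rule fundamental_theorem_of_calculus[OF assms(2)])
   (use assms(1) in "auto simp: has_real_derivative_iff_has_vector_derivative intro: has_vector_derivative_at_within")

lemma cv_deriv:
 fixes f f' :: "real => real"
 assumes k: "kern M w g" and f: "bcf f" "bcf f'" "!!x. (f has_real_derivative f' x) (at x)"
 shows "(cv M w g f has_real_derivative cv M w g f' x) (at x)"
proof (rule deriv_of_integral_form)
 show "continuous_on UNIV (cv M w g f')" by (rule cv_continuous[OF k f(2)])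
 fix x y :: real assume xy: "x <= y"
 have sh: "bcf (%u. f (u + c))" for c using f(1) unfolding bcf_def
  by (auto intro!: continuous_on_compose2[of UNIV f] continuous_intros)
 have F: "bcs {x..y} (%u s. f' (u + s))"
  using f(2) unfolding bcf_def bcs_def split_def
  by (auto intro!: continuous_on_compose2[of UNIV f'] continuous_intros)
 have I: "integral {x..y} (%s. f' (u + s)) = f (u + y) - f (u + x)" for u
 proof -
  have "((%s. u + s) has_real_derivative 1) (at s)" for s by (auto intro!: derivative_eq_intros)
  from DERIV_chain2[OF f(3) this]
  have "((%s. f (u + s)) has_real_derivative f' (u + s)) (at s)" for s by simp
  from integral_unique[OF integral_form_of_deriv[OF this xy]] show ?thesis .
 qed
 have tr: "cv M w g (%u. h (u + c)) 0 = cv M w g h c" for h :: "real => real" and c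
  by (simp add: cv_def)
 have "cv M w g f y - cv M w g f x = cv M w g (%u. f (u + y) - f (u + x)) 0"
  by (simp add: cv_diff[OF k sh sh] tr)
 also have "... = cv M w g (%u. integral {x..y} (%s. f' (u + s))) 0" by (simp add: I)
 also have "... = integral {x..y} (%s. cv M w g (%u. f' (u + s)) 0)" by (rule cv_integral_swap[OF k F])
 also have "... = integral {x..y} (cv M w g f')" by (simp add: tr)
 finally show "cv M w g f y - cv M w g f x = integral {x..y} (cv M w g f')" .
qed

lemma deriv_limit:
 fixes f f' :: "nat => real => real"
 assumes d: "!!n x. (f n has_real_derivative f' n x) (at x)"
  and c: "continuous_on UNIV G" and b: "!!n x. abs (f' n x) <= B"
  and l: "!!x. (%n. f n x) \<longlonglongrightarrow> F x" "!!x. (%n. f' n x) \<longlonglongrightarrow> G x"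
 shows "(F has_real_derivative G x) (at x)"
proof (rule deriv_of_integral_form[OF c])
 fix x y :: real assume xy: "x <= y"
 have i: "(f' n has_integral f n y - f n x) {x..y}" for n by (rule integral_form_of_deriv[OF d xy])
 have "(%n. integral {x..y} (f' n)) \<longlonglongrightarrow> integral {x..y} G"
  by (rule dominated_convergence(2)[where h="%_. B"]) (use i b l in "auto intro: has_integral_integrable")
 moreover have "(%n. integral {x..y} (f' n)) \<longlonglongrightarrow> F y - F x"
  unfolding integral_unique[OF i] by (intro tendsto_diff l)
 ultimately show "F y - F x = integral {x..y} G" using LIMSEQ_unique by blast
qed

section \<open>Jets\<close>

type_synonym jet = "real \<times> real \<times> real \<times> real \<times> real"

definition mkJ :: "(nat => real) => jet" where "mkJ f = (f 0, f 1, f 2, f 3, f 4)"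

definition jc :: "nat => jet => real" where
 "jc i v = (case v of (a, b, c, d, e) => if i = 0 then a else if i = 1 then b else if i = 2 then c else if i = 3 then d else e)"

lemma jc_mkJ: "i <= 4 ==> jc i (mkJ f) = f i"
 by (auto simp: jc_def mkJ_def) (metis One_nat_def Suc_le_eq eval_nat_numeral(3) le_SucE le_zero_eq numeral_2_eq_2 numeral_3_eq_3 numeral_eq_Suc pred_numeral_simps(2) semiring_norm(26,27))

lemma mkJ_jc: "mkJ (%i. jc i v) = v"
 by (cases v) (auto simp: jc_def mkJ_def)

lemma jet_eqI: "(!!i. i <= 4 ==> jc i u = jc i v) ==> u = v"
 by (subst mkJ_jc[symmetric], subst (2) mkJ_jc[symmetric]) (simp add: mkJ_def)

lemma bounded_linear_jc: "bounded_linear (jc i)"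
proof -
 have "linear (jc i)"
  by (rule linearI) (auto simp: jc_def split: prod.splits)
 thus ?thesis by (rule linear_conv_bounded_linear[THEN iffD1])
qed

lemma jc_add: "jc i (u + v) = jc i u + jc i v" and jc_scaleR: "jc i (c *\<^sub>R v) = c * jc i v"
 and jc_diff: "jc i (u - v) = jc i u - jc i v" and jc_minus: "jc i (- v) = - jc i v"
 by (auto simp: jc_def split: prod.splits)

lemma abs_jc_le: "abs (jc i v) <= norm v"
proof -
 obtain a b c d e where v: "v = (a, b, c, d, e)" by (cases v)
 have "norm a <= norm v" "norm (b, c, d, e) <= norm v"
  unfolding v by (rule norm_fst_le, rule norm_snd_le)
 moreover have "norm b <= norm (b, c, d, e)" "norm (c, d, e) <= norm (b, c, d, e)"
  by (rule norm_fst_le, rule norm_snd_le)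
 moreover have "norm c <= norm (c, d, e)" "norm (d, e) <= norm (c, d, e)"
  by (rule norm_fst_le, rule norm_snd_le)
 moreover have "norm d <= norm (d, e)" "norm e <= norm (d, e)"
  by (rule norm_fst_le, rule norm_snd_le)
 ultimately have "abs (a) <= norm v" "abs (b) <= norm v" "abs (c) <= norm v" "abs (d) <= norm v" "abs (e) <= norm v"
  by simp_all
 thus ?thesis by (simp add: jc_def v)
qed

lemma norm_mkJ_le: assumes "!!i. i <= 4 ==> abs (f i) <= B" shows "norm (mkJ f) <= 5 * B"
proof -
 have "norm (mkJ f) <= abs (f 0) + (abs (f 1) + (abs (f 2) + (abs (f 3) + abs (f 4))))"
  unfolding mkJ_def by (intro order_trans[OF norm_Pair_le] add_mono) auto
 thus ?thesis using assms[of 0] assms[of 1] assms[of 2] assms[of 3] assms[of 4] by simp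
qed

lemma norm_jet_le: "(!!i. i <= 4 ==> abs (jc i v) <= B) ==> norm v <= 5 * B"
 using norm_mkJ_le[of "%i. jc i v" B] by (simp add: mkJ_jc)

lemma bcf_mkJ: assumes "!!i. i <= 4 ==> bcf (%x. f i x)" shows "bcf (%x. mkJ (%i. f i x))"
proof -
 have b: "!!i. i <= 4 ==> EX B. ALL x. norm (f i x) <= B" using assms by (auto simp: bcf_def)
 obtain B where B: "!!i x. i <= 4 ==> norm (f i x) <= B i" using b by metis
 have "norm (mkJ (%i. f i x)) <= 5 * (\<Sum>i\<le>4. abs (B i))" for x
 proof (rule norm_mkJ_le)
  fix i :: nat assume i: "i <= 4"
  have "abs (B i) <= (\<Sum>i\<le>4. abs (B i))" using i by (intro member_le_sum) auto
  thus "abs (f i x) <= (\<Sum>i\<le>4. abs (B i))" using B[OF i, of x] by simp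
 qed
 moreover have "continuous_on UNIV (%x. mkJ (%i. f i x))"
  unfolding mkJ_def using assms by (intro continuous_intros) (auto simp: bcf_def)
 ultimately show ?thesis by (rule bcfI[rotated])
qed

definition jm :: "jet => jet => jet" where
 "jm u v = mkJ (%n. \<Sum>i\<le>n. real (n choose i) * (jc i u * jc (n - i) v))"

lemma jm_0: "jc 0 (jm u v) = jc 0 u * jc 0 v"
 by (simp add: jm_def jc_mkJ)

lemma bounded_bilinear_jm: "bounded_bilinear jm"
proof -
 have "bilinear jm"
  unfolding bilinear_def
 proof (intro conjI allI linearI)
  fix x :: jet
  show "jm x (b1 + b2) = jm x b1 + jm x b2" for b1 b2
   by (rule jet_eqI) (simp add: jm_def jc_mkJ jc_add algebra_simps sum.distrib)
  show "jm x (r *\<^sub>R b) = r *\<^sub>R jm x b" for r b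
   by (rule jet_eqI) (simp add: jm_def jc_mkJ jc_scaleR sum_distrib_left mult_ac)
  show "jm (b1 + b2) x = jm b1 x + jm b2 x" for b1 b2
   by (rule jet_eqI) (simp add: jm_def jc_mkJ jc_add algebra_simps sum.distrib)
  show "jm (r *\<^sub>R b) x = r *\<^sub>R jm b x" for r b
   by (rule jet_eqI) (simp add: jm_def jc_mkJ jc_scaleR sum_distrib_left mult_ac)
 qed
 thus ?thesis by (simp add: bilinear_conv_bounded_bilinear)
qed

definition isJet :: "(real => jet) => bool" where
 "isJet g \<longleftrightarrow> bcf g & (ALL i<4. ALL x. ((%x. jc i (g x)) has_real_derivative jc (Suc i) (g x)) (at x))"

lemma isJet_bcf: "isJet g ==> bcf g" by (simp add: isJet_def)

lemma isJet_deriv: "isJet g ==> i < 4 ==> ((%x. jc i (g x)) has_real_derivative jc (Suc i) (g x)) (at x)"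
 by (simp add: isJet_def)

lemma isJet_add: "isJet f ==> isJet g ==> isJet (%x. f x + g x)"
 unfolding isJet_def by (auto simp: jc_add intro!: bcf_add DERIV_add)

lemma isJet_scaleR: "isJet f ==> isJet (%x. c *\<^sub>R f x)"
 unfolding isJet_def by (auto simp: jc_scaleR intro!: bcf_scaleR DERIV_cmult)

lemma isJet_minus: "isJet f ==> isJet (%x. - f x)"
 using isJet_scaleR[of f "-1"] by simp

lemma isJet_diff: "isJet f ==> isJet g ==> isJet (%x. f x - g x)"
 using isJet_add[OF _ isJet_minus, of f g] by simp

lemma jc_cv: "kern M w g ==> bcf f ==> jc i (cv M w g f x) = cv M w g (%x. jc i (f x)) x"
 by (rule cv_linear[OF _ _ bounded_linear_jc, symmetric])

lemma isJet_cv: assumes k: "kern M w g" and f: "isJet f" shows "isJet (cv M w g f)"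
 unfolding isJet_def
proof (intro conjI allI impI)
 note fb = isJet_bcf[OF f]
 show "bcf (cv M w g f)" by (rule cv_bcf[OF k fb])
 show "((%x. jc i (cv M w g f x)) has_real_derivative jc (Suc i) (cv M w g f x)) (at x)" if "i < 4" for i x
  unfolding jc_cv[OF k fb]
  by (rule cv_deriv[OF k]) (intro bcf_linear[OF fb bounded_linear_jc] isJet_deriv[OF f that])+
qed

lemma isJet_fmult: "evs m ==> isJet f ==> isJet (fmult m f)"
 unfolding fmult_def by (rule isJet_cv[OF evs_kern])

lemma isJet_sg: "0 <= t ==> isJet f ==> isJet (sg t f)"
 unfolding sg_def by (rule isJet_cv[OF sg_kern])

lemma jm_components:
 "jc (Suc 0) (jm u v) = jc 0 u * jc (Suc 0) v + jc (Suc 0) u * jc 0 v"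
 "jc 2 (jm u v) = jc 0 u * jc 2 v + (2 * (jc (Suc 0) u * jc (Suc 0) v) + jc 2 u * jc 0 v)"
 "jc 3 (jm u v) = jc 0 u * jc 3 v + (3 * (jc (Suc 0) u * jc 2 v) + (3 * (jc 2 u * jc (Suc 0) v) + jc 3 u * jc 0 v))"
 "jc 4 (jm u v) = jc 0 u * jc 4 v + (4 * (jc (Suc 0) u * jc 3 v) + (6 * (jc 2 u * jc 2 v) + (4 * (jc 3 u * jc (Suc 0) v) + jc 4 u * jc 0 v)))"
 by (simp_all add: jm_def jc_mkJ atMost_Suc numeral_eq_Suc add_ac)

lemma isJet_jm: assumes f: "isJet f" and g: "isJet g" shows "isJet (%x. jm (f x) (g x))"
 unfolding isJet_def
proof (intro conjI allI impI)
 show "bcf (%x. jm (f x) (g x))" by (intro bcf_bilinear[OF bounded_bilinear_jm] isJet_bcf f g)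
 fix i :: nat and x assume "i < 4"
 then consider "i = 0" | "i = 1" | "i = 2" | "i = 3" by linarith
 moreover have p: "((%x. jc i (f x) * jc j (g x)) has_real_derivative jc (Suc i) (f x) * jc j (g x) + jc (Suc j) (g x) * jc i (f x)) (at x)"
  if "i < 4" "j < 4" for i j x
  by (rule DERIV_mult[OF isJet_deriv[OF f that(1)] isJet_deriv[OF g that(2)]])
 have l: "0 < (4::nat)" "Suc 0 < (4::nat)" "2 < (4::nat)" "3 < (4::nat)" by simp_all
 have S: "Suc (Suc 0) = 2" "Suc 2 = 3" "Suc 3 = 4" by simp_all
 ultimately show "((%x. jc i (jm (f x) (g x))) has_real_derivative jc (Suc i) (jm (f x) (g x))) (at x)"
 proof cases
  case 1
  thus ?thesis using p[OF l(1) l(1)] unfolding 1 jm_0 jm_components by (auto simp: algebra_simps)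
 next
  case 2
  show ?thesis unfolding 2 One_nat_def S jm_components
   by (rule DERIV_cong[OF DERIV_add[OF p[OF l(1) l(2)] p[OF l(2) l(1)]], unfolded S]) (simp add: algebra_simps)
 next
  case 3
  show ?thesis unfolding 3 S jm_components
   by (rule DERIV_cong[OF DERIV_add[OF p[OF l(1) l(3)] DERIV_add[OF DERIV_cmult[OF p[OF l(2) l(2)], of 2] p[OF l(3) l(1)]]], unfolded S]) (simp add: algebra_simps)
 next
  case 4
  show ?thesis unfolding 4 S jm_components
   by (rule DERIV_cong[OF DERIV_add[OF p[OF l(1) l(4)] DERIV_add[OF DERIV_cmult[OF p[OF l(2) l(3)], of 3]
    DERIV_add[OF DERIV_cmult[OF p[OF l(3) l(2)], of 3] p[OF l(4) l(1)]]]], unfolded S]) (simp add: algebra_simps)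
 qed
qed

lemma isJet_integral:
 fixes F :: "real => real => jet"
 assumes F: "bcs {a..b} F" and J: "!!s. s : {a..b} ==> isJet (%x. F x s)"
 shows "isJet (%x. integral {a..b} (F x))"
 unfolding isJet_def
proof (intro conjI allI impI)
 obtain B where B: "B >= 0" "!!x t. t : {a..b} ==> norm (F x t) <= B" using bcs_bound[OF F] by blast
 have ii: "F x integrable_on {a..b}" for x
  by (rule integrable_continuous_interval[OF bcs_time[OF F]])
 show "bcf (%x. integral {a..b} (F x))"
 proof (rule bcfI)
  have "continuous_on UNIV (%x. integral (cbox a b) (F x))"
   by (rule integral_continuous_on_param) (use bcs_continuous[OF F] in simp)
  thus "continuous_on UNIV (%x. integral {a..b} (F x))" by simp
  show "norm (integral {a..b} (F x)) <= integral {a..b} (%_. B)" for x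
   by (rule integral_norm_bound_integral[OF ii]) (use B in auto)
 qed
 have jcI: "jc i (integral {a..b} (F x)) = integral {a..b} (%s. jc i (F x s))" for i x
  using integral_linear[OF ii bounded_linear_jc] by (simp add: o_def)
 fix i :: nat and x assume i: "i < 4"
 have "((%x. integral (cbox a b) (%s. jc i (F x s))) has_real_derivative integral (cbox a b) (%s. jc (Suc i) (F x s))) (at x within UNIV)"
 proof (rule leibniz_rule_field_derivative)
  show "((%x. jc i (F x s)) has_real_derivative jc (Suc i) (F x s)) (at x within UNIV)" if "s : cbox a b" for x s
   using isJet_deriv[OF J i] that by simp
  show "(%s. jc i (F x s)) integrable_on cbox a b" for x
   using integrable_linear[OF ii bounded_linear_jc] by (simp add: o_def)
  show "continuous_on (UNIV \<times> cbox a b) (%(x, t). jc (Suc i) (F x t))"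
   using bcs_continuous[OF bcs_linear[OF F bounded_linear_jc]] by simp
 qed auto
 thus "((%x. jc i (integral {a..b} (F x))) has_real_derivative jc (Suc i) (integral {a..b} (F x))) (at x)"
  by (simp add: jcI)
qed

lemma isJet_duhamel:
 assumes F: "bcs {0..R} F" and J: "!!s. s : {0..R} ==> isJet (%x. F x s)" and t: "t : {0..R}"
 shows "isJet (%x. duhamel e F x t)"
 unfolding duhamel_def
proof (rule isJet_integral)
 show "bcs {0..t} (%x s. exp (e^2 * (t - s)) *\<^sub>R sg (t - s) (%y. F y s) x)"
 proof -
  from bcs_bdd[OF duhamel_integrand_bcs[OF F, of e]] obtain B
   where "B >= 0 & (ALL x. ALL p:{0..R} \<times> {0..R}. norm (exp (e^2 * fst p) *\<^sub>R sg (fst p) (%y. F y (snd p)) x) <= B)" ..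
  hence B: "norm (exp (e^2 * fst p) *\<^sub>R sg (fst p) (%y. F y (snd p)) x) <= B" if "p : {0..R} \<times> {0..R}" for x p
   using that by blast
  show ?thesis
  proof (rule bcsI)
   show "norm (exp (e^2 * (t - s)) *\<^sub>R sg (t - s) (%y. F y s) x) <= B" if "s : {0..t}" for x s using B[of "(t - s, s)"] that t by simp
   show "continuous_on (UNIV \<times> {0..t}) (%(x, s). exp (e^2 * (t - s)) *\<^sub>R sg (t - s) (%y. F y s) x)"
    using bcs_compose[OF duhamel_integrand_bcs[OF F, of e], of "UNIV \<times> {0..t}" fst "%q. (t - snd q, snd q)"] t
    by (simp add: image_subset_iff continuous_intros split_def)
  qed
 qed
 show "isJet (%x. exp (e^2 * (t - s)) *\<^sub>R sg (t - s) (%y. F y s) x)" if "s : {0..t}" for s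
  using that t by (intro isJet_scaleR isJet_sg J) auto
qed

lemma isJet_limit:
 assumes J: "!!n. isJet (f n)" and b: "!!n x. norm (f n x) <= B" and l: "!!x. (%n. f n x) \<longlonglongrightarrow> g x" and g: "bcf g"
 shows "isJet g"
 unfolding isJet_def
proof (intro conjI allI impI g)
 fix i :: nat and x assume i: "i < 4"
 show "((%x. jc i (g x)) has_real_derivative jc (Suc i) (g x)) (at x)"
 proof (rule deriv_limit)
  show "((%x. jc i (f n x)) has_real_derivative jc (Suc i) (f n x)) (at x)" for n x by (rule isJet_deriv[OF J i])
  show "abs (jc (Suc i) (f n x)) <= B" for n x using abs_jc_le b order_trans by blast
  show "continuous_on UNIV (%x. jc (Suc i) (g x))"
   using bcf_linear[OF g bounded_linear_jc] by (simp add: bcf_def)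
  show "(%n. jc i (f n x)) \<longlonglongrightarrow> jc i (g x)" "(%n. jc (Suc i) (f n x)) \<longlonglongrightarrow> jc (Suc i) (g x)" for x
   by (rule bounded_linear.tendsto[OF bounded_linear_jc l])+
 qed
qed

text \<open>An identity between jets may be checked on the functions themselves. This is how identities between operators are transferred from functions to jets.\<close>

lemma isJet_unique:
 assumes f: "isJet f" and g: "isJet g" and e: "!!x. jc 0 (f x) = jc 0 (g x)"
 shows "f x = g x"
proof -
 have "i <= 4 ==> (%x. jc i (f x)) = (%x. jc i (g x))" for i
 proof (induction i)
  case (Suc i)
  hence eq: "(%x. jc i (f x)) = (%x. jc i (g x))" by simp
  have "jc (Suc i) (f x) = jc (Suc i) (g x)" for x
   using isJet_deriv[OF f, of i x] isJet_deriv[OF g, of i x] Suc.prems unfolding eq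
   by (auto intro: DERIV_unique)
  thus ?case by auto
 qed (use e in auto)
 thus ?thesis by (intro jet_eqI) metis
qed

section \<open>The nonlinearity\<close>

definition sc :: "smeasure => (real => 'a::euclidean_space) => real => 'a" where
 "sc mu f x = cv (fst mu) (%_. 1) (%y. y) f x - cv (snd mu) (%_. 1) (%y. y) f x"

definition nB :: "('a => 'a => 'a) => smeasure => (real => 'a::euclidean_space) => (real => 'a) => real => 'a" where
 "nB p Q f g x = - p (f x) (sc Q g x)"

definition nC :: "('a => 'a => 'a) => smeasure => (real => 'a::euclidean_space) => (real => 'a) => (real => 'a) => real => 'a" where
 "nC p K f g h x = - p (f x) (sc K (%y. p (g y) (h y)) x)"

definition nN :: "('a => 'a => 'a) => smeasure => smeasure => (real => 'a::euclidean_space) => real => 'a" where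
 "nN p Q K f x = nB p Q f f x + nC p K f f f x"

lemma finite_signed_kern:
 assumes "finite_signed mu"
 shows "kern (fst mu) (%_. 1) (%y. y)" "kern (snd mu) (%_. 1) (%y. y)"
proof -
 interpret F: finite_measure "fst mu" using assms by (simp add: finite_signed_def)
 interpret S: finite_measure "snd mu" using assms by (simp add: finite_signed_def)
 have "sets (fst mu) = sets borel" "sets (snd mu) = sets borel" using assms by (auto simp: finite_signed_def)
 hence "(%y. y) : borel_measurable (fst mu)" "(%y. y) : borel_measurable (snd mu)"
  by (auto intro: measurable_ident_sets)
 thus "kern (fst mu) (%_. 1) (%y. y)" "kern (snd mu) (%_. 1) (%y. y)"
  by (auto simp: kern_def F.sigma_finite_measure_axioms S.sigma_finite_measure_axioms)
qed

definition mass :: "smeasure => real" where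
 "mass mu = measure (fst mu) (space (fst mu)) + measure (snd mu) (space (snd mu))"

context
 fixes mu :: smeasure
 assumes mu: "finite_signed mu"
begin

lemma sc_bcf: "bcf f ==> bcf (sc mu f)"
 unfolding sc_def[abs_def] by (intro bcf_diff cv_bcf finite_signed_kern[OF mu])

lemma sc_norm_le: assumes f: "bcf f" "!!x. norm (f x) <= B" shows "norm (sc mu f x) <= mass mu * B"
 using cv_norm_le[OF finite_signed_kern(1)[OF mu] f, of x] cv_norm_le[OF finite_signed_kern(2)[OF mu] f, of x]
  norm_triangle_ineq4[of "cv (fst mu) (%_. 1) (%y. y) f x" "cv (snd mu) (%_. 1) (%y. y) f x"]
 by (simp add: sc_def mass_def algebra_simps)

lemma sc_add: "bcf f ==> bcf g ==> sc mu (%x. f x + g x) x = sc mu f x + sc mu g x"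
 by (simp add: sc_def cv_add finite_signed_kern[OF mu])

lemma sc_diff: "bcf f ==> bcf g ==> sc mu (%x. f x - g x) x = sc mu f x - sc mu g x"
 by (simp add: sc_def cv_diff finite_signed_kern[OF mu])

lemma sc_linear: "bcf f ==> bounded_linear h ==> sc mu (%x. h (f x)) x = h (sc mu f x)"
 by (simp add: sc_def cv_linear[OF finite_signed_kern(1)[OF mu]] cv_linear[OF finite_signed_kern(2)[OF mu]]
   linear_diff[OF bounded_linear.linear])

lemma cv_sc: "kern M w g ==> bcf f ==> cv M w g (sc mu f) x = sc mu (cv M w g f) x"
 unfolding sc_def[abs_def]
 by (simp only: cv_diff[OF _ cv_bcf[OF finite_signed_kern(1)[OF mu]] cv_bcf[OF finite_signed_kern(2)[OF mu]]]
   cv_commute[OF _ finite_signed_kern(1)[OF mu]] cv_commute[OF _ finite_signed_kern(2)[OF mu]])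

lemma bcs_sc: "bcs P F ==> bcs P (%x t. sc mu (%y. F y t) x)"
 unfolding sc_def by (intro bcs_diff bcs_cv finite_signed_kern[OF mu])

lemma isJet_sc: "isJet f ==> isJet (sc mu f)"
 unfolding sc_def[abs_def] by (intro isJet_diff isJet_cv finite_signed_kern[OF mu])

end

lemma mass_nonneg: "0 <= mass mu" by (simp add: mass_def)

context
 fixes p :: "'a::euclidean_space => 'a => 'a" and Q K :: smeasure
 assumes p: "bounded_bilinear p" and Q: "finite_signed Q" and K: "finite_signed K"
begin

interpretation p: bounded_bilinear p by (rule p)

lemma nB_bcf: "bcf f ==> bcf g ==> bcf (nB p Q f g)"
 unfolding nB_def[abs_def] by (intro bcf_minus bcf_bilinear[OF p] sc_bcf[OF Q])

lemma nC_bcf: "bcf f ==> bcf g ==> bcf h ==> bcf (nC p K f g h)"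
 unfolding nC_def[abs_def] by (intro bcf_minus bcf_bilinear[OF p] sc_bcf[OF K])

lemma nN_bcf: "bcf f ==> bcf (nN p Q K f)"
 unfolding nN_def[abs_def] by (intro bcf_add nB_bcf nC_bcf)

lemma bcs_nB: "bcs P F ==> bcs P G ==> bcs P (%x t. nB p Q (%y. F y t) (%y. G y t) x)"
 unfolding nB_def by (intro bcs_minus bcs_bilinear[OF p] bcs_sc[OF Q])

lemma bcs_nC: "bcs P F ==> bcs P G ==> bcs P H ==> bcs P (%x t. nC p K (%y. F y t) (%y. G y t) (%y. H y t) x)"
 unfolding nC_def by (intro bcs_minus bcs_bilinear[OF p] bcs_sc[OF K])

lemma bcs_nN: "bcs P F ==> bcs P (%x t. nN p Q K (%y. F y t) x)"
 unfolding nN_def by (intro bcs_add bcs_nB bcs_nC)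

lemma nonlinear_bounds:
 "EX c>=1. (ALL f g F G x. bcf f --> bcf g --> (ALL x. norm (f x) <= F) --> (ALL x. norm (g x) <= G) --> norm (nB p Q f g x) <= c * (F * G)) &
  (ALL f g h F G H x. bcf f --> bcf g --> bcf h --> (ALL x. norm (f x) <= F) --> (ALL x. norm (g x) <= G) --> (ALL x. norm (h x) <= H) -->
    norm (nC p K f g h x) <= c * (F * G * H))"
proof -
 obtain k where k: "k > 0" "!!a b. norm (p a b) <= norm a * norm b * k" using p.pos_bounded by blast
 define c where "c = 1 + k * mass Q + k * (mass K * k)"
 have m: "0 <= mass Q" "0 <= mass K" by (rule mass_nonneg)+
 have c: "k * mass Q <= c" "k * (mass K * k) <= c" "1 <= c" using k m by (auto simp: c_def)
 have 1: "norm (nB p Q f g x) <= c * (F * G)"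
  if "bcf f" "bcf g" "ALL x. norm (f x) <= F" "ALL x. norm (g x) <= G" for f g F G x
 proof -
  have FG: "0 <= F" "0 <= G" using that(3,4) norm_ge_zero order_trans by blast+
  have "norm (nB p Q f g x) <= norm (f x) * norm (sc Q g x) * k" by (simp add: nB_def k(2))
  also have "... <= F * (mass Q * G) * k"
   using that k m FG by (intro mult_right_mono mult_mono sc_norm_le[OF Q]) auto
  also have "... = (k * mass Q) * (F * G)" by (simp add: mult_ac)
  also have "... <= c * (F * G)" using c FG by (intro mult_right_mono) auto
  finally show ?thesis .
 qed
 have 2: "norm (nC p K f g h x) <= c * (F * G * H)"
  if "bcf f" "bcf g" "bcf h" "ALL x. norm (f x) <= F" "ALL x. norm (g x) <= G" "ALL x. norm (h x) <= H" for f g h F G H x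
 proof -
  have FG: "0 <= F" "0 <= G" "0 <= H" using that(4-6) norm_ge_zero order_trans by blast+
  have gh: "norm (p (g y) (h y)) <= G * H * k" for y
   by (rule order_trans[OF k(2)]) (use that FG k in "auto intro!: mult_right_mono mult_mono")
  have "norm (nC p K f g h x) <= norm (f x) * norm (sc K (%y. p (g y) (h y)) x) * k" by (simp add: nC_def k(2))
  also have "... <= F * (mass K * (G * H * k)) * k"
   using that k m FG gh by (intro mult_right_mono mult_mono sc_norm_le[OF K] bcf_bilinear[OF p]) auto
  also have "... = (k * (mass K * k)) * (F * G * H)" by (simp add: mult_ac)
  also have "... <= c * (F * G * H)" using c FG by (intro mult_right_mono) auto
  finally show ?thesis .
 qed
 show ?thesis using 1 2 c(3) by blast
qed

lemma nB_add_left: "nB p Q (%x. f x + g x) h x = nB p Q f h x + nB p Q g h x"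
 by (simp add: nB_def p.add_left)

lemma nB_add_right: "bcf g ==> bcf h ==> nB p Q f (%x. g x + h x) x = nB p Q f g x + nB p Q f h x"
 by (simp add: nB_def sc_add[OF Q] p.add_right)

lemma nB_diff_left: "nB p Q (%x. f x - g x) h x = nB p Q f h x - nB p Q g h x"
 by (simp add: nB_def p.diff_left)

lemma nB_diff_right: "bcf g ==> bcf h ==> nB p Q f (%x. g x - h x) x = nB p Q f g x - nB p Q f h x"
 by (simp add: nB_def sc_diff[OF Q] p.diff_right)

lemma nC_diff: assumes "bcf f" "bcf g"
 shows "nC p K f f f x - nC p K g g g x = nC p K (%x. f x - g x) f f x + nC p K g (%x. f x - g x) f x + nC p K g g (%x. f x - g x) x"
proof -
 have b: "bcf (%y. p (f y) (f y))" "bcf (%y. p (g y) (f y))" "bcf (%y. p (g y) (g y))"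
  using assms by (auto intro: bcf_bilinear[OF p])
 show ?thesis
  by (simp add: nC_def p.diff_left p.diff_right sc_diff[OF K] b)
qed

end

lemma bilinear_diff_bound:
 fixes c :: real
 assumes c: "0 <= c"
  and B: "!!f g F G x. bcf f ==> bcf g ==> (!!x. norm (f x) <= F) ==> (!!x. norm (g x) <= G) ==> norm (nB p Q f g x) <= c * (F * G)"
  and p: "bounded_bilinear p" and Q: "finite_signed Q"
  and f: "bcf f" "bcf f'" "bcf g" "bcf g'"
  and b: "!!x. norm (f' x) <= F" "!!x. norm (g x) <= G" "!!x. norm (f x - f' x) <= df" "!!x. norm (g x - g' x) <= dg"
 shows "norm (nB p Q f g x - nB p Q f' g' x) <= c * (df * G + F * dg)"
proof -
 have "nB p Q f g x - nB p Q f' g' x = nB p Q (%x. f x - f' x) g x + nB p Q f' (%x. g x - g' x) x"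
  by (simp add: nB_diff_left[OF p Q Q] nB_diff_right[OF p Q Q] f)
 moreover have "norm (nB p Q (%x. f x - f' x) g x) <= c * (df * G)" "norm (nB p Q f' (%x. g x - g' x) x) <= c * (F * dg)"
  by (intro B bcf_diff f b)+
 ultimately show ?thesis by (simp add: norm_triangle_le distrib_left)
qed

lemma cubic_diff_bound:
 fixes c :: real
 assumes C: "!!f g h F G H x. bcf f ==> bcf g ==> bcf h ==> (!!x. norm (f x) <= F) ==> (!!x. norm (g x) <= G) ==> (!!x. norm (h x) <= H)
   ==> norm (nC p K f g h x) <= c * (F * G * H)"
  and p: "bounded_bilinear p" and K: "finite_signed K"
  and f: "bcf f" "bcf f'"
  and b: "!!x. norm (f x) <= m" "!!x. norm (f' x) <= m" "!!x. norm (f x - f' x) <= d"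
 shows "norm (nC p K f f f x - nC p K f' f' f' x) <= c * (3 * m^2 * d)"
proof -
 have "norm (nC p K (%x. f x - f' x) f f x) <= c * (d * m * m)" "norm (nC p K f' (%x. f x - f' x) f x) <= c * (m * d * m)"
  "norm (nC p K f' f' (%x. f x - f' x) x) <= c * (m * m * d)"
  by (intro C bcf_diff f b)+
 moreover have "c * (d * m * m) + c * (m * d * m) + c * (m * m * d) = c * (3 * m^2 * d)"
  by (simp add: power2_eq_square algebra_simps)
 ultimately show ?thesis unfolding nC_diff[OF p K K f]
  by (intro order_trans[OF norm_triangle_ineq] order_trans[OF add_mono[OF norm_triangle_ineq order_refl]]) linarith
qed

section \<open>Mode filters\<close>

definition crit2 :: "real => real" where "crit2 k = plateau (50 * sa k)"

lemma crit2_evs: "evs crit2"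
 using csa_evs[OF csa_plateau[of 50]] by (simp add: crit2_def[abs_def])

lemma crit_support: "crit k \<noteq> 0 ==> sa k < 1 / 50"
 using plateau_zero[of "100 * sa k"] by (force simp: crit_def)

lemma crit2_support: "crit2 k \<noteq> 0 ==> sa k < 1 / 25"
 using plateau_zero[of "50 * sa k"] by (force simp: crit2_def)

lemma crit2_crit: "crit2 k * crit k = crit k"
 using crit_support[of k] plateau_one[of "50 * sa k"] by (cases "crit k = 0") (auto simp: crit2_def)

lemma sum_of_critical:
 assumes "sa l < d^2" "sa j < d^2" "0 < d" "d < 1 / 2"
 shows "(l + j)^2 >= 4 * (1 - d) & (l + j)^2 <= 4 * (1 + d) \<or> (l + j)^2 <= 4 * d"
proof -
 have a: "1 - d < k^2 & k^2 < 1 + d" if "sa k < d^2" for k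
 proof -
  have "abs (1 - k^2) < d"
   by (rule power2_less_imp_less) (use that assms(3) in "auto simp: sa_def")
  thus ?thesis by auto
 qed
 have l: "1 - d < l^2" "l^2 < 1 + d" and j: "1 - d < j^2" "j^2 < 1 + d" using a assms by auto
 have e: "(l + j)^2 = l^2 + j^2 + 2 * (l * j)" by (simp add: power2_eq_square algebra_simps)
 have lj: "1 - d <= abs (l * j)"
 proof (rule power2_le_imp_le)
  have "(1 - d) * (1 - d) <= l^2 * j^2" using l j assms by (intro mult_mono) auto
  thus "(1 - d)^2 <= (abs (l * j))^2" by (simp add: power2_eq_square mult_ac)
 qed simp
 have lj2: "2 * abs (l * j) <= l^2 + j^2" using sum_squares_bound[of "abs (l)" "abs (j)"] by (simp add: abs_mult)
 show ?thesis
 proof (cases "0 <= l * j")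
  case True thus ?thesis using e lj lj2 l j by (intro disjI1) auto
 next
  case False thus ?thesis using e lj l j by (intro disjI2) auto
 qed
qed

lemma crit_crit2_sum: assumes "crit2 l \<noteq> 0" "crit2 j \<noteq> 0" shows "crit (l + j) = 0"
proof -
 have s: "sa l < (1 / 5)^2" "sa j < (1 / 5)^2" using crit2_support assms by (auto simp: power2_eq_square)
 have "abs (1 - (l + j)^2) >= 1 / 5" using sum_of_critical[OF s] by auto
 hence "(abs (1 - (l + j)^2))^2 >= (1 / 5)^2" by (intro power_mono) auto
 hence "sa (l + j) >= 1 / 25" by (simp add: sa_def power2_eq_square)
 thus ?thesis by (simp add: crit_def plateau_zero)
qed

lemma fmult_norm_le: "evs m ==> bcf f ==> (!!x. norm (f x) <= B) ==> norm (fmult m f x) <= B * (LINT z|lborel. abs (ci 0 m z))"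
 unfolding fmult_def by (rule cv_norm_le[OF evs_kern])

lemma fmult_add: "evs m ==> bcf f ==> bcf g ==> fmult m (%x. f x + g x) x = fmult m f x + fmult m g x"
 unfolding fmult_def by (rule cv_add[OF evs_kern])

lemma fmult_diff: "evs m ==> bcf f ==> bcf g ==> fmult m (%x. f x - g x) x = fmult m f x - fmult m g x"
 unfolding fmult_def by (rule cv_diff[OF evs_kern])

lemma fmult_scaleR: "evs m ==> bcf f ==> fmult m (%x. c *\<^sub>R f x) x = c *\<^sub>R fmult m f x"
 unfolding fmult_def by (rule cv_scaleR[OF evs_kern])

lemma fmult_minus: "evs m ==> bcf f ==> fmult m (%x. - f x) x = - fmult m f x"
 unfolding fmult_def by (rule cv_minus[OF evs_kern])

lemma fmult_sc: "finite_signed mu ==> evs m ==> bcf f ==> fmult m (sc mu f) x = sc mu (fmult m f) x"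
 unfolding fmult_def by (rule cv_sc[OF _ evs_kern])

lemma fmult_sg: "0 <= t ==> evs m ==> bcf f ==> fmult m (sg t f) x = sg t (fmult m f) x"
 unfolding fmult_def sg_def by (rule cv_commute[OF evs_kern sg_kern])

lemma fmult_duhamel:
 fixes F :: "real => real => 'a::euclidean_space"
 shows "evs m ==> bcs {0..R} F ==> t : {0..R} ==>
 fmult m (%y. duhamel e F y t) x = duhamel e (%x s. fmult m (%y. F y s) x) x t"
 unfolding fmult_def by (rule cv_duhamel[OF evs_kern])

text \<open>The convolution with \<open>Q\<close> commutes with the multiplier \<open>a\<close>, so it may be moved inside and \<open>fmult_product\<close> applies.\<close>

lemma quadratic_interaction_vanishes:
 fixes p :: "'a::euclidean_space => 'a => 'a"
 assumes p: "bounded_bilinear p" and Q: "finite_signed Q" and e: "evs e" and a: "evs a"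
  and s: "!!l j. a l \<noteq> 0 ==> a j \<noteq> 0 ==> e (l + j) = c"
  and f: "bcf f" "bcf g"
 shows "fmult e (nB p Q (fmult a f) (fmult a g)) x = c *\<^sub>R nB p Q (fmult a f) (fmult a g) x"
proof -
 have eq: "nB p Q (fmult a f) (fmult a g) = (%x. - p (fmult a f x) (fmult a (sc Q g) x))"
  by (auto simp: nB_def fmult_sc[OF Q a f(2)])
 have b: "bcf (%x. p (fmult a f x) (fmult a (sc Q g) x))"
  by (intro bcf_bilinear[OF p] fmult_bcf a f sc_bcf[OF Q])
 show ?thesis unfolding eq
  by (simp add: fmult_minus[OF e b] fmult_product[OF p e a a s f(1) sc_bcf[OF Q f(2)]])
qed

text \<open>The decisive cancellation: two critical modes never interact to a critical mode.\<close>

lemma critical_quadratic: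
 fixes p :: "'a::euclidean_space => 'a => 'a"
 assumes p: "bounded_bilinear p" and Q: "finite_signed Q" and f: "bcf f" "bcf g"
 shows "fmult crit (nB p Q (fmult crit2 f) (fmult crit2 g)) x = 0"
 using quadratic_interaction_vanishes[OF p Q crit_evs crit2_evs crit_crit2_sum f] by simp

section \<open>Linearity and bounds of the Duhamel operator\<close>

lemma duhamel_diff:
 fixes F G :: "real => real => 'a::euclidean_space"
 assumes F: "bcs {0..R} F" and G: "bcs {0..R} G" and t: "t : {0..R}"
 shows "duhamel e (%x s. F x s - G x s) x t = duhamel e F x t - duhamel e G x t"
proof -
 have "((%s. exp (e^2 * (t - s)) *\<^sub>R sg (t - s) (%y. F y s) x - exp (e^2 * (t - s)) *\<^sub>R sg (t - s) (%y. G y s) x)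
   has_integral duhamel e F x t - duhamel e G x t) {0..t}"
  using t by (intro has_integral_diff duhamel_has_integral[OF F] duhamel_has_integral[OF G]) auto
 moreover have "sg (t - s) (%y. F y s - G y s) x = sg (t - s) (%y. F y s) x - sg (t - s) (%y. G y s) x" if "s : {0..t}" for s
  unfolding sg_def by (rule cv_diff[OF sg_kern bcs_bcf[OF F] bcs_bcf[OF G]]) (use that t in auto)
 ultimately have "((%s. exp (e^2 * (t - s)) *\<^sub>R sg (t - s) (%y. F y s - G y s) x)
   has_integral duhamel e F x t - duhamel e G x t) {0..t}"
  by (subst has_integral_cong[where g="%s. exp (e^2 * (t - s)) *\<^sub>R sg (t - s) (%y. F y s) x - exp (e^2 * (t - s)) *\<^sub>R sg (t - s) (%y. G y s) x"])
    (auto simp: scaleR_diff_right)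
 thus ?thesis unfolding duhamel_def by (rule integral_unique)
qed

lemma duhamel_uminus:
 fixes F :: "real => real => 'a::euclidean_space"
 assumes F: "bcs {0..R} F" and t: "t : {0..R}"
 shows "duhamel e (%x s. - F x s) x t = - duhamel e F x t"
proof -
 have z: "bcs {0..R} (%x t. 0 :: 'a)" by (rule bcs_const) (auto simp: bcf_def)
 have "duhamel e (%x s. 0 :: 'a) x t = 0"
  using duhamel_diff[OF z z t, of e x] by simp
 thus ?thesis using duhamel_diff[OF z F t, of e x] by simp
qed

lemma duhamel_add:
 fixes F G :: "real => real => 'a::euclidean_space"
 assumes F: "bcs {0..R} F" and G: "bcs {0..R} G" and t: "t : {0..R}"
 shows "duhamel e (%x s. F x s + G x s) x t = duhamel e F x t + duhamel e G x t"
 using duhamel_diff[OF F bcs_minus[OF G] t, of e x] duhamel_uminus[OF G t, of e x] by simp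

lemma exp_flow_le:
 fixes e T :: real
 assumes "e > 0" "0 <= t" "t <= T / e^2" shows "exp (e^2 * t) <= exp T"
proof -
 have "e^2 > 0" using assms by simp
 thus ?thesis using assms(3) by (simp add: field_simps)
qed

lemma has_integral_exp: fixes t m :: real shows "0 <= t ==> m \<noteq> 0 ==> ((%s. exp (m * s)) has_integral (exp (m * t) - 1) / m) {0..t}"
proof -
 assume t: "0 <= t" and m: "m \<noteq> 0"
 have "((%s. exp (m * s)) has_integral exp (m * t) / m - exp (m * 0) / m) {0..t}"
  by (rule fundamental_theorem_of_calculus[OF t])
    (use m in "auto intro!: derivative_eq_intros simp flip: has_real_derivative_iff_has_vector_derivative")
 thus ?thesis by (simp add: diff_divide_distrib)
qed

section \<open>The error equation as a fixed-point problem\<close>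

text \<open>One constant that dominates all operator norms of the fixed-point argument, so that the estimates below are polynomials in \<open>c\<close> and the small parameter.\<close>

definition fp_const :: "smeasure => smeasure => real => real => bool" where
 "fp_const Q K T c \<longleftrightarrow> 1 <= c & finite_signed Q & finite_signed K &
  (ALL f g F G x. bcf f --> bcf g --> (ALL x. norm (f x) <= F) --> (ALL x. norm (g x) <= G) --> norm (nB jm Q f g x) <= c * (F * G)) &
  (ALL f g h F G H x. bcf f --> bcf g --> bcf h --> (ALL x. norm (f x) <= F) --> (ALL x. norm (g x) <= G) --> (ALL x. norm (h x) <= H) -->
    norm (nC jm K f g h x) <= c * (F * G * H)) &
  (ALL (f::real => jet) B x. bcf f --> (ALL x. norm (f x) <= B) --> norm (fmult crit f x) <= c * B & norm (fmult crit2 f x) <= c * B) &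
  (ALL (f::real => jet) B x e t. bcf f --> (ALL x. norm (f x) <= B) --> 0 < e --> t : {0..T / e^2} -->
    norm (exp (e^2 * t) *\<^sub>R sg t f x) <= c * B &
    norm (exp (e^2 * t) *\<^sub>R sg t (%y. f y - fmult crit f y) x) <= c * exp (- t / 400) * B)"

lemma fp_const_exists:
 assumes Q: "finite_signed Q" and K: "finite_signed K"
 shows "EX c>=c1. fp_const Q K T c"
proof -
 obtain cn where cn: "1 <= cn"
  "!!f g F G x. bcf f ==> bcf g ==> (ALL x. norm (f x) <= F) ==> (ALL x. norm (g x) <= G) ==> norm (nB jm Q f g x) <= cn * (F * G)"
  "!!f g h F G H x. bcf f ==> bcf g ==> bcf h ==> (ALL x. norm (f x) <= F) ==> (ALL x. norm (g x) <= G) ==> (ALL x. norm (h x) <= H) ==>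
    norm (nC jm K f g h x) <= cn * (F * G * H)"
  using nonlinear_bounds[OF bounded_bilinear_jm Q K] by blast
 obtain cd where cd: "1 <= cd" "!!t (f::real => jet) B x. t >= 0 ==> bcf f ==> (ALL x. norm (f x) <= B) ==>
   norm (sg t (%y. f y - fmult crit f y) x) <= cd * exp (- t / 400) * B"
  using stable_decay by blast
 define e1 where "e1 = (LINT z|lborel. abs (ci 0 crit z))"
 define e2 where "e2 = (LINT z|lborel. abs (ci 0 crit2 z))"
 define c where "c = abs (c1) + cn + e1 + e2 + exp T * (1000 * pi) + exp T * cd"
 have nn: "0 <= e1" "0 <= e2" "0 <= exp T * (1000 * pi)" "0 <= exp T * cd" using cd by (auto simp: e1_def e2_def)
 have ge: "c1 <= c" "1 <= c" "cn <= c" "e1 <= c" "e2 <= c" "exp T * (1000 * pi) <= c" "exp T * cd <= c"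
  using nn cn(1) unfolding c_def by linarith+
 have "fp_const Q K T c"
  unfolding fp_const_def
 proof (intro conjI allI impI Q K)
  show "1 <= c" by (rule ge)
  show "norm (nB jm Q f g x) <= c * (F * G)" if "bcf f" "bcf g" "ALL x. norm (f x) <= F" "ALL x. norm (g x) <= G" for f g F G x
  proof -
   have "0 <= F" "0 <= G" using that(3,4) norm_ge_zero order_trans by blast+
   hence "cn * (F * G) <= c * (F * G)" using ge by (intro mult_right_mono) auto
   thus ?thesis using cn(2)[OF that] order_trans by blast
  qed
  show "norm (nC jm K f g h x) <= c * (F * G * H)" if "bcf f" "bcf g" "bcf h" "ALL x. norm (f x) <= F" "ALL x. norm (g x) <= G" "ALL x. norm (h x) <= H" for f g h F G H x
  proof -
   have "0 <= F" "0 <= G" "0 <= H" using that(4-6) norm_ge_zero order_trans by blast+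
   hence "cn * (F * G * H) <= c * (F * G * H)" using ge by (intro mult_right_mono) auto
   thus ?thesis using cn(3)[OF that, of x] order_trans by blast
  qed
  fix f :: "real => jet" and B x assume f: "bcf f" "ALL x. norm (f x) <= B"
  have B: "0 <= B" using f(2) norm_ge_zero order_trans by blast
  have "norm (fmult crit f x) <= B * e1" "norm (fmult crit2 f x) <= B * e2"
   unfolding e1_def e2_def using f by (intro fmult_norm_le crit_evs crit2_evs; blast)+
  moreover have "B * e1 <= B * c" "B * e2 <= B * c" using B ge by (intro mult_left_mono; blast)+
  ultimately show "norm (fmult crit f x) <= c * B" "norm (fmult crit2 f x) <= c * B" by (simp_all add: mult.commute[of c])
  fix e t :: real assume e: "0 < e" "t : {0..T / e^2}"
  have et: "exp (e^2 * t) <= exp T" using exp_flow_le[of e t T] e by auto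
  have "norm (exp (e^2 * t) *\<^sub>R sg t f x) <= exp T * (1000 * pi * B)"
   unfolding norm_scaleR using e f B et by (intro mult_mono sg_norm_le) auto
  also have "... = exp T * (1000 * pi) * B" by simp
  also have "... <= c * B" using ge B by (intro mult_right_mono) auto
  finally show "norm (exp (e^2 * t) *\<^sub>R sg t f x) <= c * B" .
  have "norm (exp (e^2 * t) *\<^sub>R sg t (%y. f y - fmult crit f y) x) <= exp T * (cd * exp (- t / 400) * B)"
   unfolding norm_scaleR using e f B et cd by (intro mult_mono cd(2)) auto
  also have "... = exp T * cd * (exp (- t / 400) * B)" by simp
  also have "... <= c * (exp (- t / 400) * B)" using ge B by (intro mult_right_mono) auto
  finally show "norm (exp (e^2 * t) *\<^sub>R sg t (%y. f y - fmult crit f y) x) <= c * exp (- t / 400) * B" by (simp add: mult.assoc)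
 qed
 thus ?thesis using ge(1) by blast
qed

context
 fixes Q K :: smeasure and T c :: real
 assumes fpc: "fp_const Q K T c"
begin

lemma c1: "1 <= c" and Qf: "finite_signed Q" and Kf: "finite_signed K"
 using fpc by (simp_all add: fp_const_def)

lemma nB_le: "bcf f ==> bcf g ==> (!!x. norm (f x) <= F) ==> (!!x. norm (g x) <= G) ==> norm (nB jm Q f g x) <= c * (F * G)"
 using fpc unfolding fp_const_def by blast

lemma nC_le: "bcf f ==> bcf g ==> bcf h ==> (!!x. norm (f x) <= F) ==> (!!x. norm (g x) <= G) ==> (!!x. norm (h x) <= H) ==>
  norm (nC jm K f g h x) <= c * (F * G * H)"
 using fpc unfolding fp_const_def by blast

lemma crit_le: "bcf (f::real => jet) ==> (!!x. norm (f x) <= B) ==> norm (fmult crit f x) <= c * B"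
 and crit2_le: "bcf (f::real => jet) ==> (!!x. norm (f x) <= B) ==> norm (fmult crit2 f x) <= c * B"
 using fpc unfolding fp_const_def by blast+

lemma flow_le: "bcf (f::real => jet) ==> (!!x. norm (f x) <= B) ==> 0 < e ==> t : {0..T / e^2} ==>
  norm (exp (e^2 * t) *\<^sub>R sg t f x) <= c * B"
 and stable_flow_le: "bcf (f::real => jet) ==> (!!x. norm (f x) <= B) ==> 0 < e ==> t : {0..T / e^2} ==>
  norm (exp (e^2 * t) *\<^sub>R sg t (%y. f y - fmult crit f y) x) <= c * exp (- t / 400) * B"
 using fpc unfolding fp_const_def by blast+

lemma cpow: "1 <= c ^ n" "n <= m ==> c ^ n <= c ^ m"
 using c1 by (auto intro: one_le_power power_increasing)

lemma full_lipschitz: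
 assumes e: "0 < e" "e <= 1" and U: "bcf U" "bcf U'"
  and b: "!!x. norm (U x) <= 2 * c * e" "!!x. norm (U' x) <= 2 * c * e" "!!x. norm (U x - U' x) <= d"
 shows "norm (nN jm Q K U x - nN jm Q K U' x) <= 16 * c ^ 3 * e * d"
proof -
 have d0: "0 <= d" using b(3)[of 0] norm_ge_zero order_trans by blast
 have c0: "0 <= c" using c1 by simp
 have 1: "norm (nB jm Q U U x - nB jm Q U' U' x) <= c * (d * (2 * c * e) + 2 * c * e * d)"
  by (rule bilinear_diff_bound[OF c0 nB_le bounded_bilinear_jm Qf U U b(2,1,3,3)])
 have 2: "norm (nC jm K U U U x - nC jm K U' U' U' x) <= c * (3 * (2 * c * e)^2 * d)"
  by (rule cubic_diff_bound[OF nC_le bounded_bilinear_jm Kf U b])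
 have 3: "c * (d * (2 * c * e) + 2 * c * e * d) = 4 * (c^2 * (e * d))"
  "c * (3 * (2 * c * e)^2 * d) = 12 * (c ^ 3 * (e^2 * d))"
  by (simp_all add: power2_eq_square power3_eq_cube)
 have "e^2 * d <= e * d" using e d0 by (intro mult_right_mono) (auto simp: power2_eq_square mult_left_le)
 hence 4: "c ^ 3 * (e^2 * d) <= c ^ 3 * (e * d)" using c0 by (intro mult_left_mono) auto
 have 5: "c^2 * (e * d) <= c ^ 3 * (e * d)" using cpow(2)[of 2 3] e d0 by (intro mult_right_mono) auto
 have "nN jm Q K U x - nN jm Q K U' x = (nB jm Q U U x - nB jm Q U' U' x) + (nC jm K U U U x - nC jm K U' U' U' x)"
  by (simp add: nN_def)
 hence "norm (nN jm Q K U x - nN jm Q K U' x) <= norm (nB jm Q U U x - nB jm Q U' U' x) + norm (nC jm K U U U x - nC jm K U' U' U' x)"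
  by (simp only: norm_triangle_ineq)
 also have "... <= 16 * (c ^ 3 * (e * d))" using 1 2 4 5 unfolding 3 by linarith
 finally show ?thesis by (simp add: mult_ac)
qed

text \<open>Splitting both arguments into critical parts \<open>Y\<close> and small remainders \<open>G\<close>, the pure critical interaction drops out. Each remaining quadratic term carries a factor \<open>G = O(e\<^sup>2)\<close> or the difference of the remainders, which gains a power of \<open>e\<close> over \<open>full_lipschitz\<close> in the critical difference.\<close>

lemma critical_lipschitz:
 assumes e: "0 < e" "e <= 1" and y: "bcf y" "bcf y'" and G: "bcf G" "bcf G'"
 defines "Y \<equiv> fmult crit2 y" and "Y' \<equiv> fmult crit2 y'"
 defines "U \<equiv> (%x. Y x + G x)" and "U' \<equiv> (%x. Y' x + G' x)"
 assumes b: "!!x. norm (U x) <= 2 * c * e" "!!x. norm (U' x) <= 2 * c * e"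
  "!!x. norm (Y x) <= 2 * c^2 * e" "!!x. norm (Y' x) <= 2 * c^2 * e"
  "!!x. norm (G x) <= 4 * c ^ 3 * e^2" "!!x. norm (G' x) <= 4 * c ^ 3 * e^2"
  and d: "!!x. norm (Y x - Y' x) <= dY" "!!x. norm (G x - G' x) <= dG"
 shows "norm (fmult crit (nN jm Q K U) x - fmult crit (nN jm Q K U') x) <= 40 * c ^ 5 * (e^2 * dY + e * dG)"
proof -
 have c0: "0 <= c" using c1 by simp
 have d0: "0 <= dY" "0 <= dG" using d(1)[of 0] d(2)[of 0] norm_ge_zero order_trans by blast+
 have Yb: "bcf Y" "bcf Y'" unfolding Y_def Y'_def by (intro fmult_bcf crit2_evs y)+
 have Ub: "bcf U" "bcf U'" unfolding U_def U'_def by (intro bcf_add Yb G)+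
 have dU: "norm (U x - U' x) <= dY + dG" for x
 proof -
  have "U x - U' x = (Y x - Y' x) + (G x - G' x)" by (simp add: U_def U'_def)
  thus ?thesis using norm_triangle_mono[OF d(1)[of x] d(2)[of x]] by simp
 qed
 define R where "R Y G U = (%x. nB jm Q Y G x + nB jm Q G U x + nC jm K U U U x)" for Y G U
 have Rb: "bcf (R Y G U)" if "bcf Y" "bcf G" "bcf U" for Y G U
  unfolding R_def using that by (intro bcf_add nB_bcf[OF bounded_bilinear_jm Qf Kf] nC_bcf[OF bounded_bilinear_jm Qf Kf])
 have split: "fmult crit (nN jm Q K (%x. fmult crit2 y x + G x)) x = fmult crit (R (fmult crit2 y) G (%x. fmult crit2 y x + G x)) x"
  if y: "bcf y" and G: "bcf G" for y G x
 proof -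
  let ?Y = "fmult crit2 y" and ?U = "%x. fmult crit2 y x + G x"
  have Y: "bcf ?Y" by (intro fmult_bcf crit2_evs y)
  have U: "bcf ?U" by (intro bcf_add Y G)
  have "nN jm Q K ?U = (%x. nB jm Q ?Y ?Y x + R ?Y G ?U x)"
   by (rule ext) (simp add: nN_def R_def nB_add_left[OF bounded_bilinear_jm Qf Kf] nB_add_right[OF bounded_bilinear_jm Qf Kf Y G])
  thus ?thesis
   by (simp add: fmult_add[OF crit_evs nB_bcf[OF bounded_bilinear_jm Qf Kf Y Y] Rb[OF Y G U]]
    critical_quadratic[OF bounded_bilinear_jm Qf y y])
 qed
 have RD: "norm (R Y G U x - R Y' G' U' x) <= 40 * c ^ 4 * (e^2 * dY + e * dG)" for x
 proof -
  have 1: "norm (nB jm Q Y G x - nB jm Q Y' G' x) <= c * (dY * (4 * c ^ 3 * e^2) + 2 * c^2 * e * dG)"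
   by (rule bilinear_diff_bound[OF c0 nB_le bounded_bilinear_jm Qf Yb G b(4,5) d])
  have 2: "norm (nB jm Q G U x - nB jm Q G' U' x) <= c * (dG * (2 * c * e) + 4 * c ^ 3 * e^2 * (dY + dG))"
   by (rule bilinear_diff_bound[OF c0 nB_le bounded_bilinear_jm Qf G Ub b(6,1) d(2) dU])
  have 3: "norm (nC jm K U U U x - nC jm K U' U' U' x) <= c * (3 * (2 * c * e)^2 * (dY + dG))"
   by (rule cubic_diff_bound[OF nC_le bounded_bilinear_jm Kf Ub b(1,2) dU])
  have "R Y G U x - R Y' G' U' x = (nB jm Q Y G x - nB jm Q Y' G' x) + (nB jm Q G U x - nB jm Q G' U' x) + (nC jm K U U U x - nC jm K U' U' U' x)"
   by (simp add: R_def)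
  hence le: "norm (R Y G U x - R Y' G' U' x) <= c * (dY * (4 * c ^ 3 * e^2) + 2 * c^2 * e * dG) + c * (dG * (2 * c * e) + 4 * c ^ 3 * e^2 * (dY + dG)) + c * (3 * (2 * c * e)^2 * (dY + dG))"
   using norm_triangle_mono[OF norm_triangle_mono[OF 1 2] 3] by simp
  have eq: "c * (dY * (4 * c ^ 3 * e^2) + 2 * c^2 * e * dG) + c * (dG * (2 * c * e) + 4 * c ^ 3 * e^2 * (dY + dG)) + c * (3 * (2 * c * e)^2 * (dY + dG))
   = 8 * (c ^ 4 * (e^2 * dY)) + 12 * (c ^ 3 * (e^2 * dY)) + 2 * (c ^ 3 * (e * dG)) + 2 * (c^2 * (e * dG)) + 4 * (c ^ 4 * (e^2 * dG)) + 12 * (c ^ 3 * (e^2 * dG))"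
   by (simp add: power2_eq_square power3_eq_cube power4_eq_xxxx algebra_simps)
  have ee: "e^2 * dG <= e * dG" using e d0 by (intro mult_right_mono) (auto simp: power2_eq_square mult_left_le)
  have p: "c ^ n * z <= c ^ 4 * z" if "n <= 4" "0 <= z" for n z using cpow(2)[OF that(1)] that by (intro mult_right_mono) auto
  have c4: "c ^ 4 * (e^2 * dG) <= c ^ 4 * (e * dG)" using ee cpow(1)[of 4] by (intro mult_left_mono) auto
  have z: "0 <= e^2 * dY" "0 <= e * dG" "0 <= e^2 * dG" using e d0 by auto
  have zz: "0 <= c ^ 4 * (e^2 * dY)" "0 <= c ^ 4 * (e * dG)" using z cpow(1)[of 4] by auto
  have "8 * (c ^ 4 * (e^2 * dY)) + 12 * (c ^ 3 * (e^2 * dY)) + 2 * (c ^ 3 * (e * dG)) + 2 * (c^2 * (e * dG)) + 4 * (c ^ 4 * (e^2 * dG)) + 12 * (c ^ 3 * (e^2 * dG))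
   <= 40 * (c ^ 4 * (e^2 * dY)) + 40 * (c ^ 4 * (e * dG))"
   using p[of 3 "e^2 * dY"] p[of 3 "e * dG"] p[of 2 "e * dG"] p[of 3 "e^2 * dG"] z zz c4 by linarith
  also have "... = 40 * c ^ 4 * (e^2 * dY + e * dG)" by (simp add: algebra_simps)
  finally show ?thesis using le unfolding eq by linarith
 qed
 have "fmult crit (nN jm Q K U) x - fmult crit (nN jm Q K U') x = fmult crit (%x. R Y G U x - R Y' G' U' x) x"
  unfolding fmult_diff[OF crit_evs Rb[OF Yb(1) G(1) Ub(1)] Rb[OF Yb(2) G(2) Ub(2)]]
  using split[OF y(1) G(1)] split[OF y(2) G(2)] unfolding U_def U'_def Y_def Y'_def by simp
 hence "norm (fmult crit (nN jm Q K U) x - fmult crit (nN jm Q K U') x) <= c * (40 * c ^ 4 * (e^2 * dY + e * dG))"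
  using crit_le[OF bcf_diff[OF Rb[OF Yb(1) G(1) Ub(1)] Rb[OF Yb(2) G(2) Ub(2)]] RD] by simp
 also have "... = 40 * c ^ 5 * (e^2 * dY + e * dG)"
  using power_Suc[of c 4] by simp
 finally show ?thesis .
qed

lemma flow_duhamel_le:
 assumes e: "0 < e" and F: "bcs {0..T / e^2} F" and t: "t : {0..T / e^2}"
  and b: "!!x s. s : {0..t} ==> norm (F x s) <= h s" and h: "(h has_integral I) {0..t}"
 shows "norm (duhamel e F x t :: jet) <= c * I"
proof (rule duhamel_norm_le[OF F])
 show "((%s. c * h s) has_integral c * I) {0..t}" using h by (rule has_integral_mult_right)
 show "norm (exp (e^2 * (t - s)) *\<^sub>R sg (t - s) (%y. F y s) x) <= c * h s" if "s : {0..t}" for s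
  by (rule flow_le[OF bcs_bcf[OF F] b e]) (use that t in auto)
qed (use t in auto)

lemma stable_duhamel_le:
 assumes e: "0 < e" and F: "bcs {0..T / e^2} F" and t: "t : {0..T / e^2}"
  and b: "!!x s. s : {0..t} ==> norm (F x s) <= M"
 shows "norm (duhamel e (%x s. F x s - fmult crit (%y. F y s) x) x t :: jet) <= 400 * c * M"
proof -
 have "norm (F 0 0) <= M" by (rule b) (use t in auto)
 hence M: "0 <= M" by (rule order_trans[OF norm_ge_zero])
 have h: "((%s. c * M * exp (- t / 400) * exp (1 / 400 * s)) has_integral c * M * exp (- t / 400) * ((exp (1 / 400 * t) - 1) / (1 / 400))) {0..t}"
  using t by (intro has_integral_mult_right has_integral_exp) auto
 have "norm (duhamel e (%x s. F x s - fmult crit (%y. F y s) x) x t) <= c * M * exp (- t / 400) * ((exp (1 / 400 * t) - 1) / (1 / 400))"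
 proof (rule duhamel_norm_le[OF bcs_diff[OF F bcs_fmult[OF crit_evs F]] _ _ _ h])
  fix s assume s: "s : {0..t}"
  have "norm (exp (e^2 * (t - s)) *\<^sub>R sg (t - s) (%y. F y s - fmult crit (%y. F y s) y) x) <= c * exp (- (t - s) / 400) * M"
   by (rule stable_flow_le[OF bcs_bcf[OF F] b e]) (use s t in auto)
  also have "... = c * M * (exp (- t / 400) * exp (1 / 400 * s))"
   by (simp add: diff_divide_distrib flip: exp_add)
  finally show "norm (exp (e^2 * (t - s)) *\<^sub>R sg (t - s) (%y. F y s - fmult crit (%y. F y s) y) x) <= c * M * exp (- t / 400) * exp (1 / 400 * s)"
   by (simp add: mult.assoc)
 qed (use t in auto)
 also have "... = 400 * c * M * (1 - exp (- t / 400))"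
  by (simp add: algebra_simps flip: exp_add)
 also have "... <= 400 * c * M * 1" using M c1 by (intro mult_left_mono) auto
 finally show ?thesis by simp
qed

end

text \<open>What the error equation needs to know about the approximation: its size, its distance to the critical modes, and the size of the residual, which is one power better on the critical modes.\<close>

definition fp_data :: "real => real => real => (real => real => jet) => (real => real => jet) => (real => jet) => bool" where
 "fp_data c T e Ph r W0 \<longleftrightarrow> bcs {0..T / e^2} Ph & bcs {0..T / e^2} r & isJet W0 & (ALL x. norm (W0 x) <= c * e^2) &
   (ALL t:{0..T / e^2}. isJet (%x. Ph x t) & isJet (%x. r x t) & (ALL x. norm (Ph x t) <= c * e &
    norm (Ph x t - fmult crit2 (%y. Ph y t) x) <= c * e^2 & norm (r x t) <= c * e ^ 3 &
    norm (fmult crit (%y. r y t) x) <= c * e ^ 4))"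

definition clip :: "real => real => real" where "clip R t = max 0 (min R t)"

lemma clip_mem: "0 <= R ==> clip R t : {0..R}" and clip_id: "t : {0..R} ==> clip R t = t"
 by (auto simp: clip_def)

text \<open>Clipping the time extends a function to all times, so that the contraction principle can run in the complete space of bounded continuous functions.\<close>

definition toB :: "real => (real => real => jet) => (real \<times> real) \<Rightarrow>\<^sub>C jet" where
 "toB R F = Bcontfun (%q. F (fst q) (clip R (snd q)))"

lemma toB_apply: assumes F: "bcs {0..R} F" and R: "0 <= R" shows "apply_bcontfun (toB R F) q = F (fst q) (clip R (snd q))"
proof -
 from bcs_bdd[OF F] obtain B where "B >= 0 & (ALL x. ALL t:{0..R}. norm (F x t) <= B)" ..
 hence B: "!!x t. t : {0..R} ==> norm (F x t) <= B" by blast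
 have "(%q. F (fst q) (clip R (snd q))) : bcontfun"
 proof (rule bcontfun_normI)
  show "continuous_on UNIV (%q. F (fst q) (clip R (snd q)))"
  proof (rule bcs_compose[OF F])
   show "continuous_on UNIV (%q::real \<times> real. clip R (snd q))" unfolding clip_def by (intro continuous_intros)
   show "range (%q::real \<times> real. clip R (snd q)) \<subseteq> {0..R}" by (rule image_subsetI[OF clip_mem[OF R]])
  qed (intro continuous_intros)
  show "norm (F (fst q) (clip R (snd q))) <= B" for q by (rule B[OF clip_mem[OF R]])
 qed
 thus ?thesis by (simp add: toB_def Bcontfun_inverse)
qed

lemma bcs_apply: "bcs P (%x t. apply_bcontfun a (x, t))"
proof (rule bcsI)
 show "continuous_on (UNIV \<times> P) (%(x, t). apply_bcontfun a (x, t))" by (simp add: split_def)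
 show "norm (apply_bcontfun a (x, t)) <= norm a" for x t by (rule norm_bounded)
qed

lemma exp_weight_bcs: "bcs {0..R} F ==> bcs {0..R} (%x t. (k * exp (m * t)) *\<^sub>R F x t)"
proof (cases "0 <= R")
 case True
 assume F: "bcs {0..R} F"
 have "continuous_on {0..R} (%t. k * exp (m * t))" by (intro continuous_intros)
 from compact_continuous_image[OF this] obtain B where "ALL t:{0..R}. abs (k * exp (m * t)) <= B"
  by (auto dest!: compact_imp_bounded simp: bounded_iff)
 thus ?thesis by (intro bcs_scale_time[OF F, of _ B] continuous_intros) auto
qed (auto simp: bcs_def)

context
 fixes Q K :: smeasure and T c :: real
 assumes fpc: "fp_const Q K T c"
begin

text \<open>The unknowns are the Duhamel terms of the critical and of the stable equation, scaled by \<open>e\<^sup>2\<close> and \<open>e\<^sup>3 L\<close> and weighted by \<open>exp(lam e\<^sup>2 t)\<close>. The critical difference enters the stable equation with a constant that is beaten by large \<open>L\<close>; the stable difference enters the critical one with the factor \<open>L\<close>, which is beaten by large \<open>lam\<close>. The contribution of the initial error to the stable part is kept separate, since it is only \<open>O(e\<^sup>2)\<close> but integrable in time.\<close>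

lemma fixed_point_small:
 assumes T: "0 < T"
 defines "L \<equiv> 51200 * c ^ 5"
 defines "lam \<equiv> 160 * c ^ 6 * (c + L)"
 defines "D \<equiv> 2 * (41 * c ^ 10 * T + 16000 * c ^ 8 + 19600 * c ^ 8)"
 defines "m1 \<equiv> exp (lam * T) * D"
 assumes e0: "0 < e" and e1: "e <= 1" and e2: "e * (4 * c ^ 3 + m1) <= 1" and e3: "e * (L * m1) <= 1"
  and e4: "51200 * c ^ 4 * e <= 1"
  and data: "fp_data c T e Ph r W0"
 shows "EX W. bcs {0..T / e^2} W & (ALL t:{0..T / e^2}. isJet (%x. W x t) & (ALL x. norm (W x t) <= (4 * c ^ 4 + c * m1) * e^2 &
   W x t = exp (e^2 * t) *\<^sub>R sg t W0 x + duhamel e (%x s. nN jm Q K (%y. Ph y s + W y s) x - nN jm Q K (%y. Ph y s) x + r x s) x t))"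
proof -
 define tau where "tau = T / e^2"
 define I where "I = {0..tau}"
 have tau0: "0 <= tau" using T e0 by (simp add: tau_def)
 have tauT: "e^2 * tau = T" using e0 by (simp add: tau_def)
 note c1 = c1[OF fpc] and Qf = Qf[OF fpc] and Kf = Kf[OF fpc]
 have c0: "0 < c" using c1 by simp
 note cp1 = cpow(1)[OF fpc] and cp = cpow(2)[OF fpc]
 have L1: "1 <= L" using cp1[of 5] by (simp add: L_def)
 have lam0: "0 < lam" using c0 L1 by (simp add: lam_def)
 have D0: "0 <= D" using T c0 by (simp add: D_def)
 have m10: "0 <= m1" using D0 by (simp add: m1_def)
 have eps: "e ^ n <= e ^ m" if "m <= n" for m n using e0 e1 that by (intro power_decreasing) auto
 (* time weight of the contraction norm; it stays below a constant because \<open>e^2 t\<close> is at most \<open>T\<close> *)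
 define ev where "ev t = exp (lam * e^2 * t)" for t
 have ev1: "1 <= ev t" if "t : I" for t using that lam0 e0 by (simp add: ev_def I_def)
 have ev0: "0 < ev t" for t by (simp add: ev_def)
 have evm: "ev s <= ev t" if "s <= t" for s t using that lam0 e0 by (simp add: ev_def mult_left_mono)
 have evT: "ev t * D <= m1" if "t : I" for t
 proof -
  have "e^2 * t <= e^2 * tau" using that e0 by (intro mult_left_mono) (auto simp: I_def)
  hence "lam * (e^2 * t) <= lam * T" using lam0 tauT by (intro mult_left_mono) auto
  thus ?thesis unfolding m1_def using D0 by (intro mult_right_mono) (auto simp: ev_def mult.assoc)
 qed
 have phi: "bcs I Ph" and rb: "bcs I r" and W0: "isJet W0" "!!x. norm (W0 x) <= c * e^2"
  and ph: "!!t. t : I ==> isJet (%x. Ph x t)" "!!t. t : I ==> isJet (%x. r x t)"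
   "!!x t. t : I ==> norm (Ph x t) <= c * e"
   "!!x t. t : I ==> norm (Ph x t - fmult crit2 (%y. Ph y t) x) <= c * e^2"
   "!!x t. t : I ==> norm (r x t) <= c * e ^ 3"
   "!!x t. t : I ==> norm (fmult crit (%y. r y t) x) <= c * e ^ 4"
  using data unfolding fp_data_def I_def tau_def by blast+
 have W0b: "bcf W0" by (rule isJet_bcf[OF W0(1)])
 have It: "t : {0..T / e^2}" if "t : I" for t using that by (simp add: I_def tau_def)
 define SW where "SW x t = exp (e^2 * t) *\<^sub>R sg t W0 x" for x t
 define ESW where "ESW x t = fmult crit (%y. SW y t) x" for x t
 have SWb: "bcs I SW" unfolding I_def SW_def[abs_def] by (rule sg_flow_bcs[OF W0b])
 have ESWb: "bcs I ESW" unfolding ESW_def[abs_def] by (rule bcs_fmult[OF crit_evs SWb])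
 have SWJ: "isJet (%x. SW x t)" if "t : I" for t unfolding SW_def using that by (intro isJet_scaleR isJet_sg W0) (simp add: I_def)
 have ESWJ: "isJet (%x. ESW x t)" if "t : I" for t unfolding ESW_def by (rule isJet_fmult[OF crit_evs SWJ[OF that]])
 have SWn: "norm (SW x t) <= c * (c * e^2)" if "t : I" for x t
  unfolding SW_def by (rule flow_le[OF fpc W0b W0(2) e0 It[OF that]])
 have ESWn: "norm (ESW x t) <= c * (c * (c * e^2))" if "t : I" for x t
  unfolding ESW_def by (rule crit_le[OF fpc bcs_bcf[OF SWb that] SWn[OF that]])
 have XSn: "norm (SW x t - ESW x t) <= c * exp (- t / 400) * (c * e^2)" if t: "t : I" for x t
 proof -
  have t0: "0 <= t" using t by (simp add: I_def)
  have "ESW x t = exp (e^2 * t) *\<^sub>R sg t (fmult crit W0) x"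
   unfolding ESW_def SW_def by (simp add: fmult_scaleR[OF crit_evs sg_bcf[OF t0 W0b]] fmult_sg[OF t0 crit_evs W0b])
  moreover have "sg t (%y. W0 y - fmult crit W0 y) x = sg t W0 x - sg t (fmult crit W0) x"
   unfolding sg_def by (rule cv_diff[OF sg_kern[OF t0] W0b fmult_bcf[OF crit_evs W0b]])
  ultimately have "SW x t - ESW x t = exp (e^2 * t) *\<^sub>R sg t (%y. W0 y - fmult crit W0 y) x"
   by (simp add: SW_def scaleR_diff_right)
  thus ?thesis using stable_flow_le[OF fpc W0b W0(2) e0 It[OF t], of x] by simp
 qed
 define V where "V Z x t = fmult crit2 (%y. ESW y t + Z y t) x" for Z :: "real => real => jet" and x t
 define X where "X Z x t = SW x t - ESW x t + Z x t" for Z :: "real => real => jet" and x t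
 define U where "U Zc Zs x t = Ph x t + (V Zc x t + X Zs x t)" for Zc Zs x t
 define H where "H Zc Zs x t = nN jm Q K (%y. U Zc Zs y t) x - nN jm Q K (%y. Ph y t) x + r x t" for Zc Zs x t
 define EH where "EH Zc Zs x t = fmult crit (%y. H Zc Zs y t) x" for Zc Zs x t
 define SH where "SH Zc Zs x t = H Zc Zs x t - EH Zc Zs x t" for Zc Zs x t
 define y where "y Zc x t = Ph x t + (ESW x t + Zc x t)" for Zc :: "real => real => jet" and x t
 define G where "G Zs x t = (Ph x t - fmult crit2 (%y. Ph y t) x) + X Zs x t" for Zs x t
 define adm where "adm Zc Zs \<longleftrightarrow> bcs I Zc & bcs I Zs & (ALL x. ALL t:I. norm (Zc x t) <= e^2 * m1 & norm (Zs x t) <= e^2)"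
  for Zc Zs :: "real => real => jet"
 note nNb = nN_bcf[OF bounded_bilinear_jm Qf Kf] and nNs = bcs_nN[OF bounded_bilinear_jm Qf Kf]
 have Vb: "bcs I (V Z)" if "bcs I Z" for Z
  unfolding V_def[abs_def] by (intro bcs_fmult crit2_evs bcs_add ESWb that)
 have Xb: "bcs I (X Z)" if "bcs I Z" for Z
  unfolding X_def[abs_def] by (intro bcs_add bcs_diff SWb ESWb that)
 have Ub: "bcs I (U Zc Zs)" if "bcs I Zc" "bcs I Zs" for Zc Zs
  unfolding U_def[abs_def] by (intro bcs_add phi Vb Xb that)
 have Hb: "bcs I (H Zc Zs)" if "bcs I Zc" "bcs I Zs" for Zc Zs
  unfolding H_def[abs_def] by (intro bcs_add bcs_diff nNs phi rb Ub that)
 have EHb: "bcs I (EH Zc Zs)" if "bcs I Zc" "bcs I Zs" for Zc Zs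
  unfolding EH_def[abs_def] by (intro bcs_fmult crit_evs Hb that)
 have SHb: "bcs I (SH Zc Zs)" if "bcs I Zc" "bcs I Zs" for Zc Zs
  unfolding SH_def[abs_def] by (intro bcs_diff Hb EHb that)
 have yb: "bcf (%x. y Zc x t)" if "bcs I Zc" "bcs I Zs" "t : I" for Zc Zs :: "real => real => jet" and t
 proof -
  have "bcs I (y Zc)" unfolding y_def[abs_def] by (intro bcs_add phi ESWb that)
  thus ?thesis by (rule bcs_bcf[OF _ that(3)])
 qed
 have Gb: "bcf (%x. G Zs x t)" if "bcs I Zc" "bcs I Zs" "t : I" for Zc Zs :: "real => real => jet" and t
 proof -
  have "bcs I (G Zs)" unfolding G_def[abs_def] by (intro bcs_add bcs_diff bcs_fmult crit2_evs phi Xb that)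
  thus ?thesis by (rule bcs_bcf[OF _ that(3)])
 qed
 have Yeq: "fmult crit2 (%x. y Zc x t) x = fmult crit2 (%y. Ph y t) x + V Zc x t" if "bcs I Zc" "t : I" for Zc x t
  unfolding y_def V_def
  by (rule fmult_add[OF crit2_evs bcs_bcf[OF phi] bcf_add[OF bcs_bcf[OF ESWb] bcs_bcf[OF that(1)]]]) (use that in auto)
 have Ueq: "U Zc Zs x t = fmult crit2 (%x. y Zc x t) x + G Zs x t" if "bcs I Zc" "t : I" for Zc Zs x t
  by (simp add: Yeq[OF that] U_def G_def)
 have c3: "c <= c ^ 3" "c^2 <= c ^ 3" "c ^ 1 <= c ^ 2" using cp[of 1 3] cp[of 2 3] cp[of 1 2] by auto
 have Vn: "norm (V Zc x t) <= c * ((c ^ 3 + m1) * e^2)" if "adm Zc Zs" "t : I" for Zc Zs x t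
  unfolding V_def
 proof (rule crit2_le[OF fpc])
  show "bcf (%y. ESW y t + Zc y t)" using that by (intro bcf_add bcs_bcf[OF ESWb] bcs_bcf[of I]) (auto simp: adm_def)
  have "norm (ESW x t + Zc x t) <= c * (c * (c * e^2)) + e^2 * m1" for x
   using that by (intro norm_triangle_le add_mono ESWn) (auto simp: adm_def)
  thus "norm (ESW x t + Zc x t) <= (c ^ 3 + m1) * e^2" for x by (simp add: power3_eq_cube algebra_simps)
 qed
 have Xn: "norm (X Zs x t) <= 3 * c ^ 3 * e^2" if "adm Zc Zs" "t : I" for Zc Zs x t
 proof -
  have "norm (SW x t - ESW x t) <= c * (c * e^2) + c * (c * (c * e^2))"
   by (rule order_trans[OF norm_triangle_ineq4 add_mono[OF SWn[OF that(2)] ESWn[OF that(2)]]])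
  hence "norm (X Zs x t) <= c * (c * e^2) + c * (c * (c * e^2)) + e^2"
   unfolding X_def using that by (intro norm_triangle_le add_mono) (auto simp: adm_def)
  also have "... = (c^2 + c ^ 3 + 1) * e^2" by (simp add: power2_eq_square power3_eq_cube algebra_simps)
  also have "... <= (3 * c ^ 3) * e^2" using c3 cp1[of 3] by (intro mult_right_mono) auto
  finally show ?thesis .
 qed
 have Wn: "norm (V Zc x t + X Zs x t) <= (4 * c ^ 4 + c * m1) * e^2" if "adm Zc Zs" "t : I" for Zc Zs x t
 proof -
  have "norm (V Zc x t + X Zs x t) <= c * ((c ^ 3 + m1) * e^2) + 3 * c ^ 3 * e^2"
   by (intro norm_triangle_le add_mono Vn[OF that] Xn[OF that])
  also have "... = (c ^ 4 + c * m1 + 3 * c ^ 3) * e^2" by (simp add: eval_nat_numeral algebra_simps)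
  also have "... <= (4 * c ^ 4 + c * m1) * e^2" using cp[of 3 4] by (intro mult_right_mono) auto
  finally show ?thesis .
 qed
 have small: "(4 * c ^ 4 + c * m1) * e^2 <= c * e"
 proof -
  have "(c * e) * (e * (4 * c ^ 3 + m1)) <= (c * e) * 1" using e2 c0 e0 by (intro mult_left_mono) auto
  thus ?thesis by (simp add: eval_nat_numeral algebra_simps)
 qed
 have Un: "norm (U Zc Zs x t) <= 2 * c * e" if "adm Zc Zs" "t : I" for Zc Zs x t
 proof -
  have "norm (U Zc Zs x t) <= c * e + c * e"
   unfolding U_def by (intro norm_triangle_le add_mono ph(3) order_trans[OF Wn small] that)
  thus ?thesis by (simp add: mult_ac)
 qed
 have Yn: "norm (fmult crit2 (%x. y Zc x t) x) <= 2 * c^2 * e" if "adm Zc Zs" "t : I" for Zc Zs x t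
 proof -
  have "(c ^ 3 + m1) * e^2 <= (4 * c ^ 3 + m1) * e * e" using c0 e0 m10 unfolding power2_eq_square mult.assoc[symmetric]
   by (intro mult_right_mono) auto
  also have "... <= 1 * e" using e2 e0 by (intro mult_right_mono) (auto simp: mult.commute)
  finally have k: "(c ^ 3 + m1) * e^2 <= e" by simp
  have ec: "e <= c * e" using c1 e0 by simp
  have "norm (y Zc x t) <= c * e + (c * (c * (c * e^2)) + e^2 * m1)" for x
   unfolding y_def using that by (intro norm_triangle_le add_mono ph(3) ESWn) (auto simp: adm_def)
  hence "norm (y Zc x t) <= 2 * (c * e)" for x
   using k ec by (smt (verit) distrib_right mult.assoc mult.commute power3_eq_cube)
  hence "norm (fmult crit2 (%x. y Zc x t) x) <= c * (2 * (c * e))"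
   by (intro crit2_le[OF fpc] yb[of Zc Zs]) (use that in "auto simp: adm_def")
  thus ?thesis by (simp add: power2_eq_square)
 qed
 have Gn: "norm (G Zs x t) <= 4 * c ^ 3 * e^2" if "adm Zc Zs" "t : I" for Zc Zs x t
 proof -
  have "norm (G Zs x t) <= c * e^2 + 3 * c ^ 3 * e^2"
   unfolding G_def by (intro norm_triangle_le add_mono ph(4) Xn[OF that] that)
  also have "... <= 4 * c ^ 3 * e^2" using mult_right_mono[OF c3(1), of "e^2"] by (simp add: algebra_simps)
  finally show ?thesis .
 qed
 have admb: "bcs I Zc" "bcs I Zs" if "adm Zc Zs" for Zc Zs using that by (auto simp: adm_def)
 (* the critical equation gains a power of the small parameter over the full one *)
 have Hdiff: "norm (H Zc Zs x t - H Zc' Zs' x t) <= 16 * c ^ 3 * e * (c * dc + ds)"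
  and EHdiff: "norm (EH Zc Zs x t - EH Zc' Zs' x t) <= 40 * c ^ 5 * (e^2 * (c * dc) + e * ds)"
  if a: "adm Zc Zs" and a': "adm Zc' Zs'" and t: "t : I"
   and d: "!!x. norm (Zc x t - Zc' x t) <= dc" "!!x. norm (Zs x t - Zs' x t) <= ds"
  for Zc Zs Zc' Zs' x t dc ds
 proof -
  note b = admb[OF a] and b' = admb[OF a']
  have dV: "norm (V Zc x t - V Zc' x t) <= c * dc" for x
  proof -
   have "V Zc x t - V Zc' x t = fmult crit2 (%x. Zc x t - Zc' x t) x"
    unfolding V_def
    using fmult_diff[OF crit2_evs bcf_add[OF bcs_bcf[OF ESWb t] bcs_bcf[OF b(1) t]] bcf_add[OF bcs_bcf[OF ESWb t] bcs_bcf[OF b'(1) t]]]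
    by simp
   thus ?thesis using crit2_le[OF fpc bcf_diff[OF bcs_bcf[OF b(1) t] bcs_bcf[OF b'(1) t]] d(1)] by simp
  qed
  have dX: "norm (X Zs x t - X Zs' x t) <= ds" for x using d(2)[of x] by (simp add: X_def)
  have dU: "norm (U Zc Zs x t - U Zc' Zs' x t) <= c * dc + ds" for x
   using norm_triangle_mono[OF dV dX, of x] by (simp add: U_def algebra_simps)
  have "H Zc Zs x t - H Zc' Zs' x t = nN jm Q K (%y. U Zc Zs y t) x - nN jm Q K (%y. U Zc' Zs' y t) x"
   by (simp add: H_def)
  thus "norm (H Zc Zs x t - H Zc' Zs' x t) <= 16 * c ^ 3 * e * (c * dc + ds)"
   using full_lipschitz[OF fpc e0 e1 bcs_bcf[OF Ub[OF b] t] bcs_bcf[OF Ub[OF b'] t] Un[OF a t] Un[OF a' t] dU] by simp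
  have nb: "bcf (%x. nN jm Q K (%y. U Zc Zs y t) x)" "bcf (%x. nN jm Q K (%y. U Zc' Zs' y t) x)"
   by (intro nNb bcs_bcf[OF Ub[OF b] t] bcs_bcf[OF Ub[OF b'] t])+
  have "EH Zc Zs x t - EH Zc' Zs' x t = fmult crit (%x. H Zc Zs x t - H Zc' Zs' x t) x"
   unfolding EH_def by (rule fmult_diff[OF crit_evs bcs_bcf[OF Hb[OF b] t] bcs_bcf[OF Hb[OF b'] t], symmetric])
  also have "... = fmult crit (%x. nN jm Q K (%y. U Zc Zs y t) x - nN jm Q K (%y. U Zc' Zs' y t) x) x"
   by (simp add: H_def)
  also have "... = fmult crit (nN jm Q K (%y. U Zc Zs y t)) x - fmult crit (nN jm Q K (%y. U Zc' Zs' y t)) x"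
   by (rule fmult_diff[OF crit_evs nb])
  finally have eq: "EH Zc Zs x t - EH Zc' Zs' x t = fmult crit (nN jm Q K (%y. U Zc Zs y t)) x - fmult crit (nN jm Q K (%y. U Zc' Zs' y t)) x" .
  have UY: "(%x. U Zc Zs x t) = (%x. fmult crit2 (%x. y Zc x t) x + G Zs x t)"
   "(%x. U Zc' Zs' x t) = (%x. fmult crit2 (%x. y Zc' x t) x + G Zs' x t)"
   using Ueq[OF b(1) t] Ueq[OF b'(1) t] by blast+
  have dY: "norm (fmult crit2 (%x. y Zc x t) x - fmult crit2 (%x. y Zc' x t) x) <= c * dc" for x
   using dV[of x] by (simp add: Yeq[OF b(1) t] Yeq[OF b'(1) t])
  have dG: "norm (G Zs x t - G Zs' x t) <= ds" for x using dX[of x] by (simp add: G_def)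
  note Un1 = Un[OF a t, unfolded Ueq[OF b(1) t]] and Un2 = Un[OF a' t, unfolded Ueq[OF b'(1) t]]
  show "norm (EH Zc Zs x t - EH Zc' Zs' x t) <= 40 * c ^ 5 * (e^2 * (c * dc) + e * ds)"
   unfolding eq UY
   by (rule critical_lipschitz[OF fpc e0 e1 yb[OF b t] yb[OF b' t] Gb[OF b t] Gb[OF b' t] Un1 Un2 Yn[OF a t] Yn[OF a' t] Gn[OF a t] Gn[OF a' t] dY dG])
 qed
 have zb: "bcs I (%x t. 0 :: jet)" by (rule bcs_const) (auto simp: bcf_def)
 let ?z = "%(x::real) (t::real). 0 :: jet"
 have a0: "adm ?z ?z" using zb m10 by (auto simp: adm_def)
 have V0: "norm (V ?z x t) <= c ^ 4 * e^2" if t: "t : I" for x t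
 proof -
  have "norm (V ?z x t) <= c * (c * (c * (c * e^2)))"
   unfolding V_def using crit2_le[OF fpc bcs_bcf[OF ESWb t] ESWn[OF t]] by simp
  thus ?thesis by (simp add: power4_eq_xxxx mult.assoc)
 qed
 have X0: "norm (X ?z x t) <= c^2 * e^2 * exp (- t / 400)" if t: "t : I" for x t
  using XSn[OF t, of x] by (simp add: X_def power2_eq_square mult_ac)
 have H0: "norm (H ?z ?z x t) <= 33 * c ^ 7 * e ^ 3" if t: "t : I" for x t
 proof -
  have "norm (X ?z x t) <= c ^ 4 * e^2" for x
  proof -
   have "c^2 * e^2 * exp (- t / 400) <= c^2 * e^2 * 1" using t by (intro mult_left_mono) (auto simp: I_def)
   also have "... <= c ^ 4 * e^2" using mult_right_mono[OF cp[of 2 4], of "e^2"] by simp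
   finally show ?thesis using X0[OF t, of x] by linarith
  qed
  hence d: "norm (U ?z ?z x t - Ph x t) <= 2 * (c ^ 4 * e^2)" for x
   using norm_triangle_mono[OF V0[OF t, of x], of "X ?z x t" "c ^ 4 * e^2"] unfolding U_def by (simp add: mult_ac)
  have pn: "norm (Ph x t) <= 2 * c * e" for x using ph(3)[OF t, of x] c0 e0 by (auto intro: order_trans)
  have "norm (nN jm Q K (%y. U ?z ?z y t) x - nN jm Q K (%y. Ph y t) x) <= 16 * c ^ 3 * e * (2 * (c ^ 4 * e^2))"
   by (rule full_lipschitz[OF fpc e0 e1 bcs_bcf[OF Ub[OF zb zb] t] bcs_bcf[OF phi t] Un[OF a0 t] pn d])
  hence "norm (H ?z ?z x t) <= 16 * c ^ 3 * e * (2 * (c ^ 4 * e^2)) + c * e ^ 3"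
   unfolding H_def by (intro norm_triangle_le add_mono ph(5)[OF t])
  also have "... = (32 * c ^ 7 + c) * e ^ 3" by (simp add: eval_nat_numeral algebra_simps)
  also have "... <= 33 * c ^ 7 * e ^ 3" using cp[of 1 7] e0 by (intro mult_right_mono) auto
  finally show ?thesis .
 qed
 have EH0: "norm (EH ?z ?z x t) <= 41 * c ^ 9 * e ^ 4 + 40 * c ^ 7 * e^2 * exp (- t / 400)" if t: "t : I" for x t
 proof -
  have nb: "bcf (nN jm Q K (%y. U ?z ?z y t))" "bcf (nN jm Q K (%y. Ph y t))"
   by (intro nNb bcs_bcf[OF Ub[OF zb zb] t] bcs_bcf[OF phi t])+
  have eq: "EH ?z ?z x t = (fmult crit (nN jm Q K (%y. U ?z ?z y t)) x - fmult crit (nN jm Q K (%y. Ph y t)) x) + fmult crit (%y. r y t) x"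
   unfolding EH_def H_def
   by (subst fmult_add[OF crit_evs bcf_diff[OF nb] bcs_bcf[OF rb t]]) (simp add: fmult_diff[OF crit_evs nb])
  define G' where "G' = (%x. Ph x t - fmult crit2 (%y. Ph y t) x)"
  have G'b: "bcf G'" unfolding G'_def by (intro bcf_diff fmult_bcf crit2_evs bcs_bcf[OF phi t])
  have pe: "(%x. Ph x t) = (%x. fmult crit2 (%y. Ph y t) x + G' x)" by (simp add: G'_def)
  have ue: "(%x. U ?z ?z x t) = (%x. fmult crit2 (%x. y ?z x t) x + G ?z x t)" using Ueq[OF zb t] by blast
  have pn: "norm (fmult crit2 (%y. Ph y t) x + G' x) <= 2 * c * e" for x
   using ph(3)[OF t, of x] mult_pos_pos[OF c0 e0] by (simp add: G'_def)
  have pY: "norm (fmult crit2 (%y. Ph y t) x) <= 2 * c^2 * e" for x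
  proof -
   have "norm (fmult crit2 (%y. Ph y t) x) <= c * (c * e)" by (rule crit2_le[OF fpc bcs_bcf[OF phi t] ph(3)[OF t]])
   moreover have "c * (c * e) <= 2 * c^2 * e" using c0 e0 by (simp add: power2_eq_square)
   ultimately show ?thesis by linarith
  qed
  have pG: "norm (G' x) <= 4 * c ^ 3 * e^2" for x
  proof -
   have "c * e^2 <= 4 * c ^ 3 * e^2" using c3(1) c0 by (intro mult_right_mono) auto
   thus ?thesis using ph(4)[OF t, of x] unfolding G'_def by linarith
  qed
  have dY: "norm (fmult crit2 (%x. y ?z x t) x - fmult crit2 (%y. Ph y t) x) <= c ^ 4 * e^2" for x
   using V0[OF t, of x] by (simp add: Yeq[OF zb t])
  have dG: "norm (G ?z x t - G' x) <= c^2 * e^2 * exp (- t / 400)" for x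
   using X0[OF t, of x] by (simp add: G_def G'_def)
  note Un1 = Un[OF a0 t, unfolded Ueq[OF zb t]]
  have "norm (fmult crit (nN jm Q K (%y. U ?z ?z y t)) x - fmult crit (nN jm Q K (%y. Ph y t)) x)
    <= 40 * c ^ 5 * (e^2 * (c ^ 4 * e^2) + e * (c^2 * e^2 * exp (- t / 400)))"
   unfolding ue by (subst pe)
    (rule critical_lipschitz[OF fpc e0 e1 yb[OF zb zb t] bcs_bcf[OF phi t] Gb[OF zb zb t] G'b Un1 pn Yn[OF a0 t] pY Gn[OF a0 t] pG dY dG])
  hence "norm (EH ?z ?z x t) <= 40 * c ^ 5 * (e^2 * (c ^ 4 * e^2) + e * (c^2 * e^2 * exp (- t / 400))) + c * e ^ 4"
   unfolding eq by (intro norm_triangle_le add_mono ph(6)[OF t])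
  also have "... = (40 * c ^ 9 + c) * e ^ 4 + 40 * c ^ 7 * e ^ 3 * exp (- t / 400)"
   by (simp add: eval_nat_numeral algebra_simps)
  also have "... <= 41 * c ^ 9 * e ^ 4 + 40 * c ^ 7 * e^2 * exp (- t / 400)"
   using cp[of 1 9] e0 c0 eps[of 2 3] by (intro add_mono mult_right_mono mult_left_mono) auto
  finally show ?thesis .
 qed
 define Mc where "Mc Zc Zs x t = (1 / e^2 * exp (- (lam * e^2) * t)) *\<^sub>R duhamel e (EH Zc Zs) x t" for Zc Zs x t
 define Ms where "Ms Zc Zs x t = (1 / (e ^ 3 * L) * exp (- (lam * e^2) * t)) *\<^sub>R duhamel e (SH Zc Zs) x t" for Zc Zs x t
 have Mcb: "bcs I (Mc Zc Zs)" and Msb: "bcs I (Ms Zc Zs)" if "bcs I Zc" "bcs I Zs" for Zc Zs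
  using exp_weight_bcs[OF duhamel_bcs[OF EHb[OF that, unfolded I_def]]] exp_weight_bcs[OF duhamel_bcs[OF SHb[OF that, unfolded I_def]]]
  unfolding Mc_def[abs_def] Ms_def[abs_def] I_def by blast+
 have evi: "exp (- (lam * e^2) * t) = 1 / ev t" for t by (simp add: ev_def exp_minus field_simps)
 have evint: "((%s. ev s) has_integral (ev t - 1) / (lam * e^2)) {0..t}" if "t : I" for t
  unfolding ev_def by (rule has_integral_exp) (use that lam0 e0 in "auto simp: I_def")
 note Itau = I_def[unfolded tau_def]
 have McD: "norm (Mc Zc Zs x t - Mc Zc' Zs' x t) <= De / 4"
  and MsD: "norm (Ms Zc Zs x t - Ms Zc' Zs' x t) <= De / 4"
  if a: "adm Zc Zs" and a': "adm Zc' Zs'" and t: "t : I" and D: "0 <= De"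
   and d: "!!x s. s : I ==> norm (Zc x s - Zc' x s) <= e^2 * ev s * De" "!!x s. s : I ==> norm (Zs x s - Zs' x s) <= e ^ 3 * L * ev s * De"
  for Zc Zs Zc' Zs' x t De
 proof -
  note b = admb[OF a] and b' = admb[OF a']
  have st: "s : I" if "s : {0..t}" for s using that t by (auto simp: I_def)
  have "norm (duhamel e (%x s. EH Zc Zs x s - EH Zc' Zs' x s) x t) <= c * (40 * c ^ 5 * (c + L) * e ^ 4 * De * ((ev t - 1) / (lam * e^2)))"
  proof (rule flow_duhamel_le[OF fpc e0])
   show "bcs {0..T / e^2} (%x s. EH Zc Zs x s - EH Zc' Zs' x s)"
    using bcs_diff[OF EHb[OF b] EHb[OF b']] by (simp add: Itau)
   show "t : {0..T / e^2}" using t by (simp add: Itau)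
   show "((%s. 40 * c ^ 5 * (c + L) * e ^ 4 * De * ev s) has_integral 40 * c ^ 5 * (c + L) * e ^ 4 * De * ((ev t - 1) / (lam * e^2))) {0..t}"
    by (intro has_integral_mult_right evint t)
   show "norm (EH Zc Zs x s - EH Zc' Zs' x s) <= 40 * c ^ 5 * (c + L) * e ^ 4 * De * ev s" if "s : {0..t}" for x s
    using EHdiff[OF a a' st[OF that] d[OF st[OF that]], of x] by (simp add: eval_nat_numeral algebra_simps)
  qed
  also have "... = (ev t - 1) * De * e^2 / 4"
  proof -
   have q: "c + L \<noteq> 0" "c \<noteq> 0" "e \<noteq> 0" using c0 L1 e0 by auto
   show ?thesis unfolding lam_def using q by (simp add: divide_simps eval_nat_numeral)
  qed
  also have "... <= ev t * De * e^2 / 4" using D by (intro divide_right_mono mult_right_mono) auto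
  finally have 1: "norm (duhamel e (%x s. EH Zc Zs x s - EH Zc' Zs' x s) x t) <= ev t * De * e^2 / 4" .
  have dd: "duhamel e (%x s. EH Zc Zs x s - EH Zc' Zs' x s) x t = duhamel e (EH Zc Zs) x t - duhamel e (EH Zc' Zs') x t"
   by (rule duhamel_diff[OF EHb[OF b, unfolded I_def] EHb[OF b', unfolded I_def] t[unfolded I_def]])
  have "norm (Mc Zc Zs x t - Mc Zc' Zs' x t) = 1 / e^2 * (1 / ev t) * norm (duhamel e (%x s. EH Zc Zs x s - EH Zc' Zs' x s) x t)"
   unfolding Mc_def dd evi scaleR_diff_right[symmetric] norm_scaleR using e0 ev0[of t] by simp
  also have "... <= 1 / e^2 * (1 / ev t) * (ev t * De * e^2 / 4)" using 1 e0 ev0[of t] by (intro mult_left_mono) auto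
  also have "... = De / 4" using e0 ev0[of t] by simp
  finally show "norm (Mc Zc Zs x t - Mc Zc' Zs' x t) <= De / 4" .
  have Hd: "bcs I (%x s. H Zc Zs x s - H Zc' Zs' x s)" by (intro bcs_diff Hb b b')
  have SHd: "SH Zc Zs x s - SH Zc' Zs' x s = (H Zc Zs x s - H Zc' Zs' x s) - fmult crit (%y. H Zc Zs y s - H Zc' Zs' y s) x" if "s : I" for x s
   unfolding fmult_diff[OF crit_evs bcs_bcf[OF Hb[OF b] that] bcs_bcf[OF Hb[OF b'] that]] SH_def EH_def by simp
  have "norm (duhamel e (%x s. (H Zc Zs x s - H Zc' Zs' x s) - fmult crit (%y. H Zc Zs y s - H Zc' Zs' y s) x) x t)
   <= 400 * c * (16 * c ^ 3 * e ^ 3 * (c + e * L) * ev t * De)"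
  proof (rule stable_duhamel_le[OF fpc e0 Hd[unfolded Itau] It[OF t]])
   fix x s assume s: "s : {0..t}"
   have "norm (H Zc Zs x s - H Zc' Zs' x s) <= 16 * c ^ 3 * e * (c * (e^2 * ev s * De) + e ^ 3 * L * ev s * De)"
    by (rule Hdiff[OF a a' st[OF s] d[OF st[OF s]]])
   also have "... = 16 * c ^ 3 * e ^ 3 * (c + e * L) * ev s * De" by (simp add: eval_nat_numeral algebra_simps)
   also have "... <= 16 * c ^ 3 * e ^ 3 * (c + e * L) * ev t * De"
    using evm[of s t] s c0 e0 L1 D by (intro mult_right_mono mult_left_mono) auto
   finally show "norm (H Zc Zs x s - H Zc' Zs' x s) <= 16 * c ^ 3 * e ^ 3 * (c + e * L) * ev t * De" .
  qed
  also have "... = (6400 * c ^ 5 + 6400 * c ^ 4 * e * L) * (e ^ 3 * ev t * De)" by (simp add: eval_nat_numeral algebra_simps)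
  also have "... <= (L / 4) * (e ^ 3 * ev t * De)"
  proof (rule mult_right_mono)
   have "6400 * c ^ 4 * e <= 1 / 8" using e4 by simp
   from mult_right_mono[OF this, of L] L1 have "6400 * c ^ 4 * e * L <= L / 8" by simp
   thus "6400 * c ^ 5 + 6400 * c ^ 4 * e * L <= L / 4" by (simp add: L_def)
  qed (use e0 ev0[of t] D in auto)
  finally have 2: "norm (duhamel e (%x s. (H Zc Zs x s - H Zc' Zs' x s) - fmult crit (%y. H Zc Zs y s - H Zc' Zs' y s) x) x t) <= (L / 4) * (e ^ 3 * ev t * De)" .
  have "duhamel e (SH Zc Zs) x t - duhamel e (SH Zc' Zs') x t = duhamel e (%x s. SH Zc Zs x s - SH Zc' Zs' x s) x t"
   by (rule duhamel_diff[OF SHb[OF b, unfolded I_def] SHb[OF b', unfolded I_def] t[unfolded I_def], symmetric])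
  also have "... = duhamel e (%x s. (H Zc Zs x s - H Zc' Zs' x s) - fmult crit (%y. H Zc Zs y s - H Zc' Zs' y s) x) x t"
   unfolding duhamel_def by (rule integral_cong) (use SHd st in simp)
  finally have de: "duhamel e (SH Zc Zs) x t - duhamel e (SH Zc' Zs') x t = duhamel e (%x s. (H Zc Zs x s - H Zc' Zs' x s) - fmult crit (%y. H Zc Zs y s - H Zc' Zs' y s) x) x t" .
  have "norm (Ms Zc Zs x t - Ms Zc' Zs' x t) = 1 / (e ^ 3 * L) * (1 / ev t) * norm (duhamel e (SH Zc Zs) x t - duhamel e (SH Zc' Zs') x t)"
   unfolding Ms_def evi scaleR_diff_right[symmetric] norm_scaleR using e0 ev0[of t] L1 by simp
  also have "... <= 1 / (e ^ 3 * L) * (1 / ev t) * ((L / 4) * (e ^ 3 * ev t * De))" using 2 e0 ev0[of t] L1 unfolding de by (intro mult_left_mono) auto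
  also have "... = De / 4" using e0 ev0[of t] L1 by simp
  finally show "norm (Ms Zc Zs x t - Ms Zc' Zs' x t) <= De / 4" .
 qed
 have Mc0: "norm (Mc ?z ?z x t) <= D / 2" if t: "t : I" for x t
 proof -
  have st: "s : I" if "s : {0..t}" for s using that t by (auto simp: I_def)
  have t0: "0 <= t" "e^2 * t <= T" using t tauT e0 mult_left_mono[of t tau "e^2"] by (auto simp: I_def)
  have "norm (duhamel e (EH ?z ?z) x t) <= c * (41 * c ^ 9 * e ^ 4 * t + 40 * c ^ 7 * e^2 * ((exp ((- 1 / 400) * t) - 1) / (- 1 / 400)))"
  proof (rule flow_duhamel_le[OF fpc e0 EHb[OF zb zb, unfolded Itau] It[OF t]])
   have "((%s. 41 * c ^ 9 * e ^ 4) has_integral (t - 0) *\<^sub>R (41 * c ^ 9 * e ^ 4)) {0..t}"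
    using has_integral_const_real[of "41 * c ^ 9 * e ^ 4" 0 t] t0 by simp
   thus "((%s. 41 * c ^ 9 * e ^ 4 + 40 * c ^ 7 * e^2 * exp ((- 1 / 400) * s)) has_integral 41 * c ^ 9 * e ^ 4 * t + 40 * c ^ 7 * e^2 * ((exp ((- 1 / 400) * t) - 1) / (- 1 / 400))) {0..t}"
    using t0 by (intro has_integral_add has_integral_mult_right has_integral_exp) (simp_all add: mult_ac)
   show "norm (EH ?z ?z x s) <= 41 * c ^ 9 * e ^ 4 + 40 * c ^ 7 * e^2 * exp ((- 1 / 400) * s)" if "s : {0..t}" for x s
    using EH0[OF st[OF that], of x] by simp
  qed
  also have "... = e^2 * (41 * c ^ 10 * (e^2 * t) + 16000 * c ^ 8 * (1 - exp ((- 1 / 400) * t)))"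
   by (simp add: eval_nat_numeral algebra_simps)
  also have "... <= e^2 * (41 * c ^ 10 * T + 16000 * c ^ 8 * 1)"
   using t0 c0 by (intro mult_left_mono add_mono) auto
  also have "... <= e^2 * (D / 2)" using c0 by (intro mult_left_mono) (auto simp: D_def)
  finally have 1: "norm (duhamel e (EH ?z ?z) x t) <= e^2 * (D / 2)" .
  have "norm (Mc ?z ?z x t) = 1 / e^2 * (1 / ev t) * norm (duhamel e (EH ?z ?z) x t)"
   unfolding Mc_def evi norm_scaleR using e0 ev0[of t] by simp
  also have "... <= 1 / e^2 * 1 * (e^2 * (D / 2))"
   using 1 e0 ev0[of t] ev1[OF t] by (intro mult_mono) (auto simp: divide_simps)
  also have "... = D / 2" using e0 by simp
  finally show ?thesis .
 qed
 have Ms0: "norm (Ms ?z ?z x t) <= D / 2" if t: "t : I" for x t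
 proof -
  have st: "s : I" if "s : {0..t}" for s using that t by (auto simp: I_def)
  have "norm (duhamel e (%x s. H ?z ?z x s - fmult crit (%y. H ?z ?z y s) x) x t) <= 400 * c * (33 * c ^ 7 * e ^ 3)"
   by (rule stable_duhamel_le[OF fpc e0 Hb[OF zb zb, unfolded Itau] It[OF t]]) (use H0 st in auto)
  also have "... = e ^ 3 * (13200 * c ^ 8)" by (simp add: eval_nat_numeral algebra_simps)
  also have "... <= e ^ 3 * (D / 2)" using c0 e0 T by (intro mult_left_mono) (auto simp: D_def)
  finally have 1: "norm (duhamel e (SH ?z ?z) x t) <= e ^ 3 * (D / 2)" by (simp add: SH_def[abs_def] EH_def)
  have "norm (Ms ?z ?z x t) = 1 / (e ^ 3 * L) * (1 / ev t) * norm (duhamel e (SH ?z ?z) x t)"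
   unfolding Ms_def evi norm_scaleR using e0 ev0[of t] L1 by simp
  also have "... <= 1 / e ^ 3 * 1 * (e ^ 3 * (D / 2))"
   using 1 e0 ev0[of t] ev1[OF t] L1 by (intro mult_mono) (auto simp: divide_simps)
  also have "... = D / 2" using e0 by simp
  finally show ?thesis .
 qed
 define zc where "zc a = (%x t. (e^2 * exp (lam * e^2 * t)) *\<^sub>R apply_bcontfun a (x, t))" for a :: "(real \<times> real) \<Rightarrow>\<^sub>C jet"
 define zs where "zs a = (%x t. (e ^ 3 * L * exp (lam * e^2 * t)) *\<^sub>R apply_bcontfun a (x, t))" for a :: "(real \<times> real) \<Rightarrow>\<^sub>C jet"
 have zcb: "bcs I (zc a)" "bcs I (zs a)" for a
  unfolding zc_def zs_def I_def by (intro exp_weight_bcs bcs_apply)+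
 define ok where "ok a \<longleftrightarrow> (ALL q. norm (apply_bcontfun a q) <= D) & (ALL t. isJet (%x. apply_bcontfun a (x, t)))" for a :: "(real \<times> real) \<Rightarrow>\<^sub>C jet"
 define S where "S = {ab. ok (fst ab) & ok (snd ab)}"
 have admz: "adm (zc a) (zs b)" if "ok a" "ok b" for a b
  unfolding adm_def
 proof (intro conjI zcb allI ballI)
  fix x t assume t: "t : I"
  have "norm (zc a x t) = e^2 * (ev t * norm (apply_bcontfun a (x, t)))" by (simp add: zc_def ev_def abs_mult)
  also have "... <= e^2 * (ev t * D)" using that ev0[of t] by (intro mult_left_mono) (auto simp: ok_def)
  also have "... <= e^2 * m1" by (intro mult_left_mono evT[OF t]) auto
  finally show "norm (zc a x t) <= e^2 * m1" .
  have "norm (zs b x t) = e ^ 3 * L * (ev t * norm (apply_bcontfun b (x, t)))" using e0 L1 by (simp add: zs_def ev_def abs_mult)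
  also have "... <= e ^ 3 * L * (ev t * D)" using that ev0[of t] e0 L1 by (intro mult_left_mono) (auto simp: ok_def)
  also have "... <= e ^ 3 * L * m1" using e0 L1 by (intro mult_left_mono evT[OF t]) auto
  also have "... = e^2 * (e * (L * m1))" by (simp add: eval_nat_numeral)
  also have "... <= e^2 * 1" by (intro mult_left_mono e3) auto
  finally show "norm (zs b x t) <= e^2" by simp
 qed
 have jetZ: "isJet (%x. zc a x t)" "isJet (%x. zs a x t)" if "ok a" for a t
  using that unfolding zc_def zs_def by (auto simp: ok_def intro!: isJet_scaleR)
 have jetH: "isJet (%x. H (zc a) (zs b) x t)" if "ok a" "ok b" "t : I" for a b t
  unfolding H_def nN_def nB_def nC_def U_def V_def X_def
  by (intro isJet_add isJet_diff isJet_minus isJet_jm isJet_sc[OF Qf] isJet_sc[OF Kf] isJet_fmult crit2_evs jetZ SWJ ESWJ ph that)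
 have jetM: "isJet (%x. Mc (zc a) (zs b) x t)" "isJet (%x. Ms (zc a) (zs b) x t)" if "ok a" "ok b" "t : I" for a b t
 proof -
  have "isJet (%x. EH (zc a) (zs b) x s)" if "s : {0..tau}" for s
   unfolding EH_def by (intro isJet_fmult crit_evs jetH) (use \<open>ok a\<close> \<open>ok b\<close> that in "auto simp: I_def")
  moreover have "isJet (%x. SH (zc a) (zs b) x s)" if "s : {0..tau}" for s
   unfolding SH_def EH_def by (intro isJet_diff isJet_fmult crit_evs jetH) (use \<open>ok a\<close> \<open>ok b\<close> that in "auto simp: I_def")
  ultimately show "isJet (%x. Mc (zc a) (zs b) x t)" "isJet (%x. Ms (zc a) (zs b) x t)"
   unfolding Mc_def Ms_def
   by (intro isJet_scaleR isJet_duhamel[OF EHb[OF zcb, unfolded I_def]] isJet_duhamel[OF SHb[OF zcb, unfolded I_def]];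
    use that in "auto simp: I_def")+
 qed
 define F where "F ab = (toB tau (Mc (zc (fst ab)) (zs (snd ab))), toB tau (Ms (zc (fst ab)) (zs (snd ab))))" for ab
 note apF = toB_apply[OF Mcb[OF zcb, unfolded I_def] tau0] toB_apply[OF Msb[OF zcb, unfolded I_def] tau0]
 have clI: "clip tau t : I" for t using clip_mem[OF tau0] by (simp add: I_def)
 have zd: "norm (zc a x s - zc a' x s) <= e^2 * ev s * De" "norm (zs b x s - zs b' x s) <= e ^ 3 * L * ev s * De"
  if "!!q. norm (apply_bcontfun a q - apply_bcontfun a' q) <= De" "!!q. norm (apply_bcontfun b q - apply_bcontfun b' q) <= De"
  for a a' b b' x s De
  unfolding zc_def zs_def scaleR_diff_right[symmetric] norm_scaleR ev_def[symmetric]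
  using that ev0[of s] e0 L1 by (auto simp: abs_mult intro!: mult_left_mono)
 have contr: "dist (F ab) (F ab') <= 1 / 2 * dist ab ab'" if "ab : S" "ab' : S" for ab ab'
 proof -
  obtain a b a' b' where ab: "ab = (a, b)" "ab' = (a', b')" by (cases ab, cases ab')
  have ok: "ok a" "ok b" "ok a'" "ok b'" using that by (auto simp: S_def ab)
  let ?d = "dist ab ab'"
  have da: "norm (apply_bcontfun a q - apply_bcontfun a' q) <= ?d" for q
   using dist_bounded[of a q a'] dist_fst_le[of ab ab'] by (simp add: ab dist_norm)
  have db: "norm (apply_bcontfun b q - apply_bcontfun b' q) <= ?d" for q
   using dist_bounded[of b q b'] dist_snd_le[of ab ab'] by (simp add: ab dist_norm)
  have "dist (fst (F ab)) (fst (F ab')) <= ?d / 4"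
   by (rule dist_bound) (use McD[OF admz[OF ok(1,2)] admz[OF ok(3,4)] clI zero_le_dist zd(1)[OF da db] zd(2)[OF da db]] in "auto simp: F_def ab apF dist_norm")
  moreover have "dist (snd (F ab)) (snd (F ab')) <= ?d / 4"
   by (rule dist_bound) (use MsD[OF admz[OF ok(1,2)] admz[OF ok(3,4)] clI zero_le_dist zd(1)[OF da db] zd(2)[OF da db]] in "auto simp: F_def ab apF dist_norm")
  ultimately show ?thesis
   using sqrt_sum_squares_le_sum[of "dist (fst (F ab)) (fst (F ab'))" "dist (snd (F ab)) (snd (F ab'))"]
   by (simp add: dist_prod_def)
 qed
 have z0: "zc 0 = ?z" "zs 0 = ?z" by (auto simp: zc_def zs_def)
 have ok0: "ok 0" using D0 by (auto simp: ok_def isJet_def bcf_def jc_def zero_prod_def)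
 have self: "F ` S \<subseteq> S"
 proof (rule image_subsetI)
  fix ab assume abS: "ab : S"
  obtain a b where ab: "ab = (a, b)" by (cases ab)
  have ok: "ok a" "ok b" using abS by (auto simp: S_def ab)
  have nD: "norm (apply_bcontfun a q - apply_bcontfun 0 q) <= D" "norm (apply_bcontfun b q - apply_bcontfun 0 q) <= D" for q
   using conjunct1[OF ok(1)[unfolded ok_def], rule_format, of q] conjunct1[OF ok(2)[unfolded ok_def], rule_format, of q] by simp_all
  note zdd = zd(1)[OF nD, unfolded z0] zd(2)[OF nD, unfolded z0]
  have "norm (Mc (zc a) (zs b) x t) <= D" "norm (Ms (zc a) (zs b) x t) <= D" if t: "t : I" for x t
  proof -
   have "norm (Mc (zc a) (zs b) x t - Mc ?z ?z x t) <= D / 4"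
    by (rule McD[OF admz[OF ok] a0 t D0 zdd])
   thus "norm (Mc (zc a) (zs b) x t) <= D"
    using Mc0[OF t, of x] norm_triangle_sub[of "Mc (zc a) (zs b) x t" "Mc ?z ?z x t"] D0 by linarith
   have "norm (Ms (zc a) (zs b) x t - Ms ?z ?z x t) <= D / 4"
    by (rule MsD[OF admz[OF ok] a0 t D0 zdd])
   thus "norm (Ms (zc a) (zs b) x t) <= D"
    using Ms0[OF t, of x] norm_triangle_sub[of "Ms (zc a) (zs b) x t" "Ms ?z ?z x t"] D0 by linarith
  qed
  thus "F ab : S"
   using jetM[OF ok clI] clI by (auto simp: S_def ok_def F_def apF ab)
 qed
 have closed: "closed S"
  unfolding closed_sequential_limits
 proof safe
  fix X :: "nat => ((real \<times> real) \<Rightarrow>\<^sub>C jet) \<times> ((real \<times> real) \<Rightarrow>\<^sub>C jet)" and a b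
  assume X: "ALL n. X n : S" "X \<longlonglongrightarrow> (a, b)"
  have okl: "ok a" if "!!n. ok (Y n)" "Y \<longlonglongrightarrow> a" for Y a
   unfolding ok_def
  proof (intro conjI allI)
   have l: "(%n. apply_bcontfun (Y n) q) \<longlonglongrightarrow> apply_bcontfun a q" for q
   proof (rule metric_LIMSEQ_I)
    fix a0 :: real assume "0 < a0"
    from metric_LIMSEQ_D[OF that(2) this] obtain N where N: "ALL n>=N. dist (Y n) a < a0" ..
    thus "EX N. ALL n>=N. dist (apply_bcontfun (Y n) q) (apply_bcontfun a q) < a0"
    using dist_bounded[of "Y _" q a] le_less_trans by blast
   qed
   have n: "norm (apply_bcontfun (Y n) q) <= D" for n q using that(1) unfolding ok_def by blast
   show "norm (apply_bcontfun a q) <= D" for q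
    by (rule Lim_norm_ubound[OF _ l]) (use n in auto)
   show "isJet (%x. apply_bcontfun a (x, t))" for t
   proof (rule isJet_limit[where f="%n x. apply_bcontfun (Y n) (x, t)" and B=D])
    show "bcf (%x. apply_bcontfun a (x, t))" by (rule bcs_bcf[OF bcs_apply[of UNIV]]) simp
   qed (use that(1) n l in "auto simp: ok_def")
  qed
  show "(a, b) : S"
   using okl[of "%n. fst (X n)" a] okl[of "%n. snd (X n)" b] X tendsto_fst[OF X(2)] tendsto_snd[OF X(2)]
   by (auto simp: S_def)
 qed
 have "EX! ab:S. F ab = ab"
 proof (rule Banach_fix[OF closed[folded complete_eq_closed], where c="1/2"])
  show "S \<noteq> {}" using ok0 by (auto simp: S_def intro!: exI[of _ 0])
 qed (use self contr in auto)
 then obtain a b where fp: "(a, b) : S" "F (a, b) = (a, b)" by auto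
 hence ok: "ok a" "ok b" by (auto simp: S_def)
 let ?Zc = "zc a" and ?Zs = "zs b"
 have adm: "adm ?Zc ?Zs" by (rule admz[OF ok])
 note b = admb[OF adm]
 have Zc: "?Zc x t = duhamel e (EH ?Zc ?Zs) x t" and Zs: "?Zs x t = duhamel e (SH ?Zc ?Zs) x t" if t: "t : I" for x t
 proof -
  have cl: "clip tau t = t" using t by (simp add: I_def clip_id)
  have "apply_bcontfun a (x, t) = Mc ?Zc ?Zs x t" "apply_bcontfun b (x, t) = Ms ?Zc ?Zs x t"
   using arg_cong[OF fp(2), of "%ab. apply_bcontfun (fst ab) (x, t)"] arg_cong[OF fp(2), of "%ab. apply_bcontfun (snd ab) (x, t)"]
   by (simp_all add: F_def apF cl)
  thus "?Zc x t = duhamel e (EH ?Zc ?Zs) x t" "?Zs x t = duhamel e (SH ?Zc ?Zs) x t"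
   using e0 L1 by (simp_all add: zc_def[of a] zs_def[of b] Mc_def Ms_def exp_minus)
 qed
 define W where "W x t = V ?Zc x t + X ?Zs x t" for x t
 have Wb: "bcs I W" unfolding W_def[abs_def] by (intro bcs_add Vb Xb b)
 have Ee: "fmult crit2 (fmult crit f) x = fmult crit f x" if "bcf f" for f :: "real => jet" and x
  using fmult_fmult[OF crit2_evs crit_evs that, of x] by (simp add: crit2_crit)
 (* the outer cut-off in \<open>V\<close> only serves to make the critical part exactly critical; at the fixed point it acts as the identity *)
 have VZ: "V ?Zc x t = ESW x t + ?Zc x t" if t: "t : I" for x t
 proof -
  have "V ?Zc x t = fmult crit2 (%y. ESW y t) x + fmult crit2 (%y. ?Zc y t) x"
   unfolding V_def by (rule fmult_add[OF crit2_evs bcs_bcf[OF ESWb t] bcs_bcf[OF b(1) t]])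
  also have "fmult crit2 (%y. ESW y t) x = ESW x t"
   unfolding ESW_def by (rule Ee[OF bcs_bcf[OF SWb t]])
  also have "fmult crit2 (%y. ?Zc y t) x = fmult crit2 (%y. duhamel e (EH ?Zc ?Zs) y t) x"
   using Zc[OF t] by simp
  also have "... = duhamel e (%x s. fmult crit2 (%y. EH ?Zc ?Zs y s) x) x t"
   by (rule fmult_duhamel[OF crit2_evs EHb[OF b, unfolded I_def] t[unfolded I_def]])
  also have "... = duhamel e (EH ?Zc ?Zs) x t"
   unfolding duhamel_def
  proof (rule integral_cong)
   fix s assume s: "s : {0..t}"
   have "s : I" using s t by (auto simp: I_def)
   hence "fmult crit2 (%y. EH ?Zc ?Zs y s) = (%x. EH ?Zc ?Zs x s)"
    unfolding EH_def using Ee[OF bcs_bcf[OF Hb[OF b]]] by blast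
   thus "exp (e^2 * (t - s)) *\<^sub>R sg (t - s) (%y. fmult crit2 (%y. EH ?Zc ?Zs y s) y) x = exp (e^2 * (t - s)) *\<^sub>R sg (t - s) (%y. EH ?Zc ?Zs y s) x"
    by simp
  qed
  finally show ?thesis by (simp add: Zc[OF t])
 qed
 have Weq: "W x t = SW x t + duhamel e (H ?Zc ?Zs) x t" if t: "t : I" for x t
 proof -
  have "W x t = SW x t + (duhamel e (EH ?Zc ?Zs) x t + duhamel e (SH ?Zc ?Zs) x t)"
   unfolding W_def VZ[OF t] X_def Zc[OF t] Zs[OF t] by simp
  also have "duhamel e (EH ?Zc ?Zs) x t + duhamel e (SH ?Zc ?Zs) x t = duhamel e (%x s. EH ?Zc ?Zs x s + SH ?Zc ?Zs x s) x t"
   by (rule duhamel_add[OF EHb[OF b, unfolded I_def] SHb[OF b, unfolded I_def] t[unfolded I_def], symmetric])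
  also have "(%x s. EH ?Zc ?Zs x s + SH ?Zc ?Zs x s) = H ?Zc ?Zs" by (simp add: SH_def fun_eq_iff)
  finally show ?thesis .
 qed
 have HW: "H ?Zc ?Zs = (%x s. nN jm Q K (%y. Ph y s + W y s) x - nN jm Q K (%y. Ph y s) x + r x s)"
  by (simp add: H_def[abs_def] U_def W_def)
 have "isJet (%x. W x t)" if t: "t : I" for t
  unfolding W_def V_def X_def by (intro isJet_add isJet_diff isJet_fmult crit2_evs jetZ SWJ ESWJ ok t)
 thus ?thesis
  using Wb Weq Wn[OF adm] unfolding HW W_def[symmetric] SW_def[symmetric] Itau by blast
qed

theorem error_equation_solvable:
 assumes T: "0 < T"
 shows "EX d0>0. EX C. ALL e Ph r W0. 0 < e --> e < d0 --> fp_data c T e Ph r W0 -->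
  (EX W. bcs {0..T / e^2} W & (ALL t:{0..T / e^2}. isJet (%x. W x t) & (ALL x. norm (W x t) <= C * e^2 &
   W x t = exp (e^2 * t) *\<^sub>R sg t W0 x + duhamel e (%x s. nN jm Q K (%y. Ph y s + W y s) x - nN jm Q K (%y. Ph y s) x + r x s) x t)))"
proof -
 define L where "L = 51200 * c ^ 5"
 define lam where "lam = 160 * c ^ 6 * (c + L)"
 define D where "D = 2 * (41 * c ^ 10 * T + 16000 * c ^ 8 + 19600 * c ^ 8)"
 define m1 where "m1 = exp (lam * T) * D"
 have c0: "0 < c" using c1[OF fpc] by simp
 have "0 <= m1" using T c0 by (simp add: m1_def D_def)
 hence pos: "0 < 4 * c ^ 3 + m1" "0 < L * m1 + 1" "0 < 51200 * c ^ 4" using c0 by (simp_all add: L_def add_pos_nonneg add_nonneg_pos)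
 define e0 where "e0 = min 1 (min (1 / (4 * c ^ 3 + m1)) (min (1 / (L * m1 + 1)) (1 / (51200 * c ^ 4))))"
 have "0 < e0" using pos by (simp add: e0_def)
 moreover have "EX W. bcs {0..T / e^2} W & (ALL t:{0..T / e^2}. isJet (%x. W x t) & (ALL x. norm (W x t) <= (4 * c ^ 4 + c * m1) * e^2 &
   W x t = exp (e^2 * t) *\<^sub>R sg t W0 x + duhamel e (%x s. nN jm Q K (%y. Ph y s + W y s) x - nN jm Q K (%y. Ph y s) x + r x s) x t))"
  if e: "0 < e" "e < e0" and d: "fp_data c T e Ph r W0" for e Ph r W0
 proof -
  have "e <= 1" "e <= 1 / (4 * c ^ 3 + m1)" "e <= 1 / (L * m1 + 1)" "e <= 1 / (51200 * c ^ 4)"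
   using e(2) by (auto simp: e0_def)
  hence "e <= 1" "e * (4 * c ^ 3 + m1) <= 1" "e * (L * m1 + 1) <= 1" "e * (51200 * c ^ 4) <= 1"
   using pos by (simp_all only: pos_le_divide_eq)
  hence "e <= 1" "e * (4 * c ^ 3 + m1) <= 1" "e * (L * m1) <= 1" "51200 * c ^ 4 * e <= 1"
   using e(1) by (simp_all add: algebra_simps)
  from fixed_point_small[OF T e(1) this(1) this(2-4)[unfolded L_def m1_def lam_def D_def] d]
  show ?thesis unfolding L_def m1_def lam_def D_def .
 qed
 ultimately show ?thesis by blast
qed

end

section \<open>Signed measures\<close>

definition bbf :: "(real => real) => bool" where
 "bbf f \<longleftrightarrow> f : borel_measurable borel & (EX B. ALL x. abs (f x) <= B)"

lemma bbf_bound: assumes "bbf f" obtains B where "0 <= B" "!!x. abs (f x) <= B"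
 using assms unfolding bbf_def by (meson abs_ge_zero order_trans)

lemma bbfI: "f : borel_measurable borel ==> (!!x. abs (f x) <= B) ==> bbf f"
 by (auto simp: bbf_def)

lemma bbf_add: assumes "bbf f" "bbf g" shows "bbf (%x. f x + g x)"
proof -
 obtain B C where "!!x. abs (f x) <= B" "!!x. abs (g x) <= C" using assms by (metis bbf_bound)
 hence "abs (f x + g x) <= B + C" for x by (intro order_trans[OF abs_triangle_ineq] add_mono)
 thus ?thesis using assms by (intro bbfI[where B="B + C"]) (auto simp: bbf_def)
qed

lemma bbf_mult: assumes "bbf f" "bbf g" shows "bbf (%x. f x * g x)"
proof -
 obtain B C where "0 <= B" "!!x. abs (f x) <= B" "!!x. abs (g x) <= C" using assms by (metis bbf_bound)
 hence "abs (f x * g x) <= B * C" for x unfolding abs_mult by (intro mult_mono) auto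
 thus ?thesis using assms by (intro bbfI[where B="B * C"]) (auto simp: bbf_def)
qed

lemma bbf_const: "bbf (%_. c)" by (rule bbfI[of _ "abs (c)"]) auto

lemma bbf_indicator: "A : sets borel ==> bbf (indicator A)"
 by (rule bbfI[of _ 1]) (auto simp: indicator_def)

text \<open>The representing pair of a signed measure is not unique, so integrals have to be recovered from the values on sets: rounding \<open>f\<close> to multiples of \<open>1 / n\<close> gives a finite combination of indicators at distance \<open>1 / n\<close>.\<close>

lemma functional_vanishes:
 fixes L :: "(real => real) => real"
 assumes add: "!!f g. bbf f ==> bbf g ==> L (%x. f x + g x) = L f + L g"
  and mult: "!!f c. bbf f ==> L (%x. c * f x) = c * L f"
  and bnd: "!!f B. bbf f ==> 0 <= B ==> (!!x. abs (f x) <= B) ==> abs (L f) <= C * B"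
  and ind: "!!A. A : sets borel ==> L (indicator A) = 0"
  and f: "bbf f"
 shows "L f = 0"
proof -
 obtain B where B: "0 <= B" "!!x. abs (f x) <= B" using bbf_bound[OF f] by blast
 have [measurable]: "f : borel_measurable borel" using f by (simp add: bbf_def)
 have sums: "bbf (%x. \<Sum>i\<in>J. g i x) & L (%x. \<Sum>i\<in>J. g i x) = (\<Sum>i\<in>J. L (g i))"
  if "finite J" "!!i. bbf (g i)" for J and g :: "int => real => real"
  using that(1)
 proof induction
  case empty
  thus ?case using mult[OF bbf_const, of 0] by (simp add: bbf_const)
 next
  case (insert i J)
  thus ?case using add[OF that(2), of "%x. \<Sum>i\<in>J. g i x" i] bbf_add[OF that(2), of "%x. \<Sum>i\<in>J. g i x" i] by simp
 qed
 have n: "abs (L f) <= C / real n" if n0: "0 < n" for n :: nat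
 proof -
  define g where "g j x = (j / n) * indicator {x. \<lfloor>n * f x\<rfloor> = j} x" for j :: int and x
  define J where "J = {\<lfloor>- (n * B)\<rfloor>..\<lfloor>n * B\<rfloor>}"
  have g: "bbf (g j)" for j
   unfolding g_def by (intro bbf_mult bbf_const bbf_indicator) measurable
  have mem: "\<lfloor>n * f x\<rfloor> : J" for x
  proof -
   have "abs (n * f x) <= n * B" using B(2)[of x] by (simp add: abs_mult mult_left_mono)
   hence "n * f x <= n * B" "- (n * B) <= n * f x" by auto
   thus ?thesis unfolding J_def by (auto intro!: floor_mono)
  qed
  have eq: "(\<Sum>j\<in>J. g j x) = \<lfloor>n * f x\<rfloor> / n" for x
  proof -
   have "(\<Sum>j\<in>J. g j x) = (\<Sum>j\<in>J. if j = \<lfloor>n * f x\<rfloor> then j / n else 0)"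
    by (rule sum.cong) (auto simp: g_def indicator_def)
   also have "... = \<lfloor>n * f x\<rfloor> / n" using mem[of x] by (simp add: sum.delta J_def)
   finally show ?thesis .
  qed
  have Jf: "finite J" by (simp add: J_def)
  note s = sums[OF Jf, of g, OF g]
  have Lg: "L (g j) = 0" for j
   unfolding g_def using mult[OF bbf_indicator, of "{x. \<lfloor>n * f x\<rfloor> = j}" "j / n"] ind[of "{x. \<lfloor>n * f x\<rfloor> = j}"] by simp
  have d: "bbf (%x. f x - (\<Sum>j\<in>J. g j x))"
   using bbf_add[OF f bbf_mult[OF bbf_const[of "-1"] conjunct1[OF s]]] by simp
  have "L f = L (%x. f x - (\<Sum>j\<in>J. g j x)) + L (%x. \<Sum>j\<in>J. g j x)"
   using add[OF d conjunct1[OF s]] by simp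
  also have "L (%x. \<Sum>j\<in>J. g j x) = 0" using s Lg by simp
  finally have Lf: "L f = L (%x. f x - (\<Sum>j\<in>J. g j x))" by simp
  have "abs (f x - (\<Sum>j\<in>J. g j x)) <= 1 / n" for x
  proof -
   have "f x - \<lfloor>n * f x\<rfloor> / n = (n * f x - \<lfloor>n * f x\<rfloor>) / n" using n0 by (simp add: field_simps)
   moreover have "\<bar>n * f x - \<lfloor>n * f x\<rfloor>\<bar> <= 1" by linarith
   ultimately show ?thesis unfolding eq using n0 by (simp add: divide_right_mono)
  qed
  thus ?thesis unfolding Lf using bnd[OF d, of "1 / n"] by simp
 qed
 have "(%n. C / real n) \<longlonglongrightarrow> 0" by (rule lim_const_over_n)
 hence "abs (L f) <= 0"
  by (rule LIMSEQ_le_const) (intro exI[of _ 1] allI impI n, simp)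
 thus ?thesis by simp
qed

lemma sm_integrable:
 assumes "finite_signed mu" "bbf f" shows "integrable (fst mu) f" "integrable (snd mu) f"
proof -
 obtain B where B: "!!x. abs (f x) <= B" using assms(2) by (metis bbf_bound)
 have m: "f : borel_measurable borel" using assms(2) by (simp add: bbf_def)
 have s: "sets (fst mu) = sets borel" "sets (snd mu) = sets borel"
  and fin: "finite_measure (fst mu)" "finite_measure (snd mu)" using assms(1) by (auto simp: finite_signed_def)
 have m': "f : borel_measurable (fst mu)" "f : borel_measurable (snd mu)" using m s by (simp_all cong: measurable_cong_sets)
 show "integrable (fst mu) f" by (rule finite_measure.integrable_const_bound[OF fin(1) _ m'(1), where B=B]) (use B in auto)
 show "integrable (snd mu) f" by (rule finite_measure.integrable_const_bound[OF fin(2) _ m'(2), where B=B]) (use B in auto)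
qed

lemma sm_add: "finite_signed mu ==> bbf f ==> bbf g ==> sm_integral mu (%x. f x + g x) = sm_integral mu f + sm_integral mu g"
 by (simp add: sm_integral_def sm_integrable)

lemma sm_cmult: "sm_integral mu (%x. c * f x) = c * (sm_integral mu f :: real)"
 by (simp add: sm_integral_def right_diff_distrib)

lemma sm_bound:
 assumes "finite_signed mu" "bbf f" "!!x. abs (f x) <= B" shows "abs (sm_integral mu f) <= mass mu * B"
proof -
 have fin: "finite_measure (fst mu)" "finite_measure (snd mu)" using assms(1) by (auto simp: finite_signed_def)
 have *: "abs (LINT x|M. f x) <= measure M (space M) * B" if "finite_measure M" "integrable M f" for M
 proof -
  interpret finite_measure M by (rule that(1))
  have "abs (LINT x|M. f x) <= (LINT x|M. B)"
   by (rule order_trans[OF integral_abs_bound]) (intro integral_mono integrable_abs that(2) assms(3) integrable_const)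
  thus ?thesis by simp
 qed
 show ?thesis
  using *[OF fin(1) sm_integrable(1)[OF assms(1,2)]] *[OF fin(2) sm_integrable(2)[OF assms(1,2)]]
  unfolding sm_integral_def mass_def by (simp add: distrib_right)
qed

lemma sm_indicator: "finite_signed mu ==> A : sets borel ==> sm_integral mu (indicator A) = sm_val mu A"
 by (simp add: sm_integral_def sm_val_def finite_signed_def)

lemma sm_symmetric_integral:
 assumes mu: "finite_signed mu" "sm_symmetric mu" and f: "bbf f"
 shows "sm_integral mu (%x. f (- x)) = sm_integral mu f"
proof -
 have r: "bbf (%x. f (- x))" if "bbf f" for f
 proof -
  have [measurable]: "f : borel_measurable borel" using that by (simp add: bbf_def)
  show ?thesis using that by (auto simp: bbf_def)
 qed
 have "sm_integral mu (%x. f (- x)) - sm_integral mu f = 0"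
 proof (rule functional_vanishes[OF _ _ _ _ f, where C="2 * mass mu"])
  fix g B assume g: "bbf g" "0 <= B" "!!x::real. abs (g x) <= B"
  show "abs (sm_integral mu (%x. g (- x)) - sm_integral mu g) <= 2 * mass mu * B"
   using sm_bound[OF mu(1) r[OF g(1)] g(3)] sm_bound[OF mu(1) g(1,3)] by linarith
 next
  fix A :: "real set" assume A: "A : sets borel"
  have "(%x::real. indicator A (- x)) = (indicator (uminus ` A) :: real => real)"
   by (auto simp: fun_eq_iff indicator_def image_iff)
  moreover have "uminus ` A = uminus -` A \<inter> space borel" by (force simp: image_iff)
  hence "uminus ` A : sets borel"
   using measurable_sets[of "uminus :: real => real" borel borel A] A by simp
  ultimately show "sm_integral mu (%x. indicator A (- x) :: real) - sm_integral mu (indicator A) = 0"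
   using mu A by (simp add: sm_indicator sm_symmetric_def)
 qed (simp_all add: sm_add[OF mu(1)] r sm_cmult right_diff_distrib)
 thus ?thesis by simp
qed

lemma schwartz_moment:
 assumes "schwartz r" shows "integrable lborel r" "integrable lborel (%x. abs (x) * abs (r x))"
proof -
 have d: "r differentiable (at x)" for x using assms by (auto simp: schwartz_def vderiv_def dest: spec[of _ 0])
 have "bounded (range (%x. x ^ m * r x))" for m using assms by (auto simp: schwartz_def vderiv_def dest: spec[of _ 0])
 hence "EX B. ALL x. abs (x ^ m * r x) <= B" for m by (force simp: bounded_iff)
 then obtain B where B: "!!m x. abs (x ^ m * r x) <= B m" by metis
 have m[measurable]: "r : borel_measurable lborel"
  by (intro continuous_imp_measurable continuous_at_imp_continuous_on ballI differentiable_imp_continuous_within d)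
 have p: "1 + x^2 > 0" for x :: real by (simp add: add_pos_nonneg)
 have a: "abs (r x) * (1 + x^2) <= B 0 + B 2" "abs (x) * abs (r x) * (1 + x^2) <= B 1 + B 3" for x
 proof -
  have "abs (r x) * (1 + x^2) = abs (x ^ 0 * r x) + abs (x ^ 2 * r x)"
   "abs (x) * abs (r x) * (1 + x^2) = abs (x ^ 1 * r x) + abs (x ^ 3 * r x)"
   unfolding power2_abs[symmetric, of x] by (simp_all add: abs_mult power_abs power3_eq_cube power2_eq_square distrib_left mult_ac)
  thus "abs (r x) * (1 + x^2) <= B 0 + B 2" "abs (x) * abs (r x) * (1 + x^2) <= B 1 + B 3"
   using B[of x 0] B[of x 1] B[of x 2] B[of x 3] by simp_all
 qed
 show "integrable lborel r" by (rule integrable_of_recip_quadratic[OF m]) (use a(1) p in "simp add: pos_le_divide_eq")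
 show "integrable lborel (%x. abs (x) * abs (r x))"
  by (rule integrable_of_recip_quadratic) (use a(2) p in "simp_all add: pos_le_divide_eq")
qed

text \<open>On the compact part \<open>\<bar>y\<bar>\<close> is bounded, and the Schwartz density has a finite first moment.\<close>

lemma moment_bound:
 assumes mu: "admissible_kernel mu"
 shows "EX C>=0. ALL f c. bbf f --> 0 <= c --> (ALL y. abs (f y) <= c * abs (y)) --> abs (sm_integral mu f) <= C * c"
proof -
 have fs: "finite_signed mu" using mu by (simp add: admissible_kernel_def)
 obtain r si where r: "schwartz r" and si: "finite_signed si" "sm_compact_support si"
  and rep: "!!A. A : sets borel ==> sm_val mu A = (LINT x:A|lborel. r x) + sm_val si A"
  using mu unfolding admissible_kernel_def by blast
 obtain S where S: "compact S" "!!A. A : sets borel ==> A \<inter> S = {} ==> sm_val si A = 0"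
  using si(2) unfolding sm_compact_support_def by blast
 obtain R where R: "0 <= R" "!!x. x : S ==> abs (x) <= R"
  using compact_imp_bounded[OF S(1)] by (metis bounded_pos less_imp_le real_norm_def)
 have Sb: "S : sets borel" using S(1) by (simp add: borel_compact)
 note i = schwartz_moment[OF r]
 have ri: "integrable lborel (%x. f x * r x)" if f: "bbf f" for f
 proof -
  obtain B where "!!x. abs (f x) <= B" using bbf_bound[OF f] by blast
  thus ?thesis using f by (intro integrable_times_bounded[OF i(1)]) (auto simp: bbf_def)
 qed
 have e1: "sm_integral mu f - (LINT x|lborel. f x * r x) - sm_integral si f = 0" if f: "bbf f" for f
 proof (rule functional_vanishes[OF _ _ _ _ f, where C="mass mu + (LINT x|lborel. abs (r x)) + mass si"])
  fix g B assume g: "bbf g" "0 <= B" "!!x::real. abs (g x) <= B"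
  have "abs (LINT x|lborel. g x * r x) <= (LINT x|lborel. B * abs (r x))"
   by (rule order_trans[OF integral_abs_bound])
    (intro integral_mono integrable_abs ri g integrable_mult_right i, use g in "auto simp: abs_mult intro!: mult_right_mono")
  hence "abs (LINT x|lborel. g x * r x) <= B * (LINT x|lborel. abs (r x))" by simp
  thus "abs (sm_integral mu g - (LINT x|lborel. g x * r x) - sm_integral si g) <= (mass mu + (LINT x|lborel. abs (r x)) + mass si) * B"
   using sm_bound[OF fs g(1,3)] sm_bound[OF si(1) g(1,3)] by (simp add: distrib_right mult.commute[of B])
 next
  fix A :: "real set" assume A: "A : sets borel"
  show "sm_integral mu (indicator A) - (LINT x|lborel. indicator A x * r x) - sm_integral si (indicator A) = 0"
   using rep[OF A] A fs si(1) by (simp add: sm_indicator set_lebesgue_integral_def)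
 qed (simp_all add: sm_add[OF fs] sm_add[OF si(1)] sm_cmult ri distrib_right right_diff_distrib mult.assoc)
 have ic: "bbf (%x. indicator (- S) x)" "bbf (%x. indicator S x)" using Sb by (auto intro!: bbf_indicator)
 have e2: "sm_integral si (%x. f x * indicator (- S) x) = 0" if f: "bbf f" for f
 proof (rule functional_vanishes[OF _ _ _ _ f, where C="mass si"])
  fix g B assume g: "bbf g" "0 <= B" "!!x::real. abs (g x) <= B"
  show "abs (sm_integral si (%x. g x * indicator (- S) x)) <= mass si * B"
   by (rule sm_bound[OF si(1) bbf_mult[OF g(1) ic(1)]]) (use g in "auto simp: indicator_def")
 next
  fix A :: "real set" assume A: "A : sets borel"
  have "(%x. indicator A x * indicator (- S) x :: real) = indicator (A \<inter> - S)" by (auto simp: fun_eq_iff indicator_def)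
  thus "sm_integral si (%x. indicator A x * indicator (- S) x :: real) = 0"
   using S(2)[of "A \<inter> - S"] A Sb si(1) by (simp add: sm_indicator)
 qed (simp_all add: distrib_right sm_add[OF si(1)] bbf_mult ic mult.assoc sm_cmult)
 show ?thesis
 proof (intro exI conjI allI impI)
  let ?C = "(LINT x|lborel. abs (x) * abs (r x)) + mass si * R"
  show "0 <= ?C" using R(1) mass_nonneg by (intro add_nonneg_nonneg integral_nonneg_AE mult_nonneg_nonneg) auto
  fix f :: "real => real" and c :: real assume f: "bbf f" "0 <= c" "ALL y. abs (f y) <= c * abs (y)"
  have "abs (LINT x|lborel. f x * r x) <= (LINT x|lborel. c * (abs (x) * abs (r x)))"
   by (rule order_trans[OF integral_abs_bound])
    (intro integral_mono integrable_abs ri f integrable_mult_right i, use f(3) in "auto simp: abs_mult mult.assoc[symmetric] intro!: mult_right_mono")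
  moreover have "sm_integral si f = sm_integral si (%x. f x * indicator S x)"
  proof -
   have "f x = f x * indicator S x + f x * indicator (- S) x" for x by (auto simp: indicator_def)
   hence "sm_integral si f = sm_integral si (%x. f x * indicator S x + f x * indicator (- S) x)" by presburger
   also have "... = sm_integral si (%x. f x * indicator S x)"
    using sm_add[OF si(1) bbf_mult[OF f(1) ic(2)] bbf_mult[OF f(1) ic(1)]] e2[OF f(1)] by simp
   finally show ?thesis .
  qed
  moreover have "abs (sm_integral si (%x. f x * indicator S x)) <= mass si * (c * R)"
  proof (rule sm_bound[OF si(1) bbf_mult[OF f(1) ic(2)]])
   have "abs (f x) <= c * R" if "x : S" for x using f(3) mult_left_mono[OF R(2)[OF that] f(2)] by (meson order_trans)
   thus "abs (f x * indicator S x) <= c * R" for x using f(2) R(1) by (auto simp: indicator_def)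
  qed
  ultimately show "abs (sm_integral mu f) <= ?C * c" using e1[OF f(1)] by (simp add: algebra_simps)
 qed
qed

section \<open>Modulated waves and smoothing filters\<close>

text \<open>The three properties of a convolution that determine its action on modulated waves: additivity, plane waves as eigenfunctions, and a first moment of the kernel.\<close>

definition wave_op :: "((real => real) => real => real) => (real => real) => real => bool" where
 "wave_op Op s M \<longleftrightarrow> (ALL f g x. bcf f --> bcf g --> Op (%x. f x - g x) x = Op f x - Op g x) &
   (ALL n z x. Op (%y. Re (z * cis (n * y))) x = s n * Re (z * cis (n * x))) &
   (ALL f x c. bcf f --> 0 <= c --> (ALL y. abs (f y) <= c * abs (x - y)) --> abs (Op f x) <= M * c)"

definition wv :: "real => (real => complex) => real => real" where "wv n G x = Re (G x * cis (n * x))"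

lemma wv_bcf: assumes G: "bcf G" shows "bcf (wv n G)"
proof -
 obtain B where B: "!!x. cmod (G x) <= B" using bcf_bound[OF G] by blast
 have "abs (wv n G x) <= B" for x
  unfolding wv_def using abs_Re_le_cmod[of "G x * cis (n * x)"] B[of x] by (simp add: norm_mult)
 moreover have "continuous_on UNIV (wv n G)"
  unfolding wv_def cis.code using G by (intro continuous_intros) (auto simp: bcf_def)
 ultimately show ?thesis by (intro bcfI[where B=B]) auto
qed

text \<open>Freeze the amplitude at the point of evaluation; the error is the Lipschitz constant of the amplitude times the first moment.\<close>

lemma wave_op_wv:
 assumes op: "wave_op Op s M" and G: "bcf G" and l: "0 <= l" "!!x y. cmod (G x - G y) <= l * abs (x - y)"
 shows "abs (Op (wv n G) x - s n * wv n G x) <= M * l"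
proof -
 let ?h = "wv n (%_. G x)"
 have h: "bcf ?h" by (intro wv_bcf bcfI[where B="cmod (G x)"]) auto
 have "Op (%y. wv n G y - ?h y) x = Op (wv n G) x - Op ?h x" using op wv_bcf[OF G] h unfolding wave_op_def by blast
 moreover have "Op ?h x = s n * wv n G x" using op unfolding wave_op_def wv_def[abs_def] by blast
 moreover have "abs (wv n G y - ?h y) <= l * abs (x - y)" for y
 proof -
  have "wv n G y - ?h y = Re ((G y - G x) * cis (n * y))" by (simp add: wv_def algebra_simps)
  thus ?thesis using abs_Re_le_cmod[of "(G y - G x) * cis (n * y)"] l(2)[of y x] by (simp add: norm_mult abs_minus_commute)
 qed
 moreover have "abs (Op (%y. wv n G y - ?h y) x) <= M * l" if "ALL y. abs (wv n G y - ?h y) <= l * abs (x - y)"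
  using op bcf_diff[OF wv_bcf[OF G] h] l(1) that unfolding wave_op_def by blast
 ultimately show ?thesis by simp
qed

lemma plane_wave_shift: "Re (z * cis (n * (x - u))) = Re (z * cis (n * x)) * cos (n * u) + Im (z * cis (n * x)) * sin (n * u)"
 by (simp add: right_diff_distrib cos_diff sin_diff algebra_simps)

lemma fmult_wave_op:
 assumes m: "csym 3 m" "!!k. m (- k) = m k"
 shows "wave_op (fmult m) m (LINT y|lborel. abs (abs (y) * ci 0 m y))"
 unfolding wave_op_def
proof (intro conjI allI impI)
 note e = csym_evs[OF m]
 note k = evs_kern[OF e] and s = evs_symb[OF e]
 fix f g :: "real => real" and x assume "bcf f" "bcf g"
 thus "fmult m (%x. f x - g x) x = fmult m f x - fmult m g x" by (rule fmult_diff[OF e])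
next
 note e = csym_evs[OF m]
 note k = evs_kern[OF e] and s = evs_symb[OF e]
 fix n x z
 have i: "integrable lborel (%u. ci 0 m u * cos (n * u))" "integrable lborel (%u. ci 0 m u * sin (n * u))"
  using kern_integrable_bounded[OF k, of "%u. cos (n * u)"] kern_integrable_bounded[OF k, of "%u. sin (n * u)"] by auto
 have "fmult m (%y. Re (z * cis (n * y))) x =
  (LINT u|lborel. Re (z * cis (n * x)) * (ci 0 m u * cos (n * u)) + Im (z * cis (n * x)) * (ci 0 m u * sin (n * u)))"
  unfolding fmult_def cv_def plane_wave_shift by (rule Bochner_Integration.integral_cong) (simp_all add: algebra_simps)
 also have "... = Re (z * cis (n * x)) * (LINT u|lborel. ci 0 m u * cos (n * u)) + Im (z * cis (n * x)) * (LINT u|lborel. ci 0 m u * sin (n * u))"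
  by (subst Bochner_Integration.integral_add) (use i in auto)
 finally show "fmult m (%y. Re (z * cis (n * y))) x = m n * Re (z * cis (n * x))" using s by (simp add: symb_def)
next
 note e = csym_evs[OF m]
 fix f :: "real => real" and x c :: real assume f: "bcf f" "0 <= c" "ALL y. abs (f y) <= c * abs (x - y)"
 have "abs (fmult m f x) <= (LINT y|lborel. c * abs (abs (y) * ci 0 m y))"
  unfolding fmult_def cv_def
 proof (rule order_trans[OF integral_abs_bound], rule integral_mono)
  show "integrable lborel (%y. abs (ci 0 m y *\<^sub>R f (x - y)))" by (intro integrable_abs cv_integrable[OF evs_kern[OF e] f(1)])
  show "integrable lborel (%y. c * abs (abs (y) * ci 0 m y))" by (intro integrable_mult_right integrable_abs csym_third_moment m)
  have "abs (ci 0 m y) * abs (f (x - y)) <= abs (ci 0 m y) * (c * abs (y))" for y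
   using f(3)[rule_format, of "x - y"] by (intro mult_left_mono) auto
  thus "abs (ci 0 m y *\<^sub>R f (x - y)) <= c * abs (abs (y) * ci 0 m y)" for y by (simp add: abs_mult mult_ac)
 qed
 thus "abs (fmult m f x) <= (LINT y|lborel. abs (abs (y) * ci 0 m y)) * c" by (simp add: mult.commute)
qed

lemma sc_sm: "sc mu f x = sm_integral mu (%y. f (x - y) :: real)"
 by (simp add: sc_def cv_def sm_integral_def)

lemma bcf_reflect_bbf: assumes "bcf f" shows "bbf (%y. f (x - y))"
proof -
 have m[measurable]: "f : borel_measurable borel" by (rule bcf_measurable[OF assms])
 show ?thesis using assms by (auto simp: bbf_def bcf_def)
qed

lemma sm_sin_zero:
 assumes "finite_signed mu" "sm_symmetric mu" shows "sm_integral mu (%u. sin (n * u)) = (0::real)"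
proof -
 have b: "bbf (%u. sin (n * u))" by (rule bbfI[where B=1]) auto
 have "sm_integral mu (%u. sin (n * - u)) = sm_integral mu (%u. sin (n * u))" by (rule sm_symmetric_integral[OF assms b])
 thus ?thesis using sm_cmult[of mu "-1" "%u. sin (n * u)"] by simp
qed

lemma sc_wave_op:
 assumes mu: "admissible_kernel mu"
 shows "EX M>=0. wave_op (sc mu) (%n. sm_integral mu (%u. cos (n * u))) M"
proof -
 have fs: "finite_signed mu" "sm_symmetric mu" using mu by (auto simp: admissible_kernel_def)
 obtain C where C: "C >= 0" "!!f c. bbf f ==> 0 <= c ==> (!!y. abs (f y) <= c * abs (y)) ==> abs (sm_integral mu f) <= C * c"
  using moment_bound[OF mu] by blast
 have "wave_op (sc mu) (%n. sm_integral mu (%u. cos (n * u))) C"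
  unfolding wave_op_def
 proof (intro conjI allI impI)
  fix n x z
  have b: "bbf (%u. Re (z * cis (n * x)) * cos (n * u))" "bbf (%u. Im (z * cis (n * x)) * sin (n * u))"
   by (intro bbf_mult bbf_const bbfI[where B=1]; simp)+
  show "sc mu (%y. Re (z * cis (n * y))) x = sm_integral mu (%u. cos (n * u)) * Re (z * cis (n * x))"
   unfolding sc_sm plane_wave_shift sm_add[OF fs(1) b] sm_cmult sm_sin_zero[OF fs] by simp
 next
  fix f :: "real => real" and x c :: real assume f: "bcf f" "0 <= c" "ALL y. abs (f y) <= c * abs (x - y)"
  show "abs (sc mu f x) <= C * c" unfolding sc_sm
   by (rule C(2)[OF bcf_reflect_bbf[OF f(1)] f(2)]) (use f(3)[rule_format, of "x - _"] in simp)
 qed (simp add: sc_diff[OF fs(1)])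
 thus ?thesis using C(1) by blast
qed

lemma sm_fourier_real:
 assumes "finite_signed mu" "sm_symmetric mu"
 shows "sm_fourier mu n = of_real (sm_integral mu (%u. cos (n * u)))"
proof -
 have fin: "finite_measure (fst mu)" "finite_measure (snd mu)" and s: "sets (fst mu) = sets borel" "sets (snd mu) = sets borel"
  using assms(1) by (auto simp: finite_signed_def)
 have eq: "exp (\<i> * of_int n * of_real u) = cis (n * u)" for u :: real by (simp add: cis_conv_exp mult.assoc)
 have i: "integrable M (%u. cis (n * u))" if M: "finite_measure M" "sets M = sets borel" for M :: "real measure"
 proof (rule finite_measure.integrable_const_bound[OF M(1), where B=1])
  have "(%u::real. cis (n * u)) : borel_measurable borel" by (intro borel_measurable_continuous_onI continuous_intros)
  thus "(%u. cis (n * u)) : borel_measurable M" using M(2) by (simp cong: measurable_cong_sets)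
 qed simp
 have c: "(LINT u|M. cis (n * u)) = Complex (LINT u|M. cos (n * u)) (LINT u|M. sin (n * u))"
  if M: "finite_measure M" "sets M = sets borel" for M :: "real measure"
  using integral_Re[OF i[OF M]] integral_Im[OF i[OF M]] by (simp add: complex_eq_iff)
 have "sm_fourier mu n = (LINT u|fst mu. cis (n * u)) - (LINT u|snd mu. cis (n * u))"
  unfolding sm_fourier_def sm_integral_def by (simp only: eq)
 thus ?thesis
  unfolding c[OF fin(1) s(1)] c[OF fin(2) s(2)]
  using sm_sin_zero[OF assms, of n] by (simp add: complex_eq_iff sm_integral_def)
qed

text \<open>The derivatives fall on the kernel, so the jet of a filtered function is controlled by the sup-norm of the function alone.\<close>

definition smJ :: "(real => real) => (real => real) => real => jet" where
 "smJ m h x = mkJ (%j. cv lborel (ci (j * (pi / 2)) (%k. k ^ j * m k)) (%y. y) h x)"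

lemma csym_power: "csym 3 m ==> csym 3 (%k. k ^ j * m k)"
 by (rule csym_mult) (rule Ck_intros | assumption)+

lemma ci_csym_bound: assumes "csym 3 m" shows "EX c>=0. ALL th y. abs (ci th m y) <= c / (1 + y^2)"
 using csym_dec2[OF csym_3_2[OF assms]] ci_dec2 dec2_nonneg by metis

lemma ci_kern: assumes "csym 3 m" shows "kern lborel (ci th m) (%y. y)"
proof -
 obtain c where c: "!!y. abs (ci th m y) <= c / (1 + y^2)" using ci_csym_bound[OF assms] by blast
 have [measurable]: "m : borel_measurable borel" using continuous_imp_measurable[OF csym_continuous[OF assms]] by simp
 show ?thesis unfolding kern_def
  by (intro conjI lborel.sigma_finite_measure_axioms integrable_of_recip_quadratic[where c=c]) (use c in auto)
qed

lemma smooth_kernel_deriv: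
 assumes m: "csym 3 m" and h: "bcf h"
 shows "(cv lborel (ci th m) (%y. y) h has_real_derivative cv lborel (ci (th + pi / 2) (%k. k * m k)) (%y. y) h x0) (at x0)"
proof -
 have m1: "csym 3 (%k. k * m k)" using csym_power[OF m, of 1] by simp
 obtain c where c: "0 <= c" "!!th y. abs (ci th (%k. k * m k) y) <= c / (1 + y^2)" using ci_csym_bound[OF m1] by blast
 obtain B where B: "0 <= B" "!!x. abs (h x) <= B" using bcf_bound[OF h] by (metis real_norm_def)
 have eq: "cv lborel (ci th m) (%y. y) h x = (LINT y|lborel. ci th m (x - y) * h y)" for th m x
  using integral_translate_reflect[of "%z. ci th m z * h (x - z)" x] by (simp add: cv_def)
 have "((%x. LINT y|lborel. ci th m (x - y) * h y) has_real_derivative (LINT y|lborel. ci (th + pi / 2) (%k. k * m k) (x0 - y) * h y)) (at x0)"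
 proof (rule derivative_under_integral[where a="x0 - 1" and b="x0 + 1" and w="%y. 3 * c * B / (1 + (1 * (y - x0))^2)"])
  fix x y assume x: "x0 - 1 < x" "x < x0 + 1"
  have "((%x. ci th m (x - y)) has_real_derivative ci (th + pi / 2) (%k. k * m k) (x - y) * 1) (at x)"
   by (rule DERIV_chain'[OF _ ci_derivative[OF csym_integrable[OF m] csym_integrable[OF m1]]]) (auto intro!: derivative_eq_intros)
  thus "((%x. ci th m (x - y) * h y) has_real_derivative ci (th + pi / 2) (%k. k * m k) (x - y) * h y) (at x)"
   by (auto intro!: derivative_eq_intros)
  have sq: "(a + b)^2 <= 2 * a^2 + 2 * b^2" for a b :: real using zero_le_power2[of "a - b"] by (simp add: power2_sum power2_diff)
  have "(x0 - x)^2 <= 1" using x by (intro abs_square_le_1[THEN iffD2]) auto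
  moreover have "(y - x0)^2 <= 2 * (x - y)^2 + 2 * (x0 - x)^2" using sq[of "x - y" "x0 - x"] by (simp add: power2_commute)
  moreover have "1 + d <= 3 * (1 + e)" if "b <= 1" "d <= 2 * e + 2 * b" "0 <= e" for b d e :: real using that by simp
  ultimately have "1 + (y - x0)^2 <= 3 * (1 + (x - y)^2)" using zero_le_power2 by blast
  hence "3 * c / (3 * (1 + (x - y)^2)) <= 3 * c / (1 + (y - x0)^2)"
   using c(1) by (intro divide_left_mono mult_pos_pos add_pos_nonneg) auto
  hence "c / (1 + (x - y)^2) <= 3 * c / (1 + (y - x0)^2)" by (simp only: mult_divide_mult_cancel_left_if) simp
  hence "abs (ci (th + pi / 2) (%k. k * m k) (x - y)) * abs (h y) <= 3 * c / (1 + (y - x0)^2) * B"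
   using c B by (intro mult_mono order_trans[OF c(2)]) (auto intro!: divide_nonneg_nonneg)
  thus "abs (ci (th + pi / 2) (%k. k * m k) (x - y) * h y) <= 3 * c * B / (1 + (1 * (y - x0))^2)" by (simp add: abs_mult)
 next
  fix x show "integrable lborel (%y. ci th m (x - y) * h y)"
   using lborel_integrable_real_affine[OF cv_integrable[OF ci_kern[OF m] h], of "-1" th x x] by simp
  show "integrable lborel (%y. 3 * c * B / (1 + (1 * (y - x0))^2))" by (rule integral_recip_quadratic_affine(1)) simp
 qed auto
 moreover have "cv lborel (ci th m) (%y. y) h = (%x. LINT y|lborel. ci th m (x - y) * h y)" by (rule ext) (rule eq)
 ultimately show ?thesis by (simp add: eq)
qed

lemma cv_ci_bcf: "csym 3 m ==> bcf h ==> bcf (cv lborel (ci th m) (%y. y) h)"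
 by (rule cv_bcf[OF ci_kern])

lemma smJ_isJet: assumes m: "csym 3 m" and h: "bcf h" shows "isJet (smJ m h)"
 unfolding isJet_def
proof (intro conjI allI impI)
 show "bcf (smJ m h)" unfolding smJ_def by (intro bcf_mkJ cv_ci_bcf csym_power m h)
 fix i :: nat and x assume i: "i < 4"
 have e: "real (Suc i) * (pi / 2) = i * (pi / 2) + pi / 2" by (simp add: algebra_simps)
 have "(%k. k ^ Suc i * m k) = (%k. k * (k ^ i * m k))" by (simp add: mult_ac)
 thus "((%x. jc i (smJ m h x)) has_real_derivative jc (Suc i) (smJ m h x)) (at x)"
  using smooth_kernel_deriv[OF csym_power[OF m, of i] h, of "i * (pi / 2)" x] i by (simp only: smJ_def jc_mkJ e)
qed

lemma smJ_0: "jc 0 (smJ m h x) = fmult m h x"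
 by (simp add: smJ_def jc_mkJ fmult_def)

lemma smJ_bound: assumes m: "csym 3 m" shows "EX C>=0. ALL h B x. bcf h --> (ALL x. abs (h x) <= B) --> norm (smJ m h x) <= C * B"
proof -
 define I where "I j = (LINT z|lborel. abs (ci (j * (pi / 2)) (%k. k ^ j * m k) z))" for j :: nat
 have I0: "0 <= I j" for j by (simp add: I_def)
 have "norm (smJ m h x) <= (5 * (\<Sum>j\<le>4. I j)) * B" if h: "bcf h" "ALL x. abs (h x) <= B" for h B x
 proof -
  have B0: "0 <= B" using h(2) by (meson abs_ge_zero order_trans)
  have "abs (cv lborel (ci (j * (pi / 2)) (%k. k ^ j * m k)) (%y. y) h x) <= B * (\<Sum>j\<le>4. I j)" if "j <= 4" for j
  proof -
   have "abs (cv lborel (ci (j * (pi / 2)) (%k. k ^ j * m k)) (%y. y) h x) <= B * I j"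
    using cv_norm_le[OF ci_kern[OF csym_power[OF m]] h(1), of B _ j x] h(2) by (simp add: I_def)
   also have "I j <= (\<Sum>j\<le>4. I j)" using that I0 by (intro member_le_sum) auto
   finally show ?thesis using B0 by (simp add: mult_left_mono)
  qed
  from norm_mkJ_le[of "%j. cv lborel (ci (j * (pi / 2)) (%k. k ^ j * m k)) (%y. y) h x", OF this] show ?thesis by (simp add: smJ_def mult_ac)
 qed
 thus ?thesis using I0 by (intro exI[of _ "5 * (\<Sum>j\<le>4. I j)"]) (simp add: sum_nonneg)
qed

lemma bcs_mkJ: assumes "!!i. i <= 4 ==> bcs P (f i)" shows "bcs P (%x t. mkJ (%i. f i x t))"
proof -
 have "EX B. ALL i:{..4::nat}. ALL x. ALL t:P. abs (f i x t) <= B i" using bcs_bdd[OF assms] by (intro bchoice ballI) fastforce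
 then obtain B where B: "!!i x t. i <= 4 ==> t : P ==> abs (f i x t) <= B i" by auto
 show ?thesis
 proof (rule bcsI)
  show "continuous_on (UNIV \<times> P) (%(x, t). mkJ (%i. f i x t))"
   unfolding mkJ_def split_def using assms[THEN bcs_continuous] by (intro continuous_intros) (auto simp: split_def)
  fix x t assume t: "t : P"
  have "abs (f i x t) <= (\<Sum>i\<le>4. abs (B i))" if "i <= 4" for i
   using B[OF that t, of x] member_le_sum[of i "{..4}" "%i. abs (B i)"] that by force
  thus "norm (mkJ (%i. f i x t)) <= 5 * (\<Sum>i\<le>4. abs (B i))" by (rule norm_mkJ_le)
 qed
qed

lemma bcs_smJ: "csym 3 m ==> bcs P F ==> bcs P (%x t. smJ m (%y. F y t) x)"
 unfolding smJ_def by (intro bcs_mkJ bcs_cv ci_kern csym_power)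

text \<open>Both sides are components of the same jet, once with the derivatives on the kernel and once on the function.\<close>

lemma fmult_by_parts:
 assumes m: "csym 3 m" "!!k. m (- k) = m k" and g: "isJet g"
 shows "fmult (%k. sa k * m k) (%x. jc 0 (g x)) x = fmult m (%x. jc 4 (g x) + (2 * jc 2 (g x) + jc 0 (g x))) x"
proof -
 note e = csym_evs[OF m]
 have gb: "bcf (%x. jc i (g x))" for i by (intro bcf_linear[OF isJet_bcf[OF g]] bounded_linear_jc)
 have gj: "jc i (fmult m g x) = fmult m (%x. jc i (g x)) x" for i
  unfolding fmult_def by (rule jc_cv[OF evs_kern[OF e] isJet_bcf[OF g]])
 have J: "smJ m (%x. jc 0 (g x)) x = fmult m g x"
  by (rule isJet_unique[OF smJ_isJet[OF m(1) gb] isJet_fmult[OF e g]])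
   (simp add: smJ_0 fmult_def jc_cv[OF evs_kern[OF e] isJet_bcf[OF g]])
 have ev: "evs (%k. k ^ 2 * m k)" "evs (%k. k ^ 4 * m k)"
  by (intro csym_evs csym_power m; simp add: m)+
 have 4: "fmult m (%x. jc 4 (g x)) x = fmult (%k. k ^ 4 * m k) (%x. jc 0 (g x)) x"
 proof -
  have "ci (4 * (pi / 2)) (%k. k ^ 4 * m k) = ci 0 (%k. k ^ 4 * m k)" by (simp add: ci_def fun_eq_iff)
  thus ?thesis using arg_cong[OF J, of "jc 4"] by (simp add: gj) (simp add: smJ_def jc_mkJ fmult_def)
 qed
 have 2: "fmult m (%x. jc 2 (g x)) x = - fmult (%k. k ^ 2 * m k) (%x. jc 0 (g x)) x"
 proof -
  have "ci (2 * (pi / 2)) (%k. k ^ 2 * m k) = (%x. - ci 0 (%k. k ^ 2 * m k) x)" by (simp add: ci_def fun_eq_iff)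
  thus ?thesis using arg_cong[OF J, of "jc 2"] by (simp add: gj) (simp add: smJ_def jc_mkJ fmult_def cv_def)
 qed
 have "(%k. sa k * m k) = (%k. k ^ 4 * m k + ((- 2) * (k ^ 2 * m k) + m k))"
  by (simp add: sa_def fun_eq_iff power2_eq_square algebra_simps eval_nat_numeral)
 moreover have c: "evs (%k. (- 2) * (k ^ 2 * m k))" "evs (%k. (- 2) * (k ^ 2 * m k) + m k)"
  by (rule csym_evs, use csym_mult[OF csym_power[OF m(1), of 2], of "%_. - 2"] csym_mult[OF m(1), of "%k. (- 2) * k ^ 2 + 1"] m(2) Ck_intros in "auto simp: algebra_simps")+
 ultimately have "fmult (%k. sa k * m k) (%x. jc 0 (g x)) x =
   fmult (%k. k ^ 4 * m k) (%x. jc 0 (g x)) x + (- 2 * fmult (%k. k ^ 2 * m k) (%x. jc 0 (g x)) x + fmult m (%x. jc 0 (g x)) x)"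
  by (simp only: fmult_add_symbol[OF ev(2) c(2) gb] fmult_add_symbol[OF c(1) e gb] fmult_cmult_symbol real_scaleR_def)
 also have "... = fmult m (%x. jc 4 (g x)) x + (2 * fmult m (%x. jc 2 (g x)) x + fmult m (%x. jc 0 (g x)) x)" by (simp add: 2 4)
 also have "... = fmult m (%x. jc 4 (g x) + (2 * jc 2 (g x) + jc 0 (g x))) x"
  using fmult_add[OF e gb[of 4] bcf_add[OF bcf_scaleR[OF gb[of 2], of 2] gb[of 0]], of x]
   fmult_add[OF e bcf_scaleR[OF gb[of 2], of 2] gb[of 0], of x] fmult_scaleR[OF e gb[of 2], of 2 x] by simp
 finally show ?thesis .
qed

lemma jc_duhamel:
 assumes F: "bcs {0..R} F" and t: "t : {0..R}"
 shows "jc i (duhamel e F x t) = duhamel e (%x s. jc i (F x s)) x t"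
proof -
 have t': "t <= R" using t by simp
 have "((%s. jc i (exp (e^2 * (t - s)) *\<^sub>R sg (t - s) (%y. F y s) x)) has_integral jc i (duhamel e F x t)) {0..t}"
  using has_integral_linear[OF duhamel_has_integral[OF F t'] bounded_linear_jc, of i] by (simp add: o_def)
 moreover have "jc i (exp (e^2 * (t - s)) *\<^sub>R sg (t - s) (%y. F y s) x) = exp (e^2 * (t - s)) *\<^sub>R sg (t - s) (%y. jc i (F y s)) x"
  if "s : {0..t}" for s
  using jc_cv[OF sg_kern bcs_bcf[OF F], of "t - s" s i x] that t by (simp add: jc_scaleR sg_def)
 ultimately have "((%s. exp (e^2 * (t - s)) *\<^sub>R sg (t - s) (%y. jc i (F y s)) x) has_integral jc i (duhamel e F x t)) {0..t}"
  by (subst (asm) has_integral_cong) auto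
 thus ?thesis unfolding duhamel_def[of e "%x s. jc i (F x s)"] by (simp add: integral_unique)
qed

lemma cv_time_derivative:
 fixes F F' :: "real => real => real"
 assumes k: "kern M w g" and F: "bcs {0..R} F" "bcs {0..R} F'"
  and d: "!!x t. 0 < t ==> t < R ==> (F x has_real_derivative F' x t) (at t)" and t: "0 < t" "t < R"
 shows "((%t. cv M w g (%y. F y t) x) has_real_derivative cv M w g (%y. F' y t) x) (at t)"
proof -
 obtain B where B: "!!x t. t : {0..R} ==> abs (F' x t) <= B" using bcs_bdd[OF F(2)] by (metis real_norm_def)
 show ?thesis unfolding cv_def real_scaleR_def
 proof (rule derivative_under_integral[where w="%z. B * abs (w z)", OF _ _ _ _ t])
  show "integrable M (%z. B * abs (w z))" using k by (auto simp: kern_def)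
  fix s z assume s: "0 < s" "s < R"
  show "((%s. w z * F (x - g z) s) has_real_derivative w z * F' (x - g z) s) (at s)"
   by (rule DERIV_cmult[OF d[OF s]])
  show "abs (w z * F' (x - g z) s) <= B * abs (w z)" using B[of s "x - g z"] s by (simp add: abs_mult mult.commute[of B] mult_left_mono)
  show "integrable M (%z. w z * F (x - g z) s)" using cv_integrable[OF k bcs_bcf[OF F(1), of s], of x] s by simp
 qed
qed

section \<open>Multipliers of time-dependent functions\<close>

lemma heat_cut_dec2:
 assumes ph: "csym 3 ph"
 shows "EX C>=0. ALL tau:{0..R}. dec2 C (%k. heat tau k * ph k)"
proof -
 obtain p1 where p1: "!!k. (ph has_real_derivative p1 k) (at k)" "csym 2 p1"
  using csym_derivative[of 2 ph] ph by (auto simp: eval_nat_numeral)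
 obtain p2 where p2: "!!k. (p1 has_real_derivative p2 k) (at k)" "csym 1 p2"
  using csym_derivative[of 1 p1] p1(2) by (auto simp: numeral_2_eq_2)
 have "EX S. ALL k. S < abs (k) --> p k = 0" if "csym n p" for n p using that by (auto simp: csym_def)
 then obtain S0 S1 S2 where "!!k. S0 < abs (k) ==> ph k = 0" "!!k. S1 < abs (k) ==> p1 k = 0" "!!k. S2 < abs (k) ==> p2 k = 0"
  using ph p1(2) p2(2) by metis
 then obtain S where S: "!!k. S < abs (k) ==> ph k = 0 & p1 k = 0 & p2 k = 0"
  by (meson le_less_trans max.cobounded1 max.cobounded2)
 note c[continuous_intros] = csym_continuous[OF ph, THEN continuous_on_compose2] csym_continuous[OF p1(2), THEN continuous_on_compose2]
  csym_continuous[OF p2(2), THEN continuous_on_compose2]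
 define a1 where "a1 k = - (4 * k * (1 - k^2))" for k :: real
 define a2 where "a2 k = 12 * k^2 - 4" for k :: real
 have a: "(sa has_real_derivative a1 k) (at k)" "(a1 has_real_derivative a2 k) (at k)" for k
  unfolding sa_def[abs_def] a1_def[abs_def] a2_def by (auto intro!: derivative_eq_intros simp: power2_eq_square algebra_simps)
 define m1 where "m1 tau k = heat tau k * (p1 k - tau * a1 k * ph k)" for tau k
 define m2 where "m2 tau k = heat tau k * (p2 k - tau * a2 k * ph k - 2 * (tau * a1 k) * p1 k + (tau * a1 k) * (tau * a1 k) * ph k)" for tau k
 have h: "(heat tau has_real_derivative - (tau * a1 k) * heat tau k) (at k)" for tau k
  unfolding heat_def[abs_def] by (auto intro!: derivative_eq_intros a)
 have d1: "((%k. heat tau k * ph k) has_real_derivative m1 tau k) (at k)" for tau k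
  unfolding m1_def by (auto intro!: derivative_eq_intros h p1 simp: algebra_simps)
 have d2: "(m1 tau has_real_derivative m2 tau k) (at k)" for tau k
  unfolding m1_def[abs_def] m2_def by (auto intro!: derivative_eq_intros h p1 p2 a simp: algebra_simps)
 have hc: "continuous_on X (%q. heat (fst q) (snd q))" "continuous_on X (%q. a1 (snd q))" "continuous_on X (%q. a2 (snd q))" for X
  unfolding heat_def sa_def a1_def a2_def by (intro continuous_intros)+
 have cont: "continuous_on X (%q. abs (heat (fst q) (snd q) * ph (snd q)) + abs (m1 (fst q) (snd q)) + abs (m2 (fst q) (snd q)))" for X
  unfolding m1_def m2_def by (intro continuous_intros hc) auto
 have "compact ((%q. abs (heat (fst q) (snd q) * ph (snd q)) + abs (m1 (fst q) (snd q)) + abs (m2 (fst q) (snd q))) ` ({0..R} \<times> {-S..S}))"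
  by (intro compact_continuous_image cont compact_Times compact_Icc)
 from compact_imp_bounded[OF this] obtain B where B: "0 < B"
  "!!tau k. tau : {0..R} ==> k : {-S..S} ==> abs (heat tau k * ph k) + abs (m1 tau k) + abs (m2 tau k) <= B"
  unfolding bounded_pos by fastforce
 have "dec2 (B * (1 + S^2)) (%k. heat tau k * ph k)" if tau: "tau : {0..R}" for tau
  unfolding dec2_def
 proof (intro exI conjI allI)
  show "continuous_on UNIV (m2 tau)"
   unfolding m2_def[abs_def] heat_def sa_def a1_def a2_def by (intro continuous_intros) auto
  fix k
  have "abs (heat tau k * ph k) + abs (m1 tau k) + abs (m2 tau k) <= B * (1 + S^2) / (1 + k^2)"
  proof (cases "abs (k) <= S")
   case True
   hence "1 <= (1 + S^2) / (1 + k^2)" using abs_le_square_iff[of k S] by (simp add: pos_le_divide_eq add_pos_nonneg)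
   hence "B * 1 <= B * ((1 + S^2) / (1 + k^2))" using B(1) by (intro mult_left_mono) auto
   moreover have "k : {-S..S}" using True by auto
   ultimately show ?thesis using B(2)[OF tau, of k] by simp
  next
   case False
   thus ?thesis using S[of k] B(1) by (simp add: m1_def m2_def)
  qed
  thus "abs (heat tau k * ph k) <= B * (1 + S^2) / (1 + k^2)" "abs (m1 tau k) <= B * (1 + S^2) / (1 + k^2)" "abs (m2 tau k) <= B * (1 + S^2) / (1 + k^2)"
   by linarith+
 qed (rule d1 d2)+
 thus ?thesis using B(1) by (intro exI[of _ "B * (1 + S^2)"]) auto
qed

text \<open>Variation of constants for a filtered function: differentiate \<open>s \<mapsto> S(t - s) p(\<Lambda>) h(s)\<close> under the integral. The kernels of the compactly supported symbols are dominated uniformly in \<open>s\<close> by \<open>heat_cut_dec2\<close>.\<close>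

lemma mild_of_time_derivative:
 fixes h h' :: "real => real => real"
 assumes ph: "csym 3 ph" "!!k. ph (- k) = ph k"
  and h: "bcs {0..R} h" "bcs {0..R} h'" "!!x t. 0 < t ==> t < R ==> (h x has_real_derivative h' x t) (at t)"
  and t: "t : {0..R}"
 shows "fmult ph (%y. h y t) x = exp (e^2 * t) * sg t (fmult ph (%y. h y 0)) x +
  duhamel e (%x s. fmult ph (%y. h' y s) x + (fmult (%k. sa k * ph k) (%y. h y s) x - e^2 * fmult ph (%y. h y s) x)) x t"
proof -
 define ps where "ps k = sa k * ph k" for k
 have ps: "csym 3 ps" "!!k. ps (- k) = ps k"
  unfolding ps_def[abs_def] using csym_mult[OF ph(1) Ck_even_poly] ph(2) sa_even by auto
 note e = csym_evs[OF ph] and e' = csym_evs[OF ps]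
 obtain C1 where C1: "0 <= C1" "!!tau. tau : {0..R} ==> dec2 C1 (%k. heat tau k * ph k)" using heat_cut_dec2[OF ph(1)] by blast
 obtain C2 where C2: "0 <= C2" "!!tau. tau : {0..R} ==> dec2 C2 (%k. heat tau k * ps k)" using heat_cut_dec2[OF ps(1)] by blast
 have ev: "heat tau (- k) = heat tau k" for tau k by (simp add: heat_def sa_even)
 have evs: "evs (%k. heat tau k * ph k)" "evs (%k. heat tau k * ps k)" if "tau : {0..R}" for tau
  using C1(2)[OF that] C2(2)[OF that] ph(2) ps(2) ev unfolding evs_def by auto
 obtain B where B: "0 <= B" "!!x s. s : {0..R} ==> abs (h x s) <= B" using bcs_bdd[OF h(1)] by (metis real_norm_def)
 obtain B' where B': "0 <= B'" "!!x s. s : {0..R} ==> abs (h' x s) <= B'" using bcs_bdd[OF h(2)] by (metis real_norm_def)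
 define G where "G x s = fmult ph (%y. h' y s) x + (fmult ps (%y. h y s) x - e^2 * fmult ph (%y. h y s) x)" for x s
 define A where "A s = exp (e^2 * (t - s))" for s
 define ka where "ka s y = A s * ci 0 (%k. heat (t - s) k * ph k) y" for s y
 define ka' where "ka' s y = A s * (ci 0 (%k. heat (t - s) k * ps k) y - e^2 * ci 0 (%k. heat (t - s) k * ph k) y)" for s y
 define v where "v s = A s *\<^sub>R sg (t - s) (%y. fmult ph (%z. h z s) y) x" for s
 have ts: "t - s : {0..R}" "s : {0..R}" if "s : {0..t}" for s using that t by auto
 have hb: "bcf (%y. h y s)" "bcf (%y. h' y s)" if "s : {0..t}" for s
  using bcs_bcf[OF h(1) ts(2)[OF that]] bcs_bcf[OF h(2) ts(2)[OF that]] by auto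
 have sgf: "sg (t - s) (fmult m f) x = fmult (%l. heat (t - s) l * m l) f x" if "s : {0..t}" "evs m" "bcf f" for s m and f :: "real => real"
  unfolding sg_def using that by (intro cv_fmult sg_kern sg_symb) auto
 have vI: "v s = (LINT y|lborel. ka s y * h (x - y) s)" if "s : {0..t}" for s
  unfolding v_def sgf[OF that e hb(1)[OF that]] unfolding fmult_def cv_def ka_def by (simp add: mult.assoc)
 have kad: "((%s. ka s y) has_real_derivative ka' s y) (at s)" if s: "0 < s" "s < t" for s y
 proof -
  have "((%s. LINT k|lborel. cos (k * y + 0) * (heat (t - s) k * ph k)) has_real_derivative
    (LINT k|lborel. cos (k * y + 0) * (heat (t - s) k * ps k))) (at s)"
  proof (rule derivative_under_integral[where w="%k. abs (ps k)", OF _ _ _ _ s])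
   show "integrable lborel (%k. abs (ps k))" by (intro integrable_abs csym_integrable[OF ps(1)])
   fix r k assume r: "0 < r" "r < t"
   show "((%r. cos (k * y + 0) * (heat (t - r) k * ph k)) has_real_derivative cos (k * y + 0) * (heat (t - r) k * ps k)) (at r)"
    unfolding heat_def ps_def by (auto intro!: derivative_eq_intros)
   have "abs (cos (k * y + 0)) * (abs (heat (t - r) k) * abs (ps k)) <= 1 * (1 * abs (ps k))"
    using r by (intro mult_mono) (auto simp: heat_def sa_def)
   thus "abs (cos (k * y + 0) * (heat (t - r) k * ps k)) <= abs (ps k)" by (simp add: abs_mult)
   show "integrable lborel (%k. cos (k * y + 0) * (heat (t - r) k * ph k))"
    using integrable_cos_mult[OF evs_integrable[OF evs(1)], of "t - r" y 0] ts[of r] r by simp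
  qed
  hence "((%s. ci 0 (%k. heat (t - s) k * ph k) y) has_real_derivative ci 0 (%k. heat (t - s) k * ps k) y) (at s)"
   unfolding ci_def by (rule DERIV_cdivide)
  moreover have "(A has_real_derivative - (e^2) * A s) (at s)" unfolding A_def[abs_def] by (auto intro!: derivative_eq_intros)
  ultimately show ?thesis unfolding ka_def ka'_def by (auto intro!: derivative_eq_intros simp: algebra_simps)
 qed
 have A1: "0 <= A s" "A s <= exp (e^2 * t)" if "s : {0..t}" for s using that by (auto simp: A_def mult_left_mono)
 define E where "E = exp (e^2 * t)"
 have kab: "abs (ka s y) <= E * (C1 / (1 + y^2))" "abs (ka' s y) <= E * (C2 / (1 + y^2) + e^2 * (C1 / (1 + y^2)))" if s: "s : {0..t}" for s y
 proof -
  note b = ci_dec2[OF C1(2)[OF ts(1)[OF s]], of 0 y] ci_dec2[OF C2(2)[OF ts(1)[OF s]], of 0 y]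
  show "abs (ka s y) <= E * (C1 / (1 + y^2))" unfolding ka_def abs_mult E_def
   using b A1[OF s] by (intro mult_mono) auto
  have "abs (ci 0 (%k. heat (t - s) k * ps k) y - e^2 * ci 0 (%k. heat (t - s) k * ph k) y) <= C2 / (1 + y^2) + e^2 * (C1 / (1 + y^2))"
  proof -
   have "abs (e^2 * ci 0 (%k. heat (t - s) k * ph k) y) <= e^2 * (C1 / (1 + y^2))"
    using mult_left_mono[OF b(1), of "e^2"] by (simp add: abs_mult)
   from order_trans[OF abs_triangle_ineq4 add_mono[OF b(2) this]] show ?thesis .
  qed
  thus "abs (ka' s y) <= E * (C2 / (1 + y^2) + e^2 * (C1 / (1 + y^2)))" unfolding ka'_def abs_mult E_def
   using A1[OF s] by (intro mult_mono) auto
 qed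
 have vd: "(v has_real_derivative A s *\<^sub>R sg (t - s) (%y. G y s) x) (at s)" if s: "0 < s" "s < t" for s
 proof -
  have s': "s : {0..t}" using s by simp
  have hd: "((%s. h z s) has_real_derivative h' z s) (at s)" if "0 < s" "s < t" for z s using h(3)[of s z] that t by auto
  have i: "integrable lborel (%y. ci 0 (%k. heat (t - s) k * ph k) y * f (x - y))" "integrable lborel (%y. ci 0 (%k. heat (t - s) k * ps k) y * f (x - y))"
   if "bcf f" "s : {0..t}" for f :: "real => real" and s
   using cv_integrable[OF evs_kern[OF evs(1)[OF ts(1)[OF that(2)]]] that(1), of x] cv_integrable[OF evs_kern[OF evs(2)[OF ts(1)[OF that(2)]]] that(1), of x] by simp_all
  have "((%s. LINT y|lborel. ka s y * h (x - y) s) has_real_derivative (LINT y|lborel. ka' s y * h (x - y) s + ka s y * h' (x - y) s)) (at s)"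
  proof (rule derivative_under_integral[where w="%y. (E * (C2 + e^2 * C1) * B + E * C1 * B') / (1 + y^2)", OF _ _ integrable_recip_quadratic _ s])
   fix s y assume s: "0 < s" "s < t"
   hence s': "s : {0..t}" by simp
   show "((%s. ka s y * h (x - y) s) has_real_derivative ka' s y * h (x - y) s + ka s y * h' (x - y) s) (at s)"
    by (rule derivative_eq_intros kad[OF s] hd[OF s] refl | simp)+
   have "abs (ka' s y * h (x - y) s + ka s y * h' (x - y) s) <= E * (C2 / (1 + y^2) + e^2 * (C1 / (1 + y^2))) * B + E * (C1 / (1 + y^2)) * B'"
    by (rule order_trans[OF abs_triangle_ineq], rule add_mono; unfold abs_mult, rule mult_mono)
    (use kab[OF s', of y] B(2)[OF ts(2)[OF s'], of "x - y"] B'(2)[OF ts(2)[OF s'], of "x - y"] in auto)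
   thus "abs (ka' s y * h (x - y) s + ka s y * h' (x - y) s) <= (E * (C2 + e^2 * C1) * B + E * C1 * B') / (1 + y^2)"
    by (simp add: add_divide_distrib algebra_simps)
   show "integrable lborel (%y. ka s y * h (x - y) s)" unfolding ka_def mult.assoc by (intro integrable_mult_right i(1) hb(1) s')
  qed
  moreover have "(LINT y|lborel. ka' s y * h (x - y) s + ka s y * h' (x - y) s) = A s *\<^sub>R sg (t - s) (%y. G y s) x"
  proof -
   have "sg (t - s) (%y. G y s) x = sg (t - s) (fmult ph (%y. h' y s)) x + (sg (t - s) (fmult ps (%y. h y s)) x - e^2 * sg (t - s) (fmult ph (%y. h y s)) x)"
   proof -
    have k: "kern lborel (kS (sqrt (t - s))) (%z. sqrt (sqrt (t - s)) * z)" using s by (intro sg_kern) simp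
    note b = fmult_bcf[OF e hb(2)[OF s']] fmult_bcf[OF e' hb(1)[OF s']] fmult_bcf[OF e hb(1)[OF s']]
    show ?thesis unfolding G_def sg_def
    using cv_add[OF k b(1) bcf_diff[OF b(2) bcf_scaleR[OF b(3), of "e^2"]], of x] cv_diff[OF k b(2) bcf_scaleR[OF b(3), of "e^2"], of x]
    cv_scaleR[OF k b(3), of "e^2" x] by simp
   qed
   also have "... = (LINT y|lborel. ci 0 (%k. heat (t - s) k * ph k) y * h' (x - y) s + (ci 0 (%k. heat (t - s) k * ps k) y * h (x - y) s
    - e^2 * (ci 0 (%k. heat (t - s) k * ph k) y * h (x - y) s)))"
    unfolding sgf[OF s' e hb(2)[OF s']] sgf[OF s' e' hb(1)[OF s']] sgf[OF s' e hb(1)[OF s']] unfolding fmult_def cv_def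
    using i(1)[OF hb(1)[OF s'] s'] i(1)[OF hb(2)[OF s'] s'] i(2)[OF hb(1)[OF s'] s'] by simp
   finally have sgL: "sg (t - s) (%y. G y s) x = ..." .
   show ?thesis
    unfolding ka_def ka'_def real_scaleR_def sgL integral_mult_right_zero[symmetric] by (rule Bochner_Integration.integral_cong) (auto simp: algebra_simps)
  qed
  moreover have "((%s. LINT y|lborel. ka s y * h (x - y) s) has_real_derivative D) (at s) \<longleftrightarrow> (v has_real_derivative D) (at s)" for D
   by (rule DERIV_cong_ev[OF refl _ refl], rule eventually_mono[OF eventually_nhds_in_open[of "{0<..<t}" s]]) (use s vI in auto)
  ultimately show ?thesis by simp
 qed
 have Gb: "bcs {0..R} G" unfolding G_def[abs_def]
  using bcs_add[OF bcs_fmult[OF e h(2)] bcs_diff[OF bcs_fmult[OF e' h(1)] bcs_scaleR[OF bcs_fmult[OF e h(1)], of "e^2"]]] by simp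
 have "((%s. A s *\<^sub>R sg (t - s) (%y. G y s) x) has_integral (v t - v 0)) {0..t}"
 proof (rule fundamental_theorem_of_calculus_interior)
  show "continuous_on {0..t} v" unfolding v_def[abs_def] A_def
   by (rule duhamel_integrand_continuous[OF bcs_fmult[OF e h(1)]]) (use t in simp)
  fix s assume "s : {0<..<t}"
  thus "(v has_vector_derivative A s *\<^sub>R sg (t - s) (%y. G y s) x) (at s)"
   using vd[of s] by (simp add: has_real_derivative_iff_has_vector_derivative)
 qed (use t in simp)
 hence "duhamel e G x t = v t - v 0" unfolding duhamel_def A_def by (rule integral_unique)
 thus ?thesis unfolding G_def[abs_def] ps_def[symmetric] by (simp add: v_def A_def sg_zero)
qed

section \<open>Orders of magnitude\<close>

lemma vderiv_0: "vderiv 0 f = f" and vderiv_Suc: "vderiv (Suc k) f x = vector_derivative (vderiv k f) (at x)"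
 by (simp_all add: vderiv_def)

lemma Cb_deriv: "f : Cb n ==> k < n ==> (vderiv k f has_vector_derivative vderiv (Suc k) f x) (at x)"
 unfolding vderiv_Suc by (auto simp: Cb_def vector_derivative_works)

lemma vderiv_diff:
 assumes f: "f : Cb n" and g: "g : Cb n"
 shows "k <= n ==> vderiv k (%x. f x - g x) = (%x. vderiv k f x - vderiv k g x)"
proof (induction k)
 case (Suc k)
 show ?case
 proof
  fix x
  have "((%x. vderiv k f x - vderiv k g x) has_vector_derivative (vderiv (Suc k) f x - vderiv (Suc k) g x)) (at x)"
   using Suc.prems by (intro has_vector_derivative_diff Cb_deriv[OF f] Cb_deriv[OF g]) auto
  thus "vderiv (Suc k) (%x. f x - g x) x = vderiv (Suc k) f x - vderiv (Suc k) g x"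
   using Suc by (subst vderiv_Suc) (simp add: vector_derivative_at)
 qed
qed (simp add: vderiv_0)

lemma Cb_bounded_continuous: "f : Cb n ==> k <= n ==> bcf (vderiv k f)"
 by (auto simp: Cb_def bcf_def bounded_iff)

lemma Cb_diff: assumes f: "f : Cb n" and g: "g : Cb n" shows "(%x. f x - g x) : Cb n"
proof -
 have b: "bcf (vderiv k (%x. f x - g x))" if "k <= n" for k
  unfolding vderiv_diff[OF f g that] by (intro bcf_diff Cb_bounded_continuous[OF _ that] f g)
 have d: "vderiv k (%x. f x - g x) differentiable (at x)" if "k < n" for k x
  unfolding vderiv_diff[OF f g less_imp_le[OF that]] using f g that by (intro differentiable_diff) (auto simp: Cb_def)
 show ?thesis unfolding Cb_def using b d by (force simp: bcf_def bounded_iff)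
qed

lemma Cb_norm_ge: assumes f: "f : Cb n" and k: "k <= n" shows "norm (vderiv k f x) <= Cb_norm n f"
proof -
 have bdd: "bdd_above (range (%x. norm (vderiv j f x)))" if "j <= n" for j
  using Cb_bounded_continuous[OF f that] by (auto simp: bcf_def bdd_above_def)
 have "norm (vderiv k f x) <= (SUP x. norm (vderiv k f x))" by (rule cSUP_upper[OF UNIV_I bdd[OF k]])
 also have "... <= Cb_norm n f"
  unfolding Cb_norm_def using k by (intro member_le_sum) (auto intro!: order_trans[OF norm_ge_zero cSUP_upper[OF UNIV_I bdd]])
 finally show ?thesis .
qed

lemma Cb_isJet: assumes f: "f : Cb 4" shows "isJet (%x. mkJ (%k. vderiv k f x))"
 unfolding isJet_def
proof (intro conjI allI impI)
 show "bcf (%x. mkJ (%k. vderiv k f x))" by (intro bcf_mkJ Cb_bounded_continuous[OF f])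
 show "((%x. jc i (mkJ (%k. vderiv k f x))) has_real_derivative jc (Suc i) (mkJ (%k. vderiv k f x))) (at x)" if "i < 4" for i x
  using Cb_deriv[OF f that, of x] that by (simp add: jc_mkJ has_real_derivative_iff_has_vector_derivative)
qed

lemma isJet_vderiv: assumes g: "isJet g" shows "k <= 4 ==> vderiv k (%x. jc 0 (g x)) = (%x. jc k (g x))"
proof (induction k)
 case (Suc k)
 have IH: "vderiv k (%x. jc 0 (g x)) = (%x. jc k (g x))" using Suc by simp
 show ?case
 proof
  fix x
  show "vderiv (Suc k) (%x. jc 0 (g x)) x = jc (Suc k) (g x)"
   unfolding vderiv_Suc IH using isJet_deriv[OF g, of k x] Suc.prems
   by (simp add: has_real_derivative_iff_has_vector_derivative vector_derivative_at)
 qed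
qed (simp add: vderiv_0)

lemma isJet_Cb: assumes g: "isJet g" shows "(%x. jc 0 (g x)) : Cb 4"
proof -
 have "bcf (%x. jc k (g x))" for k by (intro bcf_linear[OF isJet_bcf[OF g] bounded_linear_jc])
 moreover have "(%x. jc k (g x)) differentiable (at x)" if "k < 4" for k x
  using isJet_deriv[OF g that, of x] by (auto simp: real_differentiable_def)
 ultimately show ?thesis by (auto simp: Cb_def isJet_vderiv[OF g] bcf_def bounded_iff)
qed

lemma isJet_Cb_norm: assumes g: "isJet g" and B: "!!x. norm (g x) <= B" shows "Cb_norm 4 (%x. jc 0 (g x)) <= 5 * B"
proof -
 have "(SUP x. norm (vderiv k (%x. jc 0 (g x)) x)) <= B" if "k <= 4" for k
  unfolding isJet_vderiv[OF g that] by (rule cSUP_least) (auto intro: order_trans[OF abs_jc_le B])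
 hence "(\<Sum>k\<le>4. SUP x. norm (vderiv k (%x. jc 0 (g x)) x)) <= (\<Sum>k\<le>4::nat. B)" by (intro sum_mono) auto
 thus ?thesis by (simp add: Cb_norm_def)
qed

text \<open>Continuity in time with respect to the sup-norm gives a continuous curve in the space of bounded continuous functions; its image is compact, hence bounded.\<close>

lemma time_continuous_bcs:
 assumes A: "time_continuous n T (A :: real => real => complex)" and k: "k <= n"
 shows "bcs {0..T} (%X t. vderiv k (%Y. A Y t) X)"
proof -
 define f where "f t = Bcontfun (%X. vderiv k (%Y. A Y t) X)" for t
 have Cb: "(%Y. A Y t) : Cb n" if "t : {0..T}" for t using A that by (simp add: time_continuous_def)
 have ap: "apply_bcontfun (f t) = vderiv k (%Y. A Y t)" if t: "t : {0..T}" for t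
 proof -
  have "vderiv k (%Y. A Y t) : bcontfun" using Cb_bounded_continuous[OF Cb[OF t] k] by (auto simp: bcf_def intro: bcontfun_normI)
  thus ?thesis by (simp add: f_def Bcontfun_inverse)
 qed
 have lim: "(f \<longlongrightarrow> f t) (at t within {0..T})" if t: "t : {0..T}" for t
 proof -
  have "((%s. dist (f s) (f t)) \<longlongrightarrow> 0) (at t within {0..T})"
  proof (rule Lim_null_comparison[where g="%s. Cb_norm n (%x. A x s - A x t)"])
   show "((%s. Cb_norm n (%x. A x s - A x t)) \<longlongrightarrow> 0) (at t within {0..T})" using A t by (simp add: time_continuous_def)
   have "dist (f s) (f t) <= Cb_norm n (%x. A x s - A x t)" if s: "s : {0..T}" for s
   proof (rule dist_bound)
    show "dist (apply_bcontfun (f s) x) (apply_bcontfun (f t) x) <= Cb_norm n (%x. A x s - A x t)" for x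
    using Cb_norm_ge[OF Cb_diff[OF Cb[OF s] Cb[OF t]] k, of x] unfolding vderiv_diff[OF Cb[OF s] Cb[OF t] k] by (simp add: ap[OF s] ap[OF t] dist_norm)
   qed
   thus "\<forall>\<^sub>F s in at t within {0..T}. norm (dist (f s) (f t)) <= Cb_norm n (%x. A x s - A x t)"
    by (auto simp: eventually_at_filter)
  qed
  thus ?thesis by (simp add: tendsto_dist_iff[of f])
 qed
 hence fc: "continuous_on {0..T} f" by (simp add: continuous_on_def)
 from compact_imp_bounded[OF compact_continuous_image[OF fc compact_Icc]] obtain B where B: "!!t. t : {0..T} ==> norm (f t) <= B"
  unfolding bounded_iff by blast
 show ?thesis
 proof (rule bcsI)
  show "norm (vderiv k (%Y. A Y t) X) <= B" if "t : {0..T}" for X t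
   using norm_bounded[of "f t" X] B[OF that] by (simp add: ap[OF that])
  have "continuous_on (UNIV \<times> {0..T}) (%q. apply_bcontfun (f (snd q)) (fst q))"
   unfolding continuous_on_def
  proof
   fix q0 assume q0: "q0 : (UNIV :: real set) \<times> {0..T}"
   let ?F = "at q0 within UNIV \<times> {0..T}"
   have s: "((%q. f (snd q)) \<longlongrightarrow> f (snd q0)) ?F"
   proof -
    have "continuous_on (UNIV \<times> {0..T}) (%q. f (snd q))" by (rule continuous_on_compose2[OF fc]) (auto intro!: continuous_intros)
    thus ?thesis using q0 unfolding continuous_on_def by blast
   qed
   have "((%q. apply_bcontfun (f (snd q)) (fst q) - apply_bcontfun (f (snd q0)) (fst q)) \<longlongrightarrow> 0) ?F"
   proof (rule Lim_null_comparison)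
    show "((%q. dist (f (snd q)) (f (snd q0))) \<longlongrightarrow> 0) ?F" by (rule iffD1[OF tendsto_dist_iff s])
    show "\<forall>\<^sub>F q in ?F. norm (apply_bcontfun (f (snd q)) (fst q) - apply_bcontfun (f (snd q0)) (fst q)) <= dist (f (snd q)) (f (snd q0))"
    unfolding dist_norm[symmetric] by (intro always_eventually allI dist_bounded)
   qed
   moreover have "((%q. apply_bcontfun (f (snd q0)) (fst q)) \<longlongrightarrow> apply_bcontfun (f (snd q0)) (fst q0)) ?F"
    by (rule continuous_on_tendsto_compose[OF continuous_on_apply_bcontfun[of UNIV]]) (auto intro: tendsto_intros)
   ultimately show "((%q. apply_bcontfun (f (snd q)) (fst q)) \<longlongrightarrow> apply_bcontfun (f (snd q0)) (fst q0)) ?F"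
    using tendsto_add by fastforce
  qed
  thus "continuous_on (UNIV \<times> {0..T}) (%(X, t). vderiv k (%Y. A Y t) X)"
   by (rule continuous_on_eq) (auto simp: ap)
 qed
qed

definition valid :: "real => real => real => bool" where
 "valid T e t \<longleftrightarrow> 0 < e & e <= 1 & t : {0..T / e^2}"

type_synonym 'a family = "real => real => real => 'a"

text \<open>The calculus of \<open>O(e ^ n)\<close>, uniform in space and in the long time interval. A family takes the small parameter first, then time, then space.\<close>

definition ord :: "real => nat => 'a::real_normed_vector family => bool" where
 "ord T n F \<longleftrightarrow> (EX C>=0. ALL e t x. valid T e t --> norm (F e t x) <= C * e ^ n)"

definition fam :: "real => 'a::real_normed_vector family => bool" where
 "fam T F \<longleftrightarrow> (ALL e t. valid T e t --> bcf (F e t))"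

text \<open>Amplitudes of size \<open>e ^ m\<close> whose variation in space is one power smaller.\<close>

definition slow :: "real => nat => complex family => bool" where
 "slow T m a \<longleftrightarrow> fam T a & ord T m a &
   (EX M>=0. ALL e t x y. valid T e t --> cmod (a e t x - a e t y) <= M * e ^ (m + 1) * abs (x - y))"

lemma valid_eps: "valid T e t ==> 0 < e" "valid T e t ==> e <= 1" "valid T e t ==> t : {0..T / e^2}"
 by (auto simp: valid_def)

lemma ord_cong: "ord T n F ==> (!!e t x. valid T e t ==> F e t x = G e t x) ==> ord T n G"
 unfolding ord_def by metis

lemma ord_weaken: assumes "ord T n F" "m <= n" shows "ord T m F"
proof -
 obtain C where C: "C >= 0" "!!e t x. valid T e t ==> norm (F e t x) <= C * e ^ n" using assms(1) by (auto simp: ord_def)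
 have "norm (F e t x) <= C * e ^ m" if v: "valid T e t" for e t x
  using C(2)[OF v, of x] mult_left_mono[OF power_decreasing[OF assms(2)] C(1), of e] valid_eps[OF v] by (auto intro: order_trans)
 thus ?thesis using C(1) by (auto simp: ord_def)
qed

lemma ord_add: assumes "ord T n F" "ord T n G" shows "ord T n (%e t x. F e t x + G e t x)"
proof -
 obtain C D where C: "C >= 0" "!!e t x. valid T e t ==> norm (F e t x) <= C * e ^ n"
  and D: "D >= 0" "!!e t x. valid T e t ==> norm (G e t x) <= D * e ^ n" using assms by (auto simp: ord_def)
 have "norm (F e t x + G e t x) <= (C + D) * e ^ n" if v: "valid T e t" for e t x
  unfolding distrib_right by (intro norm_triangle_le add_mono C D v)
 thus ?thesis unfolding ord_def using C(1) D(1) by (intro exI[of _ "C + D"]) auto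
qed

lemma ord_linear: assumes h: "bounded_linear h" and "ord T n F" shows "ord T n (%e t x. h (F e t x))"
proof -
 obtain C where C: "C >= 0" "!!e t x. valid T e t ==> norm (F e t x) <= C * e ^ n" using assms(2) by (auto simp: ord_def)
 obtain K where K: "K >= 0" "!!v. norm (h v) <= norm v * K" using bounded_linear.nonneg_bounded[OF h] by blast
 have "norm (h (F e t x)) <= C * K * e ^ n" if v: "valid T e t" for e t x
  using order_trans[OF K(2) mult_right_mono[OF C(2)[OF v] K(1)]] by (simp add: mult_ac)
 thus ?thesis unfolding ord_def using C(1) K(1) by (intro exI[of _ "C * K"]) auto
qed

lemma ord_minus: "ord T n F ==> ord T n (%e t x. - F e t x)" by (simp add: ord_def)

lemma ord_diff: "ord T n F ==> ord T n G ==> ord T n (%e t x. F e t x - G e t x)"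
 using ord_add[OF _ ord_minus, of T n F G] by simp

lemma ord_mult:
 fixes F G :: "real family"
 assumes "ord T n F" "ord T m G" shows "ord T (n + m) (%e t x. F e t x * G e t x)"
proof -
 obtain C D where C: "C >= 0" "!!e t x. valid T e t ==> norm (F e t x) <= C * e ^ n"
  and D: "D >= 0" "!!e t x. valid T e t ==> norm (G e t x) <= D * e ^ m" using assms by (auto simp: ord_def)
 have "norm (F e t x * G e t x) <= (C * D) * e ^ (n + m)" if v: "valid T e t" for e t x
 proof -
  have "norm (F e t x * G e t x) <= (C * e ^ n) * (D * e ^ m)"
   unfolding norm_mult using valid_eps(1)[OF v] C(1) by (intro mult_mono C D v) auto
  thus ?thesis by (simp add: power_add mult_ac)
 qed
 thus ?thesis unfolding ord_def using C(1) D(1) by (intro exI[of _ "C * D"]) auto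
qed

lemma ord_eps: "ord T n (%e t x. e ^ n * c :: real)"
 unfolding ord_def by (intro exI[of _ "abs (c)"]) (auto simp: abs_mult power_abs valid_def)

lemma ord_op:
 assumes op: "EX C>=0. ALL f B x. bcf f --> (ALL x. norm (f x) <= B) --> norm (Op f x) <= C * B"
  and F: "fam T F" "ord T n F"
 shows "ord T n (%e t x. Op (F e t) x)"
proof -
 obtain C where C: "C >= 0" "!!f B x. bcf f ==> (!!x. norm (f x) <= B) ==> norm (Op f x) <= C * B" using op by blast
 obtain D where D: "D >= 0" "!!e t x. valid T e t ==> norm (F e t x) <= D * e ^ n" using F(2) by (auto simp: ord_def)
 have "norm (Op (F e t) x) <= (C * D) * e ^ n" if v: "valid T e t" for e t x
  using C(2)[of "F e t" "D * e ^ n" x] F(1) D(2)[OF v] v by (simp add: fam_def mult.assoc)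
 thus ?thesis unfolding ord_def using C(1) D(1) by (intro exI[of _ "C * D"]) auto
qed

lemma ord_product_diff:
 fixes F G F' G' :: "real family"
 assumes "ord T (n + k) (%e t x. F e t x - F' e t x)" "ord T (m + k) (%e t x. G e t x - G' e t x)" "ord T m G" "ord T n F'"
 shows "ord T (n + m + k) (%e t x. F e t x * G e t x - F' e t x * G' e t x)"
proof -
 have "ord T (n + m + k) (%e t x. (F e t x - F' e t x) * G e t x + F' e t x * (G e t x - G' e t x))"
  using ord_add[OF ord_mult[OF assms(1,3)] ord_mult[OF assms(4,2), unfolded add.assoc[symmetric], THEN ord_weaken]]
  by (simp add: ac_simps)
 thus ?thesis by (simp add: algebra_simps)
qed

lemma slow_ord: assumes "ord T m a" shows "ord T m (%e t x. wv n (a e t) x)"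
proof -
 obtain C where C: "C >= 0" "!!e t x. valid T e t ==> norm (a e t x) <= C * e ^ m" using assms by (auto simp: ord_def)
 have "abs (wv n (a e t) x) <= C * e ^ m" if "valid T e t" for e t x
  using C(2)[OF that, of x] abs_Re_le_cmod[of "a e t x * cis (n * x)"] by (simp add: wv_def norm_mult)
 thus ?thesis using C(1) by (auto simp: ord_def)
qed

lemma slow_mult: assumes a: "slow T m a" and b: "slow T n b" shows "slow T (m + n) (%e t x. a e t x * b e t x)"
proof -
 obtain A where A: "A >= 0" "!!e t x. valid T e t ==> cmod (a e t x) <= A * e ^ m" using a by (auto simp: slow_def ord_def)
 obtain B where B: "B >= 0" "!!e t x. valid T e t ==> cmod (b e t x) <= B * e ^ n" using b by (auto simp: slow_def ord_def)
 obtain L where L: "L >= 0" "!!e t x y. valid T e t ==> cmod (a e t x - a e t y) <= L * e ^ (m + 1) * abs (x - y)" using a by (auto simp: slow_def)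
 obtain M where M: "M >= 0" "!!e t x y. valid T e t ==> cmod (b e t x - b e t y) <= M * e ^ (n + 1) * abs (x - y)" using b by (auto simp: slow_def)
 have l: "cmod (a e t x * b e t x - a e t y * b e t y) <= (L * B + A * M) * e ^ (m + n + 1) * abs (x - y)" if v: "valid T e t" for e t x y
 proof -
  have "a e t x * b e t x - a e t y * b e t y = (a e t x - a e t y) * b e t x + a e t y * (b e t x - b e t y)" by (simp add: algebra_simps)
  hence "cmod (a e t x * b e t x - a e t y * b e t y) <= cmod (a e t x - a e t y) * cmod (b e t x) + cmod (a e t y) * cmod (b e t x - b e t y)"
   by (metis norm_mult norm_triangle_ineq)
  also have "... <= L * e ^ (m + 1) * abs (x - y) * (B * e ^ n) + A * e ^ m * (M * e ^ (n + 1) * abs (x - y))"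
   using A B L M v valid_eps[OF v] by (intro add_mono mult_mono) auto
  finally show ?thesis by (simp add: algebra_simps power_add)
 qed
 have o: "cmod (a e t x * b e t x) <= A * B * e ^ (m + n)" if v: "valid T e t" for e t x
 proof -
  have "cmod (a e t x * b e t x) <= A * e ^ m * (B * e ^ n)"
   unfolding norm_mult using A(1) valid_eps[OF v] by (intro mult_mono A(2)[OF v] B(2)[OF v]) auto
  thus ?thesis by (simp add: power_add mult_ac)
 qed
 have "fam T (%e t x. a e t x * b e t x)" using a b by (auto simp: slow_def fam_def intro: bcf_bilinear[OF bounded_bilinear_mult])
 moreover have "ord T (m + n) (%e t x. a e t x * b e t x)" unfolding ord_def using o A(1) B(1) by (intro exI[of _ "A * B"]) auto
 moreover have "0 <= L * B + A * M" using A B L M by simp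
 ultimately show ?thesis unfolding slow_def using l by blast
qed

lemma slow_eps: "slow T m (%e t x. of_real (e ^ m * c))"
proof -
 have "fam T (%e t x. complex_of_real (e ^ m * c))"
  unfolding fam_def by (intro allI impI bcfI[where B="cmod (complex_of_real (_ ^ m * c))"]) auto
 moreover have "ord T m (%e t x. complex_of_real (e ^ m * c))"
  unfolding ord_def norm_of_real by (intro exI[of _ "abs (c)"]) (auto simp: abs_mult power_abs valid_def)
 ultimately show ?thesis unfolding slow_def by (auto intro!: exI[of _ 0])
qed

lemma slow_cnj: "slow T m a ==> slow T m (%e t x. cnj (a e t x))"
 unfolding slow_def fam_def ord_def complex_cnj_diff[symmetric] complex_mod_cnj by (auto intro: bcf_linear[OF _ bounded_linear_cnj])

lemma slow_fam: "slow T m a ==> fam T (%e t. wv n (a e t))"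
 by (auto simp: slow_def fam_def intro: wv_bcf)

definition op_ok :: "((real => real) => real => real) => (real => real) => bool" where
 "op_ok Op s \<longleftrightarrow> (EX M. wave_op Op s M) & (EX C>=0. ALL f B x. bcf f --> (ALL x. norm (f x) <= B) --> norm (Op f x) <= C * B)"

lemma fmult_bounded_op:
 assumes "evs m" shows "EX C>=0. ALL (f::real => 'a::euclidean_space) B x. bcf f --> (ALL x. norm (f x) <= B) --> norm (fmult m f x) <= C * B"
proof (intro exI conjI allI impI)
 show "norm (fmult m f x) <= (LINT z|lborel. abs (ci 0 m z)) * B" if "bcf f" "ALL x. norm (f x) <= B" for f :: "real => 'a" and B x
  using fmult_norm_le[OF assms that(1), of B x] that(2) by (simp add: mult.commute)
qed simp

lemma fmult_op_ok: "csym 3 m ==> (!!k. m (- k) = m k) ==> op_ok (fmult m) m"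
 unfolding op_ok_def using fmult_wave_op fmult_bounded_op csym_evs by blast

lemma sc_op_ok: assumes "admissible_kernel mu" shows "op_ok (sc mu) (%n. sm_integral mu (%u. cos (n * u)))"
proof -
 have "finite_signed mu" using assms by (simp add: admissible_kernel_def)
 thus ?thesis unfolding op_ok_def using sc_wave_op[OF assms] sc_norm_le mass_nonneg by blast
qed

lemma op_ord: "op_ok Op s ==> fam T F ==> ord T n F ==> ord T n (%e t x. Op (F e t) x)"
 unfolding op_ok_def by (blast intro: ord_op)

lemma op_wave:
 assumes op: "op_ok Op s" and F: "fam T F" and a: "slow T m a1" "slow T m a2"
  and e: "ord T (m + 1) (%e t x. F e t x - (wv n (a1 e t) x + wv k (a2 e t) x))"
 shows "ord T (m + 1) (%e t x. Op (F e t) x - (s n * wv n (a1 e t) x + s k * wv k (a2 e t) x))"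
proof -
 obtain M where w: "wave_op Op s M" using op by (auto simp: op_ok_def)
 hence d: "bcf f ==> bcf g ==> Op (%x. f x - g x) x = Op f x - Op g x" for f g x by (auto simp: wave_op_def)
 have b0: "bcf (%_. 0 :: real)" by (rule bcfI[where B=0]) auto
 have z: "Op (%y. 0) x = 0" for x using d[OF b0 b0, of x] by simp
 have pl: "Op (%x. f x + g x) x = Op f x + Op g x" if "bcf f" "bcf g" for f g x
  using d[OF that(1) bcf_minus[OF that(2)], of x] d[OF b0 that(2), of x] z by simp
 have single: "ord T (m + 1) (%e t x. Op (wv n (a e t)) x - s n * wv n (a e t) x)" if a: "slow T m a" for a n
 proof -
  obtain L where L: "L >= 0" "!!e t x y. valid T e t ==> cmod (a e t x - a e t y) <= L * e ^ (m + 1) * abs (x - y)" using a by (auto simp: slow_def)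
  have "abs (Op (wv n (a e t)) x - s n * wv n (a e t) x) <= (abs (M) * L) * e ^ (m + 1)" if v: "valid T e t" for e t x
  proof -
   have "abs (Op (wv n (a e t)) x - s n * wv n (a e t) x) <= M * (L * e ^ (m + 1))"
    by (rule wave_op_wv[OF w]) (use a v L valid_eps[OF v] in "auto simp: slow_def fam_def")
   also have "... <= abs (M) * (L * e ^ (m + 1))" using L(1) valid_eps[OF v] by (intro mult_right_mono) auto
   finally show ?thesis by simp
  qed
  thus ?thesis unfolding ord_def using L(1) by (intro exI[of _ "abs (M) * L"]) auto
 qed
 have b: "bcf (wv n (a1 e t))" "bcf (wv k (a2 e t))" "bcf (F e t)" if "valid T e t" for e t
  using slow_fam[OF a(1), of n] slow_fam[OF a(2), of k] F that by (auto simp: fam_def)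
 have "fam T (%e t x. F e t x - (wv n (a1 e t) x + wv k (a2 e t) x))"
  unfolding fam_def by (intro allI impI bcf_diff bcf_add b)
 from ord_add[OF op_ord[OF op this e] ord_add[OF single[OF a(1), of n] single[OF a(2), of k]]]
 show ?thesis
  by (rule ord_cong) (simp add: d[OF b(3) bcf_add[OF b(1,2)]] pl[OF b(1,2)])
qed

section \<open>The modulated wave\<close>

definition amp :: "(real => real => complex) => nat => complex family" where
 "amp A k e t x = vderiv k (%Y. A Y (e^2 * t)) (e * x)"

text \<open>The amplitude of the \<open>j\<close>-th derivative of \<open>A(e x) exp(i x)\<close>, by the binomial formula.\<close>

definition pamp :: "(real => real => complex) => nat => complex family" where
 "pamp A j e t x = (\<Sum>k\<le>j. of_nat (j choose k) * \<i> ^ (j - k) * of_real e ^ k * amp A k e t x)"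

definition psJ :: "(real => real => complex) => jet family" where
 "psJ A e t x = mkJ (%j. 2 * e * wv 1 (pamp A j e t) x)"

definition ptd :: "(real => real => complex) => real => real family" where
 "ptd A c e t x = 2 * e ^ 3 * wv 1 (%x. amp A 0 e t x + 4 * amp A 2 e t x - of_real c * (amp A 0 e t x * amp A 0 e t x * cnj (amp A 0 e t x))) x"

lemma pamp_simps:
 "pamp A 0 e t x = amp A 0 e t x"
 "pamp A (Suc 0) e t x = \<i> * amp A 0 e t x + e * amp A 1 e t x"
 "pamp A 2 e t x = - amp A 0 e t x + (2 * \<i> * e * amp A 1 e t x + of_real e ^ 2 * amp A 2 e t x)"
 "pamp A 3 e t x = - \<i> * amp A 0 e t x + (- 3 * e * amp A 1 e t x + (3 * \<i> * of_real e ^ 2 * amp A 2 e t x + of_real e ^ 3 * amp A 3 e t x))"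
 "pamp A 4 e t x = amp A 0 e t x + (- 4 * \<i> * e * amp A 1 e t x + (- 6 * of_real e ^ 2 * amp A 2 e t x + (4 * \<i> * of_real e ^ 3 * amp A 3 e t x + of_real e ^ 4 * amp A 4 e t x)))"
 by (simp_all add: pamp_def numeral_eq_Suc algebra_simps)

lemma psJ_0: "jc 0 (psJ A e t x) = psi A e x t" and psJ_wave: "jc 0 (psJ A e t x) = wv 1 (%x. of_real (e ^ 1 * 2) * amp A 0 e t x) x"
 by (simp_all add: psJ_def jc_mkJ wv_def pamp_simps amp_def vderiv_0 psi_def Re_exp Im_exp algebra_simps)

lemma wv_bcs: "bcs P G ==> bcs P (%x t. wv n (%x. G x t) x)"
 unfolding wv_def
 by (rule bcs_linear[OF bcs_bilinear[OF bounded_bilinear_mult _ bcs_const] bounded_linear_Re])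
  (auto intro!: bcfI[where B=1] continuous_intros)

lemma bcs_sum: "finite I ==> (!!i. i : I ==> bcs P (f i)) ==> bcs P (%x t. \<Sum>i\<in>I. f i x t)"
 by (induction I rule: finite_induct) (auto intro: bcs_add bcsI[where B=0])

lemma wv_derivative:
 assumes "(G has_vector_derivative G') (at x)"
 shows "(wv 1 G has_real_derivative Re ((G' + \<i> * G x) * cis x)) (at x)"
proof -
 have "((%x. Re (G x)) has_real_derivative Re G') (at x)" "((%x. Im (G x)) has_real_derivative Im G') (at x)"
  using bounded_linear.has_vector_derivative[OF bounded_linear_Re assms] bounded_linear.has_vector_derivative[OF bounded_linear_Im assms]
  by (simp_all add: has_real_derivative_iff_has_vector_derivative)
 from DERIV_diff[OF DERIV_mult[OF this(1) DERIV_cos] DERIV_mult[OF this(2) DERIV_sin]]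
 have "((%x. Re (G x) * cos x - Im (G x) * sin x) has_real_derivative Re ((G' + \<i> * G x) * cis x)) (at x)"
  by (simp add: algebra_simps)
 thus ?thesis by (simp add: wv_def[abs_def])
qed

lemma wave_product: "wv n G x * wv m H x = (wv (n + m) (%x. G x * H x) x + wv (n - m) (%x. G x * cnj (H x)) x) / 2"
 by (simp add: wv_def cos_add sin_add cos_diff sin_diff algebra_simps)

lemma wv_uminus: "wv (- n) G x = wv n (%x. cnj (G x)) x"
 by (simp add: wv_def)

lemma wv_scale: "wv n (%x. of_real r * G x) x = r * wv n G x"
 by (simp add: wv_def algebra_simps)

context
 fixes T :: real and A :: "real => real => complex"
 assumes T: "0 < T" and A: "time_continuous 4 T A"
begin

lemma slow_time: "0 < e ==> t : {0..T / e^2} ==> e^2 * t : {0..T}"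
 by (auto simp: pos_le_divide_eq mult.commute)

lemma amp_bcs: assumes "k <= 4" "0 < e" shows "bcs {0..T / e^2} (%x t. amp A k e t x)"
proof -
 have D: "bcs {0..T} (%X t. vderiv k (%Y. A Y t) X)" by (rule time_continuous_bcs[OF A assms(1)])
 obtain B where "!!X t. t : {0..T} ==> norm (vderiv k (%Y. A Y t) X) <= B" using bcs_bdd[OF D] by blast
 moreover have "continuous_on (UNIV \<times> {0..T / e^2}) (%q. vderiv k (%Y. A Y (e^2 * snd q)) (e * fst q))"
  using slow_time[OF assms(2)] by (intro bcs_compose[OF D] continuous_intros) auto
 ultimately show ?thesis
  using slow_time[OF assms(2)] unfolding amp_def by (intro bcsI[where B=B]) (auto simp: split_def)
qed

lemma amp_fam: "k <= 4 ==> fam T (amp A k)"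
 unfolding fam_def using bcs_bcf[OF amp_bcs] by (auto simp: valid_def)

lemma amp_ord: assumes "k <= 4" shows "ord T 0 (amp A k)"
proof -
 obtain B where "B >= 0" "!!X t. t : {0..T} ==> norm (vderiv k (%Y. A Y t) X) <= B" using bcs_bdd[OF time_continuous_bcs[OF A assms]] by blast
 thus ?thesis unfolding ord_def amp_def valid_def using slow_time by (intro exI[of _ B]) auto
qed

lemma amp_deriv:
 assumes "k < 4" "0 < e" "t : {0..T / e^2}"
 shows "(amp A k e t has_vector_derivative of_real e * amp A (Suc k) e t x) (at x)"
proof -
 have "(%Y. A Y (e^2 * t)) : Cb 4" using A slow_time[OF assms(2,3)] by (simp add: time_continuous_def)
 from Cb_deriv[OF this assms(1), of "e * x"]
 have "(vderiv k (%Y. A Y (e^2 * t)) \<circ> (%x. e * x) has_vector_derivative e *\<^sub>R vderiv (Suc k) (%Y. A Y (e^2 * t)) (e * x)) (at x)"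
  by (intro vector_diff_chain_at) (auto intro!: derivative_eq_intros)
 thus ?thesis by (simp add: amp_def[abs_def] o_def scaleR_conv_of_real)
qed

lemma amp_slow: assumes k: "k < 4" shows "slow T 0 (amp A k)"
proof -
 obtain C where C: "C >= 0" "!!e t x. valid T e t ==> cmod (amp A (Suc k) e t x) <= C"
  using amp_ord[of "Suc k"] k by (auto simp: ord_def)
 have "cmod (amp A k e t x - amp A k e t y) <= C * e ^ (0 + 1) * abs (x - y)" if v: "valid T e t" for e t x y
 proof -
  have "norm (amp A k e t x - amp A k e t y) <= (C * e) * norm (x - y)"
  proof (rule differentiable_bound[of UNIV])
   show "(amp A k e t has_derivative (%h. h *\<^sub>R (of_real e * amp A (Suc k) e t z))) (at z)" for z
    using amp_deriv[OF k valid_eps(1)[OF v] valid_eps(3)[OF v], of z] by (simp add: has_vector_derivative_def)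
   show "onorm (%h. h *\<^sub>R (complex_of_real e * amp A (Suc k) e t z)) <= C * e" for z
   proof (rule onorm_le)
    show "norm (h *\<^sub>R (complex_of_real e * amp A (Suc k) e t z)) <= C * e * norm h" for h
    using mult_left_mono[OF C(2)[OF v, of z], of "abs (h) * e"] valid_eps(1)[OF v] by (simp add: norm_mult mult_ac)
   qed
  qed auto
  thus ?thesis by simp
 qed
 thus ?thesis unfolding slow_def using amp_fam[of k] amp_ord[of k] k C(1) by auto
qed

lemma pamp_bcs: "j <= 4 ==> 0 < e ==> bcs {0..T / e^2} (%x t. pamp A j e t x)"
 unfolding pamp_def by (intro bcs_sum bcs_linear[OF amp_bcs bounded_linear_mult_right]) auto

lemma psJ_bcs: "0 < e ==> bcs {0..T / e^2} (%x t. psJ A e t x)"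
 unfolding psJ_def by (intro bcs_mkJ bcs_linear[OF wv_bcs[OF pamp_bcs] bounded_linear_mult_right])

lemma isJet_psJ:
 assumes e: "0 < e" "t : {0..T / e^2}" shows "isJet (psJ A e t)"
 unfolding isJet_def
proof (intro conjI allI impI)
 show "bcf (psJ A e t)" using bcs_bcf[OF psJ_bcs[OF e(1)] e(2)] .
 fix j :: nat and x assume j: "j < 4"
 define G' where "G' = (\<Sum>k\<le>j. of_nat (j choose k) * \<i> ^ (j - k) * of_real e ^ k * (of_real e * amp A (Suc k) e t x))"
 have d: "(pamp A j e t has_vector_derivative G') (at x)"
  unfolding pamp_def[abs_def] G'_def using j by (intro has_vector_derivative_sum has_vector_derivative_mult_right amp_deriv e) auto
 define a where "a k = amp A k e t x" for k
 define z where "z = complex_of_real e"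
 consider "j = 0" | "j = 1" | "j = 2" | "j = 3" using j by linarith
 hence G': "G' + \<i> * pamp A j e t x = pamp A (Suc j) e t x"
  unfolding pamp_def G'_def a_def[symmetric] z_def[symmetric] by cases (simp_all add: numeral_eq_Suc algebra_simps)
 have "(wv 1 (pamp A j e t) has_real_derivative wv 1 (pamp A (Suc j) e t) x) (at x)"
  using wv_derivative[OF d] unfolding G' wv_def[of 1 "pamp A (Suc j) e t"] mult_1 .
 from DERIV_cmult[OF this, of "2 * e"] show "((%x. jc j (psJ A e t x)) has_real_derivative jc (Suc j) (psJ A e t x)) (at x)"
  using j by (simp add: psJ_def jc_mkJ)
qed

lemma ptd_bcs: "0 < e ==> bcs {0..T / e^2} (%x t. ptd A c e t x)"
 unfolding ptd_def
 by (intro bcs_linear[OF wv_bcs bounded_linear_mult_right] bcs_add bcs_diff bcs_linear[OF _ bounded_linear_mult_right]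
   bcs_bilinear[OF bounded_bilinear_mult] bcs_linear[OF _ bounded_linear_cnj] amp_bcs) auto

text \<open>The terms of lower order cancel because \<open>k = 1\<close> is a double zero of \<open>a\<close>, and the terms of order three combine with the time derivative to the Ginzburg--Landau equation.\<close>

lemma linear_residual:
 "ptd A c e t x + (jc 4 (psJ A e t x) + (2 * jc 2 (psJ A e t x) + jc 0 (psJ A e t x))) - e^2 * jc 0 (psJ A e t x) =
  wv 1 (%x. of_real (e ^ 3 * (- 2 * c)) * (amp A 0 e t x * amp A 0 e t x * cnj (amp A 0 e t x))) x
  + e ^ 4 * 2 * wv 1 (%x. e * amp A 4 e t x + 4 * \<i> * amp A 3 e t x) x"
proof -
 define u where "u = amp A 0 e t x * amp A 0 e t x * cnj (amp A 0 e t x)"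
 have "complex_of_real e ^ n = of_real (e ^ n)" for n by simp
 thus ?thesis
  unfolding ptd_def psJ_def jc_mkJ[OF order_refl] wv_def u_def[symmetric]
  by (simp add: jc_mkJ wv_def pamp_simps u_def[symmetric] del: of_real_power)
   (simp add: algebra_simps power2_eq_square power3_eq_cube power4_eq_xxxx)
qed

lemma psi_time_derivative:
 assumes gl: "!!X s. s : {0..T} ==> (A X has_vector_derivative
    (A X s + 4 * vderiv 2 (%Y. A Y s) X - of_real c * of_real ((cmod (A X s))^2) * A X s)) (at s within {0..T})"
  and e: "0 < e" and t: "0 < t" "t < T / e^2"
 shows "((%t. jc 0 (psJ A e t x)) has_real_derivative ptd A c e t x) (at t)"
proof -
 have s: "0 < e^2 * t" "e^2 * t < T" using e t by (auto simp: pos_less_divide_eq mult.commute)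
 define D where "D = A (e * x) (e^2 * t) + 4 * vderiv 2 (%Y. A Y (e^2 * t)) (e * x) - of_real c * of_real ((cmod (A (e * x) (e^2 * t)))^2) * A (e * x) (e^2 * t)"
 have "(A (e * x) has_vector_derivative D) (at (e^2 * t) within {0..T})" unfolding D_def using s by (intro gl) auto
 hence "(A (e * x) has_vector_derivative D) (at (e^2 * t))" using at_within_Icc_at[OF s] by simp
 hence "(A (e * x) \<circ> (%t. e\<^sup>2 * t) has_vector_derivative e\<^sup>2 *\<^sub>R D) (at t)"
  by (intro vector_diff_chain_at) (auto intro!: derivative_eq_intros)
 hence "((%t. A (e * x) (e^2 * t) * cis x) has_vector_derivative (e^2 *\<^sub>R D) * cis x) (at t)"
  by (intro has_vector_derivative_mult_left) (simp add: o_def)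
 from bounded_linear.has_vector_derivative[OF bounded_linear_Re this]
 have "((%t. 2 * e * Re (A (e * x) (e^2 * t) * cis x)) has_real_derivative 2 * e * Re ((e^2 *\<^sub>R D) * cis x)) (at t)"
  unfolding has_real_derivative_iff_has_vector_derivative[symmetric] by (intro DERIV_cmult)
 moreover have "2 * e * Re ((e^2 *\<^sub>R D) * cis x) = ptd A c e t x"
 proof -
  have "amp A 0 e t x + 4 * amp A 2 e t x - of_real c * (amp A 0 e t x * amp A 0 e t x * cnj (amp A 0 e t x)) = D"
   unfolding D_def complex_norm_square by (simp add: amp_def vderiv_0 mult_ac)
  thus ?thesis unfolding ptd_def wv_def by (simp add: power3_eq_cube power2_eq_square algebra_simps)
 qed
 ultimately show ?thesis by (simp add: psJ_def jc_mkJ wv_def pamp_simps amp_def vderiv_0)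
qed

end

section \<open>The approximate solution\<close>

definition chi :: "real => real" where "chi k = plateau (1 / 16 * sa k) + - plateau (20 * sa k)"

text \<open>The summand with the truncated power keeps the denominator positive and vanishes where \<open>chi\<close> does not, so that \<open>a nu = chi\<close> holds exactly.\<close>

definition nu :: "real => real" where "nu k = inverse (sa k + max 0 (1 / 20 - sa k) ^ 4) * chi k"

lemma chi_csym: "csym 3 chi"
proof -
 have c: "csym 3 (%k. plateau (r * sa k))" if "r > 0" for r by (rule csa_csym[OF csa_plateau[OF that]])
 obtain R S where "!!k. R < abs (k) ==> plateau (1 / 16 * sa k) = 0" "!!k. S < abs (k) ==> plateau (20 * sa k) = 0"
  using c[of "1 / 16"] c[of 20] by (auto simp: csym_def)
 hence "ALL k. max R S < abs (k) --> chi k = 0" by (simp add: chi_def)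
 moreover have "Ck 3 chi" unfolding chi_def[abs_def] using c[of "1 / 16"] c[of 20] by (intro Ck_intros) (auto simp: csym_def)
 ultimately show ?thesis unfolding csym_def by blast
qed

lemma nu_denominator: "0 < sa k + max 0 (1 / 20 - sa k) ^ 4"
 using sa_nonneg[of k] by (cases "sa k = 0") (auto simp: add_pos_nonneg)

lemma nu_csym: "csym 3 nu"
proof -
 have "Ck 3 (%x::real. max 0 x ^ 4)" using Ck_pos_part_power[of 3] by (simp add: eval_nat_numeral)
 from Ck_compose[OF this Ck_diff[OF Ck_const[of 3 "1 / 20"] Ck_even_poly]]
 have "Ck 3 (%k. inverse (sa k + max 0 (1 / 20 - sa k) ^ 4))"
  by (intro Ck_inverse Ck_add Ck_even_poly) (use nu_denominator less_irrefl in metis)+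
 thus ?thesis unfolding nu_def[abs_def] by (rule csym_mult[OF chi_csym])
qed

lemma even_cut: "chi (- k) = chi k" "nu (- k) = nu k" "crit (- k) = crit k"
 by (simp_all add: chi_def nu_def crit_def sa_even)

lemma chi_evs: "evs chi" and nu_evs: "evs nu"
 by (rule csym_evs[OF chi_csym even_cut(1)], rule csym_evs[OF nu_csym even_cut(2)])

lemma chi_zero: "sa k <= 1 / 20 ==> chi k = 0" by (simp add: chi_def plateau_one)

lemma sa_nu: "sa k * nu k = chi k"
proof (cases "sa k <= 1 / 20")
 case False
 thus ?thesis by (simp add: nu_def)
qed (simp add: nu_def chi_zero)

lemma crit_nu: "crit k * nu k = 0"
 using crit_support[of k] chi_zero[of k] by (cases "crit k = 0"; simp add: nu_def)

lemma chi_interaction: assumes "crit l \<noteq> 0" "crit j \<noteq> 0" shows "chi (l + j) = 1"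
proof -
 have "sa l < (3 / 20)^2" "sa j < (3 / 20)^2" using crit_support[OF assms(1)] crit_support[OF assms(2)] by (simp_all add: power2_eq_square)
 from sum_of_critical[OF this] have o: "(l + j)^2 >= 17 / 5 & (l + j)^2 <= 23 / 5 \<or> (l + j)^2 <= 3 / 5" by simp
 have "1 / 10 <= (1 - s)^2 & (1 - s)^2 <= 16" if "17 / 5 <= s & s <= 23 / 5 \<or> 0 <= s & s <= 3 / 5" for s :: real
 proof -
  have "2 / 5 <= abs (1 - s)" "abs (1 - s) <= 4" using that by auto
  from power_mono[OF this(1), of 2] power_mono[OF this(2), of 2] have "(2 / 5)^2 <= (1 - s)^2" "(1 - s)^2 <= 4^2" by simp_all
  moreover have "(2 / 5)^2 = (4 / 25 :: real)" "4^2 = (16 :: real)" by (simp_all add: power2_eq_square)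
  ultimately show ?thesis by linarith
 qed
 from this[of "(l + j)^2"] o have "1 / 10 <= sa (l + j)" "sa (l + j) <= 16" by (auto simp: sa_def)
 thus ?thesis by (simp add: chi_def plateau_one plateau_zero)
qed

lemma cut_values: "crit 1 = 1" "crit 3 = 0" "nu 2 = 1 / 9" "nu 0 = 1"
proof -
 have "sa 1 = 0" "sa 3 = 64" "sa 2 = 9" "sa 0 = 1" by (simp_all add: sa_def)
 thus "crit 1 = 1" "crit 3 = 0" "nu 2 = 1 / 9" "nu 0 = 1" by (simp_all add: crit_def nu_def chi_def plateau_one plateau_zero)
qed

abbreviation nBr :: "smeasure => (real => real) => (real => real) => real => real" where "nBr \<equiv> nB (*)"

definition cosint :: "smeasure => real => real" where "cosint mu n = sm_integral mu (%u. cos (n * u))"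

definition glc :: "smeasure => smeasure => real" where
 "glc Q K = (let q = cosint Q; k = cosint K in 2 * k 0 + k 2 - q 1 * q 2 / 9 - (q 1)^2 / 9 - 2 * q 0 * q 1 - 2 * (q 1)^2)"

definition hh :: "(real => real => complex) => real family" where "hh A e t x = jc 0 (psJ A e t x)"
definition pc :: "(real => real => complex) => real family" where "pc A e t = fmult crit (hh A e t)"
definition pd :: "(real => real => complex) => real => real family" where "pd A c e t = fmult crit (ptd A c e t)"
definition bb :: "smeasure => (real => real => complex) => real family" where "bb Q A e t = nBr Q (pc A e t) (pc A e t)"
definition bd :: "smeasure => (real => real => complex) => real => real family" where
 "bd Q A c e t x = nBr Q (pd A c e t) (pc A e t) x + nBr Q (pc A e t) (pd A c e t) x"
definition Lf :: "(real => real => complex) => real => real family" where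
 "Lf A c e t x = ptd A c e t x + (jc 4 (psJ A e t x) + (2 * jc 2 (psJ A e t x) + jc 0 (psJ A e t x))) - e^2 * jc 0 (psJ A e t x)"
text \<open>Filtered wave plus the response of the noncritical modes to its quadratic interaction, as jets.\<close>

definition Phi :: "smeasure => (real => real => complex) => jet family" where
 "Phi Q A e t x = smJ crit (hh A e t) x + smJ nu (bb Q A e t) x"
definition GG :: "smeasure => (real => real => complex) => real => jet family" where
 "GG Q A c e t x = smJ crit (Lf A c e t) x + (smJ nu (%x. bd Q A c e t x - e^2 * bb Q A e t x) x + smJ chi (bb Q A e t) x)"
definition rr :: "smeasure => smeasure => (real => real => complex) => real => jet family" where
 "rr Q K A c e t x = nN jm Q K (Phi Q A e t) x - GG Q A c e t x"

context
 fixes Q K :: smeasure and T :: real and A :: "real => real => complex"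
 assumes Q: "admissible_kernel Q" and K: "admissible_kernel K" and T: "0 < T" and gl: "gl_solution Q K T A"
begin

lemma fsQ: "finite_signed Q" and fsK: "finite_signed K" using Q K by (auto simp: admissible_kernel_def)

lemma tcA: "time_continuous 4 T A" using gl by (simp add: gl_solution_def)

lemma gl_coeff_real: "gl_coeff Q K = of_real (glc Q K)"
 using Q K sm_fourier_real[of Q] sm_fourier_real[of K]
 by (simp add: gl_coeff_def glc_def cosint_def Let_def admissible_kernel_def)

lemma ansatz_bcs:
 assumes e: "0 < e"
 shows "bcs {0..T / e^2} (%x t. hh A e t x)" "bcs {0..T / e^2} (%x t. pc A e t x)" "bcs {0..T / e^2} (%x t. pd A c e t x)"
  "bcs {0..T / e^2} (%x t. bb Q A e t x)" "bcs {0..T / e^2} (%x t. bd Q A c e t x)" "bcs {0..T / e^2} (%x t. Lf A c e t x)"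
  "bcs {0..T / e^2} (%x t. Phi Q A e t x)" "bcs {0..T / e^2} (%x t. GG Q A c e t x)" "bcs {0..T / e^2} (%x t. rr Q K A c e t x)"
  "bcs {0..T / e^2} (%x t. bd Q A c e t x - e^2 * bb Q A e t x)"
proof -
 note j = bcs_linear[OF psJ_bcs[OF T tcA e] bounded_linear_jc] and p = ptd_bcs[OF T tcA e]
 show h: "bcs {0..T / e^2} (%x t. hh A e t x)" unfolding hh_def by (rule j)
 show 1: "bcs {0..T / e^2} (%x t. pc A e t x)" unfolding pc_def by (rule bcs_fmult[OF crit_evs h])
 show 2: "bcs {0..T / e^2} (%x t. pd A c e t x)" unfolding pd_def by (rule bcs_fmult[OF crit_evs p])
 note nB = bcs_nB[OF bounded_bilinear_mult fsQ fsK]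
 show 3: "bcs {0..T / e^2} (%x t. bb Q A e t x)" unfolding bb_def by (rule nB[OF 1 1])
 show 4: "bcs {0..T / e^2} (%x t. bd Q A c e t x)" unfolding bd_def by (intro bcs_add nB 1 2)
 show 5: "bcs {0..T / e^2} (%x t. Lf A c e t x)" unfolding Lf_def
  by (intro bcs_add bcs_diff p j bcs_linear[OF j bounded_linear_mult_right])
 show 6: "bcs {0..T / e^2} (%x t. Phi Q A e t x)" unfolding Phi_def by (intro bcs_add bcs_smJ crit_csym nu_csym h 3)
 show 8: "bcs {0..T / e^2} (%x t. bd Q A c e t x - e^2 * bb Q A e t x)"
  by (intro bcs_diff 4 bcs_linear[OF 3 bounded_linear_mult_right])
 show 7: "bcs {0..T / e^2} (%x t. GG Q A c e t x)" unfolding GG_def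
  by (intro bcs_add bcs_smJ[OF crit_csym 5] bcs_smJ[OF nu_csym 8] bcs_smJ[OF chi_csym 3])
 show "bcs {0..T / e^2} (%x t. rr Q K A c e t x)" unfolding rr_def
  by (intro bcs_diff bcs_nN[OF bounded_bilinear_jm fsQ fsK 6] 7)
qed

lemma ansatz_isJet:
 assumes e: "0 < e" "t : {0..T / e^2}"
 shows "isJet (Phi Q A e t)" "isJet (GG Q A c e t)" "isJet (rr Q K A c e t)"
proof -
 note b = ansatz_bcs[OF e(1), THEN bcs_bcf, OF e(2)]
 show 1: "isJet (Phi Q A e t)" unfolding Phi_def[abs_def] by (intro isJet_add smJ_isJet crit_csym nu_csym b)
 show 2: "isJet (GG Q A c e t)" unfolding GG_def[abs_def]
  by (intro isJet_add smJ_isJet[OF crit_csym b(6)] smJ_isJet[OF nu_csym b(10)] smJ_isJet[OF chi_csym b(4)])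
 show "isJet (rr Q K A c e t)" unfolding rr_def[abs_def] nN_def nB_def nC_def
  by (intro isJet_diff isJet_add isJet_minus isJet_jm isJet_sc[OF fsQ] isJet_sc[OF fsK] 1 2)
qed

lemma ansatz_jc0:
 "jc 0 (Phi Q A e t x) = pc A e t x + fmult nu (bb Q A e t) x"
 "jc 0 (GG Q A c e t x) = fmult crit (Lf A c e t) x + (fmult nu (%x. bd Q A c e t x - e^2 * bb Q A e t x) x + fmult chi (bb Q A e t) x)"
 by (simp_all add: Phi_def GG_def jc_add smJ_0 pc_def)

lemma sc_time_derivative:
 fixes F F' :: "real => real => real"
 assumes "bcs {0..R} F" "bcs {0..R} F'" "!!x t. 0 < t ==> t < R ==> (F x has_real_derivative F' x t) (at t)" "0 < t" "t < R"
 shows "((%t. sc Q (%y. F y t) x) has_real_derivative sc Q (%y. F' y t) x) (at t)"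
 unfolding sc_def by (intro DERIV_diff cv_time_derivative[OF finite_signed_kern(1)[OF fsQ] assms] cv_time_derivative[OF finite_signed_kern(2)[OF fsQ] assms])

lemma ansatz_mild:
 assumes e: "0 < e" and t: "t : {0..T / e^2}"
 shows "Phi Q A e t x = exp (e^2 * t) *\<^sub>R sg t (Phi Q A e 0) x + duhamel e (%x s. GG Q A (glc Q K) e s x) x t"
proof -
 let ?c = "glc Q K" and ?R = "T / e^2"
 note B = ansatz_bcs(1,2)[OF e] ansatz_bcs(3)[OF e, where c="?c"] ansatz_bcs(4)[OF e] ansatz_bcs(5,6)[OF e, where c="?c"] ansatz_bcs(7)[OF e]
  ansatz_bcs(8-10)[OF e, where c="?c"]
 note ptdb = ptd_bcs[OF T tcA e, of ?c]
 note b = B[THEN bcs_bcf]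
 have hd: "((%t. hh A e t x) has_real_derivative ptd A ?c e t x) (at t)" if "0 < t" "t < ?R" for x t
  unfolding hh_def
 proof (rule psi_time_derivative[OF T tcA _ e that])
  show "(A X has_vector_derivative (A X s + 4 * vderiv 2 (%Y. A Y s) X - of_real ?c * of_real ((cmod (A X s))^2) * A X s)) (at s within {0..T})"
   if "s : {0..T}" for X s using gl that unfolding gl_solution_def gl_coeff_real by blast
 qed
 have pcd: "((%t. pc A e t x) has_real_derivative pd A ?c e t x) (at t)" if "0 < t" "t < ?R" for x t
  unfolding pc_def pd_def fmult_def by (rule cv_time_derivative[OF evs_kern[OF crit_evs] B(1) ptdb hd that])
 have bbd: "((%t. bb Q A e t x) has_real_derivative bd Q A ?c e t x) (at t)" if "0 < t" "t < ?R" for x t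
  using DERIV_minus[OF DERIV_mult[OF pcd[OF that, of x] sc_time_derivative[OF B(2,3) pcd that, of x]]]
  unfolding bb_def bd_def nB_def by (simp add: algebra_simps)
 have t0: "0 : {0..?R}" "0 <= t" using t by auto
 have m1: "fmult crit (hh A e t) x = exp (e^2 * t) * sg t (fmult crit (hh A e 0)) x + duhamel e (%x s. fmult crit (Lf A ?c e s) x) x t" for x
 proof -
  have "fmult crit (ptd A ?c e s) x + (fmult (%k. sa k * crit k) (hh A e s) x - e^2 * fmult crit (hh A e s) x) = fmult crit (Lf A ?c e s) x"
   if s: "s : {0..?R}" for s x
  proof -
   let ?J = "%x. jc 4 (psJ A e s x) + (2 * jc 2 (psJ A e s x) + jc 0 (psJ A e s x))"
   have bj: "bcf (%x. jc i (psJ A e s x))" for i using bcs_bcf[OF bcs_linear[OF psJ_bcs[OF T tcA e] bounded_linear_jc] s] .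
   have bJ: "bcf ?J" using bcf_add[OF bj[of 4] bcf_add[OF bcf_scaleR[OF bj[of 2], of 2] bj[of 0]]] by simp
   have "fmult (%k. sa k * crit k) (hh A e s) x = fmult crit ?J x"
    unfolding hh_def[abs_def] by (rule fmult_by_parts[OF crit_csym even_cut(3) isJet_psJ[OF T tcA e s]])
   moreover have "fmult crit (Lf A ?c e s) x = fmult crit (ptd A ?c e s) x + fmult crit ?J x - e^2 * fmult crit (hh A e s) x"
    unfolding Lf_def[abs_def] hh_def[abs_def]
    using fmult_diff[OF crit_evs bcf_add[OF bcs_bcf[OF ptdb s] bJ] bcf_scaleR[OF bj[of 0], of "e^2"], of x]
    fmult_add[OF crit_evs bcs_bcf[OF ptdb s] bJ, of x] fmult_scaleR[OF crit_evs bj[of 0], of "e^2" x] by simp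
   ultimately show ?thesis by simp
  qed
  hence "duhamel e (%x s. fmult crit (ptd A ?c e s) x + (fmult (%k. sa k * crit k) (hh A e s) x - e^2 * fmult crit (hh A e s) x)) x t
    = duhamel e (%x s. fmult crit (Lf A ?c e s) x) x t"
   unfolding duhamel_def using t by (intro integral_cong) simp
  thus ?thesis using mild_of_time_derivative[OF crit_csym even_cut(3) B(1) ptdb hd t, of x e] by simp
 qed
 have m2: "fmult nu (bb Q A e t) x = exp (e^2 * t) * sg t (fmult nu (bb Q A e 0)) x +
   duhamel e (%x s. fmult nu (%x. bd Q A ?c e s x - e^2 * bb Q A e s x) x + fmult chi (bb Q A e s) x) x t" for x
 proof -
  have "fmult nu (bd Q A ?c e s) x + (fmult (%k. sa k * nu k) (bb Q A e s) x - e^2 * fmult nu (bb Q A e s) x)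
    = fmult nu (%x. bd Q A ?c e s x - e^2 * bb Q A e s x) x + fmult chi (bb Q A e s) x" if s: "s : {0..?R}" for s x
   using fmult_diff[OF nu_evs b(5)[OF s] bcf_scaleR[OF b(4)[OF s], of "e^2"], of x] fmult_scaleR[OF nu_evs b(4)[OF s], of "e^2" x]
   by (simp add: sa_nu)
  hence "duhamel e (%x s. fmult nu (bd Q A ?c e s) x + (fmult (%k. sa k * nu k) (bb Q A e s) x - e^2 * fmult nu (bb Q A e s) x)) x t
    = duhamel e (%x s. fmult nu (%x. bd Q A ?c e s x - e^2 * bb Q A e s x) x + fmult chi (bb Q A e s) x) x t"
   unfolding duhamel_def using t by (intro integral_cong) simp
  thus ?thesis using mild_of_time_derivative[OF nu_csym even_cut(2) B(4,5) bbd t, of x e] by simp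
 qed
 note gb = bcs_linear[OF B(8) bounded_linear_jc]
 have J: "isJet (%x. exp (e^2 * t) *\<^sub>R sg t (Phi Q A e 0) x + duhamel e (%x s. GG Q A ?c e s x) x t)"
  by (intro isJet_add isJet_scaleR isJet_sg[OF t0(2)] ansatz_isJet e t0 isJet_duhamel[OF B(8) _ t])
 have sgj: "jc 0 (sg t (Phi Q A e 0) x) = sg t (fmult crit (hh A e 0)) x + sg t (fmult nu (bb Q A e 0)) x" for x
  unfolding sg_def jc_cv[OF sg_kern[OF t0(2)] b(7)[OF t0(1)]] ansatz_jc0 pc_def
  by (rule cv_add[OF sg_kern[OF t0(2)]]) (intro fmult_bcf crit_evs nu_evs b t0)+
 have dj: "jc 0 (duhamel e (%x s. GG Q A ?c e s x) x t) = duhamel e (%x s. fmult crit (Lf A ?c e s) x) x t +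
   duhamel e (%x s. fmult nu (%x. bd Q A ?c e s x - e^2 * bb Q A e s x) x + fmult chi (bb Q A e s) x) x t" for x
  unfolding jc_duhamel[OF B(8) t] ansatz_jc0
  by (rule duhamel_add[OF bcs_fmult[OF crit_evs B(6)] bcs_add[OF bcs_fmult[OF nu_evs B(10)] bcs_fmult[OF chi_evs B(4)]] t])
 show ?thesis
 proof (rule isJet_unique[OF ansatz_isJet(1)[OF e t] J])
  fix x show "jc 0 (Phi Q A e t x) = jc 0 (exp (e^2 * t) *\<^sub>R sg t (Phi Q A e 0) x + duhamel e (%x s. GG Q A ?c e s x) x t)"
   unfolding jc_add jc_scaleR sgj dj ansatz_jc0(1) pc_def m1[of x] m2[of x] by (simp add: distrib_left)
 qed
qed

end

section \<open>The residual of the approximation\<close>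

lemma ord_from: "ord T n (%e t x. F e t x - G e t x) ==> m <= n ==> ord T m G ==> ord T m F"
 using ord_add[of T m "%e t x. F e t x - G e t x" G] ord_weaken[of T n "%e t x. F e t x - G e t x" m] by simp

lemma ord_zero: "(!!e t x. valid T e t ==> F e t x = 0) ==> ord T n F"
 unfolding ord_def by (intro exI[of _ 0]) auto

lemma ord_sum: "finite I ==> (!!i. i : I ==> ord T n (F i)) ==> ord T n (%e t x. \<Sum>i\<in>I. F i e t x)"
 by (induction I rule: finite_induct) (auto intro: ord_add ord_zero)

lemma ord_jet: assumes "!!i. i <= 4 ==> ord T n (%e t x. jc i (F e t x))" shows "ord T n F"
proof -
 have "ALL i:{..4::nat}. EX C>=0. ALL e t x. valid T e t --> abs (jc i (F e t x)) <= C * e ^ n" using assms by (auto simp: ord_def)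
 then obtain C where C: "!!i e t x. i <= 4 ==> 0 <= C i & (valid T e t --> abs (jc i (F e t x)) <= C i * e ^ n)" by (metis atMost_iff)
 have "norm (F e t x) <= 5 * ((\<Sum>i\<le>4. C i) * e ^ n)" if v: "valid T e t" for e t x
 proof (rule norm_jet_le)
  fix i :: nat assume i: "i <= 4"
  have "C i <= (\<Sum>i\<le>4. C i)" using C i by (intro member_le_sum) auto
  hence "C i * e ^ n <= (\<Sum>i\<le>4. C i) * e ^ n" using valid_eps(1)[OF v] by (intro mult_right_mono) auto
  thus "abs (jc i (F e t x)) <= (\<Sum>i\<le>4. C i) * e ^ n" using C[OF i, of e t x] v by linarith
 qed
 thus ?thesis unfolding ord_def using C by (intro exI[of _ "5 * (\<Sum>i\<le>4. C i)"]) (auto simp: mult.assoc intro!: sum_nonneg)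
qed

lemma op_wave2:
 assumes "op_ok Op s" "fam T F" "slow T m a1" "slow T m a2" "N = m + 1"
  and "ord T N (%e t x. F e t x - (wv n (a1 e t) x + wv k (a2 e t) x))"
 shows "ord T N (%e t x. Op (F e t) x - (s n * wv n (a1 e t) x + s k * wv k (a2 e t) x))"
 using op_wave[OF assms(1-4) assms(6)[unfolded assms(5)]] unfolding assms(5) .

lemma op_wave1:
 assumes "op_ok Op s" "fam T F" "slow T m a" "N = m + 1"
  and "ord T N (%e t x. F e t x - wv n (a e t) x)"
 shows "ord T N (%e t x. Op (F e t) x - s n * wv n (a e t) x)"
proof -
 have "slow T m (%e t x. 0)" using slow_eps[of T m 0] by simp
 from op_wave2[OF assms(1-3) this assms(4), of n n] assms(5) show ?thesis by (simp add: wv_def)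
qed

lemma smJ_fmult:
 assumes m: "csym 3 m" "evs m" and g: "isJet g" shows "smJ m (%x. jc 0 (g x)) x = fmult m g x"
 by (rule isJet_unique[OF smJ_isJet[OF m(1) bcf_linear[OF isJet_bcf[OF g] bounded_linear_jc]] isJet_fmult[OF m(2) g]])
  (simp add: smJ_0 fmult_def jc_cv[OF evs_kern[OF m(2)] isJet_bcf[OF g]])

lemma crit2_csym: "csym 3 crit2"
 unfolding crit2_def[abs_def] by (rule csa_csym[OF csa_plateau]) simp

lemma jc_nN:
 assumes Q: "finite_signed Q" and K: "finite_signed K" and f: "bcf f"
 shows "jc 0 (nB jm Q f f x) = nB (*) Q (%x. jc 0 (f x)) (%x. jc 0 (f x)) x"
  "jc 0 (nN jm Q K f x) = nN (*) Q K (%x. jc 0 (f x)) x"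
 by (simp_all add: nN_def nB_def nC_def jc_minus jc_diff jc_add jm_0 sc_linear[OF Q f bounded_linear_jc, symmetric]
  sc_linear[OF K bcf_bilinear[OF bounded_bilinear_jm f f] bounded_linear_jc, symmetric])

lemma fam_of_bcs: assumes "!!e. 0 < e ==> bcs {0..T / e^2} (%x t. F e t x)" shows "fam T F"
 unfolding fam_def
proof (intro allI impI)
 fix e t assume v: "valid T e t"
 show "bcf (F e t)" using bcs_bcf[OF assms[OF valid_eps(1)[OF v]] valid_eps(3)[OF v]] .
qed

lemma ord_product_diff':
 fixes F G F' G' :: "real family"
 assumes "nk = n + k" "mk = m + k" "N = n + m + k"
  and "ord T nk (%e t x. F e t x - F' e t x)" "ord T mk (%e t x. G e t x - G' e t x)" "ord T m G" "ord T n F'"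
 shows "ord T N (%e t x. F e t x * G e t x - F' e t x * G' e t x)"
 using ord_product_diff[OF assms(4-7)[unfolded assms(1,2)]] unfolding assms(3) .

lemma ord_mult': "N = n + m ==> ord T n F ==> ord T m G ==> ord T N (%e t x. F e t x * G e t x :: real)"
 using ord_mult by blast

lemma zero_symbol: "fmult (%k. 0) f x = 0"
 by (simp add: fmult_def cv_def ci_def)

context
 fixes Q K :: smeasure and T :: real and A :: "real => real => complex"
 assumes Q: "admissible_kernel Q" and K: "admissible_kernel K" and T: "0 < T" and gl: "gl_solution Q K T A"
begin

lemma ansatz_fam:
 "fam T (hh A)" "fam T (pc A)" "fam T (pd A c)" "fam T (bb Q A)" "fam T (bd Q A c)" "fam T (Lf A c)" "fam T (Phi Q A)" "fam T (GG Q A c)"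
 "fam T (rr Q K A c)" "fam T (%e t x. bd Q A c e t x - e^2 * bb Q A e t x)" "fam T (ptd A c)"
 by (rule fam_of_bcs, rule ansatz_bcs[OF Q K T gl] ptd_bcs[OF T tcA[OF Q K T gl]], assumption)+

lemma chi_bb: assumes v: "valid T e t" shows "fmult chi (bb Q A e t) x = bb Q A e t x"
 using quadratic_interaction_vanishes[OF bounded_bilinear_mult _ chi_evs crit_evs chi_interaction, of Q "hh A e t" "hh A e t" x]
  ansatz_fam(1) v Q by (simp add: bb_def pc_def fam_def admissible_kernel_def)

text \<open>The quadratic forcing \<open>bb\<close> has no critical frequencies, so only cubic interactions contribute at order three. They are products of modulated waves with modes \<open>1\<close> and \<open>3\<close>; mode \<open>3\<close> is removed by the filter and mode \<open>1\<close> cancels against the linear residual.\<close>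

lemma residual_expansion:
 defines "c \<equiv> glc Q K"
 shows "ord T 1 (hh A) & ord T 1 (pc A) & ord T 3 (pd A c) & ord T 2 (bb Q A) & ord T 3 (Lf A c) &
  ord T 4 (%e t x. fmult crit (%x. jc 0 (rr Q K A c e t x)) x)"
proof -
 note fsQ = fsQ[OF Q K T gl] and fsK = fsK[OF Q K T gl] and tc = tcA[OF Q K T gl]
 let ?a = "amp A 0"
 let ?q = "cosint Q" and ?k = "cosint K"
 define a1 where "a1 e t x = of_real (e ^ 1 * 2) * ?a e t x" for e t x
 define A2 where "A2 r e t x = of_real (e ^ 2 * r) * (?a e t x * ?a e t x)" for r e t x
 define B2 where "B2 r e t x = of_real (e ^ 2 * r) * (?a e t x * cnj (?a e t x))" for r e t x
 define A3 where "A3 r e t x = of_real (e ^ 3 * r) * (?a e t x * ?a e t x * ?a e t x)" for r e t x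
 define B3 where "B3 r e t x = of_real (e ^ 3 * r) * (?a e t x * ?a e t x * cnj (?a e t x))" for r e t x
 have s0: "slow T 0 ?a" "slow T 0 (%e t x. cnj (?a e t x))" using amp_slow[OF T tc, of 0] slow_cnj by auto
 have s: "slow T 1 a1" "slow T 2 (A2 r)" "slow T 2 (B2 r)" "slow T 3 (A3 r)" "slow T 3 (B3 r)" for r
  unfolding a1_def[abs_def] A2_def[abs_def] B2_def[abs_def] A3_def[abs_def] B3_def[abs_def]
  using slow_mult[OF slow_eps[of T 1 2] s0(1)] slow_mult[OF slow_eps[of T 2 r] slow_mult[OF s0(1) s0(1)]]
   slow_mult[OF slow_eps[of T 2 r] slow_mult[OF s0]] slow_mult[OF slow_eps[of T 3 r] slow_mult[OF slow_mult[OF s0(1) s0(1)] s0(1)]]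
   slow_mult[OF slow_eps[of T 3 r] slow_mult[OF slow_mult[OF s0(1) s0(1)] s0(2)]] by simp_all
 define H where "H e t x = wv 1 (a1 e t) x" for e t x
 note so = slow_def[THEN iffD1, THEN conjunct2, THEN conjunct1]
 have Ho: "ord T 1 H" unfolding H_def[abs_def] by (rule slow_ord[OF so[OF s(1)]])
 have hH: "hh A e t x = H e t x" for e t x by (simp add: hh_def H_def a1_def[abs_def] psJ_wave)
 have ho: "ord T 1 (hh A)" using Ho hH by (simp add: ord_def)
 have cs: "cosint mu = (%n. sm_integral mu (%u. cos (n * u)))" for mu by (rule ext) (rule cosint_def)
 have oks: "op_ok (fmult crit) crit" "op_ok (fmult nu) nu" "op_ok (sc Q) ?q" "op_ok (sc K) ?k"
  unfolding cs by (rule fmult_op_ok[OF crit_csym even_cut(3)] fmult_op_ok[OF nu_csym even_cut(2)] sc_op_ok[OF Q] sc_op_ok[OF K])+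
 note fm = ansatz_fam(1,2) ansatz_fam(3)[where c=c] ansatz_fam(4) ansatz_fam(5,6)[where c=c] ansatz_fam(7) ansatz_fam(8-11)[where c=c]
 have famQ: "fam T (%e t. sc Q (F e t))" "fam T (%e t. sc K (F e t))" if "fam T F" for F :: "real family"
  using that sc_bcf[OF fsQ] sc_bcf[OF fsK] by (auto simp: fam_def)
 have famM: "fam T (%e t. fmult m (F e t))" if "fam T F" "evs m" for F :: "real family" and m
  using that fmult_bcf by (auto simp: fam_def)
 have famp: "fam T (%e t x. F e t x * G e t x)" "fam T (%e t x. F e t x + G e t x)" if "fam T F" "fam T G" for F G :: "real family"
  using that by (auto simp: fam_def intro: bcf_bilinear[OF bounded_bilinear_mult] bcf_add)
 have E1: "ord T 2 (%e t x. pc A e t x - H e t x)"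
  using op_wave1[OF oks(1) fm(1) s(1), of 2 1] by (simp add: hH[abs_def] H_def[abs_def] ord_zero cut_values pc_def)
 have po: "ord T 1 (pc A)" by (rule ord_from[OF E1 _ Ho]) simp
 have pto: "ord T 3 (ptd A c)"
 proof -
  have "ord T 0 (%e t x. ?a e t x + 4 * amp A 2 e t x - of_real c * (?a e t x * ?a e t x * cnj (?a e t x)))"
   using so[OF slow_mult[OF slow_mult[OF s0(1) s0(1)] s0(2)]]
   by (intro ord_diff ord_add ord_linear[OF bounded_linear_mult_right] amp_ord[OF T tc]) simp_all
  from ord_mult[OF ord_eps[of T 3 2] slow_ord[OF this, of 1]] show ?thesis by (simp add: ptd_def[abs_def] mult_ac)
 qed
 have pdo: "ord T 3 (pd A c)" unfolding pd_def[abs_def] by (rule op_ord[OF oks(1) fm(11) pto])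
 have E2: "ord T 2 (%e t x. sc Q (pc A e t) x - ?q 1 * H e t x)"
  unfolding H_def by (rule op_wave1[OF oks(3) fm(2) s(1) _ E1[unfolded H_def]]) simp
 have sQ: "ord T 1 (%e t x. sc Q (pc A e t) x)" by (rule op_ord[OF oks(3) fm(2) po])
 have HH: "H e t x * H e t x * r = wv 2 (A2 (2 * r) e t) x + wv 0 (B2 (2 * r) e t) x" for e t x r
  unfolding H_def a1_def[abs_def] A2_def[abs_def] B2_def[abs_def] wv_scale
  using wave_product[of 1 "?a e t" x 1 "?a e t"] by (simp add: power2_eq_square algebra_simps)
 have E3: "ord T 3 (%e t x. bb Q A e t x - (wv 2 (A2 (- 2 * ?q 1) e t) x + wv 0 (B2 (- 2 * ?q 1) e t) x))"
 proof -
  have o: "ord T 3 (%e t x. pc A e t x * sc Q (pc A e t) x - H e t x * (?q 1 * H e t x))"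
   by (rule ord_product_diff'[where n=1 and m=1 and k=1, OF _ _ _ E1 E2 sQ Ho]) simp_all
  show ?thesis
  proof (rule ord_cong[OF ord_minus[OF o]])
   fix e t x
   show "- (pc A e t x * sc Q (pc A e t) x - H e t x * (?q 1 * H e t x)) = bb Q A e t x - (wv 2 (A2 (- 2 * ?q 1) e t) x + wv 0 (B2 (- 2 * ?q 1) e t) x)"
    using HH[of e t x "- ?q 1"] by (simp add: bb_def nB_def algebra_simps)
  qed
 qed
 have w2o: "ord T 2 (%e t x. wv 2 (A2 r e t) x + wv 0 (B2 r' e t) x)" for r r'
  by (intro ord_add slow_ord so[OF s(2)] so[OF s(3)])
 have bo: "ord T 2 (bb Q A)" by (rule ord_from[OF E3 _ w2o]) simp
 define p2 where "p2 e t = fmult nu (bb Q A e t)" for e t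
 have p2f: "fam T p2" unfolding p2_def[abs_def] by (rule famM[OF fm(4) nu_evs])
 have p2o: "ord T 2 p2" unfolding p2_def[abs_def] by (rule op_ord[OF oks(2) fm(4) bo])
 have A2s: "wv 2 (A2 r e t) x = r * wv 2 (A2 1 e t) x" "wv 0 (B2 r e t) x = r * wv 0 (B2 1 e t) x"
  "wv 3 (A3 r e t) x = r * wv 3 (A3 1 e t) x" "wv 1 (B3 r e t) x = r * wv 1 (B3 1 e t) x" for r e t x
  unfolding A2_def[abs_def] B2_def[abs_def] A3_def[abs_def] B3_def[abs_def] wv_scale by simp_all
 have E4: "ord T 3 (%e t x. p2 e t x - (wv 2 (A2 (- 2 * ?q 1 / 9) e t) x + wv 0 (B2 (- 2 * ?q 1) e t) x))"
 proof -
  have "ord T 3 (%e t x. fmult nu (bb Q A e t) x - (nu 2 * wv 2 (A2 (- 2 * ?q 1) e t) x + nu 0 * wv 0 (B2 (- 2 * ?q 1) e t) x))"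
   by (rule op_wave2[OF oks(2) fm(4) s(2) s(3) _ E3]) simp
  thus ?thesis unfolding p2_def cut_values A2s(1)[of "- 2 * ?q 1"] A2s(1)[of "- 2 * ?q 1 / 9"] by simp
 qed
 have E5: "ord T 3 (%e t x. sc Q (p2 e t) x - (?q 2 * wv 2 (A2 (- 2 * ?q 1 / 9) e t) x + ?q 0 * wv 0 (B2 (- 2 * ?q 1) e t) x))"
  by (rule op_wave2[OF oks(3) p2f s(2) s(3) _ E4]) simp
 have sQ2: "ord T 2 (%e t x. sc Q (p2 e t) x)" by (rule op_ord[OF oks(3) p2f p2o])
 define ph where "ph e t x = pc A e t x + p2 e t x" for e t x
 have phf: "fam T ph" unfolding ph_def[abs_def] by (rule famp[OF fm(2) p2f])
 have E6: "ord T 2 (%e t x. ph e t x - H e t x)" using ord_add[OF E1 p2o] by (simp add: ph_def algebra_simps)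
 have pho: "ord T 1 ph" by (rule ord_from[OF E6 _ Ho]) simp
 have E7: "ord T 3 (%e t x. ph e t x * ph e t x - (wv 2 (A2 2 e t) x + wv 0 (B2 2 e t) x))"
 proof -
  have "ord T 3 (%e t x. ph e t x * ph e t x - H e t x * H e t x)"
   by (rule ord_product_diff'[where n=1 and m=1 and k=1, OF _ _ _ E6 E6 pho Ho]) simp_all
  thus ?thesis using HH[of _ _ _ 1] by simp
 qed
 have E8: "ord T 3 (%e t x. sc K (%x. ph e t x * ph e t x) x - (?k 2 * wv 2 (A2 2 e t) x + ?k 0 * wv 0 (B2 2 e t) x))"
  by (rule op_wave2[OF oks(4) famp(1)[OF phf phf] s(2) s(3) _ E7]) simp
 have sK2: "ord T 2 (%e t x. sc K (%x. ph e t x * ph e t x) x)"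
  by (rule op_ord[OF oks(4) famp(1)[OF phf phf]]) (rule ord_mult'[OF _ pho pho], simp)
 define X where "X e t x = - (pc A e t x * sc Q (p2 e t) x) - p2 e t x * sc Q (pc A e t) x - p2 e t x * sc Q (p2 e t) x
  - ph e t x * sc K (%x. ph e t x * ph e t x) x" for e t x
 define d3 where "d3 = ?q 1 * ?q 2 / 9 + (?q 1)^2 / 9 - ?k 2"
 have E9: "ord T 4 (%e t x. X e t x - (wv 3 (A3 (2 * d3) e t) x + wv 1 (B3 (- 2 * c) e t) x))"
 proof -
  let ?Y = "%e t x. ?q 2 * wv 2 (A2 (- 2 * ?q 1 / 9) e t) x + ?q 0 * wv 0 (B2 (- 2 * ?q 1) e t) x"
  let ?Z = "%e t x. wv 2 (A2 (- 2 * ?q 1 / 9) e t) x + wv 0 (B2 (- 2 * ?q 1) e t) x"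
  let ?V = "%e t x. ?k 2 * wv 2 (A2 2 e t) x + ?k 0 * wv 0 (B2 2 e t) x"
  have 1: "ord T 4 (%e t x. pc A e t x * sc Q (p2 e t) x - H e t x * ?Y e t x)"
   by (rule ord_product_diff'[where n=1 and m=2 and k=1, OF _ _ _ E1 E5 sQ2 Ho]) simp_all
  have 2: "ord T 4 (%e t x. p2 e t x * sc Q (pc A e t) x - ?Z e t x * (?q 1 * H e t x))"
   by (rule ord_product_diff'[where n=2 and m=1 and k=1, OF _ _ _ E4 E2 sQ w2o]) simp_all
  have 3: "ord T 4 (%e t x. p2 e t x * sc Q (p2 e t) x)" by (rule ord_mult'[OF _ p2o sQ2]) simp
  have 4: "ord T 4 (%e t x. ph e t x * sc K (%x. ph e t x * ph e t x) x - H e t x * ?V e t x)"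
   by (rule ord_product_diff'[where n=1 and m=2 and k=1, OF _ _ _ E6 E8 sK2 Ho]) simp_all
  note o = ord_minus[OF ord_add[OF ord_add[OF 1 2] ord_add[OF 3 4]]]
  have hw: "H e t x * wv 2 (A2 r e t) x = wv 3 (A3 r e t) x + wv 1 (B3 r e t) x" "H e t x * wv 0 (B2 r e t) x = 2 * wv 1 (B3 r e t) x" for r e t x
  proof -
   have "wv (- 1) (%x. ?a e t x * cnj (?a e t x * ?a e t x)) x = wv 1 (%x. ?a e t x * ?a e t x * cnj (?a e t x)) x"
    unfolding wv_uminus by (simp add: mult_ac)
   hence 1: "wv 1 (?a e t) x * wv 2 (%x. ?a e t x * ?a e t x) x =
    (wv 3 (%x. ?a e t x * ?a e t x * ?a e t x) x + wv 1 (%x. ?a e t x * ?a e t x * cnj (?a e t x)) x) / 2"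
    using wave_product[of 1 "?a e t" x 2 "%x. ?a e t x * ?a e t x"] by (simp add: mult_ac)
   have 2: "wv 1 (?a e t) x * wv 0 (%x. ?a e t x * cnj (?a e t x)) x = wv 1 (%x. ?a e t x * ?a e t x * cnj (?a e t x)) x"
    using wave_product[of 1 "?a e t" x 0 "%x. ?a e t x * cnj (?a e t x)"] by (simp add: mult_ac)
   have "e ^ 3 = e * e^2" by (simp add: eval_nat_numeral)
   thus "H e t x * wv 2 (A2 r e t) x = wv 3 (A3 r e t) x + wv 1 (B3 r e t) x" "H e t x * wv 0 (B2 r e t) x = 2 * wv 1 (B3 r e t) x"
    unfolding H_def a1_def[abs_def] A2_def[abs_def] B2_def[abs_def] A3_def[abs_def] B3_def[abs_def] wv_scale
    using arg_cong[OF 1, of "%u. e * 2 * (e^2 * r) * u"] arg_cong[OF 2, of "%u. e * 2 * (e^2 * r) * u"] by (simp_all add: algebra_simps)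
  qed
  have "H e t x * ?Y e t x + ?Z e t x * (?q 1 * H e t x) + H e t x * ?V e t x = - (wv 3 (A3 (2 * d3) e t) x + wv 1 (B3 (- 2 * c) e t) x)" for e t x
  proof -
   have "H e t x * ?Y e t x + ?Z e t x * (?q 1 * H e t x) + H e t x * ?V e t x =
    (?q 2 + ?q 1) * (H e t x * wv 2 (A2 (- 2 * ?q 1 / 9) e t) x) + (?q 0 + ?q 1) * (H e t x * wv 0 (B2 (- 2 * ?q 1) e t) x)
    + ?k 2 * (H e t x * wv 2 (A2 2 e t) x) + ?k 0 * (H e t x * wv 0 (B2 2 e t) x)" by (simp add: algebra_simps)
   also have "... = - (wv 3 (A3 (2 * d3) e t) x + wv 1 (B3 (- 2 * c) e t) x)"
    unfolding hw A2s(3)[of "- 2 * ?q 1 / 9"] A2s(3)[of 2] A2s(3)[of "2 * d3"] A2s(4)[of "- 2 * ?q 1 / 9"] A2s(4)[of 2] A2s(4)[of "- 2 * ?q 1"] A2s(4)[of "- 2 * c"]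
    by (simp add: d3_def c_def glc_def Let_def power2_eq_square field_simps)
   finally show ?thesis .
  qed
  thus ?thesis by (intro ord_cong[OF o]) (simp add: X_def algebra_simps)
 qed
 have E10: "ord T 4 (%e t x. Lf A c e t x - wv 1 (B3 (- 2 * c) e t) x)"
 proof -
  have ob: "ord T 0 (%e t x. complex_of_real e * amp A 4 e t x)"
  proof -
   obtain B where B: "B >= 0" "!!e t x. valid T e t ==> cmod (amp A 4 e t x) <= B" using amp_ord[OF T tc, of 4] by (auto simp: ord_def)
   have "cmod (complex_of_real e * amp A 4 e t x) <= 1 * B" if v: "valid T e t" for e t x
    unfolding norm_mult using valid_eps[OF v] by (intro mult_mono B v) auto
   thus ?thesis unfolding ord_def using B(1) by (intro exI[of _ B]) simp
  qed
  have "ord T 0 (%e t x. of_real e * amp A 4 e t x + 4 * \<i> * amp A 3 e t x)"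
   by (intro ord_add ob ord_linear[OF bounded_linear_mult_right] amp_ord[OF T tc]) simp
  from ord_mult'[OF _ ord_eps[of T 4 2] slow_ord[OF this, of 1], of 4]
  have "ord T 4 (%e t x. e ^ 4 * 2 * wv 1 (%x. of_real e * amp A 4 e t x + 4 * \<i> * amp A 3 e t x) x)" by simp
  thus ?thesis by (rule ord_cong) (simp only: Lf_def linear_residual[OF T tc] B3_def[abs_def] add_diff_cancel_left')
 qed
 have Lo: "ord T 3 (Lf A c)" by (rule ord_from[OF E10 _ slow_ord[OF so[OF s(5)]]]) simp
 have E11: "ord T 4 (%e t x. fmult crit (Lf A c e t) x - crit 1 * wv 1 (B3 (- 2 * c) e t) x)"
  by (rule op_wave1[OF oks(1) fm(6) s(5) _ E10]) simp
 define Z where "Z e t x = X e t x - fmult crit (Lf A c e t) x" for e t x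
 have E12: "ord T 4 (%e t x. Z e t x - wv 3 (A3 (2 * d3) e t) x)"
  using ord_diff[OF E9 E11] by (simp add: Z_def cut_values algebra_simps)
 have b: "bcf (pc A e t)" "bcf (p2 e t)" "bcf (bb Q A e t)" "bcf (Lf A c e t)" "bcf (ph e t)" "bcf (%x. bd Q A c e t x - e^2 * bb Q A e t x)" if "valid T e t" for e t
  using fm p2f phf that by (auto simp: fam_def)
 have Zb: "bcf (Z e t)" if v: "valid T e t" for e t
  unfolding Z_def[abs_def] X_def
  by (intro bcf_diff bcf_minus bcf_bilinear[OF bounded_bilinear_mult] sc_bcf[OF fsQ] sc_bcf[OF fsK] fmult_bcf[OF crit_evs] b v)
 have E13: "ord T 4 (%e t x. fmult crit (Z e t) x - crit 3 * wv 3 (A3 (2 * d3) e t) x)"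
  by (rule op_wave1[OF oks(1) _ s(4) _ E12]) (simp_all add: fam_def Zb)
 have main: "ord T 4 (%e t x. fmult crit (%x. jc 0 (rr Q K A c e t x)) x)"
 proof (rule ord_cong[OF E13])
  fix e t x assume v: "valid T e t"
  note b = b[OF v]
  let ?D = "%x. bd Q A c e t x - e^2 * bb Q A e t x"
  have "jc 0 (rr Q K A c e t x) = Z e t x - fmult nu ?D x" for x
  proof -
   have P: "bcf (Phi Q A e t)" using fm(7) v by (auto simp: fam_def)
   have ph: "(%x. jc 0 (Phi Q A e t x)) = ph e t" by (simp add: ansatz_jc0[OF Q K T gl] ph_def[abs_def] p2_def fun_eq_iff)
   have "sc Q (ph e t) x = sc Q (pc A e t) x + sc Q (p2 e t) x" unfolding ph_def[abs_def] by (rule sc_add[OF fsQ b(1,2)])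
   hence "nN (*) Q K (ph e t) x = bb Q A e t x + X e t x"
    by (simp add: nN_def nB_def nC_def bb_def X_def ph_def algebra_simps)
   thus ?thesis
    unfolding rr_def jc_diff jc_nN(2)[OF fsQ fsK P] ph ansatz_jc0(2)[OF Q K T gl] chi_bb[OF v] Z_def by simp
  qed
  hence "fmult crit (%x. jc 0 (rr Q K A c e t x)) x = fmult crit (Z e t) x - fmult crit (fmult nu ?D) x"
   using fmult_diff[OF crit_evs Zb[OF v] fmult_bcf[OF nu_evs b(6)], of x] by simp
  also have "fmult crit (fmult nu ?D) x = 0"
   unfolding fmult_fmult[OF crit_evs nu_evs b(6)] crit_nu by (rule zero_symbol)
  finally show "fmult crit (Z e t) x - crit 3 * wv 3 (A3 (2 * d3) e t) x = fmult crit (%x. jc 0 (rr Q K A c e t x)) x"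
   by (simp add: cut_values)
 qed
 show ?thesis by (intro conjI ho po pdo bo Lo main)
qed

end

lemma slow_const: "slow T 0 (%e t x. z)"
proof -
 have "fam T (%e t x. z)" unfolding fam_def by (intro allI impI bcfI[where B="cmod z"]) auto
 moreover have "ord T 0 (%e t x. z)" unfolding ord_def by (intro exI[of _ "cmod z"]) auto
 ultimately show ?thesis unfolding slow_def by (auto intro!: exI[of _ 0])
qed

lemma ord_pow_amp: assumes "ord T 0 (a :: complex family)" shows "ord T k (%e t x. z * of_real e ^ k * a e t x)"
proof -
 obtain B where B: "B >= 0" "!!e t x. valid T e t ==> cmod (a e t x) <= B" using assms by (auto simp: ord_def)
 have "cmod (z * of_real e ^ k * a e t x) <= cmod z * B * e ^ k" if v: "valid T e t" for e t x
  using mult_left_mono[OF B(2)[OF v, of x], of "cmod z * e ^ k"] valid_eps(1)[OF v] by (simp add: norm_mult norm_power mult_ac)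
 thus ?thesis unfolding ord_def using B(1) by (intro exI[of _ "cmod z * B"]) auto
qed

lemma ord_smJ: "csym 3 m ==> fam T F ==> ord T n F ==> ord T n (%e t x. smJ m (F e t) x)"
 by (rule ord_op[OF smJ_bound[folded real_norm_def]])

lemma fam_isJet: "(!!e t. valid T e t ==> isJet (F e t)) ==> fam T F"
 by (simp add: fam_def isJet_bcf)

context
 fixes Q K :: smeasure and T :: real and A :: "real => real => complex"
 assumes Q: "admissible_kernel Q" and K: "admissible_kernel K" and T: "0 < T" and gl: "gl_solution Q K T A"
begin

text \<open>Jets of filtered functions are bounded by the functions, which upgrades the scalar expansion to \<open>C\<^sup>4\<close>. The quadratic interaction of the filtered wave is reproduced exactly by the filter \<open>chi\<close> and cancels in the residual.\<close>

lemma ansatz_small: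
 shows "ord T 1 (Phi Q A) & ord T 2 (%e t x. Phi Q A e t x - fmult crit2 (Phi Q A e t) x) & ord T 3 (rr Q K A (glc Q K)) &
  ord T 4 (%e t x. fmult crit (rr Q K A (glc Q K) e t) x) & ord T 2 (%e t x. psJ A e t x - Phi Q A e t x)"
proof -
 let ?c = "glc Q K"
 note fsQ = fsQ[OF Q K T gl] and fsK = fsK[OF Q K T gl] and tc = tcA[OF Q K T gl] and fm = ansatz_fam[OF Q K T gl]
 have re: "ord T 1 (hh A)" "ord T 1 (pc A)" "ord T 3 (pd A ?c)" "ord T 2 (bb Q A)" "ord T 3 (Lf A ?c)"
  "ord T 4 (%e t x. fmult crit (%x. jc 0 (rr Q K A ?c e t x)) x)" using residual_expansion[OF Q K T gl] by auto
 define P1 where "P1 e t = smJ crit (hh A e t)" for e t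
 define P2 where "P2 e t = smJ nu (bb Q A e t)" for e t
 have P1o: "ord T 1 P1" unfolding P1_def[abs_def] by (rule ord_smJ[OF crit_csym fm(1) re(1)])
 have P2o: "ord T 2 P2" unfolding P2_def[abs_def] by (rule ord_smJ[OF nu_csym fm(4) re(4)])
 have bh: "bcf (hh A e t)" "bcf (bb Q A e t)" if "valid T e t" for e t using fm(1,4) that by (auto simp: fam_def)
 have PJ: "isJet (P1 e t)" "isJet (P2 e t)" if "valid T e t" for e t
  unfolding P1_def P2_def using bh[OF that] by (auto intro: smJ_isJet crit_csym nu_csym)
 have Pb: "bcf (P1 e t)" "bcf (P2 e t)" "fam T P1" "fam T P2" if "valid T e t" for e t
  using PJ isJet_bcf that by (auto simp: fam_def)
 have P1f: "fam T P1" and P2f: "fam T P2" by (auto intro!: fam_isJet PJ)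
 have Phi: "Phi Q A e t = (%x. P1 e t x + P2 e t x)" for e t by (simp add: Phi_def[abs_def] P1_def P2_def)
 have Po: "ord T 1 (Phi Q A)" unfolding Phi_def[abs_def] using ord_add[OF P1o ord_weaken[OF P2o, of 1]] by (simp add: P1_def P2_def)
 have psJJ: "isJet (psJ A e t)" if "valid T e t" for e t by (rule isJet_psJ[OF T tc]) (use valid_eps[OF that] in auto)
 have P1J: "P1 e t x = fmult crit (psJ A e t) x" if "valid T e t" for e t x
  unfolding P1_def hh_def[abs_def] by (rule smJ_fmult[OF crit_csym crit_evs psJJ[OF that]])
 have cc: "fmult crit2 (fmult crit f) x = fmult crit f x" if "bcf f" for f :: "real => jet" and x
  using fmult_fmult[OF crit2_evs crit_evs that, of x] by (simp add: crit2_crit)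
 have R2: "ord T 2 (%e t x. Phi Q A e t x - fmult crit2 (Phi Q A e t) x)"
 proof (rule ord_cong[OF ord_diff[OF P2o ord_op[OF fmult_bounded_op[OF crit2_evs] P2f P2o]]])
  fix e t x assume v: "valid T e t"
  have "P1 e t = fmult crit (psJ A e t)" using P1J[OF v] by auto
  hence "fmult crit2 (P1 e t) x = P1 e t x" using cc[OF isJet_bcf[OF psJJ[OF v]], of x] by simp
  thus "P2 e t x - fmult crit2 (P2 e t) x = Phi Q A e t x - fmult crit2 (Phi Q A e t) x"
   unfolding Phi fmult_add[OF crit2_evs Pb(1,2)[OF v]] by simp
 qed
 have R5: "ord T 2 (%e t x. psJ A e t x - Phi Q A e t x)"
 proof -
  have oks: "op_ok (fmult crit) crit" by (rule fmult_op_ok[OF crit_csym even_cut(3)])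
  have "ord T 2 (%e t x. psJ A e t x - P1 e t x)"
  proof (rule ord_jet)
   fix j :: nat assume j: "j <= 4"
   define a where "a e t x = of_real (e ^ 1 * 2) * (\<i> ^ j * amp A 0 e t x)" for e t x
   have a: "slow T 1 a"
    using slow_mult[OF slow_eps[of T 1 2] slow_mult[OF slow_const[of T "\<i> ^ j"] amp_slow[OF T tc, of 0]]] by (simp add: a_def[abs_def])
   have fj: "fam T (%e t x. jc j (psJ A e t x))" unfolding fam_def by (auto intro!: bcf_linear[OF _ bounded_linear_jc] isJet_bcf psJJ)
   have "ord T 1 (%e t x. pamp A j e t x - \<i> ^ j * amp A 0 e t x)"
   proof -
    have "{..j} = insert 0 {1..j}" by auto
    hence "pamp A j e t x - \<i> ^ j * amp A 0 e t x = (\<Sum>k\<in>{1..j}. of_nat (j choose k) * \<i> ^ (j - k) * of_real e ^ k * amp A k e t x)" for e t x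
    unfolding pamp_def by (subst \<open>{..j} = insert 0 {1..j}\<close>) (subst sum.insert, auto)
    moreover have "ord T 1 (%e t x. \<Sum>k\<in>{1..j}. of_nat (j choose k) * \<i> ^ (j - k) * of_real e ^ k * amp A k e t x)"
    using j by (intro ord_sum ord_weaken[OF ord_pow_amp[OF amp_ord[OF T tc]]]) auto
    ultimately show ?thesis by simp
   qed
   from ord_mult'[OF _ ord_eps[of T 1 2] slow_ord[OF this, of 1], of 2]
   have "ord T 2 (%e t x. e ^ 1 * 2 * wv 1 (%x. pamp A j e t x - \<i> ^ j * amp A 0 e t x) x)" by simp
   hence e: "ord T 2 (%e t x. jc j (psJ A e t x) - wv 1 (a e t) x)"
    by (rule ord_cong) (use j in "simp add: psJ_def jc_mkJ a_def[abs_def] wv_def algebra_simps")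
   have "ord T 2 (%e t x. fmult crit (%x. jc j (psJ A e t x)) x - crit 1 * wv 1 (a e t) x)"
    by (rule op_wave1[OF oks fj a _ e]) simp
   from ord_diff[OF e this]
   show "ord T 2 (%e t x. jc j (psJ A e t x - P1 e t x))"
   proof (rule ord_cong)
    fix e t x assume v: "valid T e t"
    show "jc j (psJ A e t x) - wv 1 (a e t) x - (fmult crit (%x. jc j (psJ A e t x)) x - crit 1 * wv 1 (a e t) x) = jc j (psJ A e t x - P1 e t x)"
    by (simp add: cut_values jc_diff P1J[OF v] fmult_def jc_cv[OF evs_kern[OF crit_evs] isJet_bcf[OF psJJ[OF v]]])
   qed
  qed
  from ord_diff[OF this P2o] show ?thesis by (simp add: Phi diff_diff_eq)
 qed
 obtain k where k: "1 <= k" and kB: "!!f g F G x. bcf f ==> bcf g ==> (!!x. norm (f x) <= F) ==> (!!x. norm (g x) <= G) ==> norm (nB jm Q f g x) <= k * (F * G)"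
  and kC: "!!f g h F G H x. bcf f ==> bcf g ==> bcf h ==> (!!x. norm (f x) <= F) ==> (!!x. norm (g x) <= G) ==> (!!x. norm (h x) <= H) ==> norm (nC jm K f g h x) <= k * (F * G * H)"
  using nonlinear_bounds[OF bounded_bilinear_jm fsQ fsK] by blast
 have oB: "ord T 3 (%e t x. nB jm Q (F e t) (G e t) x)" if f: "fam T F" "fam T G" and o: "ord T n F" "ord T m G" "3 <= n + m" for F G :: "jet family" and n m
 proof -
  obtain C where C: "C >= 0" "!!e t x. valid T e t ==> norm (F e t x) <= C * e ^ n" using o by (auto simp: ord_def)
  obtain D where D: "D >= 0" "!!e t x. valid T e t ==> norm (G e t x) <= D * e ^ m" using o by (auto simp: ord_def)
  have "norm (nB jm Q (F e t) (G e t) x) <= (k * C * D) * e ^ (n + m)" if v: "valid T e t" for e t x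
   using kB[of "F e t" "G e t" "C * e ^ n" "D * e ^ m" x] f C(2)[OF v] D(2)[OF v] v by (simp add: fam_def power_add mult_ac)
  hence "ord T (n + m) (%e t x. nB jm Q (F e t) (G e t) x)" unfolding ord_def using k C(1) D(1) by (intro exI[of _ "k * C * D"]) auto
  thus ?thesis by (rule ord_weaken[OF _ o(3)])
 qed
 have oC: "ord T 3 (%e t x. nC jm K (Phi Q A e t) (Phi Q A e t) (Phi Q A e t) x)"
 proof -
  obtain C where C: "C >= 0" "!!e t x. valid T e t ==> norm (Phi Q A e t x) <= C * e" using Po by (auto simp: ord_def)
  have "norm (nC jm K (Phi Q A e t) (Phi Q A e t) (Phi Q A e t) x) <= (k * C ^ 3) * e ^ 3" if v: "valid T e t" for e t x
  proof -
   have b: "bcf (Phi Q A e t)" using fm(7) v by (simp add: fam_def)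
   from kC[OF b b b C(2)[OF v] C(2)[OF v] C(2)[OF v], of x] show ?thesis by (simp add: power3_eq_cube mult_ac)
  qed
  thus ?thesis unfolding ord_def using k C(1) by (intro exI[of _ "k * C ^ 3"]) auto
 qed
 define D where "D e t x = bd Q A ?c e t x - e^2 * bb Q A e t x" for e t x
 have Do: "ord T 3 D"
 proof -
  have sco: "ord T n (%e t x. sc Q (F e t) x)" if "fam T F" "ord T n F" for F :: "real family" and n by (rule op_ord[OF sc_op_ok[OF Q] that])
  have 1: "ord T 4 (%e t x. pd A ?c e t x * sc Q (pc A e t) x)" by (rule ord_mult'[OF _ re(3) sco[OF fm(2) re(2)]]) simp
  have 2: "ord T 4 (%e t x. pc A e t x * sc Q (pd A ?c e t) x)" by (rule ord_mult'[OF _ re(2) sco[OF fm(3) re(3)]]) simp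
  have 3: "ord T 4 (%e t x. (e^2 * 1) * bb Q A e t x)" by (rule ord_mult'[OF _ ord_eps re(4)]) simp
  from ord_minus[OF ord_add[OF ord_add[OF 1 2] 3]] have "ord T 4 D"
   by (rule ord_cong) (simp add: D_def bd_def nB_def)
  thus ?thesis by (rule ord_weaken) simp
 qed
 have chiJ: "smJ chi (bb Q A e t) x = nB jm Q (P1 e t) (P1 e t) x" if v: "valid T e t" for e t x
 proof -
  let ?g = "nB jm Q (P1 e t) (P1 e t)"
  have g: "isJet ?g" unfolding nB_def[abs_def] by (intro isJet_minus isJet_jm isJet_sc[OF fsQ] PJ v)
  have pb: "bcf (psJ A e t)" by (rule isJet_bcf[OF psJJ[OF v]])
  have Pe: "P1 e t = fmult crit (psJ A e t)" using P1J[OF v] by auto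
  have "(%x. jc 0 (P1 e t x)) = pc A e t" by (simp add: P1_def smJ_0 pc_def fun_eq_iff)
  hence "(%x. jc 0 (?g x)) = bb Q A e t" by (simp add: jc_nN(1)[OF fsQ fsK Pb(1)[OF v]] bb_def fun_eq_iff)
  hence "smJ chi (bb Q A e t) x = fmult chi ?g x" using smJ_fmult[OF chi_csym chi_evs g, of x] by simp
  also have "... = ?g x" unfolding Pe
   using quadratic_interaction_vanishes[OF bounded_bilinear_jm fsQ chi_evs crit_evs chi_interaction pb pb, of x] by simp
  finally show ?thesis .
 qed
 have R3: "ord T 3 (rr Q K A ?c)"
 proof -
  have o1: "ord T 3 (%e t x. nB jm Q (P1 e t) (P2 e t) x)" "ord T 3 (%e t x. nB jm Q (P2 e t) (P1 e t) x)" "ord T 3 (%e t x. nB jm Q (P2 e t) (P2 e t) x)"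
   by (rule oB[OF P1f P2f P1o P2o], simp, rule oB[OF P2f P1f P2o P1o], simp, rule oB[OF P2f P2f P2o P2o], simp)
  have o2: "ord T 3 (%e t x. smJ crit (Lf A ?c e t) x)" by (rule ord_smJ[OF crit_csym fm(6) re(5)])
  have o3: "ord T 3 (%e t x. smJ nu (D e t) x)" by (rule ord_smJ[OF nu_csym _ Do]) (simp add: D_def[abs_def] fm(10))
  show ?thesis
  proof (rule ord_cong[OF ord_diff[OF ord_add[OF ord_add[OF o1(1) ord_add[OF o1(2,3)]] oC] ord_add[OF o2 o3]]])
   fix e t x assume v: "valid T e t"
   note b = Pb(1,2)[OF v]
   have "nB jm Q (Phi Q A e t) (Phi Q A e t) x = nB jm Q (P1 e t) (P1 e t) x + nB jm Q (P1 e t) (P2 e t) x + (nB jm Q (P2 e t) (P1 e t) x + nB jm Q (P2 e t) (P2 e t) x)"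
    unfolding Phi by (simp add: nB_add_left[OF bounded_bilinear_jm fsQ fsK] nB_add_right[OF bounded_bilinear_jm fsQ fsK b])
   thus "nB jm Q (P1 e t) (P2 e t) x + (nB jm Q (P2 e t) (P1 e t) x + nB jm Q (P2 e t) (P2 e t) x)
    + nC jm K (Phi Q A e t) (Phi Q A e t) (Phi Q A e t) x - (smJ crit (Lf A ?c e t) x + smJ nu (D e t) x) = rr Q K A ?c e t x"
    by (simp add: rr_def nN_def GG_def chiJ[OF v] D_def[abs_def])
  qed
 qed
 have R4: "ord T 4 (%e t x. fmult crit (rr Q K A ?c e t) x)"
 proof -
  have jb: "bcf (%x. jc 0 (rr Q K A ?c e t x))" if v: "valid T e t" for e t
   using fm(9) v by (auto simp: fam_def intro: bcf_linear[OF _ bounded_linear_jc])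
  have "ord T 4 (%e t x. smJ crit2 (%x. fmult crit (%x. jc 0 (rr Q K A ?c e t x)) x) x)"
   by (rule ord_smJ[OF crit2_csym _ re(6)]) (auto simp: fam_def intro: fmult_bcf crit_evs jb)
  thus ?thesis
  proof (rule ord_cong)
   fix e t x assume v: "valid T e t"
   have J: "isJet (rr Q K A ?c e t)" by (rule ansatz_isJet(3)[OF Q K T gl]) (use valid_eps[OF v] in auto)
   have "(%x. fmult crit (%x. jc 0 (rr Q K A ?c e t x)) x) = (%x. jc 0 (fmult crit (rr Q K A ?c e t) x))"
    by (simp add: fmult_def jc_cv[OF evs_kern[OF crit_evs] isJet_bcf[OF J]])
   thus "smJ crit2 (%x. fmult crit (%x. jc 0 (rr Q K A ?c e t x)) x) x = fmult crit (rr Q K A ?c e t) x"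
    using smJ_fmult[OF crit2_csym crit2_evs isJet_fmult[OF crit_evs J], of x] cc[OF isJet_bcf[OF J], of x] by simp
  qed
 qed
 show ?thesis by (intro conjI Po R2 R3 R4 R5)
qed

end

lemma duhamel_restart:
 fixes F :: "real => real => 'a::euclidean_space"
 assumes F: "bcs {0..R} F" and s: "0 <= s" "s <= t" "t <= R"
 shows "duhamel e F x t = exp (e^2 * (t - s)) *\<^sub>R sg (t - s) (%y. duhamel e F y s) x + integral {s..t} (%r. exp (e^2 * (t - r)) *\<^sub>R sg (t - r) (%y. F y r) x)"
proof -
 let ?f = "%r. exp (e^2 * (t - r)) *\<^sub>R sg (t - r) (%y. F y r) x"
 have "integral {0..t} ?f = integral {0..s} ?f + integral {s..t} ?f"
  by (rule Henstock_Kurzweil_Integration.integral_combine[symmetric]) (use s duhamel_has_integral[OF F s(3)] in "auto simp: integrable_on_def")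
 moreover have "integral {0..s} ?f = exp (e^2 * (t - s)) *\<^sub>R sg (t - s) (%y. duhamel e F y s) x"
 proof -
  have k: "kern lborel (kS (sqrt (t - s))) (%z. sqrt (sqrt (t - s)) * z)" using s by (intro sg_kern) simp
  have e: "sg (t - s) (%y. duhamel e F y s) x = duhamel e (%x r. sg (t - s) (%y. F y r) x) x s"
   unfolding sg_def[of "t - s"] by (rule cv_duhamel[OF k F]) (use s in auto)
  have "exp (e^2 * (t - s)) *\<^sub>R sg (t - s) (%y. duhamel e F y s) x = integral {0..s} (%r. exp (e^2 * (t - s)) *\<^sub>R (exp (e^2 * (s - r)) *\<^sub>R sg (s - r) (%y. sg (t - s) (%y. F y r) y) x))"
   unfolding e unfolding duhamel_def by (rule Henstock_Kurzweil_Integration.integral_cmul[symmetric])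
  also have "... = integral {0..s} ?f"
  proof (rule integral_cong)
   fix r assume r: "r : {0..s}"
   have "bcf (%y. F y r)" by (rule bcs_bcf[OF F]) (use r s in auto)
   hence "sg (s - r) (sg (t - s) (%y. F y r)) x = sg (t - r) (%y. F y r) x" using sg_sg[of "s - r" "t - s" "%y. F y r" x] r s by simp
   thus "exp (e^2 * (t - s)) *\<^sub>R (exp (e^2 * (s - r)) *\<^sub>R sg (s - r) (%y. sg (t - s) (%y. F y r) y) x) = ?f r"
    by (simp add: exp_add[symmetric] algebra_simps)
  qed
  finally show ?thesis by simp
 qed
 ultimately show ?thesis unfolding duhamel_def by simp
qed

section \<open>Solutions of the Swift--Hohenberg equation\<close>

lemma sh_nonlin_eq: "sh_nonlin Q K f x = nN (*) Q K f x"
 by (simp add: sh_nonlin_def nN_def nB_def nC_def sm_conv_def sc_sm power2_eq_square)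

text \<open>Only continuity in time in the sup-norm requires work: restarting the mild equation at an earlier time leaves a short Duhamel term and the difference \<open>S(h) u - u\<close>, uniformly small because the jet bounds the Lipschitz constant of \<open>u\<close>.\<close>

lemma mild_is_solution:
 fixes U :: "real => real => jet"
 assumes Q: "finite_signed Q" and K: "finite_signed K" and U: "bcs {0..R} U" and J: "!!t. t : {0..R} ==> isJet (%x. U x t)"
  and W: "bcf W"
  and eq: "!!x t. t : {0..R} ==> U x t = exp (e^2 * t) *\<^sub>R sg t W x + duhamel e (%x s. nN jm Q K (%y. U y s) x) x t"
 shows "sh_mild_solution Q K e R (%x. jc 0 (W x)) (%x t. jc 0 (U x t))"
proof -
 define u where "u x t = jc 0 (U x t)" for x t
 define w where "w x = jc 0 (W x)" for x
 define N where "N x s = nN (*) Q K (%y. u y s) x" for x s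
 have ub: "bcs {0..R} u" unfolding u_def[abs_def] by (rule bcs_linear[OF U bounded_linear_jc])
 have wb: "bcf w" unfolding w_def[abs_def] by (rule bcf_linear[OF W bounded_linear_jc])
 have Nb: "bcs {0..R} N" unfolding N_def[abs_def] by (rule bcs_nN[OF bounded_bilinear_mult Q K ub])
 have eqs: "u x t = exp (e^2 * t) * sg t w x + duhamel e N x t" if t: "t : {0..R}" for x t
 proof -
  have t0: "0 <= t" using t by simp
  have "duhamel e (%x s. jc 0 (nN jm Q K (%y. U y s) x)) x t = duhamel e N x t"
   unfolding duhamel_def
  proof (rule integral_cong)
   fix s assume s: "s : {0..t}"
   have "bcf (%y. U y s)" by (rule bcs_bcf[OF U]) (use s t in auto)
   thus "exp (e^2 * (t - s)) *\<^sub>R sg (t - s) (%y. jc 0 (nN jm Q K (%y. U y s) y)) x = exp (e^2 * (t - s)) *\<^sub>R sg (t - s) (%y. N y s) x"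
    by (simp add: jc_nN(2)[OF Q K] N_def u_def)
  qed
  moreover have "jc 0 (sg t W x) = sg t w x" unfolding sg_def w_def[abs_def] by (rule jc_cv[OF sg_kern[OF t0] W])
  ultimately show ?thesis
   unfolding u_def eq[OF t] jc_add jc_scaleR jc_duhamel[OF bcs_nN[OF bounded_bilinear_jm Q K U] t] by simp
 qed
 obtain B where B: "0 <= B" "!!x t. t : {0..R} ==> norm (U x t) <= B" using bcs_bdd[OF U] by blast
 have uB: "abs (u x t) <= B" if "t : {0..R}" for x t unfolding u_def using abs_jc_le B(2)[OF that] by (rule order_trans)
 obtain D where D: "0 <= D" "!!x t. t : {0..R} ==> abs (N x t) <= D" using bcs_bdd[OF Nb] by (metis real_norm_def)
 have Lip: "abs (u x t - u y t) <= B * abs (x - y)" if t: "t : {0..R}" for x y t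
 proof -
  have "norm (u x t - u y t) <= B * norm (x - y)"
  proof (rule field_differentiable_bound[of UNIV])
   show "((%x. u x t) has_field_derivative jc (Suc 0) (U z t)) (at z)" for z
    unfolding u_def using isJet_deriv[OF J[OF t], of 0 z] by simp
   show "norm (jc (Suc 0) (U z t)) <= B" for z using order_trans[OF abs_jc_le B(2)[OF t]] by simp
  qed auto
  thus ?thesis by simp
 qed
 have restart: "u x t = exp (e^2 * (t - s)) * sg (t - s) (%y. u y s) x + integral {s..t} (%r. exp (e^2 * (t - r)) *\<^sub>R sg (t - r) (%y. N y r) x)"
  if s: "0 <= s" "s <= t" "t <= R" for x s t
 proof -
  have k: "kern lborel (kS (sqrt (t - s))) (%z. sqrt (sqrt (t - s)) * z)" using s by (intro sg_kern) simp
  have sb: "bcf (sg s w)" by (rule sg_bcf[OF s(1) wb])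
  have db: "bcf (%y. duhamel e N y s)" by (rule bcs_bcf[OF duhamel_bcs[OF Nb]]) (use s in auto)
  have "sg (t - s) (%y. u y s) x = sg (t - s) (%y. exp (e^2 * s) *\<^sub>R sg s w y + duhamel e N y s) x" using eqs[of s] s by simp
  also have "... = exp (e^2 * s) *\<^sub>R sg (t - s) (sg s w) x + sg (t - s) (%y. duhamel e N y s) x"
   unfolding sg_def[of "t - s"] cv_add[OF k bcf_scaleR[OF sb] db] cv_scaleR[OF k sb] ..
  also have "sg (t - s) (sg s w) x = sg t w x" using sg_sg[OF _ s(1) wb, of "t - s" x] s by simp
  finally have e: "sg (t - s) (%y. u y s) x = exp (e^2 * s) *\<^sub>R sg t w x + sg (t - s) (%y. duhamel e N y s) x" .
  have "exp (e^2 * (t - s)) * exp (e^2 * s) = exp (e^2 * t)" by (simp add: exp_add[symmetric] algebra_simps)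
  thus ?thesis using eqs[of t x] s unfolding e duhamel_restart[OF Nb s, of e x] by (simp add: distrib_left mult.assoc[symmetric])
 qed
 obtain om where om: "(om \<longlongrightarrow> 0) (at_right 0)" "!!h f x. h : {0..1} ==> bcf f ==> (!!x. norm (f x) <= B) ==> (!!x y. norm (f x - f y) <= B * abs (x - y)) ==> norm (sg h f x - f x :: real) <= om h"
  using sg_uniform_continuity_at_zero[OF B(1) B(1), where 'a=real] by blast
 define Om where "Om h = abs (exp (e^2 * h) - 1) * (1000 * pi * B) + om h + h * (exp (e^2 * R) * (1000 * pi * D))" for h
 have Om: "(Om \<longlongrightarrow> 0) (at_right 0)"
 proof -
  have "(Om \<longlongrightarrow> abs (exp (e^2 * 0) - 1) * (1000 * pi * B) + 0 + 0 * (exp (e^2 * R) * (1000 * pi * D))) (at_right 0)"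
   unfolding Om_def[abs_def] by (intro tendsto_intros om(1))
  thus ?thesis by simp
 qed
 have step: "abs (u x t - u x s) <= Om (t - s)" if s: "0 <= s" "s <= t" "t <= R" "t - s <= 1" for x s t
 proof -
  have sI: "s : {0..R}" using s by auto
  have us: "bcf (%y. u y s)" by (rule bcs_bcf[OF ub sI])
  let ?v = "sg (t - s) (%y. u y s) x"
  let ?I = "integral {s..t} (%r. exp (e^2 * (t - r)) *\<^sub>R sg (t - r) (%y. N y r) x)"
  have v: "abs (?v) <= 1000 * pi * B" using sg_norm_le[of "t - s" "%y. u y s" B x] uB[OF sI] us s by simp
  have "abs ((exp (e^2 * (t - s)) - 1) * ?v) <= abs (exp (e^2 * (t - s)) - 1) * (1000 * pi * B)"
   unfolding abs_mult by (intro mult_left_mono v) auto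
  moreover have "abs (?v - u x s) <= om (t - s)" using om(2)[of "t - s" "%y. u y s" x] us uB[OF sI] Lip[OF sI] s by simp
  moreover have "norm ?I <= exp (e^2 * R) * (1000 * pi * D) * (t - s)"
  proof (rule integral_bound)
   show "continuous_on {s..t} (%r. exp (e^2 * (t - r)) *\<^sub>R sg (t - r) (%y. N y r) x)"
    by (rule continuous_on_subset[OF duhamel_integrand_continuous[OF Nb s(3)]]) (use s in auto)
   fix r assume r: "r : {s..t}"
   have "e^2 * (t - r) <= e^2 * R" using r s by (intro mult_left_mono) auto
   moreover have "abs (sg (t - r) (%y. N y r) x) <= 1000 * pi * D"
    using sg_norm_le[of "t - r" "%y. N y r" D x] D(2)[of r] bcs_bcf[OF Nb, of r] r s by simp
   ultimately show "norm (exp (e^2 * (t - r)) *\<^sub>R sg (t - r) (%y. N y r) x) <= exp (e^2 * R) * (1000 * pi * D)"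
    by (simp add: abs_mult) (intro mult_mono, auto)
  qed (use s in auto)
  moreover have "u x t - u x s = (exp (e^2 * (t - s)) - 1) * ?v + (?v - u x s) + ?I"
   unfolding restart[OF s(1-3), of x] by (simp add: algebra_simps)
  ultimately show ?thesis unfolding Om_def real_norm_def by (simp add: mult.commute[of "t - s"])
 qed
 have Cb: "(%x. u x t) : Cb 4" "(%x. u x t) : Cb 0" if "t : {0..R}" for t
 proof -
  show "(%x. u x t) : Cb 4" unfolding u_def by (rule isJet_Cb[OF J[OF that]])
  thus "(%x. u x t) : Cb 0" by (simp add: Cb_def)
 qed
 have tc: "time_continuous 0 R u"
  unfolding time_continuous_def
 proof (intro conjI ballI Cb tendstoI)
  fix t a :: real assume t: "t : {0..R}" and e: "0 < a"
  obtain b where b: "0 < b" "!!h. 0 < h ==> h < b ==> Om h < a"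
   using order_tendstoD(2)[OF Om e] unfolding eventually_at_right_field by blast
  have "dist (Cb_norm 0 (%x. u x s - u x t)) 0 < a" if s: "s : {0..R}" "s \<noteq> t" "dist s t < min b 1" for s
  proof -
   have "abs (u x s - u x t) <= Om (abs (s - t))" for x
    using step[of s t x] step[of t s x] s t by (cases "s <= t") (auto simp: dist_real_def abs_minus_commute)
   hence "Cb_norm 0 (%x. u x s - u x t) <= Om (abs (s - t))" by (simp add: Cb_norm_def vderiv_0) (rule cSUP_least, auto)
   moreover have "Om (abs (s - t)) < a" using b(2)[of "abs (s - t)"] s by (auto simp: dist_real_def)
   moreover have "0 <= Cb_norm 0 (%x. u x s - u x t)"
    using order_trans[OF norm_ge_zero Cb_norm_ge[OF Cb_diff[OF Cb(2)[OF s(1)] Cb(2)[OF t]], of 0]] by simp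
   ultimately show ?thesis by simp
  qed
  thus "\<forall>\<^sub>F s in at t within {0..R}. dist (Cb_norm 0 (%x. u x s - u x t)) 0 < a"
   unfolding eventually_at using b(1) by (intro exI[of _ "min b 1"]) auto
 qed
 have int: "((%s. sh_semigroup e (t - s) (sh_nonlin Q K (%y. u y s)) x) has_integral (u x t - sh_semigroup e t w x)) {0..t}"
  if t: "t : {0..R}" for x t
 proof -
  have "sh_nonlin Q K (%y. u y s) = (%y. N y s)" for s by (simp add: sh_nonlin_eq N_def fun_eq_iff)
  hence e: "exp (e^2 * (t - s)) *\<^sub>R sg (t - s) (%y. N y s) x = sh_semigroup e (t - s) (sh_nonlin Q K (%y. u y s)) x" if "s : {0..t}" for s
   using sh_semigroup_eq[of "t - s" e "%y. N y s" x] that by simp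
  moreover have "u x t - sh_semigroup e t w x = duhamel e N x t" using eqs[OF t] sh_semigroup_eq[of t e w x] t by simp
  moreover have "((%s. exp (e^2 * (t - s)) *\<^sub>R sg (t - s) (%y. N y s) x) has_integral duhamel e N x t) {0..t}"
   by (rule duhamel_has_integral[OF Nb]) (use t in simp)
  ultimately show ?thesis using has_integral_eq[OF e, of "{0..t}"] by simp
 qed
 have "EX M. ALL t:{0..R}. Cb_norm 4 (%x. u x t) <= M"
  unfolding u_def using isJet_Cb_norm[OF J B(2)] by blast
 thus ?thesis unfolding sh_mild_solution_def u_def[symmetric] w_def[symmetric] using Cb(1) tc int
  by (simp add: w_def[abs_def, symmetric])
qed

text \<open>Iterating the integral inequality with weight \<open>exp(l t)\<close> halves the bound each time.\<close>

lemma mild_unique: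
 assumes Q: "finite_signed Q" and K: "finite_signed K"
  and u: "sh_mild_solution Q K e R u0 u" and v: "sh_mild_solution Q K e R u0 v" and t: "t : {0..R}"
 shows "v x t = u x t"
proof -
 have bnd: "EX M. ALL t:{0..R}. bcf (%x. f x t) & (ALL x. abs (f x t) <= M)" if f: "sh_mild_solution Q K e R u0 f" for f
 proof -
  obtain M where M: "!!t. t : {0..R} ==> Cb_norm 4 (%x. f x t) <= M" using f unfolding sh_mild_solution_def by blast
  have C: "(%x. f x t) : Cb 4" if "t : {0..R}" for t using f that unfolding sh_mild_solution_def by blast
  have "abs (f x t) <= M" if "t : {0..R}" for x t using order_trans[OF Cb_norm_ge[OF C[OF that], of 0 x] M[OF that]] by (simp add: vderiv_0)
  moreover have "bcf (%x. f x t)" if "t : {0..R}" for t using Cb_bounded_continuous[OF C[OF that], of 0] by (simp add: vderiv_0)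
  ultimately show ?thesis by blast
 qed
 obtain Mu Mv where Mu: "!!t. t : {0..R} ==> bcf (%x. u x t)" "!!t x. t : {0..R} ==> abs (u x t) <= Mu"
  and Mv: "!!t. t : {0..R} ==> bcf (%x. v x t)" "!!t x. t : {0..R} ==> abs (v x t) <= Mv" using bnd[OF u] bnd[OF v] by blast
 define M where "M = max Mu Mv"
 have M: "norm (u x t) <= M" "norm (v x t) <= M" if "t : {0..R}" for x t using Mu(2)[OF that, of x] Mv(2)[OF that, of x] by (auto simp: M_def)
 have M0: "0 <= M" using M(1)[OF t, of x] norm_ge_zero order_trans by blast
 obtain k where k: "1 <= k" and kB: "!!f g F G x. bcf f ==> bcf g ==> (!!x. norm (f x) <= F) ==> (!!x. norm (g x) <= G) ==> norm (nB (*) Q f g x :: real) <= k * (F * G)"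
  and kC: "!!f g h F G H x. bcf f ==> bcf g ==> bcf h ==> (!!x. norm (f x) <= F) ==> (!!x. norm (g x) <= G) ==> (!!x. norm (h x) <= H) ==> norm (nC (*) K f g h x :: real) <= k * (F * G * H)"
  using nonlinear_bounds[OF bounded_bilinear_mult Q K] by blast
 have k0: "0 <= k" using k by simp
 define L where "L = k * (2 * M) + k * (3 * M^2)"
 have L0: "0 <= L" using k0 M0 by (simp add: L_def)
 have lip: "abs (sh_nonlin Q K (%y. u y s) y - sh_nonlin Q K (%y. v y s) y) <= L * m"
  if s: "s : {0..R}" and m: "!!x. abs (u x s - v x s) <= m" for s m y
 proof -
  have m': "norm (u x s - v x s) <= m" for x using m by simp
  have "norm (nB (*) Q (%y. u y s) (%y. u y s) y - nB (*) Q (%y. v y s) (%y. v y s) y) <= k * (m * M + M * m)"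
   by (rule bilinear_diff_bound[OF k0 kB bounded_bilinear_mult Q]) (use Mu(1)[OF s] Mv(1)[OF s] M[OF s] m' in auto)
  moreover have "norm (nC (*) K (%y. u y s) (%y. u y s) (%y. u y s) y - nC (*) K (%y. v y s) (%y. v y s) (%y. v y s) y) <= k * (3 * M^2 * m)"
   by (rule cubic_diff_bound[OF kC bounded_bilinear_mult K]) (use Mu(1)[OF s] Mv(1)[OF s] M[OF s] m' in auto)
  ultimately have "abs (sh_nonlin Q K (%y. u y s) y - sh_nonlin Q K (%y. v y s) y) <= k * (m * M + M * m) + k * (3 * M^2 * m)"
   unfolding sh_nonlin_eq nN_def real_norm_def by linarith
  also have "... = L * m" by (simp add: L_def algebra_simps)
  finally show ?thesis .
 qed
 define C where "C = exp (e^2 * R) * (1000 * pi * L)"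
 have C0: "0 <= C" using L0 by (simp add: C_def)
 define l where "l = 2 * C + 1"
 have nb: "bcf (sh_nonlin Q K (%y. u y s))" "bcf (sh_nonlin Q K (%y. v y s))" if "s : {0..R}" for s
  using nN_bcf[OF bounded_bilinear_mult Q K Mu(1)[OF that]] nN_bcf[OF bounded_bilinear_mult Q K Mv(1)[OF that]] by (simp_all add: sh_nonlin_eq[abs_def])
 have "ALL t:{0..R}. ALL x. abs (u x t - v x t) <= 2 * M * exp (l * t) / 2 ^ n" for n
 proof (induction n)
  case 0
  have "abs (u x t - v x t) <= 2 * M * exp (l * t)" if t: "t : {0..R}" for x t
  proof -
   have "2 * M * 1 <= 2 * M * exp (l * t)" using t C0 M0 by (intro mult_left_mono) (auto simp: l_def)
   moreover have "abs (u x t - v x t) <= 2 * M" using M[OF t, of x] by auto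
   ultimately show ?thesis by linarith
  qed
  thus ?case by simp
 next
  case (Suc n)
  show ?case
  proof (intro ballI allI)
   fix t x assume t: "t : {0..R}"
   let ?f = "%s. sh_semigroup e (t - s) (sh_nonlin Q K (%y. u y s)) x - sh_semigroup e (t - s) (sh_nonlin Q K (%y. v y s)) x"
   have "(?f has_integral (u x t - sh_semigroup e t u0 x) - (v x t - sh_semigroup e t u0 x)) {0..t}"
    using u v t unfolding sh_mild_solution_def by (intro has_integral_diff) blast+
   hence f: "(?f has_integral u x t - v x t) {0..t}" by simp
   let ?g = "%s. C * (2 * M / 2 ^ n) * exp (l * s)"
   have g: "(?g has_integral C * (2 * M / 2 ^ n) * ((exp (l * t) - 1) / l)) {0..t}"
    using t C0 by (intro has_integral_mult_right has_integral_exp) (auto simp: l_def)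
   have "norm (?f s) <= ?g s" if s: "s : {0..t}" for s
   proof -
    have sR: "s : {0..R}" and ts: "0 <= t - s" using s t by auto
    define m where "m = 2 * M * exp (l * s) / 2 ^ n"
    have "abs (sg (t - s) (%y. sh_nonlin Q K (%y. u y s) y - sh_nonlin Q K (%y. v y s) y) x) <= 1000 * pi * (L * m)"
    using sg_norm_le[OF ts bcf_diff[OF nb[OF sR]], of "L * m" x] lip[OF sR, of m] Suc sR by (auto simp: m_def)
    moreover have "?f s = exp (e^2 * (t - s)) * sg (t - s) (%y. sh_nonlin Q K (%y. u y s) y - sh_nonlin Q K (%y. v y s) y) x"
    unfolding sh_semigroup_eq[OF ts] unfolding sg_def cv_diff[OF sg_kern[OF ts] nb[OF sR]] by (simp add: right_diff_distrib)
    moreover have "exp (e^2 * (t - s)) <= exp (e^2 * R)" using s t by (auto intro!: mult_left_mono)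
    ultimately have "norm (?f s) <= exp (e^2 * R) * (1000 * pi * (L * m))" by (simp add: abs_mult mult_mono)
    thus ?thesis by (simp add: C_def m_def mult_ac)
   qed
   hence "norm (integral {0..t} ?f) <= integral {0..t} ?g"
    by (intro integral_norm_bound_integral has_integral_integrable[OF f] has_integral_integrable[OF g])
   hence "abs (u x t - v x t) <= C * (2 * M / 2 ^ n) * ((exp (l * t) - 1) / l)" using integral_unique[OF f] integral_unique[OF g] by simp
   also have "... = (C / l) * (2 * M / 2 ^ n) * (exp (l * t) - 1)" by simp
   also have "... <= (1 / 2) * (2 * M / 2 ^ n) * exp (l * t)"
    using C0 M0 t by (intro mult_mono) (auto simp: l_def divide_simps)
   finally show "abs (u x t - v x t) <= 2 * M * exp (l * t) / 2 ^ Suc n" by simp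
  qed
 qed
 hence "abs (u x t - v x t) <= 2 * M * exp (l * t) / 2 ^ n" for n using t by blast
 moreover have "(%n. 2 * M * exp (l * t) / 2 ^ n) \<longlonglongrightarrow> 0" by (rule LIMSEQ_divide_realpow_zero) simp
 ultimately have "abs (u x t - v x t) <= 0" by (intro LIMSEQ_le_const) auto
 thus ?thesis by simp
qed

theorem theorem2p5:
  fixes Q K :: smeasure and T :: real and A :: "real \<Rightarrow> real \<Rightarrow> complex"
  assumes "admissible_kernel Q" and "admissible_kernel K"
    and "T > 0" and "gl_solution Q K T A"
  shows "\<forall>d>0. \<exists>\<epsilon>s>0. \<exists>C>0. \<forall>\<epsilon>\<in>{0<..<\<epsilon>s}. \<forall>u0 :: real \<Rightarrow> real.
    u0 \<in> Cb 4 \<and> Cb_norm 4 (\<lambda>x. u0 x - psi A \<epsilon> x 0) \<le> d * \<epsilon>\<^sup>2 \<longrightarrow>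
    (\<exists>u. sh_mild_solution Q K \<epsilon> (T / \<epsilon>\<^sup>2) u0 u \<and> (\<forall>x. u x 0 = u0 x) \<and>
         (\<forall>v. sh_mild_solution Q K \<epsilon> (T / \<epsilon>\<^sup>2) u0 v \<and> (\<forall>x. v x 0 = u0 x) \<longrightarrow>
              (\<forall>t\<in>{0..T / \<epsilon>\<^sup>2}. \<forall>x. v x t = u x t)) \<and>
         (\<forall>t\<in>{0..T / \<epsilon>\<^sup>2}. Cb_norm 4 (\<lambda>x. u x t - psi A \<epsilon> x t) \<le> C * \<epsilon>\<^sup>2))"
  (is "\<forall>d>0. \<exists>a>0. \<exists>C>0. \<forall>e\<in>{0<..<a}. \<forall>u0. ?H d e u0 \<longrightarrow> (\<exists>u. ?G C e u0 u)")
proof (intro allI impI)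
 fix d :: real assume d: "0 < d"
 note ctx = assms
 let ?c = "glc Q K" and ?P = "Phi Q A"
 note fsQ = fsQ[OF ctx] and fsK = fsK[OF ctx] and tc = tcA[OF ctx]
 note small = ansatz_small[OF ctx]
 obtain b1 b2 b3 b4 b5 where b: "!!e t x. valid T e t ==> norm (?P e t x) <= b1 * e ^ 1"
  "!!e t x. valid T e t ==> norm (?P e t x - fmult crit2 (?P e t) x) <= b2 * e^2"
  "!!e t x. valid T e t ==> norm (rr Q K A ?c e t x) <= b3 * e ^ 3"
  "!!e t x. valid T e t ==> norm (fmult crit (rr Q K A ?c e t) x) <= b4 * e ^ 4"
  "!!e t x. valid T e t ==> norm (psJ A e t x - ?P e t x) <= b5 * e^2" and b5: "0 <= b5"
  using small unfolding ord_def by blast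
 obtain c where c: "Max {b1, b2, b3, b4, 5 * d + b5} <= c" and fpc: "fp_const Q K T c" using fp_const_exists[OF fsQ fsK] by blast
 have cb: "b1 <= c" "b2 <= c" "b3 <= c" "b4 <= c" "5 * d + b5 <= c" using c by auto
 obtain e0 C where e0: "0 < e0" and fp: "!!e Ph r W0. 0 < e ==> e < e0 ==> fp_data c T e Ph r W0 ==>
  (EX W. bcs {0..T / e^2} W & (ALL t:{0..T / e^2}. isJet (%x. W x t) & (ALL x. norm (W x t) <= C * e^2 &
   W x t = exp (e^2 * t) *\<^sub>R sg t W0 x + duhamel e (%x s. nN jm Q K (%y. Ph y s + W y s) x - nN jm Q K (%y. Ph y s) x + r x s) x t)))"
  using error_equation_solvable[OF fpc ctx(3)] by blast
 show "EX a>0. EX C>0. ALL e:{0<..<a}. ALL u0. ?H d e u0 --> (EX u. ?G C e u0 u)"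
 proof (rule exI[of _ "min e0 1"], rule conjI, use e0 in simp, rule exI[of _ "5 * abs (C) + 5 * b5 + 1"], rule conjI, use b5 in simp, intro ballI allI impI)
  fix e :: real and u0 :: "real => real"
  assume "e : {0<..<min e0 1}" and "u0 : Cb 4 & Cb_norm 4 (%x. u0 x - psi A e x 0) <= d * e^2"
  hence e: "0 < e" "e < e0" "e < 1" and u0: "u0 : Cb 4" "Cb_norm 4 (%x. u0 x - psi A e x 0) <= d * e^2" by auto
  let ?R = "T / e^2"
  have R0: "0 : {0..?R}" using ctx(3) by simp
  have val: "valid T e t" if "t : {0..?R}" for t using that e by (simp add: valid_def)
  define J0 where "J0 x = mkJ (%k. vderiv k u0 x)" for x
  define W0 where "W0 x = J0 x - ?P e 0 x" for x
  have J0: "isJet J0" unfolding J0_def[abs_def] by (rule Cb_isJet[OF u0(1)])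
  have j00: "jc 0 (J0 x) = u0 x" for x by (simp add: J0_def jc_mkJ vderiv_0)
  have PJ: "isJet (?P e t)" "isJet (rr Q K A ?c e t)" "isJet (psJ A e t)" if "t : {0..?R}" for t
   using ansatz_isJet[OF ctx e(1) that] isJet_psJ[OF ctx(3) tc e(1) that] by auto
  have pe: "psi A e x t = jc 0 (psJ A e t x)" for x t by (simp add: psJ_0)
  have W0n: "norm (W0 x) <= c * e^2" for x
  proof -
   have pC: "(%x. psi A e x 0) : Cb 4" unfolding pe by (rule isJet_Cb[OF PJ(3)[OF R0]])
   have "norm (J0 x - psJ A e 0 x) <= 5 * (d * e^2)"
   proof (rule norm_jet_le)
    fix i :: nat assume i: "i <= 4"
    have "jc i (J0 x - psJ A e 0 x) = vderiv i (%x. u0 x - psi A e x 0) x"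
    unfolding vderiv_diff[OF u0(1) pC i] unfolding pe isJet_vderiv[OF PJ(3)[OF R0] i] by (simp add: jc_diff J0_def jc_mkJ i)
    thus "abs (jc i (J0 x - psJ A e 0 x)) <= d * e^2"
    using order_trans[OF Cb_norm_ge[OF Cb_diff[OF u0(1) pC] i] u0(2)] by simp
   qed
   hence "norm (J0 x - psJ A e 0 x + (psJ A e 0 x - ?P e 0 x)) <= 5 * (d * e^2) + b5 * e^2"
    by (intro norm_triangle_le add_mono b(5) val R0)
   also have "... = (5 * d + b5) * e^2" by (simp add: algebra_simps)
   also have "... <= c * e^2" using cb by (intro mult_right_mono) auto
   finally show ?thesis by (simp add: W0_def)
  qed
  have W0J: "isJet W0" unfolding W0_def[abs_def] by (intro isJet_diff J0 PJ R0)
  note B = ansatz_bcs(7)[OF ctx e(1)] ansatz_bcs(8,9)[OF ctx e(1), where c="?c"]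
  have "fp_data c T e (%x t. ?P e t x) (%x t. rr Q K A ?c e t x) W0"
   unfolding fp_data_def
  proof (intro conjI ballI allI B W0J W0n PJ)
   fix t x assume t: "t : {0..?R}"
   note v = val[OF t]
   have up: "y <= c * e ^ n" if "y <= b' * e ^ n" "b' <= c" for y b' n
    using that(1) mult_right_mono[OF that(2), of "e ^ n"] e by (auto intro: order_trans)
   show "norm (?P e t x) <= c * e" using up[OF b(1)[OF v] cb(1)] by simp
   show "norm (?P e t x - fmult crit2 (%y. ?P e t y) x) <= c * e^2" by (rule up[OF b(2)[OF v] cb(2)])
   show "norm (rr Q K A ?c e t x) <= c * e ^ 3" by (rule up[OF b(3)[OF v] cb(3)])
   show "norm (fmult crit (%y. rr Q K A ?c e t y) x) <= c * e ^ 4" by (rule up[OF b(4)[OF v] cb(4)])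
  qed
  from fp[OF e(1,2) this] obtain W where W: "bcs {0..?R} W" "!!t. t : {0..?R} ==> isJet (%x. W x t)" "!!x t. t : {0..?R} ==> norm (W x t) <= C * e^2"
   "!!x t. t : {0..?R} ==> W x t = exp (e^2 * t) *\<^sub>R sg t W0 x + duhamel e (%x s. nN jm Q K (%y. ?P e s y + W y s) x - nN jm Q K (%y. ?P e s y) x + rr Q K A ?c e s x) x t"
   by blast
  define U where "U x t = ?P e t x + W x t" for x t
  have Ub: "bcs {0..?R} U" unfolding U_def[abs_def] by (rule bcs_add[OF B(1) W(1)])
  have UJ: "isJet (%x. U x t)" if "t : {0..?R}" for t unfolding U_def by (intro isJet_add PJ W(2) that)
  have Ueq: "U x t = exp (e^2 * t) *\<^sub>R sg t J0 x + duhamel e (%x s. nN jm Q K (%y. U y s) x) x t" if t: "t : {0..?R}" for x t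
  proof -
   have t0: "0 <= t" using t by simp
   let ?H = "%x s. nN jm Q K (%y. ?P e s y + W y s) x - nN jm Q K (%y. ?P e s y) x + rr Q K A ?c e s x"
   note nNs = bcs_nN[OF bounded_bilinear_jm fsQ fsK]
   have Hb: "bcs {0..?R} ?H" by (intro bcs_add[OF bcs_diff[OF nNs nNs]] bcs_add B W(1))
   have "sg t J0 x = sg t (?P e 0) x + sg t W0 x"
    unfolding sg_def cv_add[OF sg_kern[OF t0] isJet_bcf[OF PJ(1)[OF R0]] isJet_bcf[OF W0J], symmetric] by (simp add: W0_def)
   moreover have "duhamel e (%x s. nN jm Q K (%y. U y s) x) x t = duhamel e (%x s. GG Q A ?c e s x) x t + duhamel e ?H x t"
    unfolding duhamel_add[OF B(2) Hb t, symmetric] by (simp add: rr_def U_def)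
   ultimately show ?thesis
    unfolding U_def[of x t] W(4)[OF t] ansatz_mild[OF ctx e(1) t, of x] by (simp add: scaleR_add_right)
  qed
  have sol: "sh_mild_solution Q K e ?R u0 (%x t. jc 0 (U x t))"
   using mild_is_solution[OF fsQ fsK Ub UJ isJet_bcf[OF J0] Ueq] by (simp add: j00)
  show "EX u. ?G (5 * abs (C) + 5 * b5 + 1) e u0 u"
  proof (intro exI[of _ "%x t. jc 0 (U x t)"] conjI sol allI impI ballI)
   show "jc 0 (U x 0) = u0 x" for x using Ueq[OF R0, of x] by (simp add: sg_zero duhamel_def j00)
   show "v x t = jc 0 (U x t)" if "sh_mild_solution Q K e ?R u0 v & (ALL x. v x 0 = u0 x)" "t : {0..?R}" for v t x
    using mild_unique[OF fsQ fsK sol _ that(2)] that(1) by blast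
   show "Cb_norm 4 (%x. jc 0 (U x t) - psi A e x t) <= (5 * abs (C) + 5 * b5 + 1) * e^2" if t: "t : {0..?R}" for t
   proof -
    have n: "norm (U x t - psJ A e t x) <= C * e^2 + b5 * e^2" for x
    proof -
    have "norm (W x t - (psJ A e t x - ?P e t x)) <= C * e^2 + b5 * e^2"
    by (rule order_trans[OF norm_triangle_ineq4 add_mono[OF W(3)[OF t] b(5)[OF val[OF t]]]])
    thus ?thesis by (simp add: U_def algebra_simps)
    qed
    have "Cb_norm 4 (%x. jc 0 (U x t - psJ A e t x)) <= 5 * (C * e^2 + b5 * e^2)"
    by (rule isJet_Cb_norm[OF isJet_diff[OF UJ[OF t] PJ(3)[OF t]] n])
    also have "... = (5 * C + 5 * b5) * e^2" by (simp add: algebra_simps)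
    also have "... <= (5 * abs (C) + 5 * b5 + 1) * e^2" by (intro mult_right_mono) auto
    finally show ?thesis by (simp add: jc_diff pe)
   qed
  qed
 qed
qed

end
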